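(* Let $d\in\mathbb N^*$, $H\in\,]1/2,1[$, $A\in\mathcal M_d(\mathbb R)$, $S(t):=\exp(At)$ for $t\in\mathbb R$, and let $b:\mathbb R\times\mathbb R^d\to\mathbb R^d$ and $\sigma:\mathbb R\to\mathcal M_d(\mathbb R)$ be continuous. Let $B$ be a $d$-dimensional two-sided fractional Brownian motion of Hurst index $H$ on its canonical space $(\Omega,\mathcal A,\mathbb P)$, with Wiener shift $\theta$. Assume: (1) there exist $\mathfrak c_S,\mathfrak m_S>0$ such that $\|S(t)\|_{\mathrm{op}}\leqslant \mathfrak c_S e^{-\mathfrak m_S t}$ for every $t\in\mathbb R$; (2) there exist $\mathfrak c_b,\mathfrak m_b>0$ such that, for every $t\in\mathbb R$ and $x,y\in\mathbb R^d$, $\|b(t,x)-b(t,y)\|\leqslant\mathfrak c_b\|x-y\|$ and $\|b(t,x)\|\leqslant\mathfrak m_b(1+\|x\|)$; (3) for every $t\in\mathbb R$, $S(t-\cdot)\sigma(\cdot)\mathbf 1_{]-\infty,t]}(\cdot)\in|\mathcal H|_d$; (4) $b$ is almost periodic uniformly with respect to compact subsets of $\mathbb R^d$, and $\sigma$ is almost periodic. For $X\in\mathrm{AP}^2(\Omega;\mathbb R^d)$ and $t\in\mathbb R$ put $$\Gamma X(t):=\int_{-\infty}^{t}S(t-s)b(s,X(s))\,ds+\int_{-\infty}^{t}S(t-s)\sigma(s)\,dB(s).$$ Then $\Gamma$ maps $\mathrm{AP}^2(\Omega;\mathbb R^d)$ into itself. Moreover, if $\mathfrak c_S\mathfrak c_b/\mathfrak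 m_S<1$, then the equation $$dX(t)=(AX(t)+b(t,X(t)))\,dt+\sigma(t)\,dB(t),\quad t\in\mathbb R,$$ has a unique continuous, uniformly bounded and $\theta$-almost periodic in square mean solution.
   Context: Canonical space: $\Omega$ is the space of continuous functions $\omega:\mathbb R\to\mathbb R^d$ with $\omega(0)=0$, $\mathcal A$ its Borel $\sigma$-algebra (topology of locally uniform convergence), $\mathbb P$ the law of the $d$-dimensional two-sided fractional Brownian motion (independent components $B_1,\dots,B_d$) of Hurst index $H$, and $B(t,\omega)=\omega(t)$. The Wiener shift is $\theta=(\theta_t)_{t\in\mathbb R}$, $\theta_t\omega:=\omega(t+\cdot)-\omega(t)$; it is a group of $\mathbb P$-preserving transformations, and $(\Omega,\mathcal A,\mathbb P,\theta)$ is an ergodic metric dynamical system. Almost periodicity: a set $E\subset\mathbb R$ is relatively dense if there is $l>0$ such that every interval of length $l$ meets $E$. A continuous map $f$ from $\mathbb R$ to a normed space is almost periodic (in Bohr's sense) if for every $\varepsilon>0$ the set of its $\varepsilon$-almost periods, i.e. of those $\tau$ with $\sup_{t\in\mathbb R}\|f(t+\tau)-f(t)\|\leqslant\varepsilon$, is relatively dense. A continuous $f:\mathbb R\times\mathbb R^d\to\mathbb R^d$ is almost periodic uniformly with respect to compact subsets of $\mathbb R^d$ if for every compact $K\subset\mathbb R^d$ the map $t\mapsto f(t,\cdot)_{|K}$ (with values in $C^0(K,\mathbb R^d)$ with the uniform norm) is almost periodic. $\theta$-almost periodicity: for a continuous process $Y=(Y(t))_{t\in\mathbb R}$, $\mathfrak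 T_\tau Y(t,\omega):=Y(t+\tau,\theta_{-\tau}\omega)$. Let $p\geqslant 1$, let $d_p$ be the usual distance of $\mathbb L^p(\Omega;\mathbb R^d)$, and assume $Y(t)\in\mathbb L^p(\Omega;\mathbb R^d)$ for all $t$. A number $\tau$ is a $\theta$-$\varepsilon$-almost period in $p$-mean of $Y$ if $\sup_{t\in\mathbb R}d_p(\mathfrak T_\tau Y(t),Y(t))\leqslant\varepsilon$. $Y$ is $\theta$-almost periodic in $p$-mean (in square mean if $p=2$) if $(t,\tau)\mapsto\mathfrak T_\tau Y(t)$ is continuous for $d_p$ and, for every $\varepsilon>0$, the set of its $\theta$-$\varepsilon$-almost periods in $p$-mean is relatively dense. $\mathrm{AP}^p(\Omega;\mathbb R^d)$ is the space of continuous, uniformly bounded, $\theta$-almost periodic in $p$-mean processes, where uniformly bounded means $\sup_{t\in\mathbb R}\mathbb E(\|Y(t)\|^p)<\infty$; for the solution, $p=2$. Processes are identified up to modification. Wiener integrals: $|\mathcal H|$ is the set of measurable $h:\mathbb R\to\mathbb R$ with $H(2H-1)\int_{\mathbb R}\int_{\mathbb R}|t-s|^{2H-2}|h(s)||h(t)|\,ds\,dt<\infty$; $|\mathcal H|_d$ is the set of measurable $h:\mathbb R\to\mathcal M_d(\mathbb R)$ with all entries in $|\mathcal H|$. If $h\mathbf 1_{[s,t]}\in|\mathcal H|_d$, then $\int_s^t h(u)\,dB(u)$ is the vector with $i$-th component $\sum_{j=1}^d\int_s^t h_{i,j}(u)\,dB_j(u)$, where each scalar integral is the Wiener integral (for continuous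 integrands, the $\mathbb L^2$-limit of Riemann sums $\sum_k h_{i,j}(t_k)(B_j(t_{k+1})-B_j(t_k))$ as the mesh tends to $0$). If $h\mathbf 1_{]-\infty,t]}\in|\mathcal H|_d$, then $\int_{-\infty}^t h(u)\,dB(u)$ is the $\mathbb L^2$-limit of $\int_{-s}^t h(u)\,dB(u)$ as $s\to\infty$. Solution: a continuous $\mathbb R^d$-valued process $X$ is a solution of the equation iff for every $t\in\mathbb R$ $$X(t)=\int_{-\infty}^{t}S(t-s)b(s,X(s))\,ds+\int_{-\infty}^{t}S(t-s)\sigma(s)\,dB(s).$$ *)

theory Defs
  imports "HOL-Probability.Probability"
begin

section \<open>Canonical space and Wiener shift\<close>

definition path_space :: "(real \<Rightarrow> real ^ 'd) set" where
  "path_space = {\<omega>. continuous_on UNIV \<omega> \<and> \<omega> 0 = 0}"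

text \<open>The topology of locally uniform convergence on the path space.\<close>

definition path_open :: "(real \<Rightarrow> real ^ 'd) set \<Rightarrow> bool" where
  "path_open U \<longleftrightarrow> U \<subseteq> path_space \<and>
     (\<forall>\<omega>\<in>U. \<exists>T>0. \<exists>\<epsilon>>0. \<forall>\<omega>'\<in>path_space.
        (\<forall>t\<in>{-T..T}. dist (\<omega>' t) (\<omega> t) < \<epsilon>) \<longrightarrow> \<omega>' \<in> U)"

lemma istopology_path_open: "istopology path_open"
  unfolding istopology_def
proof (intro conjI allI impI)
  fix U V :: "(real \<Rightarrow> real ^ 'd) set"
  assume U: "path_open U" and V: "path_open V"
  show "path_open (U \<inter> V)"
    unfolding path_open_def
  proof (intro conjI ballI)
    show "U \<inter> V \<subseteq> path_space" using U by (auto simp: path_open_def)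
  next
    fix \<omega> assume \<omega>: "\<omega> \<in> U \<inter> V"
    obtain T1 e1 where T1: "T1 > 0" "e1 > 0" "\<forall>\<omega>'\<in>path_space.
        (\<forall>t\<in>{-T1..T1}. dist (\<omega>' t) (\<omega> t) < e1) \<longrightarrow> \<omega>' \<in> U"
      using U \<omega> unfolding path_open_def by blast
    obtain T2 e2 where T2: "T2 > 0" "e2 > 0" "\<forall>\<omega>'\<in>path_space.
        (\<forall>t\<in>{-T2..T2}. dist (\<omega>' t) (\<omega> t) < e2) \<longrightarrow> \<omega>' \<in> V"
      using V \<omega> unfolding path_open_def by blast
    have sub: "{-T1..T1} \<subseteq> {-max T1 T2..max T1 T2}" "{-T2..T2} \<subseteq> {-max T1 T2..max T1 T2}"
      by auto
    show "\<exists>T>0. \<exists>\<epsilon>>0. \<forall>\<omega>'\<in>path_space.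
        (\<forall>t\<in>{-T..T}. dist (\<omega>' t) (\<omega> t) < \<epsilon>) \<longrightarrow> \<omega>' \<in> U \<inter> V"
    proof (rule exI[of _ "max T1 T2"], intro conjI exI[of _ "min e1 e2"] ballI impI)
      fix \<omega>' assume p: "\<omega>' \<in> path_space"
        and d: "\<forall>t\<in>{-max T1 T2..max T1 T2}. dist (\<omega>' t) (\<omega> t) < min e1 e2"
      have "\<forall>t\<in>{-T1..T1}. dist (\<omega>' t) (\<omega> t) < e1"
        and "\<forall>t\<in>{-T2..T2}. dist (\<omega>' t) (\<omega> t) < e2"
        using d sub by (meson min_less_iff_conj subsetD)+
      then show "\<omega>' \<in> U \<inter> V" using T1(3) T2(3) p by blast
    qed (use T1 T2 in auto)
  qed
next
  fix \<U> :: "(real \<Rightarrow> real ^ 'd) set set"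
  assume *: "\<forall>U\<in>\<U>. path_open U"
  show "path_open (\<Union>\<U>)"
    unfolding path_open_def
  proof (intro conjI ballI)
    show "\<Union>\<U> \<subseteq> path_space" using * by (auto simp: path_open_def)
  next
    fix \<omega> assume "\<omega> \<in> \<Union>\<U>"
    then obtain U where U: "U \<in> \<U>" "\<omega> \<in> U" by blast
    with * obtain T e where "T > 0" "e > 0" "\<forall>\<omega>'\<in>path_space.
        (\<forall>t\<in>{-T..T}. dist (\<omega>' t) (\<omega> t) < e) \<longrightarrow> \<omega>' \<in> U"
      unfolding path_open_def by blast
    with U show "\<exists>T>0. \<exists>\<epsilon>>0. \<forall>\<omega>'\<in>path_space.
        (\<forall>t\<in>{-T..T}. dist (\<omega>' t) (\<omega> t) < \<epsilon>) \<longrightarrow> \<omega>' \<in> \<Union>\<U>"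
      by blast
  qed
qed

definition path_topology :: "(real \<Rightarrow> real ^ 'd) topology" where
  "path_topology = topology path_open"

lemma openin_path_topology: "openin path_topology U \<longleftrightarrow> path_open U"
  by (simp add: path_topology_def istopology_path_open topology_inverse')

definition path_borel :: "(real \<Rightarrow> real ^ 'd) measure" where
  "path_borel = sigma path_space {U. openin path_topology U}"

definition wiener_shift :: "real \<Rightarrow> (real \<Rightarrow> real ^ 'd) \<Rightarrow> (real \<Rightarrow> real ^ 'd)" where
  "wiener_shift t \<omega> = (\<lambda>s. \<omega> (t + s) - \<omega> t)"


section \<open>Fractional Brownian motion\<close>

definition centered_gaussian :: "'w measure \<Rightarrow> ('w \<Rightarrow> real) \<Rightarrow> bool" where
  "centered_gaussian M Z \<longleftrightarrow> Z \<in> borel_measurable M \<and>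
     ((AE \<omega> in M. Z \<omega> = 0) \<or> (\<exists>v>0. distributed M lborel Z (normal_density 0 v)))"

definition fbm_scalar :: "'w measure \<Rightarrow> real \<Rightarrow> (real \<Rightarrow> 'w \<Rightarrow> real) \<Rightarrow> bool" where
  "fbm_scalar M H \<beta> \<longleftrightarrow>
     (\<forall>\<omega>\<in>space M. continuous_on UNIV (\<lambda>t. \<beta> t \<omega>)) \<and>
     (\<forall>F a. finite F \<longrightarrow> centered_gaussian M (\<lambda>\<omega>. \<Sum>t\<in>F. a t * \<beta> t \<omega>)) \<and>
     (\<forall>s t. (\<integral>\<omega>. \<beta> s \<omega> * \<beta> t \<omega> \<partial>M)
        = (\<bar>s\<bar> powr (2 * H) + \<bar>t\<bar> powr (2 * H) - \<bar>t - s\<bar> powr (2 * H)) / 2)"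

text \<open>Independence of the components is independence of the processes: each component is
  viewed as a random element of the product space of real functions on the line.\<close>

definition fbm :: "'w measure \<Rightarrow> real \<Rightarrow> (real \<Rightarrow> 'w \<Rightarrow> real ^ 'd) \<Rightarrow> bool" where
  "fbm M H B \<longleftrightarrow> prob_space M \<and>
     (\<forall>i. fbm_scalar M H (\<lambda>t \<omega>. B t \<omega> $ i)) \<and>
     prob_space.indep_vars M (\<lambda>_. Pi\<^sub>M UNIV (\<lambda>_::real. borel)) (\<lambda>i \<omega>. \<lambda>t. B t \<omega> $ i) UNIV"

definition canonical_process :: "real \<Rightarrow> (real \<Rightarrow> real ^ 'd) \<Rightarrow> real ^ 'd" where
  "canonical_process t \<omega> = \<omega> t"

text \<open>\<open>P\<close> is the law of the fractional Brownian motion on the path space iff the coordinate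
  process is such a motion under \<open>P\<close>.\<close>

definition fbm_law :: "real \<Rightarrow> (real \<Rightarrow> real ^ 'd) measure \<Rightarrow> bool" where
  "fbm_law H P \<longleftrightarrow> space P = path_space \<and> sets P = sets path_borel \<and> fbm P H canonical_process"


section \<open>Matrix exponential\<close>

text \<open>The library's \<^const>\<open>exp\<close> needs a normed algebra, which \<open>real ^ 'd ^ 'd\<close> is not
  (matrix multiplication is \<open>**\<close>).\<close>

primrec matrix_power :: "real ^ 'd ^ 'd \<Rightarrow> nat \<Rightarrow> real ^ 'd ^ 'd" where
  "matrix_power A 0 = mat 1"
| "matrix_power A (Suc n) = A ** matrix_power A n"

definition matrix_exp :: "real ^ 'd ^ 'd \<Rightarrow> real ^ 'd ^ 'd" where
  "matrix_exp A = (\<Sum>n. matrix_power A n /\<^sub>R fact n)"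


section \<open>Almost periodicity\<close>

definition relatively_dense :: "real set \<Rightarrow> bool" where
  "relatively_dense E \<longleftrightarrow> (\<exists>l>0. \<forall>a. E \<inter> {a..a + l} \<noteq> {})"

definition almost_periodic :: "(real \<Rightarrow> 'a::real_normed_vector) \<Rightarrow> bool" where
  "almost_periodic f \<longleftrightarrow> continuous_on UNIV f \<and>
     (\<forall>\<epsilon>>0. relatively_dense {\<tau>. \<forall>t. norm (f (t + \<tau>) - f t) \<le> \<epsilon>})"

text \<open>Almost periodicity of \<open>t \<mapsto> f t\<close> restricted to \<open>K\<close>, in the uniform norm on \<open>K\<close>:
  \<open>uniform_limit\<close> expresses its continuity for that norm.\<close>

definition almost_periodic_unif_compact :: "(real \<Rightarrow> real ^ 'd \<Rightarrow> real ^ 'd) \<Rightarrow> bool" where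
  "almost_periodic_unif_compact f \<longleftrightarrow> continuous_on UNIV (\<lambda>(t, x). f t x) \<and>
     (\<forall>K. compact K \<longrightarrow>
        (\<forall>t. uniform_limit K f (f t) (at t)) \<and>
        (\<forall>\<epsilon>>0. relatively_dense {\<tau>. \<forall>t. \<forall>x\<in>K. norm (f (t + \<tau>) x - f t x) \<le> \<epsilon>}))"


section \<open>Processes\<close>

definition in_Lp :: "'w measure \<Rightarrow> real \<Rightarrow> ('w \<Rightarrow> 'b::euclidean_space) \<Rightarrow> bool" where
  "in_Lp M p X \<longleftrightarrow> X \<in> borel_measurable M \<and> integrable M (\<lambda>\<omega>. norm (X \<omega>) powr p)"

definition Lp_dist :: "'w measure \<Rightarrow> real \<Rightarrow> ('w \<Rightarrow> 'b::euclidean_space) \<Rightarrow> ('w \<Rightarrow> 'b) \<Rightarrow> real" where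
  "Lp_dist M p X Y = (\<integral>\<omega>. norm (X \<omega> - Y \<omega>) powr p \<partial>M) powr (1 / p)"

definition continuous_process :: "'w measure \<Rightarrow> (real \<Rightarrow> 'w \<Rightarrow> real ^ 'd) \<Rightarrow> bool" where
  "continuous_process M Y \<longleftrightarrow> (\<forall>t. Y t \<in> borel_measurable M) \<and>
     (\<forall>\<omega>\<in>space M. continuous_on UNIV (\<lambda>t. Y t \<omega>))"

definition modification ::
    "'w measure \<Rightarrow> (real \<Rightarrow> 'w \<Rightarrow> real ^ 'd) \<Rightarrow> (real \<Rightarrow> 'w \<Rightarrow> real ^ 'd) \<Rightarrow> bool" where
  "modification M X Y \<longleftrightarrow> (\<forall>t. AE \<omega> in M. X t \<omega> = Y t \<omega>)"

definition shift_process :: "real \<Rightarrow> (real \<Rightarrow> (real \<Rightarrow> real ^ 'd) \<Rightarrow> real ^ 'd)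
    \<Rightarrow> real \<Rightarrow> (real \<Rightarrow> real ^ 'd) \<Rightarrow> real ^ 'd" where
  "shift_process \<tau> Y t \<omega> = Y (t + \<tau>) (wiener_shift (-\<tau>) \<omega>)"

definition theta_almost_periodic :: "(real \<Rightarrow> real ^ 'd) measure \<Rightarrow> real
    \<Rightarrow> (real \<Rightarrow> (real \<Rightarrow> real ^ 'd) \<Rightarrow> real ^ 'd) \<Rightarrow> bool" where
  "theta_almost_periodic P p Y \<longleftrightarrow>
     (\<forall>t0 \<tau>0. ((\<lambda>(t, \<tau>). Lp_dist P p (shift_process \<tau> Y t) (shift_process \<tau>0 Y t0)) \<longlongrightarrow> 0)
        (at (t0, \<tau>0))) \<and>
     (\<forall>\<epsilon>>0. relatively_dense {\<tau>. \<forall>t. Lp_dist P p (shift_process \<tau> Y t) (Y t) \<le> \<epsilon>})"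

definition AP :: "(real \<Rightarrow> real ^ 'd) measure \<Rightarrow> real
    \<Rightarrow> (real \<Rightarrow> (real \<Rightarrow> real ^ 'd) \<Rightarrow> real ^ 'd) set" where
  "AP P p = {Y. continuous_process P Y \<and> (\<forall>t. in_Lp P p (Y t)) \<and>
     bdd_above (range (\<lambda>t. \<integral>\<omega>. norm (Y t \<omega>) powr p \<partial>P)) \<and> theta_almost_periodic P p Y}"


section \<open>Wiener integrals\<close>

text \<open>The value of the kernel on the diagonal (\<open>0 powr _ = 0\<close>) is irrelevant, the diagonal
  being negligible.\<close>

definition abs_H :: "real \<Rightarrow> (real \<Rightarrow> real) set" where
  "abs_H H = {h \<in> borel_measurable borel.
     (\<integral>\<^sup>+ t. \<integral>\<^sup>+ s. ennreal (H * (2 * H - 1) * \<bar>t - s\<bar> powr (2 * H - 2) * \<bar>h s\<bar> * \<bar>h t\<bar>)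
        \<partial>lborel \<partial>lborel) < \<infinity>}"

definition abs_H_mat :: "real \<Rightarrow> (real \<Rightarrow> real ^ 'd ^ 'd) set" where
  "abs_H_mat H = {h. \<forall>i j. (\<lambda>u. h u $ i $ j) \<in> abs_H H}"

text \<open>Wiener integrals are only defined up to null sets, hence the relational form:
  \<open>has_wiener_integral M \<beta> h s t J\<close> says that \<open>J\<close> is a version of the integral of the
  continuous function \<open>h\<close> over \<open>[s, t]\<close>, i.e. the mean-square limit of the Riemann sums along
  the partitions \<open>s = r 0 \<le> \<dots> \<le> r n = t\<close> as the mesh tends to 0.\<close>

definition riemann_sum ::
    "(real \<Rightarrow> 'w \<Rightarrow> real) \<Rightarrow> (real \<Rightarrow> real) \<Rightarrow> nat \<Rightarrow> (nat \<Rightarrow> real) \<Rightarrow> 'w \<Rightarrow> real" where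
  "riemann_sum \<beta> h n r \<omega> = (\<Sum>k<n. h (r k) * (\<beta> (r (Suc k)) \<omega> - \<beta> (r k) \<omega>))"

definition has_wiener_integral :: "'w measure \<Rightarrow> (real \<Rightarrow> 'w \<Rightarrow> real) \<Rightarrow> (real \<Rightarrow> real)
    \<Rightarrow> real \<Rightarrow> real \<Rightarrow> ('w \<Rightarrow> real) \<Rightarrow> bool" where
  "has_wiener_integral M \<beta> h s t J \<longleftrightarrow> s \<le> t \<and> continuous_on {s..t} h \<and> in_Lp M 2 J \<and>
     (\<forall>\<epsilon>>0. \<exists>\<delta>>0. \<forall>n r. r 0 = s \<and> r n = t \<and>
        (\<forall>k<n. r k \<le> r (Suc k) \<and> r (Suc k) - r k < \<delta>) \<longrightarrow>
        in_Lp M 2 (riemann_sum \<beta> h n r) \<and> Lp_dist M 2 (riemann_sum \<beta> h n r) J < \<epsilon>)"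

definition has_wiener_integral_vec :: "'w measure \<Rightarrow> real \<Rightarrow> (real \<Rightarrow> 'w \<Rightarrow> real ^ 'd)
    \<Rightarrow> (real \<Rightarrow> real ^ 'd ^ 'd) \<Rightarrow> real \<Rightarrow> real \<Rightarrow> ('w \<Rightarrow> real ^ 'd) \<Rightarrow> bool" where
  "has_wiener_integral_vec M H B h s t J \<longleftrightarrow>
     (\<lambda>u. indicator {s..t} u *\<^sub>R h u) \<in> abs_H_mat H \<and>
     (\<exists>I. (\<forall>i j. has_wiener_integral M (\<lambda>u \<omega>. B u \<omega> $ j) (\<lambda>u. h u $ i $ j) s t (I i j)) \<and>
        J = (\<lambda>\<omega>. \<chi> i. \<Sum>j\<in>UNIV. I i j \<omega>))"

definition has_wiener_integral_atMost :: "'w measure \<Rightarrow> real \<Rightarrow> (real \<Rightarrow> 'w \<Rightarrow> real ^ 'd)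
    \<Rightarrow> (real \<Rightarrow> real ^ 'd ^ 'd) \<Rightarrow> real \<Rightarrow> ('w \<Rightarrow> real ^ 'd) \<Rightarrow> bool" where
  "has_wiener_integral_atMost M H B h t J \<longleftrightarrow>
     (\<lambda>u. indicator {..t} u *\<^sub>R h u) \<in> abs_H_mat H \<and> in_Lp M 2 J \<and>
     (\<exists>I. (\<forall>s. -s \<le> t \<longrightarrow> has_wiener_integral_vec M H B h (-s) t (I s)) \<and>
        ((\<lambda>s. Lp_dist M 2 (I s) J) \<longlongrightarrow> 0) at_top)"


section \<open>The equation\<close>

text \<open>\<open>is_Gamma P H A b \<sigma> X Y\<close>: for every \<open>t\<close>, the integrals defining \<open>\<Gamma> X t\<close> exist and
  \<open>Y t\<close> is almost surely equal to \<open>\<Gamma> X t\<close>.\<close>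

definition is_Gamma :: "(real \<Rightarrow> real ^ 'd) measure \<Rightarrow> real \<Rightarrow> real ^ 'd ^ 'd
    \<Rightarrow> (real \<Rightarrow> real ^ 'd \<Rightarrow> real ^ 'd) \<Rightarrow> (real \<Rightarrow> real ^ 'd ^ 'd)
    \<Rightarrow> (real \<Rightarrow> (real \<Rightarrow> real ^ 'd) \<Rightarrow> real ^ 'd)
    \<Rightarrow> (real \<Rightarrow> (real \<Rightarrow> real ^ 'd) \<Rightarrow> real ^ 'd) \<Rightarrow> bool" where
  "is_Gamma P H A b \<sigma> X Y \<longleftrightarrow> (\<forall>t. \<exists>J.
     has_wiener_integral_atMost P H canonical_process
       (\<lambda>s. matrix_exp ((t - s) *\<^sub>R A) ** \<sigma> s) t J \<and>
     (AE \<omega> in P.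
        set_integrable lborel {..t} (\<lambda>s. matrix_exp ((t - s) *\<^sub>R A) *v b s (X s \<omega>)) \<and>
        Y t \<omega> = (LINT s:{..t}|lborel. matrix_exp ((t - s) *\<^sub>R A) *v b s (X s \<omega>)) + J \<omega>))"

text \<open>Solutions of \<open>dX(t) = (A X(t) + b(t, X(t))) dt + \<sigma>(t) dB(t)\<close>.\<close>

definition is_solution :: "(real \<Rightarrow> real ^ 'd) measure \<Rightarrow> real \<Rightarrow> real ^ 'd ^ 'd
    \<Rightarrow> (real \<Rightarrow> real ^ 'd \<Rightarrow> real ^ 'd) \<Rightarrow> (real \<Rightarrow> real ^ 'd ^ 'd)
    \<Rightarrow> (real \<Rightarrow> (real \<Rightarrow> real ^ 'd) \<Rightarrow> real ^ 'd) \<Rightarrow> bool" where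
  "is_solution P H A b \<sigma> X \<longleftrightarrow> continuous_process P X \<and> is_Gamma P H A b \<sigma> X X"

end

theory Submission
  imports Defs
begin

text \<open>
  For \<open>H > 1/2\<close> the increments of a fractional Brownian motion are positively correlated, so the
  variance of a Riemann sum over \<open>[s, t]\<close> is at most \<open>(sup \<bar>h\<bar>)\<^sup>2 (t - s)\<^bsup>2H\<^esup>\<close>. This single bound gives
  the existence and the estimates of all Wiener integrals. With the exponential decay of the semigroup
  it also shows that \<open>\<Gamma> X\<close> is \<open>H\<close>-Hoelder continuous in mean square; since \<open>2H > 1\<close>, the chaining
  argument of Kolmogorov works with second moments and yields continuous paths.

  The Wiener shift preserves \<open>P\<close>, because the law of a Gaussian process with independent components is
  determined by the covariances. Hence the \<open>\<tau>\<close>-translate of \<open>\<Gamma> X\<close> is given by the same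
  formula with \<open>b\<close>, \<open>\<sigma>\<close> and \<open>X\<close> translated by \<open>\<tau>\<close>, and every common almost period of \<open>X\<close>, \<open>\<sigma>\<close> and
  \<open>b\<close> on a large ball is an almost period of \<open>\<Gamma> X\<close>; a ball suffices because the family \<open>\<parallel>X(t)\<parallel>\<^sup>2\<close> is
  uniformly integrable.

  Finally, \<open>\<Gamma>\<close> contracts the distance \<open>sup\<^sub>t \<parallel>X(t) - Y(t)\<parallel>\<close> in mean square by the factor
  \<open>c\<^sub>S c\<^sub>b / m\<^sub>S\<close>. The Picard iterates satisfy a common Hoelder bound, so their limit has a continuous
  modification as well.
\<close>

section \<open>The mean-square seminorm\<close>

text \<open>The integrals over half-lines do not become small with t - s, so the modulus of
  continuity of \<open>\<Gamma> X\<close> comes from the semigroup law: the increment from s to t is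
  S(t - s) - 1 applied to \<open>\<Gamma> X(s)\<close>, plus drift and noise over ]s, t]. The first
  two contributions are of order t - s, the noise of order (t - s)^H, and this fixes the exponent.
  The variance bound over an interval grows with its length; half-lines are therefore cut into unit
  cells, on which the decay of S turns the bounds into a geometric series.

  Almost periods have to be matched in three spaces: matrices, continuous functions on a ball, and
  square integrable variables, where a translation moves the path as well as the time. An abstract
  relation replaces the metric, so that common almost periods are constructed once for all three.

  The estimates are made for a general drift F and noise coefficient, kept apart from b and X.
  Translates and differences of solutions are then values of the same linear map at other data, and
  one inequality gives both the almost periods and the contraction, in which the common noise
  cancels.\<close>

definition L2 :: "'w measure \<Rightarrow> ('w \<Rightarrow> 'b::euclidean_space) \<Rightarrow> bool" where
  "L2 M X \<longleftrightarrow> X \<in> borel_measurable M \<and> integrable M (\<lambda>\<omega>. (norm (X \<omega>))\<^sup>2)"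

text \<open>Random variables are not identified when they agree almost surely, so this is only a
  seminorm and versions are exchanged explicitly by \<open>nm_cong_AE\<close>. Squares stand for
  \<open>powr 2\<close>; \<open>in_Lp_2\<close> and \<open>Lp_dist_2\<close> translate back to the
  notions of the statement.\<close>

definition nm :: "'w measure \<Rightarrow> ('w \<Rightarrow> 'b::euclidean_space) \<Rightarrow> real" where
  "nm M X = sqrt (\<integral>\<omega>. (norm (X \<omega>))\<^sup>2 \<partial>M)"

lemma powr_2: "0 \<le> x \<Longrightarrow> x powr 2 = x\<^sup>2" for x :: real
  by (cases "x = 0") auto

lemma in_Lp_2: "in_Lp M 2 X \<longleftrightarrow> L2 M X"
  by (simp add: in_Lp_def L2_def powr_2)

lemma Lp_dist_2: "Lp_dist M 2 X Y = nm M (\<lambda>\<omega>. X \<omega> - Y \<omega>)"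
  by (simp add: Lp_dist_def nm_def powr_2 powr_half_sqrt)

lemma L2_measurable[measurable_dest]: "L2 M X \<Longrightarrow> X \<in> borel_measurable M"
  by (simp add: L2_def)

lemma L2_integrable: "L2 M X \<Longrightarrow> integrable M (\<lambda>\<omega>. (norm (X \<omega>))\<^sup>2)"
  by (simp add: L2_def)

lemma nm_nonneg[simp]: "0 \<le> nm M X"
  by (simp add: nm_def)

lemma nm_sq: "(nm M X)\<^sup>2 = (\<integral>\<omega>. (norm (X \<omega>))\<^sup>2 \<partial>M)"
  by (simp add: nm_def)

lemma nn_integral_L2: "L2 M X \<Longrightarrow> (\<integral>\<^sup>+\<omega>. ennreal ((norm (X \<omega>))\<^sup>2) \<partial>M) = ennreal ((nm M X)\<^sup>2)"
  by (simp add: nm_sq nn_integral_eq_integral L2_def)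

text \<open>Entry point for bounds obtained with Fatou or Fubini in \<open>ennreal\<close>, where
  square integrability is a conclusion and not a hypothesis.\<close>

lemma L2I_nn:
  assumes [measurable]: "X \<in> borel_measurable M"
    and b: "(\<integral>\<^sup>+\<omega>. ennreal ((norm (X \<omega>))\<^sup>2) \<partial>M) \<le> ennreal (K\<^sup>2)" and "0 \<le> K"
  shows "L2 M X" "nm M X \<le> K"
proof -
  have "integrable M (\<lambda>\<omega>. (norm (X \<omega>))\<^sup>2)"
    by (rule integrableI_bounded) (use b in \<open>auto intro: le_less_trans\<close>)
  then show L: "L2 M X" by (simp add: L2_def)
  have "ennreal ((nm M X)\<^sup>2) \<le> ennreal (K\<^sup>2)" using b nn_integral_L2[OF L] by simp
  then have "(nm M X)\<^sup>2 \<le> K\<^sup>2" by (simp add: ennreal_le_iff)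
  then show "nm M X \<le> K" using \<open>0 \<le> K\<close> by (rule power2_le_imp_le)
qed

lemma L2_zero[simp]: "L2 M (\<lambda>_. 0)" "nm M (\<lambda>_. 0) = 0"
  by (simp_all add: L2_def nm_def)

lemma nm_cong_AE: "AE \<omega> in M. X \<omega> = Y \<omega> \<Longrightarrow> X \<in> borel_measurable M \<Longrightarrow> Y \<in> borel_measurable M
    \<Longrightarrow> nm M X = nm M Y"
  unfolding nm_def by (intro arg_cong[of _ _ sqrt] integral_cong_AE) auto

lemma nm_cong: "(\<And>\<omega>. \<omega> \<in> space M \<Longrightarrow> X \<omega> = Y \<omega>) \<Longrightarrow> nm M X = nm M Y"
  unfolding nm_def by (intro arg_cong[of _ _ sqrt] Bochner_Integration.integral_cong) auto

lemma L2_bound: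
  fixes X :: "'w \<Rightarrow> 'b::euclidean_space" and Y :: "'w \<Rightarrow> 'c::euclidean_space"
  assumes "L2 M X" and [measurable]: "Y \<in> borel_measurable M"
    and le: "AE \<omega> in M. norm (Y \<omega>) \<le> norm (X \<omega>)"
  shows "L2 M Y" "nm M Y \<le> nm M X"
proof -
  have "integrable M (\<lambda>\<omega>. (norm (Y \<omega>))\<^sup>2)"
    by (rule Bochner_Integration.integrable_bound[OF L2_integrable[OF \<open>L2 M X\<close>]])
       (use le in \<open>auto elim!: eventually_mono intro: power_mono\<close>)
  then show L: "L2 M Y" by (simp add: L2_def)
  show "nm M Y \<le> nm M X" unfolding nm_def
    by (intro real_sqrt_le_mono integral_mono_AE L2_integrable assms L)
       (use le in \<open>auto elim!: eventually_mono intro: power_mono\<close>)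
qed

lemma L2_cong_AE: "L2 M X \<Longrightarrow> Y \<in> borel_measurable M \<Longrightarrow> AE \<omega> in M. Y \<omega> = X \<omega> \<Longrightarrow> L2 M Y"
  by (rule L2_bound(1)[of M X]) (auto elim: eventually_mono)

lemma L2_norm: "L2 M X \<Longrightarrow> L2 M (\<lambda>\<omega>. norm (X \<omega>))" "nm M (\<lambda>\<omega>. norm (X \<omega>)) = nm M X"
  by (auto simp: L2_def nm_def)

lemma L2_scaleR: "L2 M X \<Longrightarrow> L2 M (\<lambda>\<omega>. c *\<^sub>R X \<omega>)"
  by (auto simp: L2_def power_mult_distrib)

lemma nm_scaleR: "nm M (\<lambda>\<omega>. c *\<^sub>R X \<omega>) = \<bar>c\<bar> * nm M X"
  by (simp add: nm_def power_mult_distrib real_sqrt_mult)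

lemma nm_cmult: "nm M (\<lambda>\<omega>. c * X \<omega>) = \<bar>c\<bar> * nm M X" for X :: "'w \<Rightarrow> real"
  using nm_scaleR[of M c X] by simp

lemma L2_cmult: "L2 M X \<Longrightarrow> L2 M (\<lambda>\<omega>. c * X \<omega>)" for X :: "'w \<Rightarrow> real"
  using L2_scaleR[of M X c] by simp

lemma L2_minus: "L2 M X \<Longrightarrow> L2 M (\<lambda>\<omega>. - X \<omega>)"
  by (simp add: L2_def)

lemma nm_minus: "nm M (\<lambda>\<omega>. - X \<omega>) = nm M X"
  by (simp add: nm_def)

lemma nm_commute: "nm M (\<lambda>\<omega>. X \<omega> - Y \<omega>) = nm M (\<lambda>\<omega>. Y \<omega> - X \<omega>)"
  by (simp add: nm_def norm_minus_commute)

lemma L2_prod: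
  fixes X Y :: "'w \<Rightarrow> real"
  assumes "L2 M X" "L2 M Y"
  shows "integrable M (\<lambda>\<omega>. X \<omega> * Y \<omega>)"
proof (rule Bochner_Integration.integrable_bound)
  show "integrable M (\<lambda>\<omega>. (norm (X \<omega>))\<^sup>2 + (norm (Y \<omega>))\<^sup>2)"
    using assms by (intro Bochner_Integration.integrable_add L2_integrable)
  have "2 * (\<bar>x\<bar> * \<bar>y\<bar>) \<le> x\<^sup>2 + y\<^sup>2" for x y :: real
    using sum_squares_bound[of "\<bar>x\<bar>" "\<bar>y\<bar>"] by simp
  then have *: "\<bar>x\<bar> * \<bar>y\<bar> \<le> x\<^sup>2 + y\<^sup>2" for x y :: real
    by (smt (verit) mult_nonneg_nonneg)
  show "AE x in M. norm (X x * Y x) \<le> norm ((norm (X x))\<^sup>2 + (norm (Y x))\<^sup>2)"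
    by (simp add: abs_mult *)
  show "(\<lambda>\<omega>. X \<omega> * Y \<omega>) \<in> borel_measurable M"
    using assms[THEN L2_measurable] by simp
qed

text \<open>Cauchy--Schwarz, transferred from nonnegative integrals through the squares of both
  sides; the triangle inequality for \<open>nm\<close> rests on it.\<close>

lemma integral_norm_mult_le:
  assumes X: "L2 M X" and Y: "L2 M Y"
  shows "(\<integral>\<omega>. norm (X \<omega>) * norm (Y \<omega>) \<partial>M) \<le> nm M X * nm M Y"
proof -
  note [measurable] = X[THEN L2_measurable] Y[THEN L2_measurable]
  have int: "integrable M (\<lambda>\<omega>. norm (X \<omega>) * norm (Y \<omega>))"
    by (intro L2_prod L2_norm X Y)
  let ?I = "\<integral>\<omega>. norm (X \<omega>) * norm (Y \<omega>) \<partial>M"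
  have I0: "0 \<le> ?I" by simp
  have "ennreal (?I\<^sup>2) = (\<integral>\<^sup>+\<omega>. ennreal (norm (X \<omega>)) * ennreal (norm (Y \<omega>)) \<partial>M)\<^sup>2"
    using nn_integral_eq_integral[OF int] I0 by (simp add: ennreal_mult ennreal_power)
  also have "\<dots> \<le> (\<integral>\<^sup>+\<omega>. ennreal (norm (X \<omega>)) ^ 2 \<partial>M) * (\<integral>\<^sup>+\<omega>. ennreal (norm (Y \<omega>)) ^ 2 \<partial>M)"
    by (rule Cauchy_Schwarz_nn_integral) auto
  also have "\<dots> = ennreal ((nm M X * nm M Y)\<^sup>2)"
    using nn_integral_L2[OF X] nn_integral_L2[OF Y]
    by (simp add: ennreal_power ennreal_mult power_mult_distrib)
  finally have "?I\<^sup>2 \<le> (nm M X * nm M Y)\<^sup>2" by (simp add: ennreal_le_iff)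
  then show ?thesis by (rule power2_le_imp_le) simp
qed

lemma L2_add:
  assumes X: "L2 M X" and Y: "L2 M Y"
  shows "L2 M (\<lambda>\<omega>. X \<omega> + Y \<omega>)" and nm_triangle: "nm M (\<lambda>\<omega>. X \<omega> + Y \<omega>) \<le> nm M X + nm M Y"
proof -
  note [measurable] = X[THEN L2_measurable] Y[THEN L2_measurable]
  have int: "integrable M (\<lambda>\<omega>. norm (X \<omega>) * norm (Y \<omega>))"
    by (intro L2_prod L2_norm X Y)
  note ints = int L2_integrable[OF X] L2_integrable[OF Y]
  have le: "(norm (X \<omega> + Y \<omega>))\<^sup>2 \<le> (norm (X \<omega>))\<^sup>2 + (norm (Y \<omega>))\<^sup>2 + 2 * (norm (X \<omega>) * norm (Y \<omega>))"
    for \<omega>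
  proof -
    have "(norm (X \<omega> + Y \<omega>))\<^sup>2 \<le> (norm (X \<omega>) + norm (Y \<omega>))\<^sup>2"
      by (intro power_mono norm_triangle_ineq) simp
    then show ?thesis by (simp add: power2_sum mult.assoc)
  qed
  have iX: "integrable M (\<lambda>\<omega>. (norm (X \<omega> + Y \<omega>))\<^sup>2)"
    by (rule Bochner_Integration.integrable_bound[where f="\<lambda>\<omega>. (norm (X \<omega>))\<^sup>2 + (norm (Y \<omega>))\<^sup>2
      + 2 * (norm (X \<omega>) * norm (Y \<omega>))"])
       (use le ints in auto)
  then show "L2 M (\<lambda>\<omega>. X \<omega> + Y \<omega>)" by (simp add: L2_def)
  have "(\<integral>\<omega>. (norm (X \<omega> + Y \<omega>))\<^sup>2 \<partial>M) \<le> (\<integral>\<omega>. (norm (X \<omega>))\<^sup>2 + (norm (Y \<omega>))\<^sup>2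
    + 2 * (norm (X \<omega>) * norm (Y \<omega>)) \<partial>M)"
    using ints by (intro integral_mono iX le) auto
  also have "\<dots> = (nm M X)\<^sup>2 + (nm M Y)\<^sup>2 + 2 * (\<integral>\<omega>. norm (X \<omega>) * norm (Y \<omega>) \<partial>M)"
    using ints by (simp add: nm_sq)
  also have "\<dots> \<le> (nm M X + nm M Y)\<^sup>2"
    using integral_norm_mult_le[OF X Y] by (simp add: power2_sum mult.assoc)
  finally have "(nm M (\<lambda>\<omega>. X \<omega> + Y \<omega>))\<^sup>2 \<le> (nm M X + nm M Y)\<^sup>2" by (simp add: nm_sq)
  then show "nm M (\<lambda>\<omega>. X \<omega> + Y \<omega>) \<le> nm M X + nm M Y" by (rule power2_le_imp_le) simp
qed

lemma L2_diff:
  assumes "L2 M X" "L2 M Y"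
  shows "L2 M (\<lambda>\<omega>. X \<omega> - Y \<omega>)" and nm_triangle_diff: "nm M (\<lambda>\<omega>. X \<omega> - Y \<omega>) \<le> nm M X + nm M Y"
  using L2_add[OF assms(1) L2_minus[OF assms(2)]] nm_triangle[OF assms(1) L2_minus[OF assms(2)]]
  by (simp_all add: nm_minus)

lemma nm_triangle3:
  assumes "L2 M X" "L2 M Y" "L2 M Z"
  shows "nm M (\<lambda>\<omega>. X \<omega> - Z \<omega>) \<le> nm M (\<lambda>\<omega>. X \<omega> - Y \<omega>) + nm M (\<lambda>\<omega>. Y \<omega> - Z \<omega>)"
  using nm_triangle[OF L2_diff(1)[OF assms(1,2)] L2_diff(1)[OF assms(2,3)]] by simp

lemma nm_le_add:
  assumes "L2 M X" "L2 M Y"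
  shows "nm M X \<le> nm M Y + nm M (\<lambda>\<omega>. X \<omega> - Y \<omega>)"
  using nm_triangle[OF assms(2) L2_diff(1)[OF assms]] by simp

lemma L2_sum:
  assumes "\<And>i. i \<in> I \<Longrightarrow> L2 M (X i)"
  shows "L2 M (\<lambda>\<omega>. \<Sum>i\<in>I. X i \<omega>)" "nm M (\<lambda>\<omega>. \<Sum>i\<in>I. X i \<omega>) \<le> (\<Sum>i\<in>I. nm M (X i))"
  using assms
proof (induction I rule: infinite_finite_induct)
  case (insert i I)
  { case 1 with insert show ?case by (simp add: L2_add) }
  { case 2
    with insert show ?case using nm_triangle[of M "X i" "\<lambda>\<omega>. \<Sum>i\<in>I. X i \<omega>"] by simp }
qed simp_all

lemma nm_le_0_AE:
  assumes "L2 M X" "nm M X \<le> 0"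
  shows "AE \<omega> in M. X \<omega> = 0"
proof -
  have "nm M X = 0" using assms(2) nm_nonneg[of M X] by linarith
  then have "(\<integral>\<^sup>+\<omega>. ennreal ((norm (X \<omega>))\<^sup>2) \<partial>M) = 0" using nn_integral_L2[OF assms(1)] by simp
  then show ?thesis using L2_measurable[OF assms(1)] by (simp add: nn_integral_0_iff_AE)
qed

lemma (in prob_space) L2_const: "L2 M (\<lambda>_. c)" "nm M (\<lambda>_. c) = norm c"
  by (simp_all add: L2_def nm_def prob_space)

lemma (in prob_space) L2_L1:
  assumes X: "L2 M X"
  shows "integrable M X" "(\<integral>\<omega>. norm (X \<omega>) \<partial>M) \<le> nm M X"
proof -
  have "integrable M (\<lambda>\<omega>. norm (X \<omega>) * 1)"
    by (rule L2_prod[OF L2_norm(1)[OF X] L2_const(1)])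
  then show "integrable M X" using L2_measurable[OF X] by (simp add: integrable_norm_iff)
  show "(\<integral>\<omega>. norm (X \<omega>) \<partial>M) \<le> nm M X"
    using integral_norm_mult_le[OF X L2_const(1)[of "1::real"]] L2_const(2)[of "1::real"] by simp
qed

text \<open>Riesz--Fischer: a mean-square Cauchy sequence is Cauchy in mean, so a subsequence
  converges almost surely, and Fatou identifies its pointwise limit as the mean-square limit of the
  whole sequence.\<close>

lemma (in prob_space) L2_complete:
  fixes X :: "nat \<Rightarrow> 'a \<Rightarrow> 'b::euclidean_space"
  assumes X: "\<And>n. L2 M (X n)"
    and C: "\<And>e. e > 0 \<Longrightarrow> \<exists>N. \<forall>m\<ge>N. \<forall>n\<ge>N. nm M (\<lambda>\<omega>. X m \<omega> - X n \<omega>) < e"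
  obtains J where "L2 M J" "(\<lambda>n. nm M (\<lambda>\<omega>. X n \<omega> - J \<omega>)) \<longlonglongrightarrow> 0"
proof -
  note [measurable] = X[THEN L2_measurable]
  obtain r where r: "strict_mono r" "AE \<omega> in M. Cauchy (\<lambda>i. X (r i) \<omega>)"
  proof (rule cauchy_L1_AE_cauchy_subseq[of M X])
    show "integrable M (X n)" for n using L2_L1[OF X] by simp
    fix e :: real assume "e > 0"
    from C[OF this] obtain N where "\<forall>m\<ge>N. \<forall>n\<ge>N. nm M (\<lambda>\<omega>. X m \<omega> - X n \<omega>) < e" by blast
    then show "\<exists>N. \<forall>i\<ge>N. \<forall>j\<ge>N. (LINT x|M. norm (X i x - X j x)) < e"
      using L2_L1(2)[OF L2_diff(1)[OF X X]] by (meson le_less_trans)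
  qed
  define J where "J = (\<lambda>\<omega>. lim (\<lambda>i. X (r i) \<omega>))"
  have [measurable]: "J \<in> borel_measurable M" unfolding J_def by measurable
  have lim: "AE \<omega> in M. (\<lambda>i. X (r i) \<omega>) \<longlonglongrightarrow> J \<omega>"
    using r(2) by eventually_elim (simp add: J_def Cauchy_convergent_iff convergent_LIMSEQ_iff)
  \<comment> \<open>Fatou along the subsequence: the squared distance from X n to J is at most the
    lower limit of the squared distances from X n to \<open>X (r i)\<close>, which eventually are
    below e^2.\<close>
  have key: "L2 M (\<lambda>\<omega>. X n \<omega> - J \<omega>) \<and> nm M (\<lambda>\<omega>. X n \<omega> - J \<omega>) \<le> e"
    if e: "e > 0" and N: "\<forall>m\<ge>N. \<forall>n\<ge>N. nm M (\<lambda>\<omega>. X m \<omega> - X n \<omega>) < e" and n: "n \<ge> N" for e N n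
  proof -
    have "(\<integral>\<^sup>+\<omega>. ennreal ((norm (X n \<omega> - J \<omega>))\<^sup>2) \<partial>M)
        = (\<integral>\<^sup>+\<omega>. liminf (\<lambda>i. ennreal ((norm (X n \<omega> - X (r i) \<omega>))\<^sup>2)) \<partial>M)"
    proof (rule nn_integral_cong_AE)
      show "AE \<omega> in M. ennreal ((norm (X n \<omega> - J \<omega>))\<^sup>2)
        = liminf (\<lambda>i. ennreal ((norm (X n \<omega> - X (r i) \<omega>))\<^sup>2))"
        using lim
      proof eventually_elim
        case (elim \<omega>)
        have "(\<lambda>i. ennreal ((norm (X n \<omega> - X (r i) \<omega>))\<^sup>2)) \<longlonglongrightarrow> ennreal ((norm (X n \<omega> - J \<omega>))\<^sup>2)"
          by (intro tendsto_ennrealI tendsto_intros elim)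
        from lim_imp_Liminf[OF _ this] show ?case by simp
      qed
    qed
    also have "\<dots> \<le> liminf (\<lambda>i. \<integral>\<^sup>+\<omega>. ennreal ((norm (X n \<omega> - X (r i) \<omega>))\<^sup>2) \<partial>M)"
      by (rule nn_integral_liminf) simp
    also have "\<dots> \<le> ennreal (e\<^sup>2)"
    proof (rule Liminf_le)
      show "\<forall>\<^sub>F i in sequentially. (\<integral>\<^sup>+\<omega>. ennreal ((norm (X n \<omega> - X (r i) \<omega>))\<^sup>2) \<partial>M)
        \<le> ennreal (e\<^sup>2)"
        using eventually_ge_at_top[of N]
      proof eventually_elim
        case (elim i)
        then have "r i \<ge> N" using seq_suble[OF r(1), of i] by linarith
        then have "nm M (\<lambda>\<omega>. X n \<omega> - X (r i) \<omega>) < e" using N n by blast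
        then show ?case
          unfolding nn_integral_L2[OF L2_diff(1)[OF X X]] using e
          by (intro ennreal_leI power_mono) auto
      qed
    qed simp
    finally show ?thesis using e L2I_nn[of "\<lambda>\<omega>. X n \<omega> - J \<omega>" M e] by simp
  qed
  obtain N where N: "\<forall>m\<ge>N. \<forall>n\<ge>N. nm M (\<lambda>\<omega>. X m \<omega> - X n \<omega>) < 1" using C[of 1] by auto
  \<comment> \<open>J is recovered as X N minus a difference already known to be square
    integrable.\<close>
  have "L2 M (\<lambda>\<omega>. X N \<omega> - (X N \<omega> - J \<omega>))"
    by (rule L2_diff(1)[OF X]) (use key[OF _ N, of N] in simp)
  then have "L2 M J" by simp
  moreover have "(\<lambda>n. nm M (\<lambda>\<omega>. X n \<omega> - J \<omega>)) \<longlonglongrightarrow> 0"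
  proof (rule LIMSEQ_I)
    fix e :: real assume e: "0 < e"
    then obtain N where N: "\<forall>m\<ge>N. \<forall>n\<ge>N. nm M (\<lambda>\<omega>. X m \<omega> - X n \<omega>) < e/2" using C[of "e/2"] by auto
    then show "\<exists>no. \<forall>n\<ge>no. norm (nm M (\<lambda>\<omega>. X n \<omega> - J \<omega>) - 0) < e"
      using e key[of "e/2" N] by (intro exI[of _ N]) fastforce
  qed
  ultimately show ?thesis by (rule that)
qed

lemma L2_lim_unique:
  assumes "\<And>n::nat. L2 M (X n)" "L2 M J" "L2 M J'"
    and "(\<lambda>n. nm M (\<lambda>\<omega>. X n \<omega> - J \<omega>)) \<longlonglongrightarrow> 0" "(\<lambda>n. nm M (\<lambda>\<omega>. X n \<omega> - J' \<omega>)) \<longlonglongrightarrow> 0"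
  shows "AE \<omega> in M. J \<omega> = J' \<omega>"
proof -
  have "(\<lambda>n. nm M (\<lambda>\<omega>. X n \<omega> - J \<omega>) + nm M (\<lambda>\<omega>. X n \<omega> - J' \<omega>)) \<longlonglongrightarrow> 0"
    using tendsto_add[OF assms(4,5)] by simp
  then have "nm M (\<lambda>\<omega>. J \<omega> - J' \<omega>) \<le> 0"
    using nm_triangle3[OF assms(2,1,3)]
    by (intro tendsto_lowerbound[of _ _ sequentially]) (auto simp: nm_commute[of M J])
  then show ?thesis using nm_le_0_AE[OF L2_diff(1)[OF assms(2,3)]] by simp
qed

text \<open>Carries bounds that are uniform in n through mean-square limits, from Riemann sums to
  integrals and from Picard iterates to the solution.\<close>

lemma nm_lim_le:
  assumes "\<And>n::nat. L2 M (X n)" "L2 M J" "(\<lambda>n. nm M (\<lambda>\<omega>. X n \<omega> - J \<omega>)) \<longlonglongrightarrow> 0"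
    and K: "\<forall>\<^sub>F n in sequentially. nm M (X n) \<le> K"
  shows "nm M J \<le> K"
proof (rule tendsto_lowerbound)
  show "(\<lambda>n. K + nm M (\<lambda>\<omega>. X n \<omega> - J \<omega>)) \<longlonglongrightarrow> K"
    using tendsto_add[OF tendsto_const assms(3), of K] by simp
  show "\<forall>\<^sub>F n in sequentially. nm M J \<le> K + nm M (\<lambda>\<omega>. X n \<omega> - J \<omega>)"
    using K
  proof eventually_elim
    case (elim n)
    then show ?case using nm_le_add[OF assms(2) assms(1)[of n]] nm_commute[of M J "X n"] by simp
  qed
qed simp

section \<open>The matrix exponential\<close>

lemma matrix_power_add: "matrix_power A (m + n) = matrix_power A m ** matrix_power A n"
  by (induction m) (simp_all add: matrix_mul_assoc)

lemma matrix_power_scaleR: "matrix_power (t *\<^sub>R A) n = t ^ n *\<^sub>R matrix_power A n"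
  by (induction n) (simp_all add: matrix_scalar_ac scalar_matrix_assoc[symmetric])

text \<open>The operator norm is submultiplicative and dominates every entry, so each entry of the
  exponential series is dominated by the scalar series of exp(\<open>onorm\<close> of A).\<close>

lemma matrix_power_component_le: "\<bar>matrix_power A n $ i $ j\<bar> \<le> onorm ((*v) A) ^ n"
proof -
  have "onorm ((*v) (matrix_power A n)) \<le> onorm ((*v) A) ^ n"
  proof (induction n)
    case 0
    have "((*v) (mat 1) :: real^'a \<Rightarrow> _) = (\<lambda>x. x)" by (simp add: fun_eq_iff)
    then show ?case by (simp add: onorm_id_le)
  next
    case (Suc n)
    have "onorm ((*v) (A ** matrix_power A n)) \<le> onorm ((*v) A) * onorm ((*v) (matrix_power A n))"
      using onorm_compose[of "(*v) A" "(*v) (matrix_power A n)"]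
      by (simp add: matrix_vector_mul_bounded_linear matrix_vector_mul_assoc o_def)
    also have "\<dots> \<le> onorm ((*v) A) * onorm ((*v) A) ^ n"
      by (intro mult_left_mono Suc onorm_pos_le matrix_vector_mul_bounded_linear)
    finally show ?case by simp
  qed
  then show ?thesis using matrix_component_le_onorm[of "matrix_power A n" i j] by linarith
qed

text \<open>Every entry of exp(tA) is a scalar power series in t. The addition formula, continuity
  and the bound near 0 are all obtained entry by entry from these coefficients.\<close>

definition exp_coeff :: "real ^ 'd ^ 'd \<Rightarrow> 'd \<Rightarrow> 'd \<Rightarrow> nat \<Rightarrow> real" where
  "exp_coeff A i j n = matrix_power A n $ i $ j / fact n"

lemma summable_exp_coeff: "summable (\<lambda>n. norm (exp_coeff A i j n * t ^ n))"
proof (rule summable_comparison_test)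
  let ?K = "onorm ((*v) A)"
  show "summable (\<lambda>n. (?K * \<bar>t\<bar>) ^ n /\<^sub>R fact n)" by (rule summable_exp_generic)
  have "norm (norm (exp_coeff A i j n * t ^ n)) \<le> (?K * \<bar>t\<bar>) ^ n /\<^sub>R fact n" for n
  proof -
    have "\<bar>matrix_power A n $ i $ j\<bar> * \<bar>t\<bar> ^ n \<le> ?K ^ n * \<bar>t\<bar> ^ n"
      by (intro mult_right_mono matrix_power_component_le) simp
    then show ?thesis
      by (simp add: exp_coeff_def abs_mult power_abs power_mult_distrib divide_simps)
  qed
  then show "\<exists>N. \<forall>n\<ge>N. norm (norm (exp_coeff A i j n * t ^ n)) \<le> (?K * \<bar>t\<bar>) ^ n /\<^sub>R fact n" by blast
qed

lemma matrix_exp_component: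
  "matrix_exp (t *\<^sub>R A) $ i $ j = (\<Sum>n. exp_coeff A i j n * t ^ n)"
proof -
  have "(\<lambda>n. matrix_power (t *\<^sub>R A) n /\<^sub>R fact n) sums (\<chi> i j. \<Sum>n. exp_coeff A i j n * t ^ n)"
    unfolding sums_def
  proof (intro vec_tendstoI)
    fix i j
    have "(\<lambda>n. exp_coeff A i j n * t ^ n) sums (\<Sum>n. exp_coeff A i j n * t ^ n)"
      using summable_norm_cancel[OF summable_exp_coeff] by (rule summable_sums)
    then show "(\<lambda>n. (\<Sum>k<n. matrix_power (t *\<^sub>R A) k /\<^sub>R fact k) $ i $ j)
        \<longlonglongrightarrow> (\<chi> i j. \<Sum>n. exp_coeff A i j n * t ^ n) $ i $ j"
      by (simp add: sums_def matrix_power_scaleR exp_coeff_def sum_component divide_simps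
        mult.commute)
  qed
  then show ?thesis by (simp add: matrix_exp_def sums_iff)
qed

text \<open>For each inner index l of the matrix product the two scalar series have a Cauchy
  product. Summing over l merges the powers k and n - k of A into the n-th power, and the binomial
  theorem remains.\<close>

lemma matrix_exp_add:
  "matrix_exp ((s + t) *\<^sub>R A) = matrix_exp (s *\<^sub>R A) ** matrix_exp (t *\<^sub>R A)"
proof -
  let ?c = "exp_coeff A"
  have "matrix_exp ((s + t) *\<^sub>R A) $ i $ j = (matrix_exp (s *\<^sub>R A) ** matrix_exp (t *\<^sub>R A)) $ i $ j"
    for i j
  proof -
    have "(\<lambda>n. \<Sum>k\<le>n. (?c i l k * s ^ k) * (?c l j (n - k) * t ^ (n - k)))
        sums (matrix_exp (s *\<^sub>R A) $ i $ l * matrix_exp (t *\<^sub>R A) $ l $ j)" for l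
      unfolding matrix_exp_component by (rule Cauchy_product_sums[OF summable_exp_coeff
        summable_exp_coeff])
    then have "(\<lambda>n. \<Sum>l\<in>UNIV. \<Sum>k\<le>n. (?c i l k * s ^ k) * (?c l j (n - k) * t ^ (n - k)))
        sums (\<Sum>l\<in>UNIV. matrix_exp (s *\<^sub>R A) $ i $ l * matrix_exp (t *\<^sub>R A) $ l $ j)"
      by (intro sums_sum)
    moreover have "(\<Sum>l\<in>UNIV. \<Sum>k\<le>n. (?c i l k * s ^ k) * (?c l j (n - k) * t ^ (n - k)))
      = ?c i j n * (s + t) ^ n" for n
    proof -
      have "(\<Sum>l\<in>UNIV. \<Sum>k\<le>n. (?c i l k * s ^ k) * (?c l j (n - k) * t ^ (n - k)))
        = (\<Sum>k\<le>n. (\<Sum>l\<in>UNIV. matrix_power A k $ i $ l * matrix_power A (n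
          - k) $ l $ j) * (s ^ k / fact k * (t ^ (n - k) / fact (n - k))))"
        unfolding sum_distrib_right by (subst sum.swap) (intro sum.cong refl, simp add:
          exp_coeff_def)
      also have "\<dots> = (\<Sum>k\<le>n. matrix_power A n $ i $ j * (s ^ k / fact k * (t ^ (n - k) / fact (n
        - k))))"
      proof (intro sum.cong refl)
        fix k assume "k \<in> {..n}"
        then have "matrix_power A n = matrix_power A k ** matrix_power A (n - k)"
          by (subst matrix_power_add[symmetric]) simp
        then show "(\<Sum>l\<in>UNIV. matrix_power A k $ i $ l * matrix_power A (n
          - k) $ l $ j) * (s ^ k / fact k * (t ^ (n - k) / fact (n - k)))
          = matrix_power A n $ i $ j * (s ^ k / fact k * (t ^ (n - k) / fact (n - k)))"
          by (simp add: matrix_matrix_mult_def)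
      qed
      also have "\<dots> = matrix_power A n $ i $ j * ((s + t) ^ n / fact n)"
        unfolding binomial_ring sum_divide_distrib sum_distrib_left
        by (intro sum.cong refl) (simp add: binomial_fact field_simps)
      finally show ?thesis by (simp add: exp_coeff_def)
    qed
    ultimately show ?thesis
      by (simp add: matrix_exp_component sums_iff matrix_matrix_mult_def)
  qed
  then show ?thesis by (simp add: vec_eq_iff)
qed

lemma matrix_exp_differentiable:
  "\<exists>D. ((\<lambda>t. matrix_exp (t *\<^sub>R A) $ i $ j) has_field_derivative D) (at t)"
  unfolding matrix_exp_component
  using termdiffs_strong_converges_everywhere[OF summable_norm_cancel[OF summable_exp_coeff]]
    by blast

lemma continuous_matrix_exp: "continuous_on UNIV (\<lambda>t. matrix_exp (t *\<^sub>R A))"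
proof -
  have "continuous_on UNIV (\<lambda>t. matrix_exp (t *\<^sub>R A) $ i $ j)" for i j
    using matrix_exp_differentiable[of A i j]
      by (metis DERIV_isCont continuous_at_imp_continuous_on)
  then have "continuous_on UNIV (\<lambda>t. \<chi> i j. matrix_exp (t *\<^sub>R A) $ i $ j)"
    by (intro continuous_on_vec_lambda)
  then show ?thesis by simp
qed

text \<open>Without its constant term the series has a factor h, and for h \<le> 1 the other powers
  of h are at most 1. This controls the factor S(t - s) - 1 in the Hoelder estimate.\<close>

lemma matrix_exp_Lipschitz:
  "\<exists>C\<ge>0. \<forall>h. 0 \<le> h \<and> h \<le> 1 \<longrightarrow> onorm ((*v) (matrix_exp (h *\<^sub>R A) - mat 1)) \<le> C * h"
proof -
  let ?K = "onorm ((*v) A)"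
  define L where "L = exp ?K"
  have K: "0 \<le> ?K" by (intro onorm_pos_le matrix_vector_mul_bounded_linear)
  have "\<bar>(matrix_exp (h *\<^sub>R A) - mat 1) $ i $ j\<bar> \<le> L * h" if h: "0 \<le> h" "h \<le> 1" for h i j
  proof -
    have sm: "summable (\<lambda>n. exp_coeff A i j n * h ^ n)"
      by (rule summable_norm_cancel[OF summable_exp_coeff])
    have eq: "(matrix_exp (h *\<^sub>R A) - mat 1) $ i $ j = (\<Sum>n. exp_coeff A i j (Suc n) * h ^ Suc n)"
      unfolding suminf_split_head[OF sm] vector_minus_component matrix_exp_component
      by (simp add: exp_coeff_def)
    have le: "\<bar>exp_coeff A i j (Suc n) * h ^ Suc n\<bar> \<le> (?K ^ Suc n /\<^sub>R fact (Suc n)) * h" for n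
    proof -
      have "\<bar>exp_coeff A i j (Suc n)\<bar> \<le> ?K ^ Suc n /\<^sub>R fact (Suc n)"
        using matrix_power_component_le[of A "Suc n" i j]
          by (simp add: exp_coeff_def divide_simps del: matrix_power.simps)
      moreover have "h ^ Suc n \<le> h" using h by (simp add: power_le_one mult_left_le)
      ultimately show ?thesis using h by (auto simp add: abs_mult intro!: mult_mono)
    qed
    have sE: "(\<lambda>n. ?K ^ Suc n /\<^sub>R fact (Suc n)) sums (exp ?K - 1)"
      using exp_converges[of ?K] sums_Suc_iff[of "\<lambda>n. ?K ^ n /\<^sub>R fact n" "exp ?K - 1"] by simp
    have sEh: "(\<lambda>n. (?K ^ Suc n /\<^sub>R fact (Suc n)) * h) sums ((exp ?K - 1) * h)"
      by (rule sums_mult2[OF sE])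
    have sa: "summable (\<lambda>n. \<bar>exp_coeff A i j (Suc n) * h ^ Suc n\<bar>)"
      using summable_exp_coeff[of A i j h] summable_Suc_iff[of "\<lambda>n. \<bar>exp_coeff A i j n * h ^ n\<bar>"]
      unfolding real_norm_def by blast
    then have "\<bar>\<Sum>n. exp_coeff A i j (Suc n) * h ^ Suc n\<bar>
      \<le> (\<Sum>n. \<bar>exp_coeff A i j (Suc n) * h ^ Suc n\<bar>)"
      by (rule summable_rabs)
    also have "\<dots> \<le> (\<Sum>n. (?K ^ Suc n /\<^sub>R fact (Suc n)) * h)"
      by (rule suminf_le[OF le sa sums_summable[OF sEh]])
    also have "\<dots> = (exp ?K - 1) * h" by (rule sums_unique[OF sEh, symmetric])
    also have "\<dots> \<le> L * h" using h by (intro mult_right_mono) (auto simp: L_def)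
    finally show ?thesis unfolding eq .
  qed
  \<comment> \<open>The two factors \<open>CARD('a)\<close> pass from a bound on the entries to a
    bound on the operator norm.\<close>
  then have "onorm ((*v) (matrix_exp (h *\<^sub>R A) - mat 1)) \<le> real CARD('a) * real CARD('a) * (L * h)"
    if "0 \<le> h" "h \<le> 1" for h
    by (rule onorm_le_matrix_component) (use that in auto)
  then show ?thesis
    by (intro exI[of _ "real CARD('a) * real CARD('a) * L"]) (auto simp: L_def mult.assoc)
qed

lemma norm_matrix_vector_le: "norm (A *v x) \<le> onorm ((*v) A) * norm x" for A :: "real ^ 'n ^ 'm"
  by (intro onorm matrix_vector_mul_bounded_linear)

lemma L2_matrix:
  fixes A :: "real ^ 'n ^ 'm"
  assumes "L2 M X"
  shows "L2 M (\<lambda>\<omega>. A *v X \<omega>)" "nm M (\<lambda>\<omega>. A *v X \<omega>) \<le> onorm ((*v) A) * nm M X"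
proof -
  note [measurable] = L2_measurable[OF assms]
  have K: "0 \<le> onorm ((*v) A)" by (intro onorm_pos_le matrix_vector_mul_bounded_linear)
  have m: "(\<lambda>\<omega>. A *v X \<omega>) \<in> borel_measurable M"
    by (rule measurable_compose[OF L2_measurable[OF assms]])
       (intro borel_measurable_continuous_onI linear_continuous_on matrix_vector_mul_bounded_linear)
  have "norm (A *v X \<omega>) \<le> norm (onorm ((*v) A) *\<^sub>R X \<omega>)" for \<omega>
    using norm_matrix_vector_le[of A "X \<omega>"] K by simp
  then show "L2 M (\<lambda>\<omega>. A *v X \<omega>)" "nm M (\<lambda>\<omega>. A *v X \<omega>) \<le> onorm ((*v) A) * nm M X"
    using L2_bound[OF L2_scaleR[OF assms, of "onorm ((*v) A)"] m] K by (auto simp: nm_scaleR)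
qed

section \<open>Finite-dimensional laws\<close>

lemma (in prob_space) bounded_integrable:
  fixes f :: "'a \<Rightarrow> real"
  assumes "f \<in> borel_measurable M" "\<And>x. \<bar>f x\<bar> \<le> B"
  shows "integrable M f"
  by (rule integrable_const_bound[where B=B]) (use assms in auto)

text \<open>Normalised, the weights become probability densities, and the uniqueness theorem of Levy
  applies to the image laws. The free phase makes real cosines encode the whole characteristic
  function. In the induction below, the weights carry the coordinates already treated.\<close>

lemma weighted_law_unique_pos:
  fixes X :: "'m \<Rightarrow> real" and Y :: "'n \<Rightarrow> real"
  assumes M: "prob_space M" and N: "prob_space N"
    and [measurable]: "X \<in> borel_measurable M" "Y \<in> borel_measurable N"
      "w \<in> borel_measurable M" "v \<in> borel_measurable N"
    and w: "\<And>x. 0 \<le> w x" "\<And>x. w x \<le> B" and v: "\<And>x. 0 \<le> v x" "\<And>x. v x \<le> B"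
    and eq: "\<And>t \<psi>. (\<integral>x. w x * cos (t * X x + \<psi>) \<partial>M) = (\<integral>x. v x * cos (t * Y x + \<psi>) \<partial>N)"
    and A [measurable]: "A \<in> sets borel"
  shows "(\<integral>x. w x * indicator A (X x) \<partial>M) = (\<integral>x. v x * indicator A (Y x) \<partial>N)"
proof -
  interpret M: prob_space M by (rule M)
  interpret N: prob_space N by (rule N)
  \<comment> \<open>At t = 0 and phase 0 the hypothesis says that both weights have the same total
    mass, so one constant c normalises both.\<close>
  have eq0: "(\<integral>x. w x \<partial>M) = (\<integral>x. v x \<partial>N)" using eq[of 0 0] by simp
  have iw: "integrable M w" by (rule M.bounded_integrable[where B=B]) (use w in auto)
  have iv: "integrable N v" by (rule N.bounded_integrable[where B=B]) (use v in auto)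
  define c where "c = (\<integral>x. w x \<partial>M)"
  have c0: "0 \<le> c" unfolding c_def using w(1) by simp
  \<comment> \<open>With mass 0 no normalisation is possible, but then both weights vanish almost
    everywhere.\<close>
  show ?thesis
  proof (cases "c = 0")
    case True
    then have "AE x in M. w x = 0" "AE x in N. v x = 0"
      using integral_nonneg_eq_0_iff_AE[OF iw] integral_nonneg_eq_0_iff_AE[OF iv] w v eq0 c_def
        by auto
    then have "AE x in M. w x * indicator A (X x) = 0" "AE x in N. v x * indicator A (Y x) = 0"
      by (auto elim: eventually_mono)
    then show ?thesis by (simp add: integral_eq_zero_AE)
  next
    case False
    with c0 have c: "c > 0" by simp
    define DM where "DM = density M (\<lambda>x. ennreal (w x / c))"
    define DN where "DN = density N (\<lambda>x. ennreal (v x / c))"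
    have "emeasure DM (space DM) = 1"
    proof -
      have "emeasure DM (space DM) = (\<integral>\<^sup>+x. ennreal (w x / c) \<partial>M)"
        by (simp add: DM_def emeasure_density)
      also have "\<dots> = ennreal (\<integral>x. w x / c \<partial>M)"
        by (rule nn_integral_eq_integral) (use iw w c in auto)
      also have "\<dots> = 1" using c by (simp add: c_def[symmetric])
      finally show ?thesis .
    qed
    then interpret DM: prob_space DM by (rule prob_spaceI)
    have "emeasure DN (space DN) = 1"
    proof -
      have "emeasure DN (space DN) = (\<integral>\<^sup>+x. ennreal (v x / c) \<partial>N)"
        by (simp add: DN_def emeasure_density)
      also have "\<dots> = ennreal (\<integral>x. v x / c \<partial>N)"
        by (rule nn_integral_eq_integral) (use iv v c in auto)
      also have "\<dots> = 1" using c eq0 by (simp add: c_def)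
      finally show ?thesis .
    qed
    then interpret DN: prob_space DN by (rule prob_spaceI)
    have X: "X \<in> borel_measurable DM" and Y: "Y \<in> borel_measurable DN"
      by (simp_all add: DM_def DN_def)
    let ?LM = "distr DM borel X" and ?LN = "distr DN borel Y"
    interpret LM: real_distribution ?LM by (rule DM.real_distribution_distr[OF X])
    interpret LN: real_distribution ?LN by (rule DN.real_distribution_distr[OF Y])
    have "char ?LM t = char ?LN t" for t
    proof -
      have cM: "char ?LM t = (\<integral>x. (w x / c) *\<^sub>R iexp (t * X x) \<partial>M)"
        unfolding char_def DM_def
        by (subst integral_distr) (auto simp: integral_density w c less_imp_le)
      have cN: "char ?LN t = (\<integral>x. (v x / c) *\<^sub>R iexp (t * Y x) \<partial>N)"
        unfolding char_def DN_def
        by (subst integral_distr) (auto simp: integral_density v c less_imp_le)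
      have iM: "integrable M (\<lambda>x. (w x / c) *\<^sub>R iexp (t * X x))"
        by (rule M.integrable_const_bound[where B="B/c"]) (use w c in \<open>auto simp: divide_simps\<close>)
      have iN: "integrable N (\<lambda>x. (v x / c) *\<^sub>R iexp (t * Y x))"
        by (rule N.integrable_const_bound[where B="B/c"]) (use v c in \<open>auto simp: divide_simps\<close>)
      \<comment> \<open>The imaginary part is a cosine with phase -pi/2, so the hypothesis covers it
        as well.\<close>
      have sincos: "sin z = cos (z - pi/2)" for z :: real by (simp add: cos_diff)
      have iexp: "iexp z = Complex (cos z) (cos (z - pi/2))" for z
        unfolding sincos[symmetric] by (simp add: complex_eq_iff Re_exp Im_exp)
      have "Re (char ?LM t) = (\<integral>x. w x * cos (t * X x + 0) \<partial>M) / c"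
        unfolding cM integral_Re[OF iM, symmetric] by (simp add: iexp del: of_real_mult)
      moreover have "Re (char ?LN t) = (\<integral>x. v x * cos (t * Y x + 0) \<partial>N) / c"
        unfolding cN integral_Re[OF iN, symmetric] by (simp add: iexp del: of_real_mult)
      moreover have "Im (char ?LM t) = (\<integral>x. w x * cos (t * X x + (-pi/2)) \<partial>M) / c"
        unfolding cM integral_Im[OF iM, symmetric] by (simp add: iexp del: of_real_mult)
      moreover have "Im (char ?LN t) = (\<integral>x. v x * cos (t * Y x + (-pi/2)) \<partial>N) / c"
        unfolding cN integral_Im[OF iN, symmetric] by (simp add: iexp del: of_real_mult)
      ultimately show ?thesis unfolding complex_eq_iff eq by simp
    qed
    then have L: "?LM = ?LN"
      by (intro Levy_uniqueness ext) (unfold_locales)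
    have "measure ?LM A = (\<integral>x. indicator A x \<partial>?LM)" by simp
    also have "\<dots> = (\<integral>x. w x * indicator A (X x) \<partial>M) / c"
      unfolding DM_def by (subst integral_distr) (auto simp: integral_density w c less_imp_le)
    finally have 1: "measure ?LM A = (\<integral>x. w x * indicator A (X x) \<partial>M) / c" .
    have "measure ?LN A = (\<integral>x. indicator A x \<partial>?LN)" by simp
    also have "\<dots> = (\<integral>x. v x * indicator A (Y x) \<partial>N) / c"
      unfolding DN_def by (subst integral_distr) (auto simp: integral_density v c less_imp_le)
    finally have 2: "measure ?LN A = (\<integral>x. v x * indicator A (Y x) \<partial>N) / c" .
    show ?thesis using 1 2 L c by simp
  qed
qed

text \<open>Cramer--Wold: the coordinates in \<open>F\<close> have already been replaced by indicators, and one
  further coordinate is treated by the one-dimensional uniqueness theorem.\<close>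

lemma law_unique_aux:
  fixes X :: "'k \<Rightarrow> 'm \<Rightarrow> real" and Y :: "'k \<Rightarrow> 'n \<Rightarrow> real"
  assumes M: "prob_space M" and N: "prob_space N" and "finite K"
    and X[measurable]: "\<And>k. X k \<in> borel_measurable M"
      and Y[measurable]: "\<And>k. Y k \<in> borel_measurable N"
    and eq: "\<And>a \<phi>. (\<integral>x. cos ((\<Sum>k\<in>K. a k * X k x) + \<phi>) \<partial>M) = (\<integral>x. cos ((\<Sum>k\<in>K. a k * Y k x) + \<phi>) \<partial>N)"
    and A[measurable]: "\<And>k. A k \<in> sets borel"
    and F: "finite F" "F \<subseteq> K"
  shows "(\<integral>x. (\<Prod>k\<in>F. indicator (A k) (X k x)) * cos ((\<Sum>k\<in>K - F. a k * X k x) + \<phi>) \<partial>M)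
       = (\<integral>x. (\<Prod>k\<in>F. indicator (A k) (Y k x)) * cos ((\<Sum>k\<in>K - F. a k * Y k x) + \<phi>) \<partial>N)"
  using F
proof (induction F arbitrary: a \<phi> rule: finite_induct)
  case empty
  then show ?case using eq by simp
next
  case (insert j F)
  interpret M: prob_space M by (rule M)
  interpret N: prob_space N by (rule N)
  have j: "j \<in> K - F" and F: "F \<subseteq> K" using insert by auto
  note IH = insert.IH[OF F]
  let ?G = "K - insert j F"
  have KF: "K - F = insert j ?G" and jG: "j \<notin> ?G" "finite ?G" using j \<open>finite K\<close> by auto
  define pX where "pX x = (\<Prod>k\<in>F. indicator (A k) (X k x) :: real)" for x
  define pY where "pY x = (\<Prod>k\<in>F. indicator (A k) (Y k x) :: real)" for x
  define sX where "sX x = (\<Sum>k\<in>?G. a k * X k x)" for x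
  define sY where "sY x = (\<Sum>k\<in>?G. a k * Y k x)" for x
  have [measurable]: "pX \<in> borel_measurable M" "pY \<in> borel_measurable N"
      "sX \<in> borel_measurable M" "sY \<in> borel_measurable N"
    unfolding pX_def pY_def sX_def sY_def by measurable
  have p01: "0 \<le> pX x" "pX x \<le> 1" "0 \<le> pY y" "pY y \<le> 1" for x y
    unfolding pX_def pY_def by (auto intro!: prod_nonneg prod_le_1)
  have bnd: "\<bar>p * cos z\<bar> \<le> 1" if "0 \<le> p" "p \<le> 1" for p z :: real
    using that abs_cos_le_one[of z] by (simp add: abs_mult mult_le_one)
  have int: "integrable M (\<lambda>x. pX x * cos (u * sX x + t * X j x + \<psi>))"
       "integrable N (\<lambda>x. pY x * cos (u * sY x + t * Y j x + \<psi>))" for u t \<psi>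
    by (rule M.bounded_integrable[where B=1], measurable, rule bnd[OF p01(1,2)])
       (rule N.bounded_integrable[where B=1], measurable, rule bnd[OF p01(3,4)])
  \<comment> \<open>The coordinate j gets its own frequency t, the remaining ones a common factor u.
    The value u = 0 removes them and u = 1 keeps them.\<close>
  have IH': "(\<integral>x. pX x * cos (u * sX x + t * X j x + \<psi>) \<partial>M)
    = (\<integral>x. pY x * cos (u * sY x + t * Y j x + \<psi>) \<partial>N)"
    for u t \<psi>
  proof -
    have "(\<Sum>k\<in>K - F. (if k = j then t else u * a k) * Z k) = u * (\<Sum>k\<in>?G. a k * Z k) + t * Z j"
      for Z :: "'k \<Rightarrow> real"
    proof -
      have "(\<Sum>k\<in>?G. (if k = j then t else u * a k) * Z k) = (\<Sum>k\<in>?G. u * (a k * Z k))"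
        using jG by (intro sum.cong) auto
      then show ?thesis unfolding KF using jG by (simp add: sum_distrib_left)
    qed
    then show ?thesis using IH[of "\<lambda>k. if k = j then t else u * a k" \<psi>]
      by (simp add: pX_def pY_def sX_def sY_def)
  qed
  have w0: "(\<integral>x. pX x * indicator (A j) (X j x) \<partial>M) = (\<integral>x. pY x * indicator (A j) (Y j x) \<partial>N)"
    by (rule weighted_law_unique_pos[OF M N, where B=1])
       (use IH'[of 0] p01 in \<open>auto\<close>)
  \<comment> \<open>A cosine may be negative and cannot serve as a weight; 1 + cos can, and the
    identity \<open>w0\<close> for the constant 1 is subtracted afterwards.\<close>
  have w1: "(\<integral>x. (pX x * (1 + cos (sX x + \<phi>))) * indicator (A j) (X j x) \<partial>M)
      = (\<integral>x. (pY x * (1 + cos (sY x + \<phi>))) * indicator (A j) (Y j x) \<partial>N)"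
  proof (rule weighted_law_unique_pos[OF M N, where B=2])
    have nn: "0 \<le> 1 + cos z" "1 + cos z \<le> 2" for z :: real
      using cos_ge_minus_one[of z] cos_le_one[of z] by linarith+
    show "0 \<le> pX x * (1 + cos (sX x + \<phi>))" "0 \<le> pY y * (1 + cos (sY y + \<phi>))" for x y
      using p01 nn by (auto intro!: mult_nonneg_nonneg)
    show "pX x * (1 + cos (sX x + \<phi>)) \<le> 2" "pY y * (1 + cos (sY y + \<phi>)) \<le> 2" for x y
      using mult_mono[OF p01(2) nn(2)] mult_mono[OF p01(4) nn(2)] p01 nn by auto
    fix t \<psi>
    \<comment> \<open>The product formula for cosines returns to single cosines of linear
      combinations, to which the induction hypothesis applies.\<close>
    have split: "p * (1 + cos (s + \<phi>)) * cos (t * z + \<psi>)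
        = p * cos (0 * s + t * z + \<psi>) + (1/2) * (p * cos (1 * s + t * z + (\<phi> + \<psi>)))
          + (1/2) * (p * cos (1 * s + (-t) * z + (\<phi> - \<psi>)))" for p s z :: real
    proof -
      have "s + t * z + (\<phi> + \<psi>) = (s + \<phi>) + (t * z + \<psi>)" "s + (-t) * z + (\<phi> - \<psi>)
        = (s + \<phi>) - (t * z + \<psi>)" by auto
      then show ?thesis by (simp only: cos_add cos_diff mult_1) (simp add: algebra_simps)
    qed
    show "(\<integral>x. pX x * (1 + cos (sX x + \<phi>)) * cos (t * X j x + \<psi>) \<partial>M)
        = (\<integral>x. pY x * (1 + cos (sY x + \<phi>)) * cos (t * Y j x + \<psi>) \<partial>N)"
      unfolding split
      by (simp only: Bochner_Integration.integral_add Bochner_Integration.integrable_add int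
          integrable_mult_right integral_mult_right_zero IH')
  qed measurable
  have ind: "\<bar>indicator S z :: real\<bar> \<le> 1" for S and z :: real by (simp add: indicator_def)
  have bnd2: "\<bar>p * i\<bar> \<le> 1" if "0 \<le> p" "p \<le> 1" "\<bar>i\<bar> \<le> 1" for p i :: real
    using that by (simp add: abs_mult mult_le_one)
  have bnd3: "\<bar>p * c * i\<bar> \<le> 1" if "0 \<le> p" "p \<le> 1" "\<bar>c\<bar> \<le> 1" "\<bar>i\<bar> \<le> 1" for p c i :: real
    using that by (simp add: abs_mult mult_le_one)
  have i0: "integrable M (\<lambda>x. pX x * indicator (A j) (X j x))"
    "integrable N (\<lambda>x. pY x * indicator (A j) (Y j x))"
    by (rule M.bounded_integrable[where B=1], measurable, rule bnd2[OF p01(1,2) ind])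
       (rule N.bounded_integrable[where B=1], measurable, rule bnd2[OF p01(3,4) ind])
  have i1: "integrable M (\<lambda>x. pX x * cos (sX x + \<phi>) * indicator (A j) (X j x))"
    "integrable N (\<lambda>x. pY x * cos (sY x + \<phi>) * indicator (A j) (Y j x))"
    by (rule M.bounded_integrable[where B=1], measurable, rule bnd3[OF p01(1,2) abs_cos_le_one ind])
       (rule N.bounded_integrable[where B=1], measurable, rule bnd3[OF p01(3,4) abs_cos_le_one ind])
  have sp: "p * (1 + c) * i = p * i + p * c * i" for p c i :: real by (simp add: algebra_simps)
  have "(\<integral>x. pX x * cos (sX x + \<phi>) * indicator (A j) (X j x) \<partial>M)
      = (\<integral>x. pY x * cos (sY x + \<phi>) * indicator (A j) (Y j x) \<partial>N)"
    using w1 w0 i0 i1 unfolding sp by simp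
  then show ?case
    using insert.hyps by (simp add: pX_def pY_def sX_def sY_def mult_ac)
qed

lemma law_unique:
  fixes X :: "'k \<Rightarrow> 'm \<Rightarrow> real" and Y :: "'k \<Rightarrow> 'n \<Rightarrow> real"
  assumes M: "prob_space M" and N: "prob_space N" and K: "finite K"
    and X[measurable]: "\<And>k. X k \<in> borel_measurable M"
      and Y[measurable]: "\<And>k. Y k \<in> borel_measurable N"
    and eq: "\<And>a \<phi>. (\<integral>x. cos ((\<Sum>k\<in>K. a k * X k x) + \<phi>) \<partial>M) = (\<integral>x. cos ((\<Sum>k\<in>K. a k * Y k x) + \<phi>) \<partial>N)"
    and A[measurable]: "\<And>k. A k \<in> sets borel"
  shows "measure M {x\<in>space M. \<forall>k\<in>K. X k x \<in> A k} = measure N {x\<in>space N. \<forall>k\<in>K. Y k x \<in> A k}"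
proof -
  interpret M: prob_space M by (rule M)
  interpret N: prob_space N by (rule N)
  have p: "(\<Prod>k\<in>K. indicator (A k) (Z k) :: real) = (if \<forall>k\<in>K. Z k \<in> A k then 1 else 0)" for Z
    using K by (auto simp: indicator_def prod_zero_iff)
  have [measurable]: "{x\<in>space M. \<forall>k\<in>K. X k x \<in> A k} \<in> sets M" "{x\<in>space N. \<forall>k\<in>K. Y k x \<in> A k} \<in>
    sets N"
    using K by measurable
  have "(\<integral>x. indicator {x\<in>space M. \<forall>k\<in>K. X k x \<in> A k} x \<partial>M)
    = (\<integral>x. (\<Prod>k\<in>K. indicator (A k) (X k x) :: real) \<partial>M)"
    unfolding p by (intro Bochner_Integration.integral_cong) auto
  moreover have "(\<integral>x. indicator {x\<in>space N. \<forall>k\<in>K. Y k x \<in> A k} x \<partial>N)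
    = (\<integral>x. (\<Prod>k\<in>K. indicator (A k) (Y k x) :: real) \<partial>N)"
    unfolding p by (intro Bochner_Integration.integral_cong) auto
  \<comment> \<open>For F = K the sum is empty and the remaining factor is cos 0 = 1.\<close>
  moreover have "(\<integral>x. (\<Prod>k\<in>K. indicator (A k) (X k x) :: real) \<partial>M)
    = (\<integral>x. (\<Prod>k\<in>K. indicator (A k) (Y k x) :: real) \<partial>N)"
    using law_unique_aux[OF M N K X Y eq A K subset_refl, where a="\<lambda>_. 0" and \<phi>=0] by simp
  ultimately show ?thesis by simp
qed

section \<open>Invariance of the law under the Wiener shift\<close>

lemma centered_gaussian_L2:
  assumes "prob_space M" "centered_gaussian M Z"
  shows "L2 M Z"
proof -
  interpret prob_space M by (rule assms)
  have [measurable]: "Z \<in> borel_measurable M" using assms(2) by (simp add: centered_gaussian_def)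
  consider "AE \<omega> in M. Z \<omega> = 0" | v where "v > 0" "distributed M lborel Z (normal_density 0 v)"
    using assms(2) unfolding centered_gaussian_def by blast
  then show ?thesis
  proof cases
    case 1
    then show ?thesis by (intro L2_cong_AE[OF L2_zero(1)]) auto
  next
    case 2
    have "integrable lborel (\<lambda>x. normal_density 0 v x * (x - 0)\<^sup>2)"
      by (rule integrable_normal_moment[OF 2(1)])
    then have "integrable M (\<lambda>\<omega>. (Z \<omega>)\<^sup>2)"
      by (subst distributed_integrable[OF 2(2), symmetric]) auto
    then show ?thesis by (simp add: L2_def)
  qed
qed

text \<open>The value at 1 determines the joint laws, since the coefficients of linear combinations
  absorb the argument. A variable that vanishes almost surely has variance 0 and obeys the same
  formula.\<close>

lemma centered_gaussian_char:
  assumes "prob_space M" "centered_gaussian M Z"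
  shows "char (distr M borel Z) 1 = complex_of_real (exp (- (\<integral>\<omega>. (Z \<omega>)\<^sup>2 \<partial>M) / 2))"
proof -
  interpret prob_space M by (rule assms)
  have [measurable]: "Z \<in> borel_measurable M" using assms(2) by (simp add: centered_gaussian_def)
  have c: "char (distr M borel Z) 1 = (\<integral>\<omega>. iexp (Z \<omega>) \<partial>M)"
    unfolding char_def by (subst integral_distr) auto
  consider "AE \<omega> in M. Z \<omega> = 0" | v where "v > 0" "distributed M lborel Z (normal_density 0 v)"
    using assms(2) unfolding centered_gaussian_def by blast
  then show ?thesis
  proof cases
    case 1
    have "(\<integral>\<omega>. iexp (Z \<omega>) \<partial>M) = (\<integral>\<omega>. 1 \<partial>M)" by (intro integral_cong_AE) (use 1 in auto)
    moreover have "(\<integral>\<omega>. (Z \<omega>)\<^sup>2 \<partial>M) = 0" by (rule integral_eq_zero_AE) (use 1 in auto)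
    ultimately show ?thesis by (simp add: c prob_space)
  next
    case 2
    have "(\<integral>\<omega>. (Z \<omega>)\<^sup>2 \<partial>M) = v\<^sup>2"
      using normal_distributed_variance[OF 2] normal_distributed_expectation[OF 2] by simp
    moreover have "(\<integral>\<omega>. iexp (Z \<omega>) \<partial>M) = exp (- (v\<^sup>2) / 2)"
    proof -
      \<comment> \<open>Division by the standard deviation v leads to the standard normal law, whose
        characteristic function is taken at v.\<close>
      have "distributed M lborel (\<lambda>x. 0 + (1/v) * Z x) (normal_density (0 + (1/v) * 0) (\<bar>1/v\<bar> * v))"
        by (rule normal_density_affine[OF 2(2,1)]) (use 2 in auto)
      then have d: "distributed M lborel (\<lambda>x. Z x / v) std_normal_density" using 2(1) by simp
      have "complex_of_real (exp (- (v\<^sup>2) / 2)) = char std_normal_distribution v"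
        by (simp add: char_std_normal_distribution)
      also have "\<dots> = (CLINT x|std_normal_distribution. iexp (v * x))" by (simp add: char_def)
      also have "std_normal_distribution = distr M lborel (\<lambda>x. Z x / v)"
        using d by (simp add: distributed_def)
      also have "(CLINT x|distr M lborel (\<lambda>x. Z x / v). iexp (v * x))
        = (CLINT x|M. iexp (v * (Z x / v)))"
        by (rule integral_distr) auto
      also have "\<dots> = (CLINT x|M. iexp (Z x))" using 2 by simp
      finally show ?thesis by simp
    qed
    ultimately show ?thesis by (simp add: c)
  qed
qed

text \<open>Stationarity of the increments at the level of covariances: all powers containing
  \<open>\<tau>\<close> cancel, and the difference of the two shifted times is t - s.\<close>

lemma fbm_cov_shift:
  fixes s t \<tau> H :: real
  defines "R \<equiv> \<lambda>s t. (\<bar>s\<bar> powr (2 * H) + \<bar>t\<bar> powr (2 * H) - \<bar>t - s\<bar> powr (2 * H)) / 2"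
  shows "R (\<tau> + s) (\<tau> + t) - R (\<tau> + s) \<tau> - R \<tau> (\<tau> + t) + R \<tau> \<tau> = R s t"
  by (simp add: R_def field_simps abs_minus_commute)

lemma fbm_scalar_L2:
  assumes "prob_space M" "fbm_scalar M H \<beta>" shows "L2 M (\<beta> t)"
proof -
  have "centered_gaussian M (\<lambda>\<omega>. \<Sum>t\<in>{t}. 1 * \<beta> t \<omega>)"
    using assms(2) unfolding fbm_scalar_def by (elim conjE allE[of _ "{t}"] allE[of _ "\<lambda>_. 1"]) auto
  then show ?thesis using centered_gaussian_L2[OF assms(1)] by simp
qed

text \<open>\<open>fbm_scalar\<close> speaks of combinations over finite sets of distinct times, so
  a combination of increments must be regrouped. Since \<open>\<tau>\<close> may itself be one of
  the shifted times, its coefficient can have two contributions, which are added.\<close>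

lemma finite_combination_shift:
  fixes \<beta> :: "real \<Rightarrow> 'w \<Rightarrow> real"
  assumes "finite F"
  shows "\<exists>G c. finite G \<and> (\<forall>\<omega>. (\<Sum>t\<in>F. a t * (\<beta> (\<tau> + t) \<omega> - \<beta> \<tau> \<omega>)) = (\<Sum>t\<in>G. c t * \<beta> t \<omega>))"
proof (intro exI conjI allI)
  let ?F = "(+) \<tau> ` F" let ?G = "insert \<tau> ?F"
  let ?c = "\<lambda>u. (if u \<in> ?F then a (u - \<tau>) else 0) + (if u = \<tau> then - (\<Sum>t\<in>F. a t) else 0)"
  show fin: "finite ?G" using assms by simp
  fix \<omega>
  have "(\<Sum>u\<in>?G. ?c u * \<beta> u \<omega>) = (\<Sum>u\<in>?G. (if u \<in> ?F then a (u - \<tau>) * \<beta> u \<omega> else 0))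
      + (\<Sum>u\<in>?G. (if u = \<tau> then - (\<Sum>t\<in>F. a t) * \<beta> u \<omega> else 0))"
    unfolding sum.distrib[symmetric] by (intro sum.cong) (auto simp: algebra_simps)
  also have "(\<Sum>u\<in>?G. (if u = \<tau> then - (\<Sum>t\<in>F. a t) * \<beta> u \<omega> else 0)) = - (\<Sum>t\<in>F. a t) * \<beta> \<tau> \<omega>"
    using fin by (simp add: sum.delta)
  also have "(\<Sum>u\<in>?G. (if u \<in> ?F then a (u - \<tau>) * \<beta> u \<omega> else 0)) = (\<Sum>u\<in>?F. a (u - \<tau>) * \<beta> u \<omega>)"
    using fin by (intro sum.mono_neutral_cong_right) auto
  also have "\<dots> = (\<Sum>t\<in>F. a t * \<beta> (\<tau> + t) \<omega>)"
    by (subst sum.reindex) auto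
  finally show "(\<Sum>t\<in>F. a t * (\<beta> (\<tau> + t) \<omega> - \<beta> \<tau> \<omega>)) = (\<Sum>u\<in>?G. ?c u * \<beta> u \<omega>)"
    by (simp add: right_diff_distrib sum_subtractf sum_distrib_right)
qed

text \<open>Gaussian, with a variance from which \<open>\<tau>\<close> has disappeared: this is
  shift invariance for one component.\<close>

lemma fbm_scalar_shift_combination:
  assumes "prob_space M" "fbm_scalar M H \<beta>" "finite F"
  shows "centered_gaussian M (\<lambda>\<omega>. \<Sum>t\<in>F. a t * (\<beta> (\<tau> + t) \<omega> - \<beta> \<tau> \<omega>))"
    and "(\<integral>\<omega>. (\<Sum>t\<in>F. a t * (\<beta> (\<tau> + t) \<omega> - \<beta> \<tau> \<omega>))\<^sup>2 \<partial>M)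
      = (\<Sum>s\<in>F. \<Sum>t\<in>F. a s * a t * ((\<bar>s\<bar> powr (2 * H)
        + \<bar>t\<bar> powr (2 * H) - \<bar>t - s\<bar> powr (2 * H)) / 2))"
proof -
  obtain G c where G: "finite G" "\<And>\<omega>. (\<Sum>t\<in>F. a t * (\<beta> (\<tau> + t) \<omega> - \<beta> \<tau> \<omega>)) = (\<Sum>t\<in>G. c t * \<beta> t \<omega>)"
    using finite_combination_shift[OF assms(3), of a \<beta> \<tau>] by blast
  show "centered_gaussian M (\<lambda>\<omega>. \<Sum>t\<in>F. a t * (\<beta> (\<tau> + t) \<omega> - \<beta> \<tau> \<omega>))"
    unfolding G(2) using assms(2) G(1) unfolding fbm_scalar_def by blast
  let ?R = "\<lambda>s t. (\<bar>s\<bar> powr (2 * H) + \<bar>t\<bar> powr (2 * H) - \<bar>t - s\<bar> powr (2 * H)) / 2"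
  have cov: "(\<integral>\<omega>. \<beta> s \<omega> * \<beta> t \<omega> \<partial>M) = ?R s t" for s t using assms(2) by (simp add: fbm_scalar_def)
  have int: "integrable M (\<lambda>\<omega>. \<beta> s \<omega> * \<beta> t \<omega>)" for s t
    by (intro L2_prod fbm_scalar_L2[OF assms(1,2)])
  have ex: "(\<beta> (\<tau> + s) \<omega> - \<beta> \<tau> \<omega>) * (\<beta> (\<tau> + t) \<omega> - \<beta> \<tau> \<omega>)
     = \<beta> (\<tau> + s) \<omega> * \<beta> (\<tau> + t) \<omega> - \<beta> (\<tau> + s) \<omega> * \<beta> \<tau> \<omega> - \<beta> \<tau> \<omega> * \<beta> (\<tau> + t) \<omega> + \<beta> \<tau> \<omega> * \<beta> \<tau> \<omega>"
       for s t \<omega>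
    by (simp add: algebra_simps)
  have inc_int: "integrable M (\<lambda>\<omega>. (\<beta> (\<tau> + s) \<omega> - \<beta> \<tau> \<omega>) * (\<beta> (\<tau> + t) \<omega> - \<beta> \<tau> \<omega>))" for s t
    by (intro L2_prod L2_diff fbm_scalar_L2[OF assms(1,2)])
  have inc: "(\<integral>\<omega>. (\<beta> (\<tau> + s) \<omega> - \<beta> \<tau> \<omega>) * (\<beta> (\<tau> + t) \<omega> - \<beta> \<tau> \<omega>) \<partial>M) = ?R s t" for s t
    unfolding ex using int fbm_cov_shift[of \<tau> s H t] by (simp add: cov)
  have sq: "(\<Sum>t\<in>F. a t * Z t)\<^sup>2 = (\<Sum>s\<in>F. \<Sum>t\<in>F. a s * a t * (Z s * Z t))" for Z :: "real \<Rightarrow> real"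
    by (simp add: power2_eq_square sum_product mult_ac)
  show "(\<integral>\<omega>. (\<Sum>t\<in>F. a t * (\<beta> (\<tau> + t) \<omega> - \<beta> \<tau> \<omega>))\<^sup>2 \<partial>M) = (\<Sum>s\<in>F. \<Sum>t\<in>F. a s * a t * ?R s t)"
    unfolding sq using inc_int by (simp add: Bochner_Integration.integral_sum inc)
qed

section \<open>Joint law of the increments under P\<close>

context
  fixes H :: real and P :: "(real \<Rightarrow> real ^ 'd) measure"
  assumes P: "fbm_law H P"
begin

lemma space_P: "space P = path_space" and prob_P: "prob_space P"
  and fbm_component: "fbm_scalar P H (\<lambda>t \<omega>. \<omega> t $ i)"
  using P by (simp_all add: fbm_law_def fbm_def canonical_process_def)

lemma fbm_indep: "prob_space.indep_vars P (\<lambda>_. Pi\<^sub>M UNIV (\<lambda>_::real. borel)) (\<lambda>i \<omega>. \<lambda>t. \<omega> t $ i)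
  UNIV"
  using P by (simp add: fbm_law_def fbm_def canonical_process_def)

lemma coord_measurable[measurable]: "(\<lambda>\<omega>. \<omega> t $ i) \<in> borel_measurable P"
  using fbm_scalar_L2[OF prob_P fbm_component] by (rule L2_measurable)

lemma coord_vec_measurable[measurable]: "(\<lambda>\<omega>. \<omega> t) \<in> borel_measurable P"
  by (rule borel_measurable_euclidean_space[THEN iffD2])
     (auto simp: Basis_vec_def inner_axis)

text \<open>Independence of the components factorises the characteristic function, and the phase
  enters through \<open>cis\<close>. What matters is that the right-hand side is free of
  \<open>\<tau>\<close>.\<close>

lemma char_combination:
  assumes F: "finite F"
  shows "(\<integral>\<omega>. cos ((\<Sum>i\<in>UNIV. \<Sum>t\<in>F. a i t * (\<omega> (\<tau> + t) $ i - \<omega> \<tau> $ i)) + \<phi>) \<partial>P)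
    = Re (cis \<phi> * (\<Prod>i\<in>UNIV. complex_of_real (exp (- (\<Sum>s\<in>F. \<Sum>t\<in>F. a i s * a i t *
        ((\<bar>s\<bar> powr (2 * H) + \<bar>t\<bar> powr (2 * H) - \<bar>t - s\<bar> powr (2 * H)) / 2)) / 2))))"
proof -
  interpret prob_space P by (rule prob_P)
  define Z where "Z = (\<lambda>i (\<omega> :: real \<Rightarrow> real ^ 'd). \<Sum>t\<in>F. a i t * (\<omega> (\<tau> + t) $ i - \<omega> \<tau> $ i))"
  have [measurable]: "Z i \<in> borel_measurable P" for i unfolding Z_def by measurable
  have ind: "indep_vars (\<lambda>_. borel) Z UNIV"
    unfolding Z_def
    using indep_vars_compose2[OF fbm_indep, of "\<lambda>i f. \<Sum>t\<in>F. a i t * (f (\<tau> + t) - f \<tau>)" "\<lambda>_. borel"]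
    by simp
  have ch: "char (distr P borel (\<lambda>\<omega>. \<Sum>i\<in>UNIV. Z i \<omega>)) 1
    = (\<Prod>i\<in>UNIV. complex_of_real (exp (- (\<Sum>s\<in>F. \<Sum>t\<in>F. a i s * a i t *
        ((\<bar>s\<bar> powr (2 * H) + \<bar>t\<bar> powr (2 * H) - \<bar>t - s\<bar> powr (2 * H)) / 2)) / 2)))"
    unfolding char_distr_sum[OF ind]
    unfolding Z_def centered_gaussian_char[OF prob_P fbm_scalar_shift_combination(1)[OF prob_P
      fbm_component F]]
      fbm_scalar_shift_combination(2)[OF prob_P fbm_component F] ..
  have ci: "char (distr P borel (\<lambda>\<omega>. \<Sum>i\<in>UNIV. Z i \<omega>)) 1 = (CLINT \<omega>|P. iexp (\<Sum>i\<in>UNIV. Z i \<omega>))"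
    unfolding char_def by (subst integral_distr) auto
  have int: "integrable P (\<lambda>\<omega>. iexp (\<Sum>i\<in>UNIV. Z i \<omega>))"
    by (rule integrable_const_bound[where B=1]) auto
  have "(\<integral>\<omega>. cos ((\<Sum>i\<in>UNIV. Z i \<omega>) + \<phi>) \<partial>P) = (\<integral>\<omega>. Re (cis \<phi> * iexp (\<Sum>i\<in>UNIV. Z i \<omega>)) \<partial>P)"
    by (intro Bochner_Integration.integral_cong refl) (simp add: cis_conv_exp[symmetric] cis_mult
      add.commute del: of_real_sum)
  also have "\<dots> = Re (CLINT \<omega>|P. cis \<phi> * iexp (\<Sum>i\<in>UNIV. Z i \<omega>))"
    by (rule integral_Re) (intro integrable_mult_right int)
  also have "(CLINT \<omega>|P. cis \<phi> * iexp (\<Sum>i\<in>UNIV. Z i \<omega>))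
    = cis \<phi> * (CLINT \<omega>|P. iexp (\<Sum>i\<in>UNIV. Z i \<omega>))"
    by simp
  finally show ?thesis unfolding ci[symmetric] ch by (simp add: Z_def)
qed

section \<open>Cylinder sets and the Borel sigma-algebra of the path space\<close>

definition cylinders :: "(real \<Rightarrow> real ^ 'd) set set" where
  "cylinders = {C. \<exists>K A. finite K \<and> (\<forall>k. A k \<in> sets borel) \<and>
     C = {\<omega>\<in>path_space. \<forall>k\<in>K. \<omega> (fst k) $ (snd k) \<in> A k}}"

lemma cylinders_subset: "cylinders \<subseteq> Pow path_space"
  by (auto simp: cylinders_def)

lemma Int_stable_cylinders: "Int_stable (cylinders :: (real \<Rightarrow> real ^ 'd) set set)"
proof (rule Int_stableI)
  fix C D :: "(real \<Rightarrow> real ^ 'd) set" assume "C \<in> cylinders" "D \<in> cylinders"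
  then obtain K A L B where C: "finite K" "\<forall>k. A k \<in> sets borel" "C
    = {\<omega>\<in>path_space. \<forall>k\<in>K. \<omega> (fst k) $ (snd k) \<in> A k}"
    and D: "finite L" "\<forall>k. B k \<in> sets borel" "D = {\<omega>\<in>path_space. \<forall>k\<in>L. \<omega> (fst k) $ (snd k) \<in> B k}"
    unfolding cylinders_def by blast
  show "C \<inter> D \<in> cylinders"
    unfolding cylinders_def
  proof (intro CollectI exI conjI allI)
    show "finite (K \<union> L)" using C D by simp
    show "(if k \<in> K then A k else UNIV) \<inter> (if k \<in> L then B k else UNIV) \<in> sets borel" for k
      using C(2)[THEN spec, of k] D(2)[THEN spec, of k] by simp
    show "C \<inter> D = {\<omega>\<in>path_space. \<forall>k\<in>K \<union> L. \<omega> (fst k) $ (snd k) \<in>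
       (if k \<in> K then A k else UNIV) \<inter> (if k \<in> L then B k else UNIV)}"
      unfolding C D by (auto split: if_splits)
  qed
qed

lemma coord_measurable_cylinders:
  "(\<lambda>\<omega>. \<omega> t) \<in> borel_measurable (sigma path_space (cylinders :: (real \<Rightarrow> real ^ 'd) set set))"
proof -
  have "(\<lambda>\<omega>. \<omega> t $ i) \<in> borel_measurable (sigma path_space (cylinders :: (real \<Rightarrow> real ^ 'd) set
    set))" for i
  proof (rule measurableI)
    fix A :: "real set" assume A: "A \<in> sets borel"
    have "{\<omega> \<in> path_space. \<omega> t $ i \<in> A} \<in> (cylinders :: (real \<Rightarrow> real ^ 'd) set set)"
      unfolding cylinders_def using A by (intro CollectI exI[of _ "{(t, i)}"] exI[of _ "\<lambda>_. A"])
        auto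
    moreover have "cylinders \<subseteq> Pow (path_space :: (real \<Rightarrow> real ^ 'd) set)"
      by (auto simp: cylinders_def)
    ultimately show "(\<lambda>\<omega>. \<omega> t $ i) -` A \<inter> space (sigma path_space cylinders) \<in> sets (sigma
      path_space cylinders)"
      by (auto simp: vimage_def Int_def conj_commute)
  qed simp
  then show ?thesis
    by (intro borel_measurable_euclidean_space[THEN iffD2]) (auto simp: Basis_vec_def inner_axis)
qed

text \<open>Allows closeness of paths to be tested at countably many times, which is what makes the
  approximating sets measurable.\<close>

lemma continuous_le_of_Rats:
  fixes g :: "real \<Rightarrow> real"
  assumes g: "continuous_on UNIV g" and T: "T > 0" and le: "\<And>t. t \<in> \<rat> \<Longrightarrow> t \<in> {-T..T} \<Longrightarrow> g t \<le> c"
    and t: "t \<in> {-T..T}"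
  shows "g t \<le> c"
proof (rule ccontr)
  assume "\<not> g t \<le> c"
  then have "g t > c" by simp
  have "open (g -` {c<..})" using g by (intro open_vimage) auto
  then obtain d where d: "d > 0" "\<And>s. dist s t < d \<Longrightarrow> g s > c"
    using \<open>g t > c\<close> unfolding open_dist by (auto dest!: bspec[of _ _ t])
  \<comment> \<open>The rational time must lie near t and inside the interval, also when t is an
    endpoint.\<close>
  have "max (-T) (t - d) < min T (t + d)" using T t d(1) by auto
  then obtain r where r: "r \<in> \<rat>" "max (-T) (t - d) < r" "r < min T (t + d)"
    using Rats_dense_in_real by blast
  then have "g r > c" using d(2)[of r] by (auto simp: dist_real_def)
  moreover have "g r \<le> c" using le[of r] r by auto
  ultimately show False by simp
qed

text \<open>The path topology is second countable: a path is approximated on \<open>[-T, T]\<close> by a step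
  function with values in a countable dense set; step \<open>j\<close> covers \<open>[j/n - T, (j+1)/n - T)\<close>.\<close>

lemma open_in_sigma_cylinders:
  fixes U :: "(real \<Rightarrow> real ^ 'd) set"
  assumes U: "path_open U"
  shows "U \<in> sets (sigma path_space cylinders)"
proof -
  let ?N = "sigma path_space (cylinders :: (real \<Rightarrow> real ^ 'd) set set)"
  have spN: "space ?N = path_space" by (rule space_measure_of[OF cylinders_subset])
  note [measurable] = coord_measurable_cylinders
  obtain D :: "(real ^ 'd) set" where D: "countable D" "\<And>X. open X \<Longrightarrow> X \<noteq> {} \<Longrightarrow> \<exists>d\<in>D. d \<in> X"
    using countable_dense_exists by blast
  \<comment> \<open>The index under \<open>nth\<close> is the number of the step that contains t,
    counted from -T with step length 1/n.\<close>
  define C where "C = (\<lambda>(n::nat, T::nat, k::nat, qs :: (real ^ 'd) list).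
     {\<omega>\<in>path_space. \<forall>t\<in>\<rat> \<inter> {-real T..real T}. dist (\<omega> t) (qs ! nat (\<lfloor>n * t\<rfloor> + int (n * T)))
       \<le> 1 / Suc k})"
  define I where "I = {x \<in> UNIV \<times> UNIV \<times> UNIV \<times> lists D. C x \<subseteq> U}"
  have "countable (UNIV \<times> UNIV \<times> UNIV \<times> lists D :: (nat \<times> nat \<times> nat \<times> (real ^ 'd) list) set)"
    using D(1) by (intro countable_SIGMA countable_lists) auto
  then have cI: "countable I" unfolding I_def by (rule countable_subset[rotated]) auto
  have CN: "C x \<in> sets ?N" for x
  proof -
    obtain n T k qs where x: "x = (n, T, k, qs)" by (cases x) auto
    have "countable (\<rat> \<inter> {-real T..real T})" using countable_rat
      by (rule countable_subset[rotated]) auto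
    then have "space ?N - (\<Union>t\<in>\<rat> \<inter> {-real T..real T}. {\<omega>\<in>space ?N. \<not> dist (\<omega> t) (qs ! nat (\<lfloor>n * t\<rfloor>
      + int (n * T))) \<le> 1 / Suc k}) \<in> sets ?N"
      by (intro sets.compl_sets sets.countable_UN'' ) measurable
    also have "space ?N - (\<Union>t\<in>\<rat> \<inter> {-real T..real T}. {\<omega>\<in>space ?N. \<not> dist (\<omega> t) (qs ! nat (\<lfloor>n * t\<rfloor>
      + int (n * T))) \<le> 1 / Suc k}) = C x"
      unfolding x C_def spN by auto
    finally show ?thesis .
  qed
  have "U = (\<Union>x\<in>I. C x)"
  proof (intro equalityI subsetI)
    fix \<omega> assume \<omega>: "\<omega> \<in> U"
    then have \<omega>p: "\<omega> \<in> path_space" using U by (auto simp: path_open_def)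
    obtain T0 e where T0: "T0 > 0" "e > 0" and ball: "\<And>\<omega>'. \<omega>' \<in> path_space \<Longrightarrow>
      (\<forall>t\<in>{-T0..T0}. dist (\<omega>' t) (\<omega> t) < e) \<Longrightarrow> \<omega>' \<in> U"
      using U \<omega> unfolding path_open_def by blast
    obtain T :: nat where "T0 < real T" using reals_Archimedean2 by blast
    then have T: "T0 \<le> real T" "T > 0" using T0 by auto
    obtain k where k: "1 / real (Suc k) < e / 2" using T0 by (meson half_gt_zero nat_approx_posE)
    \<comment> \<open>A path stays within 2h of its step function, one h for its oscillation on a
      step and one for the choice in D. Two paths near the same step function differ by at most 4h,
      which is below e by the choice of k.\<close>
    define h where "h = 1 / (2 * real (Suc k))"
    have h: "h > 0" "2 * h = 1 / Suc k" unfolding h_def by (auto simp: divide_simps)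
    have "uniformly_continuous_on {-real T..real T} \<omega>"
      using \<omega>p by (intro compact_uniformly_continuous) (auto simp: path_space_def intro:
        continuous_on_subset)
    then obtain \<delta> where \<delta>: "\<delta> > 0" "\<And>s t. s \<in> {-real T..real T} \<Longrightarrow> t \<in> {-real T..real T} \<Longrightarrow>
      dist s t < \<delta> \<Longrightarrow> dist (\<omega> s) (\<omega> t) < h"
      unfolding uniformly_continuous_on_def using h(1) by metis
    obtain n0 where n0: "1 / real (Suc n0) < \<delta>" using \<delta>(1) by (meson nat_approx_posE)
    define n where "n = Suc n0"
    have n: "n > 0" "1 / real n < \<delta>" using n0 by (auto simp: n_def)
    have "\<exists>d\<in>D. d \<in> ball (\<omega> (real j / n - T)) h" for j
      by (rule D(2)) (use h in auto)
    then obtain q where q: "\<And>j::nat. q j \<in> D" "\<And>j. dist (\<omega> (real j / n - T)) (q j) < h"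
      by (metis mem_ball)
    \<comment> \<open>The last of the 2nT + 1 entries serves t = T alone.\<close>
    define qs where "qs = map q [0..<2 * n * T + 1]"
    have qs: "qs \<in> lists D" using q(1) by (auto simp: qs_def)
    have approx: "dist (\<omega> t) (qs ! nat (\<lfloor>n * t\<rfloor> + int (n * T)))
      < 2 * h" if t: "t \<in> {-real T..real T}" for t :: real
    proof -
      define j where "j = nat (\<lfloor>n * t\<rfloor> + int (n * T))"
      have "real n * (- real T) \<le> n * t" "n * t \<le> real n * real T"
        using t by (intro mult_left_mono; simp)+
      then have fl: "- int (n * T) \<le> \<lfloor>n * t\<rfloor>" "\<lfloor>n * t\<rfloor> \<le> int (n * T)"
        by (simp_all add: le_floor_iff floor_le_iff)
      then have j: "int j = \<lfloor>n * t\<rfloor> + int (n * T)" by (simp add: j_def)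
      then have "real j = real_of_int \<lfloor>n * t\<rfloor> + real n * real T"
        by (metis of_int_add of_int_of_nat_eq of_nat_mult)
      then have jt: "real j / n - T = real_of_int \<lfloor>n * t\<rfloor> / n" using n by (simp add: field_simps)
      have "real_of_int \<lfloor>n * t\<rfloor> / n \<le> t" "t - real_of_int \<lfloor>n * t\<rfloor> / n < 1 / n"
        using n by (simp_all add: divide_simps mult.commute) linarith
      moreover have "- real T \<le> real j / n - T" by simp
      ultimately have "dist (\<omega> t) (\<omega> (real j / n - T)) < h"
        using t n by (intro \<delta>(2)) (auto simp: dist_real_def jt)
      moreover have "j < 2 * n * T + 1" using j fl(2) by linarith
      then have "qs ! j = q j" unfolding qs_def by (subst nth_map_upt) auto
      ultimately have "dist (\<omega> t) (qs ! j) < h + h"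
        using q(2)[of j] dist_triangle_lt[of "\<omega> t" "\<omega> (real j / n - T)" "q j"]
          by (smt (verit) dist_triangle)
      then show ?thesis by (simp add: j_def)
    qed
    have "\<omega> \<in> C (n, T, k, qs)"
      using \<omega>p approx unfolding C_def h(2) by (auto intro: less_imp_le)
    moreover have "C (n, T, k, qs) \<subseteq> U"
    proof
      fix \<omega>' assume "\<omega>' \<in> C (n, T, k, qs)"
      then have \<omega>': "\<omega>' \<in> path_space" and c: "\<And>t::real. t \<in> \<rat> \<Longrightarrow> t \<in> {-real T..real T} \<Longrightarrow>
        dist (\<omega>' t) (qs ! nat (\<lfloor>n * t\<rfloor> + int (n * T))) \<le> 2 * h"
        unfolding h(2) by (auto simp: C_def)
      have "dist (\<omega>' t) (\<omega> t) \<le> 4 * h" if "t \<in> {-real T..real T}" for t :: real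
      proof (rule continuous_le_of_Rats[of "\<lambda>t. dist (\<omega>' t) (\<omega> t)", OF _ _ _ that])
        show "continuous_on UNIV (\<lambda>t. dist (\<omega>' t) (\<omega> t))"
          using \<omega>' \<omega>p by (auto simp: path_space_def intro!: continuous_intros)
        show "dist (\<omega>' t) (\<omega> t) \<le> 4 * h" if "t \<in> \<rat>" "t \<in> {-real T..real T}" for t :: real
          using c[OF that] approx[OF that(2)] dist_triangle2[of "\<omega>' t" "\<omega> t" "qs ! nat (\<lfloor>n * t\<rfloor>
            + int (n * T))"] by linarith
      qed (use T in simp)
      moreover have "4 * h < e" using k h(2) by linarith
      moreover have "t \<in> {-real T..real T}" if "t \<in> {-T0..T0}" for t :: real using T that by auto
      ultimately show "\<omega>' \<in> U" by (intro ball \<omega>' ballI) (meson le_less_trans)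
    qed
    ultimately show "\<omega> \<in> (\<Union>x\<in>I. C x)" using qs by (auto simp: I_def)
  qed (auto simp: I_def)
  also have "\<dots> \<in> sets ?N" using cI CN by (intro sets.countable_UN') auto
  finally show ?thesis .
qed

lemma wiener_shift_path_space: "\<omega> \<in> path_space \<Longrightarrow> wiener_shift \<tau> \<omega> \<in> path_space"
  by (auto simp: path_space_def wiener_shift_def intro!: continuous_intros
      intro: continuous_on_compose2[of UNIV \<omega>])

text \<open>The cylinders form the pi-system on which measures will be compared. They are measurable
  because the coordinates are random variables, and they generate the open sets by second
  countability.\<close>

lemma sets_P: "sets P = sigma_sets path_space cylinders"
proof
  have "cylinders \<subseteq> sets P"
  proof
    fix C assume "C \<in> (cylinders :: (real \<Rightarrow> real ^ 'd) set set)"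
    then obtain K A where C: "finite K" "\<And>k. A k \<in> sets borel" "C
      = {\<omega>\<in>space P. \<forall>k\<in>K. \<omega> (fst k) $ (snd k) \<in> A k}"
      unfolding cylinders_def space_P by blast
    note [measurable] = C(2)
    show "C \<in> sets P" unfolding C(3) using C(1) by measurable
  qed
  then show "sigma_sets path_space cylinders \<subseteq> sets P"
    using sets.sigma_sets_subset[of cylinders P] by (simp add: space_P)
  have "sets P = sigma_sets path_space {U. path_open U}"
    using P by (simp add: fbm_law_def path_borel_def openin_path_topology path_open_def
      sets_measure_of Collect_mono_iff subset_iff)
  moreover have "{U. path_open U} \<subseteq> sigma_sets path_space (cylinders :: (real \<Rightarrow> real ^ 'd) set set)"
    using open_in_sigma_cylinders cylinders_subset by auto
  ultimately show "sets P \<subseteq> sigma_sets path_space cylinders"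
    by (simp add: sigma_sets_mono)
qed

section \<open>Measurability and invariance under the Wiener shift\<close>

lemma wiener_shift_measurable[measurable]: "wiener_shift \<tau> \<in> measurable P P"
proof (rule measurable_sigma_sets[OF sets_P cylinders_subset])
  show "wiener_shift \<tau> \<in> space P \<rightarrow> path_space" using wiener_shift_path_space by (auto simp: space_P)
  fix C assume "C \<in> (cylinders :: (real \<Rightarrow> real ^ 'd) set set)"
  then obtain K A where C: "finite K" "\<And>k. A k \<in> sets borel" "C
    = {\<omega>\<in>path_space. \<forall>k\<in>K. \<omega> (fst k) $ (snd k) \<in> A k}"
    unfolding cylinders_def by blast
  note [measurable] = C(2)
  have "wiener_shift \<tau> -` C \<inter> space P = {\<omega>\<in>space P. \<forall>k\<in>K. \<omega> (\<tau>
    + fst k) $ (snd k) - \<omega> \<tau> $ (snd k) \<in> A k}"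
    unfolding C(3) using wiener_shift_path_space by (auto simp: space_P wiener_shift_def)
  also have "\<dots> \<in> sets P" using C(1) by measurable
  finally show "wiener_shift \<tau> -` C \<inter> space P \<in> sets P" .
qed

text \<open>On a cylinder the two measures compare the increments from \<open>\<tau>\<close> with
  those from 0. Both have the characteristic function of \<open>char_combination\<close>, so
  \<open>law_unique\<close> makes them equal, and the pi-system argument extends this to all Borel
  sets.\<close>

lemma distr_wiener_shift: "distr P P (wiener_shift \<tau>) = P"
proof (rule measure_eqI_generator_eq[OF Int_stable_cylinders cylinders_subset])
  interpret prob_space P by (rule prob_P)
  show "sets (distr P P (wiener_shift \<tau>)) = sigma_sets path_space cylinders" by (simp add: sets_P)
  show "sets P = sigma_sets path_space cylinders" by (rule sets_P)
  show "range (\<lambda>_::nat. path_space :: (real \<Rightarrow> real ^ 'd) set) \<subseteq> cylinders"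
    unfolding cylinders_def by (auto intro!: exI[of _ "{}"] exI[of _ "\<lambda>_. UNIV"])
  show "emeasure (distr P P (wiener_shift \<tau>)) path_space \<noteq> \<infinity>"
    using prob_space.emeasure_le_1[OF prob_space_distr[OF wiener_shift_measurable]]
      by (metis ennreal_one_neq_top infinity_ennreal_def top.extremum_unique)
  fix C assume CC: "C \<in> (cylinders :: (real \<Rightarrow> real ^ 'd) set set)"
  then obtain K A where C: "finite K" "\<And>k. A k \<in> sets borel" "C
    = {\<omega>\<in>path_space. \<forall>k\<in>K. \<omega> (fst k) $ (snd k) \<in> A k}"
    unfolding cylinders_def by blast
  \<comment> \<open>\<open>char_combination\<close> sums over all components at every time, so the
    index set is completed to a rectangle, with the trivial constraint \<open>UNIV\<close> at the
    added indices.\<close>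
  let ?K = "fst ` K \<times> (UNIV :: 'd set)"
  have sum_eq: "(\<Sum>k\<in>?K. a k * f k) = (\<Sum>i\<in>UNIV. \<Sum>t\<in>fst ` K. a (t, i) * f (t, i))"
    for a f :: "real \<times> 'd \<Rightarrow> real"
    by (subst sum.swap) (simp add: sum.cartesian_product)
  \<comment> \<open>The terms 0 + t and \<open>\<omega>\<close> at 0 cast the unshifted coordinates
    into the shape of the case \<open>\<tau>\<close> = 0; on the path space the subtracted value is
    0.\<close>
  have "measure P {\<omega>\<in>space P. \<forall>k\<in>?K. (\<omega> (\<tau> + fst k) $ (snd k)
    - \<omega> \<tau> $ (snd k)) \<in> (if k \<in> K then A k else UNIV)}
     = measure P {\<omega>\<in>space P. \<forall>k\<in>?K. \<omega> (0 + fst k) $ (snd k)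
       - \<omega> 0 $ (snd k) \<in> (if k \<in> K then A k else UNIV)}"
  proof (rule law_unique[OF prob_P prob_P])
    show "finite ?K" using C by simp
    show "(\<integral>\<omega>. cos ((\<Sum>k\<in>?K. a k * (\<omega> (\<tau> + fst k) $ snd k - \<omega> \<tau> $ snd k)) + \<phi>) \<partial>P)
      = (\<integral>\<omega>. cos ((\<Sum>k\<in>?K. a k * (\<omega> (0 + fst k) $ snd k - \<omega> 0 $ snd k)) + \<phi>) \<partial>P)" for a \<phi>
      unfolding sum_eq fst_conv snd_conv by (simp only: char_combination[OF finite_imageI[OF C(1)]])
  qed (use C in auto)
  also have "{\<omega>\<in>space P. \<forall>k\<in>?K. \<omega> (0 + fst k) $ (snd k)
    - \<omega> 0 $ (snd k) \<in> (if k \<in> K then A k else UNIV)} = C"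
    unfolding C(3) space_P by (force simp: path_space_def)
  also have "{\<omega>\<in>space P. \<forall>k\<in>?K. (\<omega> (\<tau> + fst k) $ (snd k)
    - \<omega> \<tau> $ (snd k)) \<in> (if k \<in> K then A k else UNIV)}
      = wiener_shift \<tau> -` C \<inter> space P"
    unfolding C(3) using wiener_shift_path_space by (force simp: space_P wiener_shift_def)
  finally have "measure P (wiener_shift \<tau> -` C \<inter> space P) = measure P C" .
  moreover have "C \<in> sets P" using CC sets_P by auto
  ultimately show "emeasure (distr P P (wiener_shift \<tau>)) C = emeasure P C"
    by (simp add: emeasure_distr emeasure_eq_measure)
qed auto

lemma AE_wiener_shift:
  assumes "AE \<omega> in P. Q \<omega>"
  shows "AE \<omega> in P. Q (wiener_shift \<tau> \<omega>)"
proof -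
  have "AE \<omega> in distr P P (wiener_shift \<tau>). Q \<omega>" unfolding distr_wiener_shift by (rule assms)
  then show ?thesis by (rule AE_distrD[OF wiener_shift_measurable])
qed

lemma L2_wiener_shift:
  assumes X: "L2 P X"
  shows "L2 P (\<lambda>\<omega>. X (wiener_shift \<tau> \<omega>))" "nm P (\<lambda>\<omega>. X (wiener_shift \<tau> \<omega>)) = nm P X"
proof -
  note [measurable] = L2_measurable[OF X]
  have "integrable (distr P P (wiener_shift \<tau>)) (\<lambda>\<omega>. (norm (X \<omega>))\<^sup>2)"
    using L2_integrable[OF X] by (simp add: distr_wiener_shift)
  then show "L2 P (\<lambda>\<omega>. X (wiener_shift \<tau> \<omega>))"
    unfolding L2_def by (subst (asm) integrable_distr_eq) auto
  have "(\<integral>\<omega>. (norm (X \<omega>))\<^sup>2 \<partial>distr P P (wiener_shift \<tau>)) = (\<integral>\<omega>. (norm (X (wiener_shift \<tau> \<omega>)))\<^sup>2 \<partial>P)"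
    by (rule integral_distr) auto
  then show "nm P (\<lambda>\<omega>. X (wiener_shift \<tau> \<omega>)) = nm P X" by (simp add: nm_def distr_wiener_shift)
qed

end

section \<open>Almost periods\<close>

text \<open>\<open>Q \<epsilon> \<tau> t\<close> abstracts \<open>d (f (t + \<tau>)) (f t) \<le> \<epsilon>\<close>
  for a function \<open>f\<close> with values in a metric space.\<close>

definition ap_system :: "(real \<Rightarrow> real \<Rightarrow> real \<Rightarrow> bool) \<Rightarrow> bool" where
  "ap_system Q \<longleftrightarrow>
    (\<forall>e e' \<tau> \<eta> t. Q e \<tau> (t + \<eta>) \<longrightarrow> Q e' \<eta> t \<longrightarrow> Q (e + e') (\<tau> + \<eta>) t) \<and>
    (\<forall>e \<tau> t. Q e \<tau> t \<longrightarrow> Q e (- \<tau>) (t + \<tau>)) \<and>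
    (\<forall>e e' \<tau> t. Q e \<tau> t \<longrightarrow> e \<le> e' \<longrightarrow> Q e' \<tau> t) \<and>
    (\<forall>e>0. \<forall>t0. \<exists>\<delta>>0. \<forall>t \<tau>. \<bar>t - t0\<bar> < \<delta> \<longrightarrow> \<bar>\<tau>\<bar> < \<delta> \<longrightarrow> Q e \<tau> t) \<and>
    (\<forall>e>0. relatively_dense {\<tau>. \<forall>t. Q e \<tau> t})"

lemma ap_systemD:
  assumes "ap_system Q"
  shows "Q e \<tau> (t + \<eta>) \<Longrightarrow> Q e' \<eta> t \<Longrightarrow> Q (e + e') (\<tau> + \<eta>) t"
    and "Q e \<tau> t \<Longrightarrow> Q e (- \<tau>) (t + \<tau>)"
    and "Q e \<tau> t \<Longrightarrow> e \<le> e' \<Longrightarrow> Q e' \<tau> t"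
    and "e > 0 \<Longrightarrow> \<exists>\<delta>>0. \<forall>t \<tau>. \<bar>t - t0\<bar> < \<delta> \<longrightarrow> \<bar>\<tau>\<bar> < \<delta> \<longrightarrow> Q e \<tau> t"
    and "e > 0 \<Longrightarrow> relatively_dense {\<tau>. \<forall>t. Q e \<tau> t}"
  using assms unfolding ap_system_def by blast+

lemma relatively_denseD:
  assumes "relatively_dense E"
  obtains l where "l > 0" "\<And>a. \<exists>\<tau>\<in>E. a \<le> \<tau> \<and> \<tau> \<le> a + l"
  using assms unfolding relatively_dense_def by (force simp: disjoint_iff)

lemma relatively_dense_mono: "relatively_dense E \<Longrightarrow> E \<subseteq> F \<Longrightarrow> relatively_dense F"
  unfolding relatively_dense_def by blast

lemma ap_period_diff:
  assumes Q: "ap_system Q" and "\<forall>t. Q e \<tau> t" "\<forall>t. Q e' \<eta> t"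
  shows "Q (e + e') (\<tau> - \<eta>) t"
proof -
  have "Q e' (- \<eta>) t" using ap_systemD(2)[OF Q, of e' \<eta> "t - \<eta>"] assms(3) by simp
  then show ?thesis using ap_systemD(1)[OF Q, of e \<tau> t "- \<eta>" e'] assms(2) by simp
qed

lemma ap_period_add:
  assumes Q: "ap_system Q" and "\<forall>t. Q e \<tau> t" "\<forall>t. Q e' \<eta> t"
  shows "Q (e + e') (\<tau> + \<eta>) t"
  using ap_systemD(1)[OF Q, of e \<tau> t \<eta> e'] assms(2,3) by simp

text \<open>Uniform continuity of almost periodic functions: an almost period carries t into the
  compact interval [0, l], where one \<open>\<delta>\<close> works for all times, and the same
  period leads back. Each of the three moves costs e/3.\<close>

lemma ap_small_period:
  assumes Q: "ap_system Q" and e: "e > 0"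
  obtains \<delta> where "\<delta> > 0" "\<And>\<tau> t. \<bar>\<tau>\<bar> < \<delta> \<Longrightarrow> Q e \<tau> t"
proof -
  have e3: "e / 3 > 0" using e by simp
  obtain l where l: "l > 0" "\<And>a. \<exists>\<tau>\<in>{\<tau>. \<forall>t. Q (e/3) \<tau> t}. a \<le> \<tau> \<and> \<tau> \<le> a + l"
    using relatively_denseD[OF ap_systemD(5)[OF Q e3]] by blast
  have "\<forall>t0. \<exists>\<delta>>0. \<forall>t \<tau>. \<bar>t - t0\<bar> < \<delta> \<longrightarrow> \<bar>\<tau>\<bar> < \<delta> \<longrightarrow> Q (e/3) \<tau> t"
    using ap_systemD(4)[OF Q e3] by blast
  then obtain D where D: "\<And>t0. D t0 > 0" "\<And>t0 t \<tau>. \<bar>t - t0\<bar> < D t0 \<Longrightarrow> \<bar>\<tau>\<bar> < D t0 \<Longrightarrow> Q (e/3) \<tau> t"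
    by metis
  obtain C where C: "C \<subseteq> {0..l}" "finite C" "{0..l} \<subseteq> (\<Union>c\<in>C. ball c (D c))"
    using compactE_image[of "{0..l}" "{0..l}" "\<lambda>c. ball c (D c)"] D(1) by force
  define \<delta> where "\<delta> = Min (D ` C)"
  have "C \<noteq> {}" using C l(1) by fastforce
  then have \<delta>: "\<delta> > 0" "\<And>c. c \<in> C \<Longrightarrow> \<delta> \<le> D c" using C(2) D(1) by (auto simp: \<delta>_def)
  have "Q e \<tau> t" if \<tau>: "\<bar>\<tau>\<bar> < \<delta>" for \<tau> t
  proof -
    \<comment> \<open>This almost period brings t into [0, l].\<close>
    obtain \<eta> where \<eta>: "\<forall>t. Q (e/3) \<eta> t" "- t \<le> \<eta>" "\<eta> \<le> - t + l" using l(2)[of "- t"] by blast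
    then have "t + \<eta> \<in> {0..l}" by auto
    then obtain c where c: "c \<in> C" "dist c (t + \<eta>) < D c" using C(3) by auto
    then have "Q (e/3) \<tau> (t + \<eta>)" using D(2)[of "t + \<eta>" c \<tau>] \<delta>(2)[OF c(1)] \<tau>
      by (simp add: dist_real_def abs_minus_commute)
    then have "Q (e/3 + e/3) (\<tau> + \<eta>) t" using ap_systemD(1)[OF Q] \<eta>(1) by blast
    moreover have "Q (e/3) (- \<eta>) (t + (\<tau> + \<eta>))"
      using ap_systemD(2)[OF Q, of "e/3" \<eta> "t + \<tau>"] \<eta>(1) by (simp add: add.assoc)
    ultimately have "Q (e/3 + (e/3 + e/3)) (- \<eta> + (\<tau> + \<eta>)) t" using ap_systemD(1)[OF Q] by blast
    then show ?thesis by simp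
  qed
  with \<delta>(1) show ?thesis by (rule that)
qed

text \<open>Common almost periods of two functions (Bohr): almost periods \<open>\<tau>\<close> of the first and \<open>\<tau>'\<close> of the
  second in the same interval have a bounded difference; two such pairs with nearly the same
  difference yield the nearly common almost periods \<open>\<tau> - f k\<close> and \<open>\<tau>' - g k\<close>.\<close>

lemma ap_system_conj:
  assumes Q: "ap_system Q" and R: "ap_system R"
  shows "ap_system (\<lambda>e \<tau> t. Q e \<tau> t \<and> R e \<tau> t)"
proof -
  have "relatively_dense {\<tau>. \<forall>t. Q e \<tau> t \<and> R e \<tau> t}" if e: "e > 0" for e
  proof -
    have e3: "e / 3 > 0" using e by simp
    obtain l1 where l1: "l1 > 0" "\<And>a. \<exists>\<tau>\<in>{\<tau>. \<forall>t. Q (e/3) \<tau> t}. a \<le> \<tau> \<and> \<tau> \<le> a + l1"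
      using relatively_denseD[OF ap_systemD(5)[OF Q e3]] by blast
    obtain l2 where l2: "l2 > 0" "\<And>a. \<exists>\<tau>\<in>{\<tau>. \<forall>t. R (e/3) \<tau> t}. a \<le> \<tau> \<and> \<tau> \<le> a + l2"
      using relatively_denseD[OF ap_systemD(5)[OF R e3]] by blast
    define l where "l = max l1 l2"
    obtain \<delta> where \<delta>: "\<delta> > 0" "\<And>\<tau> t. \<bar>\<tau>\<bar> < \<delta> \<Longrightarrow> R (e/3) \<tau> t" using ap_small_period[OF R e3] by blast
    \<comment> \<open>The bounded differences are sorted into cells of width
      \<open>\<delta>\<close>. Only finitely many cells occur, and a representative pair is fixed in
      each.\<close>
    define pair where "pair k \<tau> \<tau>' \<longleftrightarrow> (\<forall>t. Q (e/3) \<tau> t) \<and> (\<forall>t. R (e/3) \<tau>' t) \<and> \<bar>\<tau> - \<tau>'\<bar>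
      \<le> l \<and> \<lfloor>(\<tau> - \<tau>') / \<delta>\<rfloor> = k" for k \<tau> \<tau>'
    define K where "K = {k. \<exists>\<tau> \<tau>'. pair k \<tau> \<tau>'}"
    have "K \<subseteq> {\<lfloor>- l / \<delta>\<rfloor>..\<lfloor>l / \<delta>\<rfloor>}"
    proof
      fix k assume "k \<in> K"
      then obtain \<tau> \<tau>' where "\<bar>\<tau> - \<tau>'\<bar> \<le> l" "\<lfloor>(\<tau> - \<tau>') / \<delta>\<rfloor> = k" by (auto simp: K_def pair_def)
      moreover from this(1) have "- l / \<delta> \<le> (\<tau> - \<tau>') / \<delta>" "(\<tau> - \<tau>') / \<delta> \<le> l / \<delta>"
        using \<delta>(1) by (intro divide_right_mono; simp)+
      ultimately show "k \<in> {\<lfloor>- l / \<delta>\<rfloor>..\<lfloor>l / \<delta>\<rfloor>}" using floor_mono by fastforce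
    qed
    then have finK: "finite K" by (rule finite_subset) simp
    have "\<forall>k\<in>K. \<exists>p. pair k (fst p) (snd p)" by (auto simp: K_def)
    then obtain h where h: "\<And>k. k \<in> K \<Longrightarrow> pair k (fst (h k)) (snd (h k))" by metis
    define f where "f k = fst (h k)" for k
    define g where "g k = snd (h k)" for k
    have fg: "pair k (f k) (g k)" if "k \<in> K" for k using h[OF that] by (simp add: f_def g_def)
    define L where "L = (\<Sum>k\<in>K. \<bar>f k\<bar>)"
    have L: "\<bar>f k\<bar> \<le> L" if "k \<in> K" for k unfolding L_def
      using finK that by (intro member_le_sum) auto
    have L0: "0 \<le> L" by (simp add: L_def sum_nonneg)
    show ?thesis
      unfolding relatively_dense_def
    proof (intro exI[of _ "l + 2 * L"] conjI allI)
      show "l + 2 * L > 0" using l1(1) L0 by (simp add: l_def)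
      fix a
      \<comment> \<open>The search starts at a + L because the representative \<open>f k\<close>, of
        size at most L, will be subtracted; the result then lies in the interval of length l + 2L
        from a.\<close>
      obtain \<tau> where \<tau>: "\<forall>t. Q (e/3) \<tau> t" "a + L \<le> \<tau>" "\<tau> \<le> a + L + l1"
        using l1(2)[of "a + L"] by blast
      obtain \<tau>' where \<tau>': "\<forall>t. R (e/3) \<tau>' t" "a + L \<le> \<tau>'" "\<tau>' \<le> a + L + l2"
        using l2(2)[of "a + L"] by blast
      define k where "k = \<lfloor>(\<tau> - \<tau>') / \<delta>\<rfloor>"
      have pk: "pair k \<tau> \<tau>'" using \<tau> \<tau>' by (auto simp: pair_def k_def l_def)
      then have k: "k \<in> K" by (auto simp: K_def)
      note pf = fg[OF k]
      \<comment> \<open>Two pairs in the same cell have differences closer than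
        \<open>\<delta>\<close>, so \<open>\<xi>\<close> is a small period of R, and
        \<open>\<tau> - f k\<close> is \<open>\<xi>\<close> plus
        \<open>\<tau>' - g k\<close>.\<close>
      define \<xi> where "\<xi> = (\<tau> - \<tau>') - (f k - g k)"
      have "\<bar>(\<tau> - \<tau>') / \<delta> - (f k - g k) / \<delta>\<bar> < 1"
        using pk pf unfolding pair_def by linarith
      then have "\<bar>\<xi>\<bar> < \<delta>" using \<delta>(1) by (simp add: \<xi>_def diff_divide_distrib[symmetric]
        divide_simps)
      then have "\<forall>t. R (e/3) \<xi> t" using \<delta>(2) by blast
      moreover have "\<forall>t. R (e/3 + e/3) (\<tau>' - g k) t"
        using ap_period_diff[OF R \<tau>'(1), of "e/3" "g k"] pf unfolding pair_def by blast
      ultimately have "\<forall>t. R (e/3 + (e/3 + e/3)) (\<xi> + (\<tau>' - g k)) t"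
        using ap_period_add[OF R] by blast
      then have "\<forall>t. R e (\<tau> - f k) t" by (simp add: \<xi>_def)
      moreover have "\<forall>t. Q (e/3 + e/3) (\<tau> - f k) t"
        using ap_period_diff[OF Q \<tau>(1), of "e/3" "f k"] pf unfolding pair_def by blast
      then have "\<forall>t. Q e (\<tau> - f k) t" using ap_systemD(3)[OF Q, of "e/3 + e/3" _ _ e] e by auto
      moreover have "\<tau> - f k \<in> {a..a + (l + 2 * L)}"
        using L[OF k] \<tau> by (auto simp: l_def abs_le_iff)
      ultimately show "{\<tau>. \<forall>t. Q e \<tau> t \<and> R e \<tau> t} \<inter> {a..a + (l + 2 * L)} \<noteq> {}" by blast
    qed
  qed
  moreover have "\<exists>\<delta>>0. \<forall>t \<tau>. \<bar>t - t0\<bar> < \<delta> \<longrightarrow> \<bar>\<tau>\<bar> < \<delta> \<longrightarrow> Q e \<tau> t \<and> R e \<tau> t" if e: "e > 0" for e t0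
  proof -
    obtain \<delta>1 \<delta>2 where "\<delta>1 > 0" "\<And>\<tau> t. \<bar>\<tau>\<bar> < \<delta>1 \<Longrightarrow> Q e \<tau> t" "\<delta>2 > 0" "\<And>\<tau> t. \<bar>\<tau>\<bar> < \<delta>2 \<Longrightarrow> R e \<tau> t"
      using ap_small_period[OF Q e] ap_small_period[OF R e] by metis
    then show ?thesis by (intro exI[of _ "min \<delta>1 \<delta>2"]) auto
  qed
  ultimately show ?thesis
    unfolding ap_system_def
    by (intro conjI allI impI; (elim conjE)?)
       (erule (1) ap_systemD(1)[OF Q] ap_systemD(1)[OF R] ap_systemD(3)[OF Q] ap_systemD(3)[OF R]
        | erule ap_systemD(2)[OF Q] ap_systemD(2)[OF R] | simp)+
qed

lemma almost_periodic_system: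
  assumes "almost_periodic f"
  shows "ap_system (\<lambda>e \<tau> t. norm (f (t + \<tau>) - f t) \<le> e)"
  unfolding ap_system_def
proof (intro conjI allI impI)
  fix e e' \<tau> \<eta> t
  assume "norm (f (t + \<eta> + \<tau>) - f (t + \<eta>)) \<le> e" "norm (f (t + \<eta>) - f t) \<le> e'"
  then show "norm (f (t + (\<tau> + \<eta>)) - f t) \<le> e + e'"
    using norm_triangle_ineq[of "f (t + \<eta> + \<tau>) - f (t + \<eta>)" "f (t + \<eta>) - f t"] by (simp add: add_ac)
next
  fix e t0 :: real assume e: "e > 0"
  have "isCont f t0" using assms by (auto simp: almost_periodic_def continuous_on_eq_continuous_at)
  then obtain d where d: "d > 0" "\<And>s. dist s t0 < d \<Longrightarrow> dist (f s) (f t0) < e/2"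
    using e unfolding continuous_at_eps_delta by (metis half_gt_zero)
  show "\<exists>\<delta>>0. \<forall>t \<tau>. \<bar>t - t0\<bar> < \<delta> \<longrightarrow> \<bar>\<tau>\<bar> < \<delta> \<longrightarrow> norm (f (t + \<tau>) - f t) \<le> e"
  proof (intro exI[of _ "d/2"] conjI allI impI)
    fix t \<tau> assume "\<bar>t - t0\<bar> < d / 2" "\<bar>\<tau>\<bar> < d / 2"
    then have "dist (t + \<tau>) t0 < d" "dist t t0 < d" unfolding dist_real_def by linarith+
    then have "dist (f (t + \<tau>)) (f t0) < e/2" "dist (f t) (f t0) < e/2" using d(2) by blast+
    then show "norm (f (t + \<tau>) - f t) \<le> e" using dist_triangle2[of "f (t + \<tau>)" "f t" "f t0"]
      by (simp add: dist_norm)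
  qed (use d in simp)
qed (use assms in \<open>auto simp: almost_periodic_def norm_minus_commute\<close>)

lemma almost_periodic_unif_compact_system:
  assumes b: "almost_periodic_unif_compact b" and K: "compact K"
  shows "ap_system (\<lambda>e \<tau> t. \<forall>x\<in>K. norm (b (t + \<tau>) x - b t x) \<le> e)"
  unfolding ap_system_def
proof (intro conjI allI impI)
  fix e e' \<tau> \<eta> t
  assume *: "\<forall>x\<in>K. norm (b (t + \<eta> + \<tau>) x - b (t + \<eta>) x) \<le> e" "\<forall>x\<in>K. norm (b (t + \<eta>) x - b t x) \<le> e'"
  show "\<forall>x\<in>K. norm (b (t + (\<tau> + \<eta>)) x - b t x) \<le> e + e'"
  proof
    fix x assume "x \<in> K"
    then show "norm (b (t + (\<tau> + \<eta>)) x - b t x) \<le> e + e'"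
      using * norm_triangle_ineq[of "b (t + \<eta> + \<tau>) x - b (t + \<eta>) x" "b (t + \<eta>) x - b t x"]
        by (force simp: add_ac)
  qed
next
  fix e t0 :: real assume e: "e > 0"
  have ul: "uniform_limit K b (b t0) (at t0)"
    using b K by (simp add: almost_periodic_unif_compact_def)
  have "\<forall>\<^sub>F s in at t0. \<forall>x\<in>K. dist (b s x) (b t0 x) < e/2"
    using uniform_limitD[OF ul, of "e/2"] e by simp
  then obtain d where d: "d > 0" "\<And>s. s \<noteq> t0 \<Longrightarrow> dist s t0 < d \<Longrightarrow> \<forall>x\<in>K. dist (b s x) (b t0 x) < e/2"
    unfolding eventually_at by auto
  have d': "dist (b s x) (b t0 x) < e/2" if "dist s t0 < d" "x \<in> K" for s x
    using d(2)[of s] that e by (cases "s = t0") auto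
  show "\<exists>\<delta>>0. \<forall>t \<tau>. \<bar>t - t0\<bar> < \<delta> \<longrightarrow> \<bar>\<tau>\<bar> < \<delta> \<longrightarrow> (\<forall>x\<in>K. norm (b (t + \<tau>) x - b t x) \<le> e)"
  proof (intro exI[of _ "d/2"] conjI allI impI ballI)
    fix t \<tau> x assume a: "\<bar>t - t0\<bar> < d / 2" "\<bar>\<tau>\<bar> < d / 2" "x \<in> K"
    then have "dist (t + \<tau>) t0 < d" "dist t t0 < d" unfolding dist_real_def by linarith+
    then have "dist (b (t + \<tau>) x) (b t0 x) < e/2" "dist (b t x) (b t0 x) < e/2"
      using a(3) d' by blast+
    then show "norm (b (t + \<tau>) x - b t x) \<le> e"
      using dist_triangle2[of "b (t + \<tau>) x" "b t x" "b t0 x"] by (simp add: dist_norm)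
  qed (use d in simp)
qed (use b K in \<open>auto simp: almost_periodic_unif_compact_def norm_minus_commute\<close>)

text \<open>Every value is within 1 of a value on the compact interval [0, l]. Applied to the noise
  coefficient, this gives the bound used in all noise estimates.\<close>

lemma almost_periodic_bounded:
  assumes f: "almost_periodic f"
  obtains B where "\<And>t. norm (f t) \<le> B"
proof -
  have "relatively_dense {\<tau>. \<forall>t. norm (f (t + \<tau>) - f t) \<le> 1}"
    using f by (simp add: almost_periodic_def)
  then obtain l where l: "l > 0" "\<And>a. \<exists>\<tau>\<in>{\<tau>. \<forall>t. norm (f (t + \<tau>) - f t) \<le> 1}. a \<le> \<tau> \<and> \<tau> \<le> a + l"
    by (rule relatively_denseD) blast
  have "compact (f ` {0..l})" using f by (intro compact_continuous_image) (auto simp: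
    almost_periodic_def intro: continuous_on_subset)
  then have "bounded (f ` {0..l})" by (rule compact_imp_bounded)
  then obtain B where B: "\<And>t. t \<in> {0..l} \<Longrightarrow> norm (f t) \<le> B" unfolding bounded_iff by blast
  have "norm (f t) \<le> B + 1" for t
  proof -
    obtain \<tau> where \<tau>: "\<forall>t. norm (f (t + \<tau>) - f t) \<le> 1" "- t \<le> \<tau>" "\<tau> \<le> - t + l"
      using l(2)[of "- t"] by blast
    then have "norm (f (t + \<tau>)) \<le> B" by (intro B) auto
    then show ?thesis using \<tau>(1)[rule_format, of t] norm_triangle_ineq2[of "f t" "f (t + \<tau>)"]
      by (simp add: norm_minus_commute)
  qed
  then show ?thesis by (rule that)
qed

section \<open>A continuity theorem of Kolmogorov type\<close>

text \<open>Plays the role of Borel--Cantelli: summable seminorms make the sum of the norms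
  integrable, hence finite almost surely.\<close>

lemma (in prob_space) AE_summable_nm:
  fixes Z :: "nat \<Rightarrow> 'a \<Rightarrow> 'b::euclidean_space"
  assumes Z: "\<And>n. L2 M (Z n)" and le: "\<And>n. nm M (Z n) \<le> c n" and c: "summable c"
  shows "AE \<omega> in M. summable (\<lambda>n. norm (Z n \<omega>))"
proof -
  note [measurable] = Z[THEN L2_measurable]
  have c0: "0 \<le> c n" for n using le[of n] nm_nonneg[of M "Z n"] by linarith
  have "(\<integral>\<^sup>+\<omega>. (\<Sum>n. ennreal (norm (Z n \<omega>))) \<partial>M) = (\<Sum>n. \<integral>\<^sup>+\<omega>. ennreal (norm (Z n \<omega>)) \<partial>M)"
    by (rule nn_integral_suminf) measurable
  also have "\<dots> \<le> (\<Sum>n. ennreal (c n))"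
  proof (intro suminf_le summableI)
    fix n
    have "(\<integral>\<^sup>+\<omega>. ennreal (norm (Z n \<omega>)) \<partial>M) = ennreal (\<integral>\<omega>. norm (Z n \<omega>) \<partial>M)"
      by (rule nn_integral_eq_integral) (simp_all add: L2_L1(1)[OF Z])
    then show "(\<integral>\<^sup>+\<omega>. ennreal (norm (Z n \<omega>)) \<partial>M) \<le> ennreal (c n)"
      using L2_L1(2)[OF Z, of n] le[of n] by (simp add: ennreal_leI)
  qed
  also have "\<dots> = ennreal (\<Sum>n. c n)" by (rule suminf_ennreal2[OF c0 c])
  finally have "(\<integral>\<^sup>+\<omega>. (\<Sum>n. ennreal (norm (Z n \<omega>))) \<partial>M) \<noteq> \<infinity>" by (auto simp: top_unique)
  then have "AE \<omega> in M. (\<Sum>n. ennreal (norm (Z n \<omega>))) \<noteq> \<infinity>"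
    by (intro nn_integral_noteq_infinite) measurable
  then show ?thesis
    by eventually_elim (simp add: summable_suminf_not_top)
qed

text \<open>The deterministic half of the chaining argument. Passing to the next dyadic level moves
  the evaluation point by at most one dyadic increment of that level, so a summable bound on the
  largest increments gives locally uniform convergence.\<close>

lemma dyadic_chain:
  fixes x :: "real \<Rightarrow> 'b::euclidean_space" and v :: "nat \<Rightarrow> nat \<Rightarrow> real"
  defines "S \<equiv> \<lambda>n (t::real). x (real_of_int \<lfloor>2 ^ n * t\<rfloor> / 2 ^ n)"
  assumes sm: "\<And>N. summable (v N)"
    and v: "\<And>N n k. \<bar>k\<bar> \<le> int N * 2 ^ n \<Longrightarrow>
       norm (x (real_of_int (k + 1) / 2 ^ n) - x (real_of_int k / 2 ^ n)) \<le> v N n"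
  shows "convergent (\<lambda>n. S n t)" and "continuous_on UNIV (\<lambda>t. lim (\<lambda>n. S n t))"
proof -
  have v0: "0 \<le> v N n" for N n using order_trans[OF norm_ge_zero v[of 0 N n]] by simp
  have floor_bound: "\<bar>\<lfloor>2 ^ n * t\<rfloor>\<bar> \<le> int N * 2 ^ n" if "\<bar>t\<bar> \<le> real N" for n N and t :: real
  proof -
    have "\<bar>2 ^ n * t\<bar> \<le> 2 ^ n * real N" using that by (simp add: abs_mult)
    then have "- (2 ^ n * real N) \<le> 2 ^ n * t" "2 ^ n * t \<le> 2 ^ n * real N" by linarith+
    moreover have "real_of_int (int N * 2 ^ n) = 2 ^ n * real N" by simp
    ultimately have "real_of_int (- (int N * 2 ^ n))
      \<le> 2 ^ n * t" "2 ^ n * t < real_of_int (int N * 2 ^ n) + 1" by linarith+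
    then have "- (int N * 2 ^ n) \<le> \<lfloor>2 ^ n * t\<rfloor>" "\<lfloor>2 ^ n * t\<rfloor> \<le> int N * 2 ^ n"
      unfolding le_floor_iff floor_le_iff .
    then show ?thesis by linarith
  qed
  have step: "norm (S (Suc n) t - S n t) \<le> v N (Suc n)" if t: "\<bar>t\<bar> \<le> real N" for n N t
  proof -
    define k where "k = \<lfloor>2 ^ n * t\<rfloor>"
    have "real_of_int k \<le> 2 ^ n * t" "2 ^ n * t < real_of_int k + 1" by (auto simp: k_def)
    then have "\<lfloor>2 ^ Suc n * t\<rfloor> = 2 * k \<or> \<lfloor>2 ^ Suc n * t\<rfloor> = 2 * k + 1"
      by (simp add: floor_eq_iff) linarith
    moreover have "S n t = x (real_of_int (2 * k) / 2 ^ Suc n)" by (simp add: S_def k_def)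
    moreover have "\<bar>2 * k\<bar> \<le> int N * 2 ^ Suc n" using floor_bound[OF t, of n] by (simp add: k_def)
    ultimately show ?thesis using v[of "2 * k" N "Suc n"] v0 unfolding S_def by auto
  qed
  \<comment> \<open>Points at distance at most 2^-n lie in the same dyadic cell of level n or in
    neighbouring ones.\<close>
  have near: "norm (S n s - S n t) \<le> v N n" if s: "\<bar>s\<bar> \<le> real N" and t: "\<bar>t\<bar> \<le> real N"
    and st: "\<bar>s - t\<bar> \<le> 1 / 2 ^ n" for n N s t
  proof -
    have *: "norm (S n s - S n t) \<le> v N n" if s: "\<bar>s\<bar> \<le> real N" and st: "s \<le> t" "t - s \<le> 1 / 2 ^ n"
      for s t
    proof -
      have "2 ^ n * s \<le> 2 ^ n * t" "2 ^ n * t \<le> 2 ^ n * s + 1" using st by (auto simp: field_simps)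
      then have "\<lfloor>2 ^ n * t\<rfloor> = \<lfloor>2 ^ n * s\<rfloor> \<or> \<lfloor>2 ^ n * t\<rfloor> = \<lfloor>2 ^ n * s\<rfloor> + 1" by linarith
      then show ?thesis using v[OF floor_bound[OF s, of n]] v0 unfolding S_def
        by (auto simp: norm_minus_commute)
    qed
    show ?thesis
    proof (cases "s \<le> t")
      case True
      then show ?thesis using *[OF s, of t] st by simp
    next
      case False
      then show ?thesis using *[OF t, of s] st unfolding norm_minus_commute[of "S n s"] by simp
    qed
  qed
  \<comment> \<open>\<open>S n\<close> is written as a telescoping series, to which the Weierstrass
    test applies on each compact interval.\<close>
  have unif: "uniform_limit {- real N..real N} S (\<lambda>t. S 0 t
    + (\<Sum>i. S (Suc i) t - S i t)) sequentially" for N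
  proof -
    have "uniform_limit {- real N..real N} (\<lambda>n t. \<Sum>i<n. S (Suc i) t - S i t) (\<lambda>t. \<Sum>i. S (Suc i) t
      - S i t) sequentially"
    proof (rule Weierstrass_m_test)
      show "norm (S (Suc n) t - S n t) \<le> v N (Suc n)" if "t \<in> {- real N..real N}" for n t
        using step[of t N n] that by auto
      show "summable (\<lambda>n. v N (Suc n))" using sm by (simp add: summable_Suc_iff)
    qed
    then have "uniform_limit {- real N..real N} (\<lambda>n t. S 0 t
      + (\<Sum>i<n. S (Suc i) t - S i t)) (\<lambda>t. S 0 t + (\<Sum>i. S (Suc i) t - S i t)) sequentially"
      by (intro uniform_limit_intros)
    moreover have "S 0 t + (\<Sum>i<n. S (Suc i) t - S i t) = S n t" for n t
      using sum_lessThan_telescope[of "\<lambda>i. S i t" n] by simp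
    ultimately show ?thesis by simp
  qed
  have lim: "(\<lambda>n. S n t) \<longlonglongrightarrow> S 0 t + (\<Sum>i. S (Suc i) t - S i t)" for t
  proof -
    obtain N :: nat where "\<bar>t\<bar> \<le> real N" using real_arch_simple by blast
    then show ?thesis using tendsto_uniform_limitI[OF unif[of N], of t] by (simp add: abs_le_iff)
  qed
  then show "convergent (\<lambda>n. S n t)" by (auto simp: convergent_def)
  have limeq: "lim (\<lambda>n. S n t) = S 0 t + (\<Sum>i. S (Suc i) t - S i t)" for t using lim by (rule limI)
  show "continuous_on UNIV (\<lambda>t. lim (\<lambda>n. S n t))"
    unfolding continuous_on_iff
  proof (intro ballI allI impI)
    fix t e :: real assume e: "e > 0"
    \<comment> \<open>The extra 1 keeps every s within distance 1 of t in the interval.\<close>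
    obtain N :: nat where N: "\<bar>t\<bar> + 1 \<le> real N" using real_arch_simple by blast
    have "\<forall>\<^sub>F n in sequentially. \<forall>s\<in>{- real N..real N}. dist (S n s) (lim (\<lambda>n. S n s)) < e/3"
      using uniform_limitD[OF unif[of N], of "e/3"] e unfolding limeq by simp
    moreover have "\<forall>\<^sub>F n in sequentially. v N n < e/3"
      using order_tendstoD(2)[OF summable_LIMSEQ_zero[OF sm[of N]], of "e/3"] e by simp
    ultimately have "\<forall>\<^sub>F n in sequentially. (\<forall>s\<in>{- real N..real N}. dist (S n s) (lim (\<lambda>n. S n s))
      < e/3) \<and> v N n < e/3"
      by (rule eventually_conj)
    then obtain n where n: "\<And>s. s \<in> {- real N..real N} \<Longrightarrow>
      dist (S n s) (lim (\<lambda>n. S n s)) < e/3" "v N n < e/3"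
      unfolding eventually_sequentially by blast
    show "\<exists>d>0. \<forall>s\<in>UNIV. dist s t < d \<longrightarrow> dist (lim (\<lambda>n. S n s)) (lim (\<lambda>n. S n t)) < e"
    proof (intro exI[of _ "1 / 2 ^ n"] conjI ballI impI)
      fix s :: real assume "dist s t < 1 / 2 ^ n"
      moreover have "1 / 2 ^ n \<le> (1::real)" by simp
      ultimately have s: "\<bar>s - t\<bar> \<le> 1 / 2 ^ n" "\<bar>s\<bar> \<le> real N" "\<bar>t\<bar> \<le> real N"
        using N unfolding dist_real_def by linarith+
      then have "dist (S n s) (S n t) < e/3" using near[OF s(2,3,1)] n(2) by (simp add: dist_norm)
      moreover have "s \<in> {- real N..real N}" "t \<in> {- real N..real N}" using s by auto
      then have "dist (S n s) (lim (\<lambda>n. S n s)) < e/3" "dist (S n t) (lim (\<lambda>n. S n t)) < e/3"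
        by (blast intro: n(1))+
      ultimately show "dist (lim (\<lambda>n. S n s)) (lim (\<lambda>n. S n t)) < e"
        using dist_triangle[of "lim (\<lambda>n. S n s)" "lim (\<lambda>n. S n t)" "S n s"]
          dist_triangle[of "S n s" "lim (\<lambda>n. S n t)" "S n t"] dist_commute[of "lim (\<lambda>n. S n s)" "S n
            s"]
        by linarith
    qed simp
  qed
qed

text \<open>On [-N, N] there are about 2N 2^n dyadic increments of level n, each with second moment
  at most C^2 2^(-2Hn). Their sum is of order 2^((1 - 2H)n), which is geometric because H >
  1/2.\<close>

theorem kolmogorov_L2:
  fixes X :: "real \<Rightarrow> 'w \<Rightarrow> real ^ 'd"
  assumes M: "prob_space M" and X: "\<And>t. L2 M (X t)" and H: "1/2 < H" and C: "0 \<le> C"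
    and Hoelder: "\<And>s t. s \<le> t \<Longrightarrow> t - s \<le> 1 \<Longrightarrow> nm M (\<lambda>\<omega>. X t \<omega> - X s \<omega>) \<le> C * (t - s) powr H"
  obtains Y where "continuous_process M Y" "\<And>t. AE \<omega> in M. Y t \<omega> = X t \<omega>"
proof -
  interpret prob_space M by (rule M)
  note [measurable] = X[THEN L2_measurable]
  define \<rho> where "\<rho> = 2 powr (1/2 - H)"
  have \<rho>: "0 < \<rho>" "\<rho> < 1" using H by (auto simp: \<rho>_def powr_less_one)
  have pow: "(1 / 2 ^ n) powr H = 2 powr (- H * n)" for n :: nat
    by (simp add: powr_divide powr_powr powr_realpow[symmetric] powr_minus divide_simps mult.commute
      flip: powr_add)
  define D where "D = (\<lambda>(n::nat) (k::int) \<omega>. X (real_of_int (k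
    + 1) / 2 ^ n) \<omega> - X (real_of_int k / 2 ^ n) \<omega>)"
  have LD: "L2 M (D n k)" for n k unfolding D_def by (intro L2_diff X)
  note [measurable] = LD[THEN L2_measurable]
  have nD: "nm M (D n k) \<le> C * 2 powr (- H * n)" for n k
    using Hoelder[of "real_of_int k / 2 ^ n" "real_of_int (k + 1) / 2 ^ n"]
    by (simp add: D_def add_divide_distrib pow)
  \<comment> \<open>The root of the sum of squares dominates the largest increment, and its seminorm
    is computed exactly because second moments add up.\<close>
  define V where "V N n \<omega> = sqrt (\<Sum>k\<in>{-(int N * 2 ^ n)..int N * 2 ^ n}. (norm (D n k \<omega>))\<^sup>2)"
    for N n \<omega>
  have VD: "norm (D n k \<omega>) \<le> V N n \<omega>" if "\<bar>k\<bar> \<le> int N * 2 ^ n" for N n k \<omega>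
  proof -
    have "(norm (D n k \<omega>))\<^sup>2 \<le> (\<Sum>k\<in>{-(int N * 2 ^ n)..int N * 2 ^ n}. (norm (D n k \<omega>))\<^sup>2)"
      using that by (intro member_le_sum) auto
    then show ?thesis unfolding V_def by (rule real_le_rsqrt)
  qed
  have Vsq: "(norm (V N n \<omega>))\<^sup>2 = (\<Sum>k\<in>{-(int N * 2 ^ n)..int N * 2 ^ n}. (norm (D n k \<omega>))\<^sup>2)"
    for N n \<omega>
    by (simp add: V_def sum_nonneg)
  have LV: "L2 M (V N n)" for N n
  proof -
    have [measurable]: "V N n \<in> borel_measurable M" unfolding V_def by measurable
    show ?thesis unfolding L2_def Vsq using L2_integrable[OF LD] by auto
  qed
  have nV: "nm M (V N n) \<le> (sqrt (2 * real N + 1) * C) * \<rho> ^ n" for N n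
  proof (rule power2_le_imp_le)
    let ?I = "{-(int N * 2 ^ n)..int N * 2 ^ n}"
    have "(nm M (V N n))\<^sup>2 = (\<Sum>k\<in>?I. (nm M (D n k))\<^sup>2)"
      unfolding nm_sq Vsq using L2_integrable[OF LD] by (simp add: Bochner_Integration.integral_sum)
    also have "\<dots> \<le> (\<Sum>k\<in>?I. (C * 2 powr (- H * n))\<^sup>2)"
      by (intro sum_mono power_mono nD) simp
    also have "\<dots> = real (card ?I) * (C\<^sup>2 * (2 powr (- H * n))\<^sup>2)" by (simp add: power_mult_distrib)
    also have "\<dots> \<le> ((2 * real N + 1) * 2 ^ n) * (C\<^sup>2 * (2 powr (- H * n))\<^sup>2)"
    proof (intro mult_right_mono)
      have "real (card ?I) = 2 * real N * 2 ^ n + 1"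
        by (simp add: nat_add_distrib nat_mult_distrib nat_power_eq algebra_simps)
      also have "\<dots> \<le> (2 * real N + 1) * 2 ^ n" by (simp add: algebra_simps)
      finally show "real (card ?I) \<le> (2 * real N + 1) * 2 ^ n" .
    qed simp
    also have "\<dots> = (sqrt (2 * real N + 1) * C * \<rho> ^ n)\<^sup>2"
    proof -
      have "\<rho> ^ n = 2 powr ((1/2 - H) * n)" using powr_realpow[OF \<rho>(1), of n]
        by (simp add: \<rho>_def powr_powr)
      then have "(\<rho> ^ n)\<^sup>2 = 2 powr ((1/2 - H) * n + (1/2 - H) * n)"
        by (simp only: power2_eq_square powr_add)
      also have "(1/2 - H) * n + (1/2 - H) * n = real n + (- H * n + - H * n)"
        by (simp add: algebra_simps)
      also have "2 powr \<dots> = 2 ^ n * (2 powr (- H * n))\<^sup>2"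
        by (simp only: powr_add power2_eq_square) (simp add: powr_realpow)
      finally show ?thesis by (simp add: power_mult_distrib)
    qed
    finally show "(nm M (V N n))\<^sup>2 \<le> (sqrt (2 * real N + 1) * C * \<rho> ^ n)\<^sup>2" .
    show "0 \<le> sqrt (2 * real N + 1) * C * \<rho> ^ n" using C \<rho> by simp
  qed
  have "AE \<omega> in M. summable (\<lambda>n. norm (V N n \<omega>))" for N
    by (rule AE_summable_nm[OF LV nV]) (use \<rho> in \<open>auto intro!: summable_mult summable_geometric\<close>)
  then have "AE \<omega> in M. \<forall>N. summable (\<lambda>n. norm (V N n \<omega>))" by (simp add: AE_all_countable)
  then obtain B where B: "B \<in> null_sets M" "\<And>\<omega>. \<omega> \<in> space M - B \<Longrightarrow> \<forall>N. summable (\<lambda>n. norm (V N n \<omega>))"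
    by (auto elim!: AE_E3)
  have sV: "summable (\<lambda>n. V N n \<omega>)" if "\<omega> \<in> space M - B" for \<omega> N
    using B(2)[OF that] by (auto intro: summable_norm_cancel)
  define S where "S = (\<lambda>(n::nat) (t::real). X (real_of_int \<lfloor>2 ^ n * t\<rfloor> / 2 ^ n))"
  \<comment> \<open>The value 0 on the exceptional null set makes every path continuous, as
    \<open>continuous_process\<close> demands.\<close>
  define Y where "Y t \<omega> = (if \<omega> \<in> B then 0 else lim (\<lambda>n. S n t \<omega>))" for t \<omega>
  have chain: "convergent (\<lambda>n. S n t \<omega>)" "continuous_on UNIV (\<lambda>t. lim (\<lambda>n. S n t \<omega>))"
    if "\<omega> \<in> space M - B" for \<omega> t
    unfolding S_def
    by (rule dyadic_chain[where v="\<lambda>N n. V N n \<omega>" and x="\<lambda>t. X t \<omega>", OF sV[OF that]];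
        use VD in \<open>auto simp: D_def\<close>)+
  have [measurable]: "B \<in> sets M" "S n t \<in> borel_measurable M" for n t using B by (auto simp: S_def)
  have Ym: "Y t \<in> borel_measurable M" for t unfolding Y_def by measurable
  have "continuous_process M Y"
    unfolding continuous_process_def
  proof (intro conjI allI ballI Ym)
    fix \<omega> assume "\<omega> \<in> space M"
    then show "continuous_on UNIV (\<lambda>t. Y t \<omega>)"
      using chain(2)[of \<omega>] by (cases "\<omega> \<in> B") (auto simp: Y_def)
  qed
  moreover have "AE \<omega> in M. Y t \<omega> = X t \<omega>" for t
  proof -
    \<comment> \<open>At a fixed time the dyadic values also converge to X t, at a geometric rate in
      mean square and hence almost surely; so the pathwise limit is X t.\<close>
    have L: "L2 M (\<lambda>\<omega>. X t \<omega> - S n t \<omega>)" for n unfolding S_def by (intro L2_diff X)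
    have le: "nm M (\<lambda>\<omega>. X t \<omega> - S n t \<omega>) \<le> C * (2 powr (- H)) ^ n" for n
    proof -
      let ?s = "real_of_int \<lfloor>2 ^ n * t\<rfloor> / 2 ^ n"
      have s: "?s \<le> t" "t - ?s \<le> 1 / 2 ^ n" by (simp_all add: divide_simps mult.commute) linarith
      have "1 / 2 ^ n \<le> (1::real)" by simp
      then have "nm M (\<lambda>\<omega>. X t \<omega> - X ?s \<omega>) \<le> C * (t - ?s) powr H"
        using s by (intro Hoelder) linarith+
      also have "\<dots> \<le> C * (1 / 2 ^ n) powr H" using s H C by (intro mult_left_mono powr_mono2) auto
      also have "\<dots> = C * (2 powr (- H)) ^ n" unfolding pow
        using powr_realpow[of "2 powr (- H)" n] by (simp add: powr_powr)
      finally show ?thesis by (simp add: S_def)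
    qed
    have "2 powr (- H) < 1" using H by (simp add: powr_less_one)
    then have "AE \<omega> in M. summable (\<lambda>n. norm (X t \<omega> - S n t \<omega>))"
      by (intro AE_summable_nm[OF L le]) (auto intro!: summable_mult summable_geometric)
    moreover have "AE \<omega> in M. \<omega> \<notin> B" using B(1) by (rule AE_not_in)
    ultimately show ?thesis
    proof eventually_elim
      case (elim \<omega>)
      have "(\<lambda>n. X t \<omega> - S n t \<omega>) \<longlonglongrightarrow> 0" using summable_LIMSEQ_zero[OF elim(1)]
        by (rule tendsto_norm_zero_cancel)
      then have "(\<lambda>n. X t \<omega> - (X t \<omega> - S n t \<omega>)) \<longlonglongrightarrow> X t \<omega> - 0" by (intro tendsto_intros)
      then have "lim (\<lambda>n. S n t \<omega>) = X t \<omega>" by (intro limI) simp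
      then show ?case using elim(2) by (simp add: Y_def)
    qed
  qed
  ultimately show ?thesis by (rule that)
qed

section \<open>The scalar Wiener integral\<close>

text \<open>Convexity including the endpoint 0: if one argument vanishes, the claim reduces to m^p
  \<le> m for m in [0, 1].\<close>

lemma powr_convex_nonneg:
  fixes x y l p :: real
  assumes p: "1 \<le> p" and xy: "0 \<le> x" "0 \<le> y" and l: "0 \<le> l" "l \<le> 1"
  shows "(l * x + (1 - l) * y) powr p \<le> l * x powr p + (1 - l) * y powr p"
proof -
  have z: "(m * z) powr p \<le> m * z powr p" if "0 \<le> m" "m \<le> 1" "0 \<le> z" for m z :: real
  proof -
    have "m powr p \<le> m powr 1"
    proof (cases "m = 0")
      case False
      then show ?thesis using that p by (intro powr_mono') auto
    qed simp
    then have "m powr p * z powr p \<le> m * z powr p" using that by (intro mult_right_mono) auto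
    then show ?thesis using that by (simp add: powr_mult)
  qed
  consider "x = 0" | "y = 0" | "0 < x" "0 < y" using xy by linarith
  then show ?thesis
  proof cases
    case 1
    then show ?thesis using z[of "1 - l" y] l xy by simp
  next
    case 2
    then show ?thesis using z[of l x] l xy by simp
  next
    case 3
    show ?thesis using convex_onD[OF powr_convex[OF p], of "1 - l" x y] 3 l by simp
  qed
qed

lemma abs_powr_convex:
  fixes x y l p :: real
  assumes p: "1 \<le> p" and l: "0 \<le> l" "l \<le> 1"
  shows "\<bar>l * x + (1 - l) * y\<bar> powr p \<le> l * \<bar>x\<bar> powr p + (1 - l) * \<bar>y\<bar> powr p"
proof -
  have "\<bar>l * x + (1 - l) * y\<bar> \<le> l * \<bar>x\<bar> + (1 - l) * \<bar>y\<bar>"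
    using abs_triangle_ineq[of "l * x" "(1 - l) * y"] l by (simp add: abs_mult)
  then have "\<bar>l * x + (1 - l) * y\<bar> powr p \<le> (l * \<bar>x\<bar> + (1 - l) * \<bar>y\<bar>) powr p"
    using p by (intro powr_mono2) auto
  also have "\<dots> \<le> l * \<bar>x\<bar> powr p + (1 - l) * \<bar>y\<bar> powr p" using powr_convex_nonneg[OF p _ _ l] by simp
  finally show ?thesis .
qed

text \<open>For a convex function, increments over a fixed length grow. The points x + u and x + w
  are mirror-image convex combinations of x and x + u + w; adding the two convexity inequalities
  gives the claim. With p = 2H it expresses positive correlation.\<close>

lemma abs_powr_increments:
  fixes x u w p :: real
  assumes p: "1 \<le> p" and uw: "0 \<le> u" "0 \<le> w"
  shows "\<bar>x + w\<bar> powr p + \<bar>x + u\<bar> powr p \<le> \<bar>x + u + w\<bar> powr p + \<bar>x\<bar> powr p"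
proof (cases "u + w = 0")
  case True
  then have "u = 0" "w = 0" using uw by linarith+
  then show ?thesis by simp
next
  case False
  then have s: "u + w > 0" using uw by simp
  define l where "l = u / (u + w)"
  have l: "0 \<le> l" "l \<le> 1" "l * (u + w) = u" using uw s by (auto simp: l_def)
  have "l * (x + u + w) + (1 - l) * x = x + u" "(1 - l) * (x + u + w) + (1 - (1 - l)) * x = x + w"
    using l(3) by (simp_all add: algebra_simps)
  then have "\<bar>x + u\<bar> powr p \<le> l * \<bar>x + u + w\<bar> powr p + (1 - l) * \<bar>x\<bar> powr p"
       "\<bar>x + w\<bar> powr p \<le> (1 - l) * \<bar>x + u + w\<bar> powr p + (1 - (1 - l)) * \<bar>x\<bar> powr p"
    using abs_powr_convex[OF p, of l "x + u + w" x] abs_powr_convex[OF p, of "1 - l" "x + u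
      + w" x] l by auto
  then show ?thesis by (simp add: algebra_simps)
qed

text \<open>Both sides are the increment of \<open>f\<close> over \<open>[a, b] \<inter> [c, d]\<close>: this symmetry replaces the common
  refinement of two partitions.\<close>

lemma clamp_swap:
  fixes a b c d :: real and f :: "real \<Rightarrow> 'a::ab_group_add"
  assumes "a \<le> b" "c \<le> d"
  shows "f (max a (min d b)) - f (max a (min c b)) = f (max c (min b d)) - f (max c (min a d))"
proof -
  consider "b \<le> c" | "d \<le> a" | "c < b" "a < d" by linarith
  then show ?thesis
  proof cases
    case 1
    then have "max a (min d b) = b" "max a (min c b) = b" "max c (min b d) = c" "max c (min a d)
      = c" using assms by auto
    then show ?thesis by simp
  next
    case 2
    then have "max a (min d b) = a" "max a (min c b) = a" "max c (min b d) = d" "max c (min a d)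
      = d" using assms by auto
    then show ?thesis by simp
  next
    case 3
    then have "max a (min d b) = max c (min b d)" "max a (min c b) = max c (min a d)"
      using assms by auto
    then show ?thesis by (simp only:)
  qed
qed

section \<open>Partitions of an interval\<close>

lemma partition_mono:
  fixes r :: "nat \<Rightarrow> real"
  assumes "\<And>k. k < n \<Longrightarrow> r k \<le> r (Suc k)"
  shows "i \<le> j \<Longrightarrow> j \<le> n \<Longrightarrow> r i \<le> r j"
proof (induction j)
  case (Suc j)
  then show ?case using assms[of j] by (cases "i = Suc j") (auto intro: order_trans)
qed simp

text \<open>It has n + 1 cells, so that n = 0 is no exception and the sequence of meshes starts
  without a division by zero.\<close>

definition unif_partition :: "real \<Rightarrow> real \<Rightarrow> nat \<Rightarrow> nat \<Rightarrow> real" where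
  "unif_partition s t n k = s + (t - s) * real k / real (Suc n)"

lemma unif_partition:
  assumes "s \<le> t"
  shows "unif_partition s t n 0 = s" "unif_partition s t n (Suc n) = t"
    "unif_partition s t n k \<le> unif_partition s t n (Suc k)"
    "unif_partition s t n (Suc k) - unif_partition s t n k = (t - s) / real (Suc n)"
proof -
  show *: "unif_partition s t n (Suc k) - unif_partition s t n k = (t - s) / real (Suc n)"
    by (simp add: unif_partition_def diff_divide_distrib[symmetric] algebra_simps)
  have "0 \<le> (t - s) / real (Suc n)" using assms by simp
  then show "unif_partition s t n k \<le> unif_partition s t n (Suc k)" using * by linarith
qed (simp_all add: unif_partition_def del: of_nat_Suc)

lemma unif_partition_mesh:
  assumes "\<delta> > 0"
  shows "\<forall>\<^sub>F n in sequentially. (t - s) / real (Suc n) < \<delta>"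
proof -
  have "(\<lambda>n. (t - s) / real (Suc n)) \<longlonglongrightarrow> 0" by (rule LIMSEQ_Suc[OF lim_const_over_n])
  then show ?thesis using assms by (rule order_tendstoD(2))
qed

lemma nm_tendsto_0:
  assumes "\<And>n::nat. nm M (X n) \<le> g n" "g \<longlonglongrightarrow> 0"
  shows "(\<lambda>n. nm M (X n)) \<longlonglongrightarrow> 0"
  by (rule tendsto_sandwich[OF _ _ tendsto_const assms(2)]) (use assms(1) in auto)

lemma riemann_sum_add: "riemann_sum \<beta> (\<lambda>u. h u + c * g u) n r \<omega>
  = riemann_sum \<beta> h n r \<omega> + c * riemann_sum \<beta> g n r \<omega>"
  by (simp add: riemann_sum_def sum_distrib_left sum.distrib[symmetric] algebra_simps)

context
  fixes M :: "'w measure" and H :: real and \<beta> :: "real \<Rightarrow> 'w \<Rightarrow> real"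
  assumes M: "prob_space M" and fbm: "fbm_scalar M H \<beta>" and H: "1/2 < H"
begin

lemma L2_fbm: "L2 M (\<beta> t)" by (rule fbm_scalar_L2[OF M fbm])

lemma L2_increment: "L2 M (\<lambda>\<omega>. \<beta> t \<omega> - \<beta> s \<omega>)" by (intro L2_diff L2_fbm)

lemma increment_cov:
  "(\<integral>\<omega>. (\<beta> b \<omega> - \<beta> a \<omega>) * (\<beta> d \<omega> - \<beta> c \<omega>) \<partial>M)
    = (\<bar>d - a\<bar> powr (2*H) + \<bar>c - b\<bar> powr (2*H) - \<bar>d - b\<bar> powr (2*H) - \<bar>c - a\<bar> powr (2*H)) / 2"
proof -
  have cov: "(\<integral>\<omega>. \<beta> s \<omega> * \<beta> t \<omega> \<partial>M) = (\<bar>s\<bar> powr (2*H) + \<bar>t\<bar> powr (2*H) - \<bar>t - s\<bar> powr (2*H)) / 2"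
    for s t
    using fbm by (simp add: fbm_scalar_def)
  have int: "integrable M (\<lambda>\<omega>. \<beta> s \<omega> * \<beta> t \<omega>)" for s t by (intro L2_prod L2_fbm)
  have "(\<beta> b \<omega> - \<beta> a \<omega>) * (\<beta> d \<omega> - \<beta> c \<omega>) = \<beta> b \<omega> * \<beta> d \<omega> - \<beta> b \<omega> * \<beta> c \<omega> - \<beta> a \<omega> * \<beta> d \<omega>
    + \<beta> a \<omega> * \<beta> c \<omega>" for \<omega>
    by (simp add: algebra_simps)
  then show ?thesis using int by (simp add: cov field_simps)
qed

text \<open>Take x = c - b, which is negative when the intervals overlap; this is why
  \<open>abs_powr_increments\<close> is proved for all real x.\<close>

lemma increment_cov_nonneg:
  assumes "a \<le> b" "c \<le> d"
  shows "0 \<le> (\<integral>\<omega>. (\<beta> b \<omega> - \<beta> a \<omega>) * (\<beta> d \<omega> - \<beta> c \<omega>) \<partial>M)"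
  unfolding increment_cov
  using abs_powr_increments[of "2*H" "b - a" "d - c" "c - b"] H assms by (simp add: algebra_simps)

lemma nm_increment: "s \<le> t \<Longrightarrow> nm M (\<lambda>\<omega>. \<beta> t \<omega> - \<beta> s \<omega>) = (t - s) powr H"
proof -
  assume "s \<le> t"
  have "(nm M (\<lambda>\<omega>. \<beta> t \<omega> - \<beta> s \<omega>))\<^sup>2 = (t - s) powr (2 * H)"
  proof -
    have "\<bar>t - s\<bar> = t - s" "\<bar>s - t\<bar> = t - s" using \<open>s \<le> t\<close> by auto
    then show ?thesis unfolding nm_sq real_norm_def power2_abs
      unfolding power2_eq_square increment_cov by simp
  qed
  also have "\<dots> = ((t - s) powr H)\<^sup>2" by (simp add: power2_eq_square flip: powr_add)
  finally show ?thesis by (simp add: power2_eq_iff_nonneg)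
qed

text \<open>For \<open>H > 1/2\<close> increments are positively correlated, so the coefficients of a combination
  may be replaced by their common bound.\<close>

lemma nm_increments_le:
  assumes I: "finite I" and le: "\<And>i. i \<in> I \<Longrightarrow> p i \<le> q i" and c: "\<And>i. i \<in> I \<Longrightarrow> p i < q i \<Longrightarrow>
    \<bar>c i\<bar> \<le> K" and K: "0 \<le> K"
  shows "nm M (\<lambda>\<omega>. \<Sum>i\<in>I. c i * (\<beta> (q i) \<omega> - \<beta> (p i) \<omega>))
    \<le> K * nm M (\<lambda>\<omega>. \<Sum>i\<in>I. \<beta> (q i) \<omega> - \<beta> (p i) \<omega>)"
proof (rule power2_le_imp_le)
  let ?D = "\<lambda>i \<omega>. \<beta> (q i) \<omega> - \<beta> (p i) \<omega>"
  let ?m = "\<lambda>i j. \<integral>\<omega>. ?D i \<omega> * ?D j \<omega> \<partial>M"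
  have int: "integrable M (\<lambda>\<omega>. ?D i \<omega> * ?D j \<omega>)" for i j by (intro L2_prod L2_increment)
  have sq: "(nm M (\<lambda>\<omega>. \<Sum>i\<in>I. c i * ?D i \<omega>))\<^sup>2 = (\<Sum>i\<in>I. \<Sum>j\<in>I. (c i * c j) * ?m i j)" for c
  proof -
    have "(\<Sum>i\<in>I. c i * ?D i \<omega>)\<^sup>2 = (\<Sum>i\<in>I. \<Sum>j\<in>I. (c i * c j) * (?D i \<omega> * ?D j \<omega>))" for \<omega>
      by (simp add: power2_eq_square sum_product mult_ac)
    then show ?thesis unfolding nm_sq real_norm_def power2_abs
      using int by (simp add: Bochner_Integration.integral_sum)
  qed
  have "(\<Sum>i\<in>I. \<Sum>j\<in>I. (c i * c j) * ?m i j) \<le> (\<Sum>i\<in>I. \<Sum>j\<in>I. K\<^sup>2 * ?m i j)"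
  proof (intro sum_mono)
    fix i j assume ij: "i \<in> I" "j \<in> I"
    show "(c i * c j) * ?m i j \<le> K\<^sup>2 * ?m i j"
    proof (cases "p i < q i \<and> p j < q j")
      case True
      have "\<bar>c i * c j\<bar> \<le> K * K" unfolding abs_mult using c ij True K by (intro mult_mono) auto
      then have "c i * c j \<le> K\<^sup>2" by (simp add: power2_eq_square abs_le_iff)
      then show ?thesis using increment_cov_nonneg le ij by (intro mult_right_mono) auto
    next
      \<comment> \<open>Empty increments contribute nothing, so the coefficients are bounded only
        where the increment is proper; cells of two partitions that do not meet rely on
        this.\<close>
      case False
      then have "p i = q i \<or> p j = q j" using le[OF ij(1)] le[OF ij(2)] by auto
      then show ?thesis by auto
    qed
  qed
  also have "\<dots> = K\<^sup>2 * (nm M (\<lambda>\<omega>. \<Sum>i\<in>I. ?D i \<omega>))\<^sup>2"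
    using sq[of "\<lambda>_. 1"] by (simp add: sum_distrib_left)
  finally show "(nm M (\<lambda>\<omega>. \<Sum>i\<in>I. c i * ?D i \<omega>))\<^sup>2 \<le> (K * nm M (\<lambda>\<omega>. \<Sum>i\<in>I. ?D i \<omega>))\<^sup>2"
    unfolding sq power_mult_distrib .
qed (use K in simp)

section \<open>Riemann sums and their convergence\<close>

lemma L2_riemann_sum: "L2 M (riemann_sum \<beta> h n r)"
proof -
  have "L2 M (\<lambda>\<omega>. \<Sum>k<n. h (r k) * (\<beta> (r (Suc k)) \<omega> - \<beta> (r k) \<omega>))"
    by (intro L2_sum L2_cmult L2_increment)
  then show ?thesis by (simp add: riemann_sum_def[abs_def])
qed

text \<open>With all coefficients replaced by K the sum telescopes to one increment, whose seminorm
  is (t - s)^H whatever the partition.\<close>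

lemma nm_riemann_sum_le:
  assumes r: "r 0 = s" "r n = t" "\<And>k. k < n \<Longrightarrow> r k \<le> r (Suc k)"
    and h: "\<And>u. u \<in> {s..t} \<Longrightarrow> \<bar>h u\<bar> \<le> K" and st: "s \<le> t"
  shows "nm M (riemann_sum \<beta> h n r) \<le> K * (t - s) powr H"
proof -
  have "\<bar>h (r k)\<bar> \<le> K" if "k < n" for k
    using partition_mono[of n r 0 k] partition_mono[of n r k n] r that by (intro h) auto
  moreover have "0 \<le> K" using h[of s] st by force
  ultimately have "nm M (\<lambda>\<omega>. \<Sum>k<n. h (r k) * (\<beta> (r (Suc k)) \<omega> - \<beta> (r k) \<omega>))
    \<le> K * nm M (\<lambda>\<omega>. \<Sum>k<n. \<beta> (r (Suc k)) \<omega> - \<beta> (r k) \<omega>)"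
    using r by (intro nm_increments_le) auto
  also have "(\<lambda>\<omega>. \<Sum>k<n. \<beta> (r (Suc k)) \<omega> - \<beta> (r k) \<omega>) = (\<lambda>\<omega>. \<beta> t \<omega> - \<beta> s \<omega>)"
    using r sum_lessThan_telescope[of "\<lambda>k. \<beta> (r k) \<omega>" n for \<omega>] by simp
  finally show ?thesis by (simp add: riemann_sum_def[abs_def] nm_increment[OF st])
qed

text \<open>Both sums are rewritten over the intersections of the cells of the two partitions. Where
  two cells really overlap, their left endpoints differ by less than \<open>\<delta>\<close>, so the
  coefficients differ by at most e; elsewhere the increment is zero.\<close>

lemma nm_riemann_sum_diff:
  assumes r: "r 0 = s" "r n = t" "\<And>k. k < n \<Longrightarrow> r k \<le> r (Suc k) \<and> r (Suc k) - r k < \<delta>"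
    and q: "q 0 = s" "q m = t" "\<And>k. k < m \<Longrightarrow> q k \<le> q (Suc k) \<and> q (Suc k) - q k < \<delta>"
    and h: "\<And>u v. u \<in> {s..t} \<Longrightarrow> v \<in> {s..t} \<Longrightarrow> \<bar>u - v\<bar> < \<delta> \<Longrightarrow> \<bar>h u - h v\<bar> \<le> e"
    and e: "0 \<le> e" and st: "s \<le> t"
  shows "nm M (\<lambda>\<omega>. riemann_sum \<beta> h n r \<omega> - riemann_sum \<beta> h m q \<omega>) \<le> e * (t - s) powr H"
proof -
  have rm: "s \<le> r k" "r k \<le> t" if "k \<le> n" for k
    using partition_mono[of n r 0 k] partition_mono[of n r k n] r that by auto
  have qm: "s \<le> q k" "q k \<le> t" if "k \<le> m" for k
    using partition_mono[of m q 0 k] partition_mono[of m q k m] q that by auto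
  let ?I = "{..<n} \<times> {..<m}"
  \<comment> \<open>Endpoints of the intersection of cell k of r with cell l of q, clamped so that
    they coincide when the cells do not overlap.\<close>
  define a where "a k l = max (r k) (min (q l) (r (Suc k)))" for k l
  define b where "b k l = max (r k) (min (q (Suc l)) (r (Suc k)))" for k l
  let ?D = "\<lambda>\<omega> k l. \<beta> (b k l) \<omega> - \<beta> (a k l) \<omega>"
  have s1: "(\<Sum>l<m. ?D \<omega> k l) = \<beta> (r (Suc k)) \<omega> - \<beta> (r k) \<omega>" if k: "k < n" for k \<omega>
  proof -
    have "(\<Sum>l<m. ?D \<omega> k l) = \<beta> (max (r k) (min (q m) (r (Suc k)))) \<omega>
      - \<beta> (max (r k) (min (q 0) (r (Suc k)))) \<omega>"
      unfolding a_def b_def by (rule sum_lessThan_telescope[of "\<lambda>l. \<beta> (max (r k) (min (q l) (r (Suc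
        k)))) \<omega>" m])
    moreover have "max (r k) (min (q m) (r (Suc k))) = r (Suc k)" "max (r k) (min (q 0) (r (Suc k)))
      = r k"
      using rm[of k] rm[of "Suc k"] r(3)[OF k] k q by auto
    ultimately show ?thesis by simp
  qed
  have s2: "(\<Sum>k<n. ?D \<omega> k l) = \<beta> (q (Suc l)) \<omega> - \<beta> (q l) \<omega>" if l: "l < m" for l \<omega>
  proof -
    have "?D \<omega> k l = \<beta> (max (q l) (min (r (Suc k)) (q (Suc l)))) \<omega>
      - \<beta> (max (q l) (min (r k) (q (Suc l)))) \<omega>" if "k < n" for k
      unfolding a_def b_def using r(3)[OF that] q(3)[OF l]
      by (intro clamp_swap[of "r k" "r (Suc k)" "q l" "q (Suc l)" "\<lambda>u. \<beta> u \<omega>"]) auto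
    then have "(\<Sum>k<n. ?D \<omega> k l) = (\<Sum>k<n. \<beta> (max (q l) (min (r (Suc k)) (q (Suc l)))) \<omega>
      - \<beta> (max (q l) (min (r k) (q (Suc l)))) \<omega>)"
      by (intro sum.cong refl) (simp only: lessThan_iff)
    also have "\<dots> = \<beta> (max (q l) (min (r n) (q (Suc l)))) \<omega>
      - \<beta> (max (q l) (min (r 0) (q (Suc l)))) \<omega>"
      by (rule sum_lessThan_telescope[of "\<lambda>k. \<beta> (max (q l) (min (r k) (q (Suc l)))) \<omega>" n])
    moreover have "max (q l) (min (r n) (q (Suc l))) = q (Suc l)" "max (q l) (min (r 0) (q (Suc l)))
      = q l"
      using qm[of l] qm[of "Suc l"] q(3)[OF l] l r by auto
    ultimately show ?thesis by simp
  qed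
  have R1: "riemann_sum \<beta> h n r \<omega> = (\<Sum>i\<in>?I. h (r (fst i)) * (?D \<omega> (fst i) (snd i)))" for \<omega>
  proof -
    have "riemann_sum \<beta> h n r \<omega> = (\<Sum>k<n. \<Sum>l<m. h (r k) * ?D \<omega> k l)"
      unfolding riemann_sum_def by (intro sum.cong refl) (simp only: sum_distrib_left[symmetric] s1
        lessThan_iff)
    then show ?thesis by (simp add: sum.cartesian_product case_prod_unfold)
  qed
  have R2: "riemann_sum \<beta> h m q \<omega> = (\<Sum>i\<in>?I. h (q (snd i)) * (?D \<omega> (fst i) (snd i)))" for \<omega>
  proof -
    have "riemann_sum \<beta> h m q \<omega> = (\<Sum>l<m. \<Sum>k<n. h (q l) * ?D \<omega> k l)"
      unfolding riemann_sum_def by (intro sum.cong refl) (simp only: sum_distrib_left[symmetric] s2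
        lessThan_iff)
    also have "\<dots> = (\<Sum>k<n. \<Sum>l<m. h (q l) * ?D \<omega> k l)" by (rule sum.swap)
    finally show ?thesis by (simp add: sum.cartesian_product case_prod_unfold)
  qed
  have "nm M (\<lambda>\<omega>. riemann_sum \<beta> h n r \<omega> - riemann_sum \<beta> h m q \<omega>)
      = nm M (\<lambda>\<omega>. \<Sum>i\<in>?I. (h (r (fst i)) - h (q (snd i))) * (?D \<omega> (fst i) (snd i)))"
    unfolding R1 R2 by (simp add: sum_subtractf left_diff_distrib)
  also have "\<dots> \<le> e * nm M (\<lambda>\<omega>. \<Sum>i\<in>?I. ?D \<omega> (fst i) (snd i))"
  proof (rule nm_increments_le[OF _ _ _ e])
    fix i assume "i \<in> ?I"
    then obtain k l where i: "i = (k, l)" "k < n" "l < m" by auto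
    show "a (fst i) (snd i) \<le> b (fst i) (snd i)"
      using q(3)[OF i(3)] by (auto simp: i(1) a_def b_def)
    assume "a (fst i) (snd i) < b (fst i) (snd i)"
    then have lt: "max (r k) (min (q l) (r (Suc k))) < max (r k) (min (q (Suc l)) (r (Suc k)))"
      by (simp add: i(1) a_def b_def)
    have "q l < r (Suc k)" "r k < q (Suc l)"
      using lt r(3)[OF i(2)] q(3)[OF i(3)] by (auto simp: max_def min_def split: if_splits)
    then have "\<bar>r k - q l\<bar> < \<delta>" using r(3)[OF i(2)] q(3)[OF i(3)] by linarith
    then show "\<bar>h (r (fst i)) - h (q (snd i))\<bar> \<le> e" unfolding i(1) fst_conv snd_conv
      using rm[of k] qm[of l] i by (intro h) auto
  qed simp
  also have "(\<lambda>\<omega>. \<Sum>i\<in>?I. ?D \<omega> (fst i) (snd i)) = (\<lambda>\<omega>. \<beta> t \<omega> - \<beta> s \<omega>)"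
  proof
    fix \<omega>
    have "(\<Sum>i\<in>?I. ?D \<omega> (fst i) (snd i)) = (\<Sum>k<n. \<Sum>l<m. ?D \<omega> k l)"
      by (simp add: sum.cartesian_product case_prod_unfold)
    also have "\<dots> = (\<Sum>k<n. \<beta> (r (Suc k)) \<omega> - \<beta> (r k) \<omega>)"
      by (intro sum.cong refl) (simp only: s1 lessThan_iff)
    also have "\<dots> = \<beta> t \<omega> - \<beta> s \<omega>" using sum_lessThan_telescope[of "\<lambda>k. \<beta> (r k) \<omega>" n] r by simp
    finally show "(\<Sum>i\<in>?I. ?D \<omega> (fst i) (snd i)) = \<beta> t \<omega> - \<beta> s \<omega>" .
  qed
  finally show ?thesis by (simp add: nm_increment[OF st])
qed

lemma riemann_sum_Cauchy:
  assumes st: "s \<le> t" and h: "continuous_on {s..t} h" and e: "e > 0"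
  obtains \<delta> where "\<delta> > 0"
    "\<And>n r m q. r 0 = s \<Longrightarrow> r n = t \<Longrightarrow> (\<And>k. k < n \<Longrightarrow> r k \<le> r (Suc k) \<and> r (Suc k) - r k < \<delta>) \<Longrightarrow>
      q 0 = s \<Longrightarrow> q m = t \<Longrightarrow> (\<And>k. k < m \<Longrightarrow> q k \<le> q (Suc k) \<and> q (Suc k) - q k < \<delta>) \<Longrightarrow>
      nm M (\<lambda>\<omega>. riemann_sum \<beta> h n r \<omega> - riemann_sum \<beta> h m q \<omega>) < e"
proof -
  define T where "T = (t - s) powr H"
  have T: "0 \<le> T" by (simp add: T_def)
  \<comment> \<open>The summand 1 guards against T = 0, the factor 2 makes the final inequality
    strict.\<close>
  define e' where "e' = e / (2 * (T + 1))"
  have e': "e' > 0" "e' * T < e"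
  proof -
    show "e' > 0" using e T by (simp add: e'_def)
    have "e' * T \<le> e' * (T + 1)" using \<open>e' > 0\<close> by simp
    also have "\<dots> = e / 2" using T by (simp add: e'_def field_simps)
    finally show "e' * T < e" using e by simp
  qed
  have "uniformly_continuous_on {s..t} h" using h by (intro compact_uniformly_continuous) auto
  then obtain \<delta> where \<delta>: "\<delta> > 0" "\<And>u v. u \<in> {s..t} \<Longrightarrow> v \<in> {s..t} \<Longrightarrow> dist u v < \<delta> \<Longrightarrow>
    dist (h u) (h v) < e'"
    unfolding uniformly_continuous_on_def using e'(1) by metis
  show ?thesis
  proof (rule that[OF \<delta>(1)])
    fix n r m q
    assume *: "r 0 = s" "r n = t" "\<And>k. k < n \<Longrightarrow> r k \<le> r (Suc k) \<and> r (Suc k) - r k < \<delta>"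
      "q 0 = s" "q m = t" "\<And>k. k < m \<Longrightarrow> q k \<le> q (Suc k) \<and> q (Suc k) - q k < \<delta>"
    have "nm M (\<lambda>\<omega>. riemann_sum \<beta> h n r \<omega> - riemann_sum \<beta> h m q \<omega>) \<le> e' * (t - s) powr H"
      by (rule nm_riemann_sum_diff[OF *]) (use \<delta>(2) e' st in \<open>auto simp: dist_real_def intro:
        less_imp_le\<close>)
    then show "nm M (\<lambda>\<omega>. riemann_sum \<beta> h n r \<omega> - riemann_sum \<beta> h m q \<omega>) < e"
      using e' by (simp add: T_def)
  qed
qed

text \<open>Any two fine partitions have close sums, so convergence along the uniform partitions
  already yields the limit over all partitions.\<close>

lemma has_wiener_integralI:
  assumes st: "s \<le> t" and h: "continuous_on {s..t} h" and J: "L2 M J"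
    and lim: "(\<lambda>n. nm M (\<lambda>\<omega>. riemann_sum \<beta> h (Suc n) (unif_partition s t n) \<omega> - J \<omega>)) \<longlonglongrightarrow> 0"
  shows "has_wiener_integral M \<beta> h s t J"
  unfolding has_wiener_integral_def in_Lp_2 Lp_dist_2
proof (intro conjI allI impI st h J)
  fix e :: real assume e: "e > 0"
  obtain \<delta> where \<delta>: "\<delta> > 0" "\<And>n r m q. r 0 = s \<Longrightarrow> r n = t \<Longrightarrow> (\<And>k. k < n \<Longrightarrow>
    r k \<le> r (Suc k) \<and> r (Suc k) - r k < \<delta>) \<Longrightarrow>
      q 0 = s \<Longrightarrow> q m = t \<Longrightarrow> (\<And>k. k < m \<Longrightarrow> q k \<le> q (Suc k) \<and> q (Suc k) - q k < \<delta>) \<Longrightarrow>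
      nm M (\<lambda>\<omega>. riemann_sum \<beta> h n r \<omega> - riemann_sum \<beta> h m q \<omega>) < e/2"
    using riemann_sum_Cauchy[OF st h, of "e/2"] e by auto
  have "\<forall>\<^sub>F n in sequentially. (t - s) / real (Suc n)
    < \<delta> \<and> nm M (\<lambda>\<omega>. riemann_sum \<beta> h (Suc n) (unif_partition s t n) \<omega> - J \<omega>) < e/2"
    using order_tendstoD(2)[OF lim, of "e/2"] e
      by (intro eventually_conj unif_partition_mesh \<delta>(1)) auto
  then obtain N where N: "(t - s) / real (Suc N)
    < \<delta>" "nm M (\<lambda>\<omega>. riemann_sum \<beta> h (Suc N) (unif_partition s t N) \<omega> - J \<omega>) < e/2"
    unfolding eventually_sequentially by blast
  have "L2 M (riemann_sum \<beta> h n r) \<and> nm M (\<lambda>\<omega>. riemann_sum \<beta> h n r \<omega> - J \<omega>) < e"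
    if "r 0 = s \<and> r n = t \<and> (\<forall>k<n. r k \<le> r (Suc k) \<and> r (Suc k) - r k < \<delta>)" for n r
  proof -
    have "nm M (\<lambda>\<omega>. riemann_sum \<beta> h n r \<omega> - riemann_sum \<beta> h (Suc N) (unif_partition s t N) \<omega>) < e/2"
      by (rule \<delta>(2)) (use that N(1) unif_partition[OF st] in auto)
    then show ?thesis
      using nm_triangle3[OF L2_riemann_sum L2_riemann_sum J, of h n r h "Suc N" "unif_partition s t
        N"] N(2) L2_riemann_sum by auto
  qed
  then show "\<exists>\<delta>>0. \<forall>n r. r 0 = s \<and> r n = t \<and> (\<forall>k<n. r k \<le> r (Suc k) \<and> r (Suc k) - r k < \<delta>) \<longrightarrow>
      L2 M (riemann_sum \<beta> h n r) \<and> nm M (\<lambda>\<omega>. riemann_sum \<beta> h n r \<omega> - J \<omega>) < e"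
    using \<delta>(1) by blast
qed

lemma has_wiener_integralD:
  assumes "has_wiener_integral M \<beta> h s t J"
  shows "s \<le> t" "continuous_on {s..t} h" "L2 M J"
    and "\<And>r N. (\<And>n. r n 0 = s) \<Longrightarrow> (\<And>n. r n (N n) = t) \<Longrightarrow> (\<And>n k. k < N n \<Longrightarrow>
      r n k \<le> r n (Suc k) \<and> r n (Suc k) - r n k \<le> \<mu> n) \<Longrightarrow>
      \<mu> \<longlonglongrightarrow> 0 \<Longrightarrow> (\<lambda>n::nat. nm M (\<lambda>\<omega>. riemann_sum \<beta> h (N n) (r n) \<omega> - J \<omega>)) \<longlonglongrightarrow> 0"
proof -
  note A = assms[unfolded has_wiener_integral_def in_Lp_2 Lp_dist_2]
  show "s \<le> t" "continuous_on {s..t} h" "L2 M J" using A by auto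
  fix r N
  assume r: "\<And>n. r n 0 = s" "\<And>n. r n (N n) = t" "\<And>n k. k < N n \<Longrightarrow>
    r n k \<le> r n (Suc k) \<and> r n (Suc k) - r n k \<le> \<mu> n" and \<mu>: "\<mu> \<longlonglongrightarrow> 0"
  show "(\<lambda>n. nm M (\<lambda>\<omega>. riemann_sum \<beta> h (N n) (r n) \<omega> - J \<omega>)) \<longlonglongrightarrow> 0"
  proof (rule order_tendstoI)
    fix e :: real assume "0 < e"
    then obtain \<delta> where \<delta>: "\<delta> > 0" "\<And>n r. r 0 = s \<and> r n = t \<and> (\<forall>k<n. r k
      \<le> r (Suc k) \<and> r (Suc k) - r k < \<delta>) \<longrightarrow> nm M (\<lambda>\<omega>. riemann_sum \<beta> h n r \<omega> - J \<omega>) < e"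
      using A by meson
    have "\<forall>\<^sub>F n in sequentially. \<mu> n < \<delta>" using \<mu> \<delta>(1) by (rule order_tendstoD(2))
    then show "\<forall>\<^sub>F n in sequentially. nm M (\<lambda>\<omega>. riemann_sum \<beta> h (N n) (r n) \<omega> - J \<omega>) < e"
    proof eventually_elim
      case (elim n)
      then have "r n k \<le> r n (Suc k) \<and> r n (Suc k) - r n k < \<delta>" if "k < N n" for k
        using r(3)[OF that] by linarith
      then show ?case using \<delta>(2) r(1,2) by blast
    qed
  next
    fix e :: real assume "e < 0"
    then show "\<forall>\<^sub>F n in sequentially. e < nm M (\<lambda>\<omega>. riemann_sum \<beta> h (N n) (r n) \<omega> - J \<omega>)"
      by (intro always_eventually allI) (rule less_le_trans[OF _ nm_nonneg])
  qed
qed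

lemma has_wiener_integral_unif:
  assumes J: "has_wiener_integral M \<beta> h s t J"
  shows "(\<lambda>n. nm M (\<lambda>\<omega>. riemann_sum \<beta> h (Suc n) (unif_partition s t n) \<omega> - J \<omega>)) \<longlonglongrightarrow> 0"
proof (rule has_wiener_integralD(4)[OF J, where \<mu>="\<lambda>n. (t - s) / real (Suc n)" and N=Suc])
  show "(\<lambda>n. (t - s) / real (Suc n)) \<longlonglongrightarrow> 0" by (rule LIMSEQ_Suc[OF lim_const_over_n])
qed (use unif_partition[OF has_wiener_integralD(1)[OF J]] in auto)

lemma has_wiener_integral_exists:
  assumes st: "s \<le> t" and h: "continuous_on {s..t} h"
  obtains J where "has_wiener_integral M \<beta> h s t J"
proof (rule prob_space.L2_complete[OF M, of "\<lambda>n. riemann_sum \<beta> h (Suc n) (unif_partition s t n)"])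
  show "L2 M (riemann_sum \<beta> h (Suc n) (unif_partition s t n))" for n by (rule L2_riemann_sum)
  fix e :: real assume e: "e > 0"
  obtain \<delta> where \<delta>: "\<delta> > 0" "\<And>n r m q. r 0 = s \<Longrightarrow> r n = t \<Longrightarrow> (\<And>k. k < n \<Longrightarrow>
    r k \<le> r (Suc k) \<and> r (Suc k) - r k < \<delta>) \<Longrightarrow>
      q 0 = s \<Longrightarrow> q m = t \<Longrightarrow> (\<And>k. k < m \<Longrightarrow> q k \<le> q (Suc k) \<and> q (Suc k) - q k < \<delta>) \<Longrightarrow>
      nm M (\<lambda>\<omega>. riemann_sum \<beta> h n r \<omega> - riemann_sum \<beta> h m q \<omega>) < e"
    using riemann_sum_Cauchy[OF st h e] by blast
  obtain N where N: "\<And>n. n \<ge> N \<Longrightarrow> (t - s) / real (Suc n) < \<delta>"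
    using unif_partition_mesh[OF \<delta>(1), of t s] unfolding eventually_sequentially by blast
  have "nm M (\<lambda>\<omega>. riemann_sum \<beta> h (Suc m) (unif_partition s t m) \<omega>
    - riemann_sum \<beta> h (Suc n) (unif_partition s t n) \<omega>) < e"
    if "m \<ge> N" "n \<ge> N" for m n
    by (rule \<delta>(2)) (use N that unif_partition[OF st] in auto)
  then show "\<exists>N. \<forall>m\<ge>N. \<forall>n\<ge>N. nm M (\<lambda>\<omega>. riemann_sum \<beta> h (Suc m) (unif_partition s t m) \<omega>
    - riemann_sum \<beta> h (Suc n) (unif_partition s t n) \<omega>) < e"
    by blast
next
  fix J assume "L2 M J" "(\<lambda>n. nm M (\<lambda>\<omega>. riemann_sum \<beta> h (Suc n) (unif_partition s t n) \<omega>
    - J \<omega>)) \<longlonglongrightarrow> 0"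
  then show ?thesis by (intro that has_wiener_integralI st h)
qed

lemma nm_wiener_integral_le:
  assumes J: "has_wiener_integral M \<beta> h s t J" and h: "\<And>u. u \<in> {s..t} \<Longrightarrow> \<bar>h u\<bar> \<le> K"
  shows "nm M J \<le> K * (t - s) powr H"
  using has_wiener_integralD(1)[OF J] unif_partition h
  by (intro nm_lim_le[OF L2_riemann_sum has_wiener_integralD(3)[OF J] has_wiener_integral_unif[OF
    J]] always_eventually allI
        nm_riemann_sum_le) auto

lemma has_wiener_integral_add:
  assumes J: "has_wiener_integral M \<beta> h s t J" and J': "has_wiener_integral M \<beta> g s t J'"
  shows "has_wiener_integral M \<beta> (\<lambda>u. h u + c * g u) s t (\<lambda>\<omega>. J \<omega> + c * J' \<omega>)"
proof (rule has_wiener_integralI)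
  note LJ = has_wiener_integralD(3)[OF J] and LJ' = has_wiener_integralD(3)[OF J']
  show "s \<le> t" "continuous_on {s..t} (\<lambda>u. h u + c * g u)"
    using has_wiener_integralD(1,2)[OF J] has_wiener_integralD(2)[OF J']
      by (auto intro!: continuous_intros)
  show "L2 M (\<lambda>\<omega>. J \<omega> + c * J' \<omega>)" by (intro L2_add L2_cmult LJ LJ')
  let ?R = "\<lambda>h n. riemann_sum \<beta> h (Suc n) (unif_partition s t n)"
  show "(\<lambda>n. nm M (\<lambda>\<omega>. ?R (\<lambda>u. h u + c * g u) n \<omega> - (J \<omega> + c * J' \<omega>))) \<longlonglongrightarrow> 0"
  proof (rule nm_tendsto_0)
    show "(\<lambda>n. nm M (\<lambda>\<omega>. ?R h n \<omega> - J \<omega>) + \<bar>c\<bar> * nm M (\<lambda>\<omega>. ?R g n \<omega> - J' \<omega>)) \<longlonglongrightarrow> 0"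
      using tendsto_add[OF has_wiener_integral_unif[OF J] tendsto_mult_right_zero[OF
        has_wiener_integral_unif[OF J'], of "\<bar>c\<bar>"]] by simp
    show "nm M (\<lambda>\<omega>. ?R (\<lambda>u. h u + c * g u) n \<omega> - (J \<omega> + c * J' \<omega>))
      \<le> nm M (\<lambda>\<omega>. ?R h n \<omega> - J \<omega>) + \<bar>c\<bar> * nm M (\<lambda>\<omega>. ?R g n \<omega> - J' \<omega>)" for n
    proof -
      have "nm M (\<lambda>\<omega>. (?R h n \<omega> - J \<omega>) + c * (?R g n \<omega> - J' \<omega>))
        \<le> nm M (\<lambda>\<omega>. ?R h n \<omega> - J \<omega>) + nm M (\<lambda>\<omega>. c * (?R g n \<omega> - J' \<omega>))"
        by (intro nm_triangle L2_cmult L2_diff L2_riemann_sum LJ LJ')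
      then show "nm M (\<lambda>\<omega>. ?R (\<lambda>u. h u + c * g u) n \<omega> - (J \<omega> + c * J' \<omega>))
        \<le> nm M (\<lambda>\<omega>. ?R h n \<omega> - J \<omega>) + \<bar>c\<bar> * nm M (\<lambda>\<omega>. ?R g n \<omega> - J' \<omega>)"
        unfolding nm_cmult by (simp add: riemann_sum_add algebra_simps)
    qed
  qed
qed

text \<open>Uniform partitions of [s, t] and [t, u], glued at t, are partitions of [s, u] with
  vanishing mesh. Their sums converge both to I and to J + J', and mean-square limits are
  unique.\<close>

lemma has_wiener_integral_concat:
  assumes J: "has_wiener_integral M \<beta> h s t J" and J': "has_wiener_integral M \<beta> h t u J'"
    and I: "has_wiener_integral M \<beta> h s u I"
  shows "AE \<omega> in M. I \<omega> = J \<omega> + J' \<omega>"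
proof -
  have st: "s \<le> t" "t \<le> u" using J J' by (auto dest: has_wiener_integralD(1))
  note L = has_wiener_integralD(3)[OF J] has_wiener_integralD(3)[OF J'] has_wiener_integralD(3)[OF
    I]
  \<comment> \<open>The index \<open>Suc n\<close> is the common point t, reached as the last point
    of the first partition and the first point of the second.\<close>
  define q where "q n k = (if k \<le> Suc n then unif_partition s t n k else unif_partition t u n (k
    - Suc n))" for n k
  let ?R1 = "\<lambda>n. riemann_sum \<beta> h (Suc n) (unif_partition s t n)"
  let ?R2 = "\<lambda>n. riemann_sum \<beta> h (Suc n) (unif_partition t u n)"
  let ?R = "\<lambda>n. riemann_sum \<beta> h (Suc n + Suc n) (q n)"
  have sum_add: "(\<Sum>k<n + m. f k) = (\<Sum>k<n. f k) + (\<Sum>k<m. f (n + k))" for n m and f :: "nat \<Rightarrow> real"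
    by (induction m) auto
  have q2: "q n (Suc n + k) = unif_partition t u n k" for n k
    using unif_partition(1,2)[OF st(1), of n] unif_partition(1)[OF st(2), of n]
      by (cases k) (auto simp: q_def)
  have q1: "q n k = unif_partition s t n k" if "k \<le> Suc n" for n k using that by (simp add: q_def)
  have R: "?R n \<omega> = ?R1 n \<omega> + ?R2 n \<omega>" for n \<omega>
  proof -
    have "?R n \<omega> = (\<Sum>k<Suc n. h (q n k) * (\<beta> (q n (Suc k)) \<omega> - \<beta> (q n k) \<omega>))
      + (\<Sum>k<Suc n. h (q n (Suc n + k)) * (\<beta> (q n (Suc n + Suc k)) \<omega> - \<beta> (q n (Suc n + k)) \<omega>))"
      unfolding riemann_sum_def sum_add by simp
    also have "(\<Sum>k<Suc n. h (q n k) * (\<beta> (q n (Suc k)) \<omega> - \<beta> (q n k) \<omega>)) = ?R1 n \<omega>"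
      unfolding riemann_sum_def by (intro sum.cong refl) (simp add: q1 Suc_leI del:
        sum.lessThan_Suc)
    finally show ?thesis by (simp only: q2 riemann_sum_def)
  qed
  have "(\<lambda>n. nm M (\<lambda>\<omega>. ?R n \<omega> - I \<omega>)) \<longlonglongrightarrow> 0"
  proof (rule has_wiener_integralD(4)[OF I, where \<mu>="\<lambda>n. (t - s) / real (Suc n)
    + (u - t) / real (Suc n)" and N="\<lambda>n. Suc n + Suc n"])
    show "(\<lambda>n. (t - s) / real (Suc n) + (u - t) / real (Suc n)) \<longlonglongrightarrow> 0"
      using tendsto_add[OF LIMSEQ_Suc[OF lim_const_over_n[of "t
        - s"]] LIMSEQ_Suc[OF lim_const_over_n[of "u - t"]]] by simp
    show "q n 0 = s" for n using unif_partition(1)[OF st(1)] by (simp add: q_def)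
    show "q n (Suc n + Suc n) = u" for n using q2[of n "Suc n"] unif_partition(2)[OF st(2)] by simp
    fix n k assume k: "k < Suc n + Suc n"
    have nn: "0 \<le> (t - s) / real (Suc n)" "0 \<le> (u - t) / real (Suc n)" using st by auto
    show "q n k \<le> q n (Suc k) \<and> q n (Suc k) - q n k
      \<le> (t - s) / real (Suc n) + (u - t) / real (Suc n)"
    proof (cases "k < Suc n")
      case True
      then show ?thesis using unif_partition(3,4)[OF st(1), of n k] nn
        by (simp add: q1 del: of_nat_Suc)
    next
      case False
      then obtain j where j: "k = Suc n + j" by (metis le_iff_add not_less)
      have "q n (Suc k) = unif_partition t u n (Suc j)" using q2[of n "Suc j"] by (simp add: j)
      moreover have "q n k = unif_partition t u n j" using q2[of n j] by (simp add: j)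
      ultimately show ?thesis using unif_partition(3,4)[OF st(2), of n j] nn
        by (simp del: of_nat_Suc)
    qed
  qed
  moreover have "(\<lambda>n. nm M (\<lambda>\<omega>. ?R n \<omega> - (J \<omega> + J' \<omega>))) \<longlonglongrightarrow> 0"
  proof (rule nm_tendsto_0)
    show "(\<lambda>n. nm M (\<lambda>\<omega>. ?R1 n \<omega> - J \<omega>) + nm M (\<lambda>\<omega>. ?R2 n \<omega> - J' \<omega>)) \<longlonglongrightarrow> 0"
      using tendsto_add[OF has_wiener_integral_unif[OF J] has_wiener_integral_unif[OF J']] by simp
    show "nm M (\<lambda>\<omega>. ?R n \<omega> - (J \<omega> + J' \<omega>)) \<le> nm M (\<lambda>\<omega>. ?R1 n \<omega> - J \<omega>) + nm M (\<lambda>\<omega>. ?R2 n \<omega> - J' \<omega>)"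
      for n
    proof -
      have "nm M (\<lambda>\<omega>. (?R1 n \<omega> - J \<omega>) + (?R2 n \<omega> - J' \<omega>))
        \<le> nm M (\<lambda>\<omega>. ?R1 n \<omega> - J \<omega>) + nm M (\<lambda>\<omega>. ?R2 n \<omega> - J' \<omega>)"
        by (intro nm_triangle L2_diff L2_riemann_sum L)
      then show "nm M (\<lambda>\<omega>. ?R n \<omega> - (J \<omega> + J' \<omega>))
        \<le> nm M (\<lambda>\<omega>. ?R1 n \<omega> - J \<omega>) + nm M (\<lambda>\<omega>. ?R2 n \<omega> - J' \<omega>)"
        unfolding R by (simp add: algebra_simps)
    qed
  qed
  ultimately show ?thesis
    by (intro L2_lim_unique[OF L2_riemann_sum L(3) L2_add(1)[OF L(1,2)]])
qed

lemma has_wiener_integral_unique: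
  assumes J: "has_wiener_integral M \<beta> h s t J" and J': "has_wiener_integral M \<beta> h s t J'"
  shows "AE \<omega> in M. J \<omega> = J' \<omega>"
  by (rule L2_lim_unique[OF L2_riemann_sum has_wiener_integralD(3)[OF J] has_wiener_integralD(3)[OF
    J']
        has_wiener_integral_unif[OF J] has_wiener_integral_unif[OF J']])

end

section \<open>Matrix-valued integrands and integrals over half-lines\<close>

lemma abs_le_onorm_mult:
  fixes A :: "real ^ 'd ^ 'd" and B :: "real ^ 'd ^ 'd"
  assumes "onorm ((*v) A) \<le> a" "norm B \<le> b"
  shows "\<bar>(A ** B) $ i $ j\<bar> \<le> a * (real CARD('d) * real CARD('d) * b)"
proof -
  have "\<bar>B $ i $ j\<bar> \<le> b" for i j
    using Finite_Cartesian_Product.norm_nth_le[of "B $ i" j] Finite_Cartesian_Product.norm_nth_le[of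
      B i] assms(2) by simp
  then have B: "onorm ((*v) B) \<le> real CARD('d) * real CARD('d) * b"
    by (rule onorm_le_matrix_component)
  have "\<bar>(A ** B) $ i $ j\<bar> \<le> onorm ((*v) (A ** B))" by (rule matrix_component_le_onorm)
  also have "\<dots> \<le> onorm ((*v) A) * onorm ((*v) B)"
    using onorm_compose[of "(*v) A" "(*v) B"]
      by (simp add: matrix_vector_mul_bounded_linear matrix_vector_mul_assoc o_def)
  also have "\<dots> \<le> a * (real CARD('d) * real CARD('d) * b)"
    using assms(1) B onorm_pos_le[OF matrix_vector_mul_bounded_linear[of A]] onorm_pos_le[OF
      matrix_vector_mul_bounded_linear[of B]]
    by (intro mult_mono) auto
  finally show ?thesis .
qed

lemma L2_vec:
  fixes Z :: "'d::finite \<Rightarrow> 'w \<Rightarrow> real"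
  assumes Z: "\<And>i. L2 M (Z i)"
  shows "L2 M (\<lambda>\<omega>. \<chi> i. Z i \<omega>)" "nm M (\<lambda>\<omega>. \<chi> i. Z i \<omega>) \<le> (\<Sum>i\<in>UNIV. nm M (Z i))"
proof -
  have m: "(\<lambda>\<omega>. (\<chi> i. Z i \<omega>)) \<in> borel_measurable M"
    using L2_measurable[OF Z] by (intro borel_measurable_euclidean_space[THEN iffD2]) (auto simp:
      Basis_vec_def inner_axis)
  have L: "L2 M (\<lambda>\<omega>. \<Sum>i\<in>UNIV. \<bar>Z i \<omega>\<bar>)" using L2_norm(1)[OF Z] by (intro L2_sum) auto
  have le: "norm (\<chi> i. Z i \<omega>) \<le> norm (\<Sum>i\<in>UNIV. \<bar>Z i \<omega>\<bar>)" for \<omega>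
    using norm_le_l1_cart[of "\<chi> i. Z i \<omega>"] by (simp add: sum_nonneg)
  show "L2 M (\<lambda>\<omega>. \<chi> i. Z i \<omega>)" by (rule L2_bound(1)[OF L m]) (use le in simp)
  have "nm M (\<lambda>\<omega>. \<chi> i. Z i \<omega>) \<le> nm M (\<lambda>\<omega>. \<Sum>i\<in>UNIV. \<bar>Z i \<omega>\<bar>)"
    by (rule L2_bound(2)[OF L m]) (use le in simp)
  also have "\<dots> \<le> (\<Sum>i\<in>UNIV. nm M (\<lambda>\<omega>. \<bar>Z i \<omega>\<bar>))" using L2_norm(1)[OF Z] by (intro L2_sum(2)) auto
  also have "\<dots> = (\<Sum>i\<in>UNIV. nm M (Z i))" using L2_norm(2)[of M "Z i" for i] by simp
  finally show "nm M (\<lambda>\<omega>. \<chi> i. Z i \<omega>) \<le> (\<Sum>i\<in>UNIV. nm M (Z i))" .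
qed

context
  fixes H :: real and P :: "(real \<Rightarrow> real ^ 'd) measure"
  assumes P: "fbm_law H P" and H: "1/2 < H"
begin

text \<open>\<open>has_wiener_integral_vec\<close> for the canonical process without membership in
  \<open>abs_H_mat\<close>. That condition is carried apart and rejoined in
  \<open>has_wiener_integral_atMost_iff\<close>.\<close>

definition wint :: "(real \<Rightarrow> real ^ 'd ^ 'd) \<Rightarrow> real \<Rightarrow> real \<Rightarrow> ((real \<Rightarrow> real ^ 'd) \<Rightarrow> real ^ 'd) \<Rightarrow> bool"
  where
  "wint h s t J \<longleftrightarrow> (\<exists>I. (\<forall>i j. has_wiener_integral P (\<lambda>u \<omega>. \<omega> u $ j) (\<lambda>u. h u $ i $ j) s t (I i j)) \<and>
     J = (\<lambda>\<omega>. \<chi> i. \<Sum>j\<in>UNIV. I i j \<omega>))"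

lemmas scalar_D = has_wiener_integralD[OF prob_P[OF P] fbm_component[OF P] H]
lemmas scalar_add = has_wiener_integral_add[OF prob_P[OF P] fbm_component[OF P] H]

lemma wintE:
  assumes "wint h s t J"
  obtains I where "\<And>i j. has_wiener_integral P (\<lambda>u \<omega>. \<omega> u $ j) (\<lambda>u. h u $ i $ j) s t (I i j)"
    "J = (\<lambda>\<omega>. \<chi> i. \<Sum>j\<in>UNIV. I i j \<omega>)"
  using assms unfolding wint_def by blast

lemma wint_L2: assumes "wint h s t J" shows "L2 P J" "s \<le> t"
proof -
  obtain I where I: "\<And>i j. has_wiener_integral P (\<lambda>u \<omega>. \<omega> u $ j) (\<lambda>u. h u $ i $ j) s t (I i j)"
    "J = (\<lambda>\<omega>. \<chi> i. \<Sum>j\<in>UNIV. I i j \<omega>)" using wintE[OF assms] by blast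
  show "L2 P J" unfolding I(2) by (intro L2_vec L2_sum scalar_D(3)[OF I(1)])
  show "s \<le> t" by (rule scalar_D(1)[OF I(1)])
qed

lemma wint_exists:
  assumes "s \<le> t" "continuous_on {s..t} h"
  obtains J where "wint h s t J"
proof -
  have "\<exists>I. has_wiener_integral P (\<lambda>u \<omega>. \<omega> u $ j) (\<lambda>u. h u $ i $ j) s t I" for i j
  proof -
    have "continuous_on {s..t} (\<lambda>u. h u $ i $ j)" by (intro continuous_on_component assms(2))
    then show ?thesis by (rule has_wiener_integral_exists[OF prob_P[OF P] fbm_component[OF P] H
      assms(1)]) blast
  qed
  then obtain I where "\<And>i j. has_wiener_integral P (\<lambda>u \<omega>. \<omega> u $ j) (\<lambda>u. h u $ i $ j) s t (I i j)"
    by metis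
  then show ?thesis by (intro that) (auto simp: wint_def)
qed

lemma nm_wint_le:
  assumes "wint h s t J" and h: "\<And>u i j. u \<in> {s..t} \<Longrightarrow> \<bar>h u $ i $ j\<bar> \<le> K"
  shows "nm P J \<le> real CARD('d) * real CARD('d) * (K * (t - s) powr H)"
proof -
  obtain I where I: "\<And>i j. has_wiener_integral P (\<lambda>u \<omega>. \<omega> u $ j) (\<lambda>u. h u $ i $ j) s t (I i j)"
    "J = (\<lambda>\<omega>. \<chi> i. \<Sum>j\<in>UNIV. I i j \<omega>)" using wintE[OF assms(1)] by blast
  have "nm P J \<le> (\<Sum>i\<in>UNIV. nm P (\<lambda>\<omega>. \<Sum>j\<in>UNIV. I i j \<omega>))"
    unfolding I(2) by (intro L2_vec L2_sum scalar_D(3)[OF I(1)])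
  also have "\<dots> \<le> (\<Sum>i\<in>(UNIV::'d set). \<Sum>j\<in>(UNIV::'d set). K * (t - s) powr H)"
  proof (intro sum_mono)
    fix i
    have "nm P (\<lambda>\<omega>. \<Sum>j\<in>UNIV. I i j \<omega>) \<le> (\<Sum>j\<in>UNIV. nm P (I i j))"
      by (intro L2_sum scalar_D(3)[OF I(1)])
    also have "\<dots> \<le> (\<Sum>j\<in>(UNIV::'d set). K * (t - s) powr H)"
      using h by (intro sum_mono nm_wiener_integral_le[OF prob_P[OF P] fbm_component[OF P] H I(1)])
        auto
    finally show "nm P (\<lambda>\<omega>. \<Sum>j\<in>UNIV. I i j \<omega>) \<le> (\<Sum>j\<in>(UNIV::'d set). K * (t - s) powr H)" .
  qed
  finally show ?thesis by simp
qed

lemma wint_add: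
  assumes "wint h s t J" "wint g s t J'"
  shows "wint (\<lambda>u. h u + c *\<^sub>R g u) s t (\<lambda>\<omega>. J \<omega> + c *\<^sub>R J' \<omega>)"
proof -
  obtain I where I: "\<And>i j. has_wiener_integral P (\<lambda>u \<omega>. \<omega> u $ j) (\<lambda>u. h u $ i $ j) s t (I i j)"
    "J = (\<lambda>\<omega>. \<chi> i. \<Sum>j\<in>UNIV. I i j \<omega>)" using wintE[OF assms(1)] by blast
  obtain I' where I': "\<And>i j. has_wiener_integral P (\<lambda>u \<omega>. \<omega> u $ j) (\<lambda>u. g u $ i $ j) s t (I' i j)"
    "J' = (\<lambda>\<omega>. \<chi> i. \<Sum>j\<in>UNIV. I' i j \<omega>)" using wintE[OF assms(2)] by blast
  show ?thesis unfolding wint_def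
  proof (intro exI conjI allI)
    show "has_wiener_integral P (\<lambda>u \<omega>. \<omega> u $ j) (\<lambda>u. (h u + c *\<^sub>R g u) $ i $ j) s t (\<lambda>\<omega>. I i j \<omega>
      + c * I' i j \<omega>)" for i j
      using scalar_add[OF I(1)[of j i] I'(1)[of j i], of c] by simp
    show "(\<lambda>\<omega>. J \<omega> + c *\<^sub>R J' \<omega>) = (\<lambda>\<omega>. \<chi> i. \<Sum>j\<in>UNIV. I i j \<omega> + c * I' i j \<omega>)"
      by (simp add: I(2) I'(2) fun_eq_iff vec_eq_iff sum.distrib sum_distrib_left)
  qed
qed

lemma has_wiener_integral_sum:
  assumes "finite K" "\<And>k. k \<in> K \<Longrightarrow> has_wiener_integral P (\<lambda>u \<omega>. \<omega> u $ j) (h k) s t (I k)" and "s \<le> t"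
  shows "has_wiener_integral P (\<lambda>u \<omega>. \<omega> u $ j) (\<lambda>u. \<Sum>k\<in>K. a k * h k u) s t (\<lambda>\<omega>. \<Sum>k\<in>K. a k * I k \<omega>)"
  using assms(1,2)
proof (induction K rule: finite_induct)
  case empty
  \<comment> \<open>The integral of 0 is found as J - J for some version J.\<close>
  obtain J where J: "has_wiener_integral P (\<lambda>u \<omega>. \<omega> u $ j) (\<lambda>_. 0) s t J"
    using has_wiener_integral_exists[OF prob_P[OF P] fbm_component[OF P] H assms(3), of "\<lambda>_. 0"]
      by auto
  show ?case using scalar_add[OF J J, of "-1"] by simp
next
  case (insert k K)
  have "has_wiener_integral P (\<lambda>u \<omega>. \<omega> u $ j) (\<lambda>u. \<Sum>k\<in>K. a k * h k u) s t (\<lambda>\<omega>. \<Sum>k\<in>K. a k * I k \<omega>)"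
    using insert by auto
  from scalar_add[OF this insert.prems[of k], of "a k"] show ?case
    using insert.hyps by (simp add: add.commute)
qed

lemma wint_matrix:
  assumes "wint h s t J"
  shows "wint (\<lambda>u. S ** h u) s t (\<lambda>\<omega>. S *v J \<omega>)"
proof -
  obtain I where I: "\<And>i j. has_wiener_integral P (\<lambda>u \<omega>. \<omega> u $ j) (\<lambda>u. h u $ i $ j) s t (I i j)"
    "J = (\<lambda>\<omega>. \<chi> i. \<Sum>j\<in>UNIV. I i j \<omega>)" using wintE[OF assms(1)] by blast
  show ?thesis unfolding wint_def
  proof (intro exI conjI allI)
    show "has_wiener_integral P (\<lambda>u \<omega>. \<omega> u $ j) (\<lambda>u. (S ** h u) $ i $ j) s t (\<lambda>\<omega>. \<Sum>k\<in>UNIV. S $ i $ k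
      * I k j \<omega>)" for i j
      unfolding matrix_matrix_mult_def vec_lambda_beta
      by (intro has_wiener_integral_sum I(1) wint_L2(2)[OF assms]) auto
    show "(\<lambda>\<omega>. S *v J \<omega>) = (\<lambda>\<omega>. \<chi> i. \<Sum>j\<in>UNIV. \<Sum>k\<in>UNIV. S $ i $ k * I k j \<omega>)"
      unfolding I(2) matrix_vector_mult_def fun_eq_iff vec_eq_iff vec_lambda_beta sum_distrib_left
      by (intro allI sum.swap)
  qed
qed

lemma wint_unique:
  assumes "wint h s t J" "wint h s t J'"
  shows "AE \<omega> in P. J \<omega> = J' \<omega>"
proof -
  obtain I where I: "\<And>i j. has_wiener_integral P (\<lambda>u \<omega>. \<omega> u $ j) (\<lambda>u. h u $ i $ j) s t (I i j)"
    "J = (\<lambda>\<omega>. \<chi> i. \<Sum>j\<in>UNIV. I i j \<omega>)" using wintE[OF assms(1)] by blast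
  obtain I' where I': "\<And>i j. has_wiener_integral P (\<lambda>u \<omega>. \<omega> u $ j) (\<lambda>u. h u $ i $ j) s t (I' i j)"
    "J' = (\<lambda>\<omega>. \<chi> i. \<Sum>j\<in>UNIV. I' i j \<omega>)" using wintE[OF assms(2)] by blast
  have "AE \<omega> in P. \<forall>i. \<forall>j. I i j \<omega> = I' i j \<omega>"
    unfolding AE_all_countable
    using has_wiener_integral_unique[OF prob_P[OF P] fbm_component[OF P] H I(1) I'(1)] by blast
  then show ?thesis by eventually_elim (simp add: I(2) I'(2))
qed

lemma wint_concat:
  assumes "wint h s t J" "wint h t u J'" "wint h s u K"
  shows "AE \<omega> in P. K \<omega> = J \<omega> + J' \<omega>"
proof -
  obtain I where I: "\<And>i j. has_wiener_integral P (\<lambda>u \<omega>. \<omega> u $ j) (\<lambda>u. h u $ i $ j) s t (I i j)"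
    "J = (\<lambda>\<omega>. \<chi> i. \<Sum>j\<in>UNIV. I i j \<omega>)" using wintE[OF assms(1)] by blast
  obtain I' where I': "\<And>i j. has_wiener_integral P (\<lambda>u \<omega>. \<omega> u $ j) (\<lambda>u. h u $ i $ j) t u (I' i j)"
    "J' = (\<lambda>\<omega>. \<chi> i. \<Sum>j\<in>UNIV. I' i j \<omega>)" using wintE[OF assms(2)] by blast
  obtain I'' where I'': "\<And>i j. has_wiener_integral P (\<lambda>u \<omega>. \<omega> u $ j) (\<lambda>u. h u $ i $ j) s u (I'' i
    j)"
    "K = (\<lambda>\<omega>. \<chi> i. \<Sum>j\<in>UNIV. I'' i j \<omega>)" using wintE[OF assms(3)] by blast
  have "AE \<omega> in P. \<forall>i. \<forall>j. I'' i j \<omega> = I i j \<omega> + I' i j \<omega>"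
    unfolding AE_all_countable
    using has_wiener_integral_concat[OF prob_P[OF P] fbm_component[OF P] H I(1) I'(1) I''(1)]
      by blast
  then show ?thesis by eventually_elim (simp add: I(2) I'(2) I''(2) vec_eq_iff sum.distrib)
qed

text \<open>The increments of the shifted path over a translated partition are those of
  \<open>\<omega>\<close> over the original one, so the Riemann sums coincide pathwise after the
  shift. Invariance of P preserves their distance to the limit.\<close>

lemma has_wiener_integral_shift:
  assumes J: "has_wiener_integral P (\<lambda>u \<omega>. \<omega> u $ j) h (s + \<tau>) (t + \<tau>) J"
  shows "has_wiener_integral P (\<lambda>u \<omega>. \<omega> u $ j) (\<lambda>u. h (u + \<tau>)) s t (\<lambda>\<omega>. J (wiener_shift (-\<tau>) \<omega>))"
proof (rule has_wiener_integralI[OF prob_P[OF P] fbm_component[OF P] H])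
  show st: "s \<le> t" using scalar_D(1)[OF J] by simp
  show "continuous_on {s..t} (\<lambda>u. h (u + \<tau>))"
    by (rule continuous_on_compose2[OF scalar_D(2)[OF J]]) (auto intro!: continuous_intros)
  show "L2 P (\<lambda>\<omega>. J (wiener_shift (-\<tau>) \<omega>))" by (intro L2_wiener_shift[OF P] scalar_D(3)[OF J])
  let ?\<beta> = "\<lambda>u (\<omega> :: real \<Rightarrow> real ^ 'd). \<omega> u $ j"
  have eq: "riemann_sum ?\<beta> (\<lambda>u. h (u + \<tau>)) (Suc n) (unif_partition s t n) \<omega>
      = riemann_sum ?\<beta> h (Suc n) (unif_partition (s + \<tau>) (t + \<tau>) n) (wiener_shift (-\<tau>) \<omega>)" for n \<omega>
    by (simp add: riemann_sum_def wiener_shift_def unif_partition_def algebra_simps)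
  have "nm P (\<lambda>\<omega>. riemann_sum ?\<beta> (\<lambda>u. h (u + \<tau>)) (Suc n) (unif_partition s t n) \<omega>
    - J (wiener_shift (-\<tau>) \<omega>))
      = nm P (\<lambda>\<omega>. riemann_sum ?\<beta> h (Suc n) (unif_partition (s + \<tau>) (t + \<tau>) n) \<omega> - J \<omega>)" for n
    unfolding eq
    by (intro L2_wiener_shift(2)[OF P, of "\<lambda>\<omega>. riemann_sum ?\<beta> h (Suc n) (unif_partition (s + \<tau>) (t
      + \<tau>) n) \<omega> - J \<omega>"]
         L2_diff L2_riemann_sum[OF prob_P[OF P] fbm_component[OF P] H] scalar_D(3)[OF J])
  then show "(\<lambda>n. nm P (\<lambda>\<omega>. riemann_sum ?\<beta> (\<lambda>u. h (u
    + \<tau>)) (Suc n) (unif_partition s t n) \<omega> - J (wiener_shift (-\<tau>) \<omega>))) \<longlonglongrightarrow> 0"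
    using has_wiener_integral_unif[OF prob_P[OF P] fbm_component[OF P] H J] by simp
qed

lemma wint_shift:
  assumes "wint h (s + \<tau>) (t + \<tau>) J"
  shows "wint (\<lambda>u. h (u + \<tau>)) s t (\<lambda>\<omega>. J (wiener_shift (-\<tau>) \<omega>))"
proof -
  obtain I where I: "\<And>i j. has_wiener_integral P (\<lambda>u \<omega>. \<omega> u $ j) (\<lambda>u. h u $ i $ j) (s + \<tau>) (t
    + \<tau>) (I i j)"
    "J = (\<lambda>\<omega>. \<chi> i. \<Sum>j\<in>UNIV. I i j \<omega>)" using wintE[OF assms(1)] by blast
  show ?thesis unfolding wint_def I(2)
    using has_wiener_integral_shift[OF I(1)] by (intro exI[of _ "\<lambda>i j \<omega>. I i j (wiener_shift (-\<tau>)
      \<omega>)"]) auto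
qed

section \<open>Exponentially decaying integrands\<close>

definition decaying :: "(real \<Rightarrow> real ^ 'd ^ 'd) \<Rightarrow> real \<Rightarrow> real \<Rightarrow> real \<Rightarrow> bool" where
  "decaying h t m K \<longleftrightarrow> continuous_on UNIV h \<and> (\<forall>u\<le>t. \<forall>i j. \<bar>h u $ i $ j\<bar> \<le> K * exp (- m * (t - u)))"

text \<open>The series sums the decay over unit cells; the two dimensions come from the passage from
  entries to vectors.\<close>

definition decay_const :: "real \<Rightarrow> real" where
  "decay_const m = real CARD('d) * real CARD('d) * (\<Sum>n. exp (- m) ^ n)"

lemma decay_const_nonneg: "m > 0 \<Longrightarrow> 0 \<le> decay_const m"
  unfolding decay_const_def by (intro mult_nonneg_nonneg suminf_nonneg summable_geometric) auto

text \<open>Cut the interval of integration into unit intervals and sum a geometric series.\<close>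

lemma nm_wint_decaying:
  assumes m: "m > 0" and h: "decaying h t m K" and J: "wint h a b J" and bt: "b \<le> t"
  shows "nm P J \<le> decay_const m * K * exp (- m * (t - b))"
proof -
  let ?c = "real CARD('d) * real CARD('d)"
  have cont: "continuous_on {x..y} h" for x y
    using h by (auto simp: decaying_def intro: continuous_on_subset)
  have K: "0 \<le> K"
  proof -
    have "\<bar>h t $ i $ i\<bar> \<le> K" for i using h unfolding decaying_def by force
    then show ?thesis by (meson abs_ge_zero order_trans)
  qed
  have unit: "nm P J \<le> ?c * (K * exp (- m * (t - b)))" if J: "wint h a b J"
    and ab: "b - a \<le> 1" "b \<le> t" for a b J
  proof -
    have le: "a \<le> b" by (rule wint_L2(2)[OF J])
    have "nm P J \<le> ?c * (K * exp (- m * (t - b)) * (b - a) powr H)"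
    proof (rule nm_wint_le[OF J])
      fix u i j assume u: "u \<in> {a..b}"
      have "\<bar>h u $ i $ j\<bar> \<le> K * exp (- m * (t - u))" using h u ab by (auto simp: decaying_def)
      also have "\<dots> \<le> K * exp (- m * (t - b))" using u m K by (intro mult_left_mono) auto
      finally show "\<bar>h u $ i $ j\<bar> \<le> K * exp (- m * (t - b))" .
    qed
    also have "\<dots> \<le> ?c * (K * exp (- m * (t - b)) * 1)"
      using K H le ab powr_mono2[of H "b - a" 1] by (intro mult_left_mono) auto
    finally show ?thesis by simp
  qed
  \<comment> \<open>The left end a stays fixed and the right end b moves. The bound carries the
    weight exp(-m(t - b)), so cutting off the last unit cell gains a factor exp(-m), and the result
    does not depend on a.\<close>
  have ind: "nm P J \<le> ?c * (K * exp (- m * (t - b))) * (\<Sum>k<Suc n. exp (- m) ^ k)"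
    if "wint h a b J" "b - a \<le> real (Suc n)" "b \<le> t" for n a b J
    using that
  proof (induction n arbitrary: b J)
    case 0
    then show ?case using unit[OF 0(1)] by simp
  next
    case (Suc n)
    let ?q = "\<Sum>k<Suc n. exp (- m) ^ k"
    have nn: "0 \<le> ?c * (K * exp (- m * (t - b)))" using K by simp
    have split: "(\<Sum>k<Suc (Suc n). exp (- m) ^ k) = 1 + exp (- m) * ?q"
      by (subst sum.lessThan_Suc_shift) (simp add: sum_distrib_left del: sum.lessThan_Suc)
    show ?case
    proof (cases "b - a \<le> 1")
      case True
      have "0 \<le> exp (- m) * ?q" by (intro mult_nonneg_nonneg sum_nonneg) auto
      then have "?c * (K * exp (- m * (t - b))) * 1
        \<le> ?c * (K * exp (- m * (t - b))) * (1 + exp (- m) * ?q)"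
        using nn by (intro mult_left_mono) auto
      then show ?thesis using unit[OF Suc.prems(1) True Suc.prems(3)] unfolding split by linarith
    next
      case False
      have "a \<le> b - 1" using False by simp
      then obtain J1 where J1: "wint h a (b - 1) J1" by (rule wint_exists[OF _ cont])
      obtain J2 where J2: "wint h (b - 1) b J2" using wint_exists[OF _ cont, of "b - 1" b] by auto
      have "nm P J = nm P (\<lambda>\<omega>. J1 \<omega> + J2 \<omega>)"
        using wint_concat[OF J1 J2 Suc.prems(1)] wint_L2(1)[OF J1] wint_L2(1)[OF J2] wint_L2(1)[OF
          Suc.prems(1)]
        by (intro nm_cong_AE) (auto dest: L2_measurable)
      also have "\<dots> \<le> nm P J1 + nm P J2" by (intro nm_triangle wint_L2(1)[OF J1] wint_L2(1)[OF J2])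
      also have "\<dots> \<le> ?c * (K * exp (- m * (t - (b - 1)))) * ?q + ?c * (K * exp (- m * (t - b)))"
        using Suc.IH[OF J1] unit[OF J2] Suc.prems by (intro add_mono) auto
      also have "exp (- m * (t - (b - 1))) = exp (- m * (t - b)) * exp (- m)"
        by (simp add: algebra_simps flip: exp_add)
      finally show ?thesis unfolding split by (simp add: algebra_simps)
    qed
  qed
  obtain n :: nat where "b - a \<le> real n" using real_arch_simple by blast
  then have "b - a \<le> real (Suc n)" by simp
  then have "nm P J \<le> ?c * (K * exp (- m * (t - b))) * (\<Sum>k<Suc n. exp (- m) ^ k)"
    by (rule ind[OF J _ bt])
  also have "\<dots> \<le> ?c * (K * exp (- m * (t - b))) * (\<Sum>k. exp (- m) ^ k)"
    using m K by (intro mult_left_mono sum_le_suminf summable_geometric) auto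
  finally show ?thesis by (simp add: decay_const_def algebra_simps)
qed

text \<open>Closeness is demanded of every version I, which avoids choosing versions. The
  formulation with a chosen family agrees with it because versions over the same interval are almost
  surely equal.\<close>

definition wintU :: "(real \<Rightarrow> real ^ 'd ^ 'd) \<Rightarrow> real \<Rightarrow> ((real \<Rightarrow> real ^ 'd) \<Rightarrow> real ^ 'd) \<Rightarrow> bool" where
  "wintU h t J \<longleftrightarrow> continuous_on UNIV h \<and> L2 P J \<and>
     (\<forall>e>0. \<exists>s0\<le>t. \<forall>s\<le>s0. \<forall>I. wint h s t I \<longrightarrow> nm P (\<lambda>\<omega>. I \<omega> - J \<omega>) < e)"

lemma wintUD:
  assumes "wintU h t J"
  shows "continuous_on UNIV h" "L2 P J"
    and "e > 0 \<Longrightarrow> \<exists>s0\<le>t. \<forall>s\<le>s0. \<forall>I. wint h s t I \<longrightarrow> nm P (\<lambda>\<omega>. I \<omega> - J \<omega>) < e"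
  using assms unfolding wintU_def by blast+

lemma wint_exists': "continuous_on UNIV h \<Longrightarrow> s \<le> t \<Longrightarrow> \<exists>I. wint h s t I"
  by (meson wint_exists continuous_on_subset subset_UNIV)

lemma wintU_approx:
  assumes J: "wintU h t J" and e: "e > 0" and r: "r \<le> t"
  obtains s I where "s \<le> r" "wint h s t I" "nm P (\<lambda>\<omega>. I \<omega> - J \<omega>) < e"
proof -
  obtain s0 where s0: "s0 \<le> t" "\<And>s I. s \<le> s0 \<Longrightarrow> wint h s t I \<Longrightarrow> nm P (\<lambda>\<omega>. I \<omega> - J \<omega>) < e"
    using wintUD(3)[OF J e] by blast
  have "min s0 r \<le> t" using r by simp
  from wint_exists'[OF wintUD(1)[OF J] this] obtain I where "wint h (min s0 r) t I" ..
  moreover from this have "nm P (\<lambda>\<omega>. I \<omega> - J \<omega>) < e" by (intro s0(2)[of "min s0 r" I]) auto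
  ultimately show ?thesis by (intro that[OF min.cobounded2])
qed

lemma nm_wintU_le:
  assumes J: "wintU h t J" and m: "m > 0" and h: "decaying h t m K"
  shows "nm P J \<le> decay_const m * K"
proof (rule field_le_epsilon)
  fix e :: real assume e: "0 < e"
  obtain s I where I: "wint h s t I" "nm P (\<lambda>\<omega>. I \<omega> - J \<omega>) < e"
    using wintU_approx[OF J e order_refl] by blast
  have "nm P J \<le> nm P I + nm P (\<lambda>\<omega>. I \<omega> - J \<omega>)"
    using nm_le_add[OF wintUD(2)[OF J] wint_L2(1)[OF I(1)]] by (simp add: nm_commute[of P J])
  then show "nm P J \<le> decay_const m * K + e"
    using nm_wint_decaying[OF m h I(1)] I(2) by simp
qed

lemma wintU_exists:
  assumes m: "m > 0" and h: "decaying h t m K"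
  obtains J where "wintU h t J"
proof -
  have hc: "continuous_on UNIV h" using h by (simp add: decaying_def)
  define I where "I n = (SOME I'. wint h (t - real n) t I')" for n
  have I: "wint h (t - real n) t (I n)" for n
    using someI_ex[OF wint_exists'[OF hc, of "t - real n" t]] by (simp add: I_def)
  let ?C = "decay_const m * K"
  \<comment> \<open>An integral that starts earlier than t - n differs from \<open>I n\<close> by
    the integral over the additional piece, which is exponentially small in n.\<close>
  have diff: "nm P (\<lambda>\<omega>. I' \<omega> - I n \<omega>) \<le> ?C * exp (- m) ^ n" if I': "wint h s t I'"
    and s: "s \<le> t - n" for s I' n
  proof -
    obtain J where J: "wint h s (t - n) J" using wint_exists'[OF hc s] by blast
    have "nm P (\<lambda>\<omega>. I' \<omega> - I n \<omega>) = nm P J"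
      using wint_concat[OF J I I'] wint_L2(1)[OF J] wint_L2(1)[OF I] wint_L2(1)[OF I']
      by (intro nm_cong_AE) (auto dest: L2_measurable)
    also have "\<dots> \<le> ?C * exp (- m * (t - (t - n)))" by (rule nm_wint_decaying[OF m h J]) simp
    also have "exp (- m * (t - (t - n))) = exp (- m) ^ n"
      by (simp add: exp_of_nat_mult[symmetric] mult.commute)
    finally show ?thesis .
  qed
  have small: "\<exists>N. \<forall>n\<ge>N. ?C * exp (- m) ^ n < e" if "e > 0" for e
  proof -
    have "(\<lambda>n. ?C * exp (- m) ^ n) \<longlonglongrightarrow> ?C * 0" using m
      by (intro tendsto_intros LIMSEQ_power_zero) auto
    then show ?thesis using that order_tendstoD(2)[of _ 0 sequentially e]
      by (simp add: eventually_sequentially)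
  qed
  obtain J where J: "L2 P J" "(\<lambda>n. nm P (\<lambda>\<omega>. I n \<omega> - J \<omega>)) \<longlonglongrightarrow> 0"
  proof (rule prob_space.L2_complete[OF prob_P[OF P], of I])
    show "L2 P (I n)" for n by (rule wint_L2(1)[OF I])
    fix e :: real assume "e > 0"
    then obtain N where N: "\<And>n. n \<ge> N \<Longrightarrow> ?C * exp (- m) ^ n < e" using small by blast
    have "nm P (\<lambda>\<omega>. I k \<omega> - I n \<omega>) < e" if "k \<ge> N" "n \<ge> N" for k n
    proof (cases "n \<le> k")
      case True
      then have "nm P (\<lambda>\<omega>. I k \<omega> - I n \<omega>) \<le> ?C * exp (- m) ^ n" by (intro diff[OF I]) simp
      then show ?thesis using N[OF that(2)] by simp
    next
      case False
      then have "nm P (\<lambda>\<omega>. I n \<omega> - I k \<omega>) \<le> ?C * exp (- m) ^ k" by (intro diff[OF I]) simp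
      then show ?thesis using N[OF that(1)] by (simp add: nm_commute[of P "I k"])
    qed
    then show "\<exists>N. \<forall>k\<ge>N. \<forall>n\<ge>N. nm P (\<lambda>\<omega>. I k \<omega> - I n \<omega>) < e" by blast
  qed blast
  have "wintU h t J" unfolding wintU_def
  proof (intro conjI hc J(1) allI impI)
    fix e :: real assume e: "e > 0"
    obtain N1 where N1: "\<And>n. n \<ge> N1 \<Longrightarrow> ?C * exp (- m) ^ n < e/2" using small[of "e/2"] e by auto
    obtain N2 where N2: "\<And>n. n \<ge> N2 \<Longrightarrow> nm P (\<lambda>\<omega>. I n \<omega> - J \<omega>) < e/2"
      using order_tendstoD(2)[OF J(2), of "e/2"] e by (auto simp: eventually_sequentially)
    let ?n = "max N1 N2"
    have "nm P (\<lambda>\<omega>. I' \<omega> - J \<omega>) < e" if "s \<le> t - ?n" "wint h s t I'" for s I'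
    proof -
      have "nm P (\<lambda>\<omega>. I' \<omega> - J \<omega>) \<le> nm P (\<lambda>\<omega>. I' \<omega> - I ?n \<omega>) + nm P (\<lambda>\<omega>. I ?n \<omega> - J \<omega>)"
        by (intro nm_triangle3 wint_L2(1)[OF that(2)] wint_L2(1)[OF I] J(1))
      then show ?thesis using diff[OF that(2,1)] N1[of ?n] N2[of ?n] by simp
    qed
    then show "\<exists>s0\<le>t. \<forall>s\<le>s0. \<forall>I. wint h s t I \<longrightarrow> nm P (\<lambda>\<omega>. I \<omega> - J \<omega>) < e"
      by (intro exI[of _ "t - ?n"]) auto
  qed
  then show ?thesis by (rule that)
qed

lemma wintU_unique:
  assumes J: "wintU h t J" and J': "wintU h t J'"
  shows "AE \<omega> in P. J \<omega> = J' \<omega>"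
proof -
  have "nm P (\<lambda>\<omega>. J \<omega> - J' \<omega>) \<le> 0"
  proof (rule field_le_epsilon)
    fix e :: real assume "0 < e"
    then have e: "e / 2 > 0" by simp
    obtain s0 where s0: "s0 \<le> t" "\<And>s I. s \<le> s0 \<Longrightarrow> wint h s t I \<Longrightarrow> nm P (\<lambda>\<omega>. I \<omega> - J \<omega>) < e/2"
      using wintUD(3)[OF J e] by blast
    obtain s I where I: "s \<le> s0" "wint h s t I" "nm P (\<lambda>\<omega>. I \<omega> - J' \<omega>) < e/2"
      using wintU_approx[OF J' e s0(1)] by blast
    show "nm P (\<lambda>\<omega>. J \<omega> - J' \<omega>) \<le> 0 + e"
      using nm_triangle3[OF wintUD(2)[OF J] wint_L2(1)[OF I(2)] wintUD(2)[OF J']] s0(2)[OF I(1,2)]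
        I(3) nm_commute[of P J I] by simp
  qed
  then show ?thesis using nm_le_0_AE[OF L2_diff(1)[OF wintUD(2)[OF J] wintUD(2)[OF J']]] by simp
qed

lemma wintU_add:
  assumes J: "wintU h t J" and J': "wintU g t J'"
  shows "wintU (\<lambda>u. h u + c *\<^sub>R g u) t (\<lambda>\<omega>. J \<omega> + c *\<^sub>R J' \<omega>)"
  unfolding wintU_def
proof (intro conjI allI impI)
  note L = wintUD(2)[OF J] wintUD(2)[OF J']
  show "continuous_on UNIV (\<lambda>u. h u + c *\<^sub>R g u)"
    using wintUD(1)[OF J] wintUD(1)[OF J'] by (intro continuous_intros)
  show L': "L2 P (\<lambda>\<omega>. J \<omega> + c *\<^sub>R J' \<omega>)" by (intro L2_add L2_scaleR L)
  fix e :: real assume "e > 0"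
  then have e: "e / 2 > 0" "e / (2 * (\<bar>c\<bar> + 1)) > 0" by simp_all
  obtain s1 where s1: "s1 \<le> t" "\<And>s I. s \<le> s1 \<Longrightarrow> wint h s t I \<Longrightarrow> nm P (\<lambda>\<omega>. I \<omega> - J \<omega>) < e/2"
    using wintUD(3)[OF J e(1)] by blast
  obtain s2 where s2: "s2 \<le> t" "\<And>s I. s \<le> s2 \<Longrightarrow> wint g s t I \<Longrightarrow>
    nm P (\<lambda>\<omega>. I \<omega> - J' \<omega>) < e / (2 * (\<bar>c\<bar> + 1))"
    using wintUD(3)[OF J' e(2)] by blast
  have "nm P (\<lambda>\<omega>. I \<omega> - (J \<omega> + c *\<^sub>R J' \<omega>)) < e" if s: "s \<le> min s1 s2"
    and I: "wint (\<lambda>u. h u + c *\<^sub>R g u) s t I" for s I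
  proof -
    have st: "s \<le> t" using s s1(1) by simp
    obtain I1 where I1: "wint h s t I1" using wint_exists'[OF wintUD(1)[OF J] st] by blast
    obtain I2 where I2: "wint g s t I2" using wint_exists'[OF wintUD(1)[OF J'] st] by blast
    note L1 = wint_L2(1)[OF I1] wint_L2(1)[OF I2] wint_L2(1)[OF I]
    have "nm P (\<lambda>\<omega>. I \<omega> - (J \<omega> + c *\<^sub>R J' \<omega>)) = nm P (\<lambda>\<omega>. (I1 \<omega> - J \<omega>) + c *\<^sub>R (I2 \<omega> - J' \<omega>))"
    proof (rule nm_cong_AE)
      show "AE \<omega> in P. I \<omega> - (J \<omega> + c *\<^sub>R J' \<omega>) = I1 \<omega> - J \<omega> + c *\<^sub>R (I2 \<omega> - J' \<omega>)"
        using wint_unique[OF I wint_add[OF I1 I2]] by eventually_elim (simp add: algebra_simps)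
    qed (use L L1 in \<open>auto dest!: L2_measurable\<close>)
    also have "\<dots> \<le> nm P (\<lambda>\<omega>. I1 \<omega> - J \<omega>) + nm P (\<lambda>\<omega>. c *\<^sub>R (I2 \<omega> - J' \<omega>))"
      by (intro nm_triangle L2_diff L2_scaleR L L1)
    also have "\<dots> < e/2 + e/2"
    proof (rule add_less_le_mono)
      show "nm P (\<lambda>\<omega>. I1 \<omega> - J \<omega>) < e/2" using s1(2)[OF _ I1] s by simp
      have "\<bar>c\<bar> * nm P (\<lambda>\<omega>. I2 \<omega> - J' \<omega>) \<le> (\<bar>c\<bar> + 1) * (e / (2 * (\<bar>c\<bar> + 1)))"
        using s2(2)[OF _ I2] s by (intro mult_mono) auto
      also have "\<dots> = e / 2" by (simp add: divide_simps add_eq_0_iff)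
      finally show "nm P (\<lambda>\<omega>. c *\<^sub>R (I2 \<omega> - J' \<omega>)) \<le> e/2" by (simp add: nm_scaleR)
    qed
    finally show ?thesis by simp
  qed
  then show "\<exists>s0\<le>t. \<forall>s\<le>s0. \<forall>I. wint (\<lambda>u. h u + c *\<^sub>R g u) s t I \<longrightarrow>
    nm P (\<lambda>\<omega>. I \<omega> - (J \<omega> + c *\<^sub>R J' \<omega>)) < e"
    using s1(1) by (intro exI[of _ "min s1 s2"]) auto
qed

lemma continuous_matrix_mult:
  fixes h :: "real \<Rightarrow> real ^ 'd ^ 'd" and g :: "real \<Rightarrow> real ^ 'd ^ 'd"
  assumes "continuous_on UNIV g" "continuous_on UNIV h"
  shows "continuous_on UNIV (\<lambda>u. g u ** h u)"
  unfolding matrix_matrix_mult_def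
  by (intro continuous_on_vec_lambda continuous_on_sum continuous_on_mult continuous_on_component
    assms)

text \<open>For h(u) = S(s - u) \<open>\<sigma> u\<close> and the matrix S(t - s) this is the
  semigroup decomposition of the noise: the past up to s is transported by the matrix, and the noise
  over [s, t] is added.\<close>

lemma wintU_matrix_concat:
  assumes J: "wintU h s J" and J': "wint (\<lambda>u. S ** h u) s t J'"
  shows "wintU (\<lambda>u. S ** h u) t (\<lambda>\<omega>. S *v J \<omega> + J' \<omega>)"
  unfolding wintU_def
proof (intro conjI allI impI)
  note L = wintUD(2)[OF J] wint_L2(1)[OF J']
  have st: "s \<le> t" by (rule wint_L2(2)[OF J'])
  show "continuous_on UNIV (\<lambda>u. S ** h u)" using wintUD(1)[OF J]
    by (intro continuous_matrix_mult continuous_on_const)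
  show L': "L2 P (\<lambda>\<omega>. S *v J \<omega> + J' \<omega>)" by (intro L2_add L2_matrix L)
  fix e :: real assume e: "e > 0"
  let ?c = "onorm ((*v) S)"
  have c: "0 \<le> ?c" by (intro onorm_pos_le matrix_vector_mul_bounded_linear)
  have e': "e / (?c + 1) > 0" using e c by simp
  obtain s1 where s1: "s1 \<le> s" "\<And>r I. r \<le> s1 \<Longrightarrow> wint h r s I \<Longrightarrow> nm P (\<lambda>\<omega>. I \<omega> - J \<omega>) < e / (?c + 1)"
    using wintUD(3)[OF J e'] by blast
  have "nm P (\<lambda>\<omega>. I \<omega> - (S *v J \<omega> + J' \<omega>)) < e" if r: "r \<le> s1" and I: "wint (\<lambda>u. S ** h u) r t I"
    for r I
  proof -
    have rs: "r \<le> s" using r s1(1) by simp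
    obtain I1 where I1: "wint h r s I1" using wint_exists'[OF wintUD(1)[OF J] rs] by blast
    note L1 = wint_L2(1)[OF I1] wint_L2(1)[OF I]
    have "nm P (\<lambda>\<omega>. I \<omega> - (S *v J \<omega> + J' \<omega>)) = nm P (\<lambda>\<omega>. S *v (I1 \<omega> - J \<omega>))"
    proof (rule nm_cong_AE)
      show "AE \<omega> in P. I \<omega> - (S *v J \<omega> + J' \<omega>) = S *v (I1 \<omega> - J \<omega>)"
        using wint_concat[OF wint_matrix[OF I1] J' I]
          by eventually_elim (simp add: matrix_vector_mult_diff_distrib)
      show "(\<lambda>\<omega>. I \<omega> - (S *v J \<omega> + J' \<omega>)) \<in> borel_measurable P"
        by (intro L2_measurable L2_diff L' L1)
      show "(\<lambda>\<omega>. S *v (I1 \<omega> - J \<omega>)) \<in> borel_measurable P"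
        by (intro L2_measurable L2_matrix L2_diff L L1)
    qed
    also have "\<dots> \<le> ?c * nm P (\<lambda>\<omega>. I1 \<omega> - J \<omega>)" by (intro L2_matrix L2_diff L L1)
    also have "\<dots> \<le> ?c * (e / (?c + 1))" using s1(2)[OF r I1] c by (intro mult_left_mono) auto
    also have "\<dots> < e" using e c by (simp add: divide_simps algebra_simps)
    finally show ?thesis .
  qed
  then show "\<exists>s0\<le>t. \<forall>s\<le>s0. \<forall>I. wint (\<lambda>u. S ** h u) s t I \<longrightarrow> nm P (\<lambda>\<omega>. I \<omega> - (S *v J \<omega> + J' \<omega>)) < e"
    using s1(1) st by (intro exI[of _ s1]) auto
qed

lemma wintU_shift:
  assumes J: "wintU h (t + \<tau>) J"
  shows "wintU (\<lambda>u. h (u + \<tau>)) t (\<lambda>\<omega>. J (wiener_shift (-\<tau>) \<omega>))"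
  unfolding wintU_def
proof (intro conjI allI impI)
  note L = wintUD(2)[OF J]
  show "continuous_on UNIV (\<lambda>u. h (u + \<tau>))"
    by (rule continuous_on_compose2[OF wintUD(1)[OF J]]) (auto intro!: continuous_intros)
  show L': "L2 P (\<lambda>\<omega>. J (wiener_shift (-\<tau>) \<omega>))" by (intro L2_wiener_shift[OF P] L)
  fix e :: real assume e: "e > 0"
  obtain s1 where s1: "s1 \<le> t + \<tau>" "\<And>r I. r \<le> s1 \<Longrightarrow> wint h r (t + \<tau>) I \<Longrightarrow> nm P (\<lambda>\<omega>. I \<omega> - J \<omega>) < e"
    using wintUD(3)[OF J e] by blast
  have "nm P (\<lambda>\<omega>. I \<omega> - J (wiener_shift (-\<tau>) \<omega>)) < e" if s: "s \<le> s1 - \<tau>"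
    and I: "wint (\<lambda>u. h (u + \<tau>)) s t I" for s I
  proof -
    have st: "s + \<tau> \<le> t + \<tau>" using s s1(1) by simp
    obtain I1 where I1: "wint h (s + \<tau>) (t + \<tau>) I1"
      using wint_exists'[OF wintUD(1)[OF J] st] by blast
    note L1 = wint_L2(1)[OF I1] wint_L2(1)[OF I]
    have "nm P (\<lambda>\<omega>. I \<omega> - J (wiener_shift (-\<tau>) \<omega>))
      = nm P (\<lambda>\<omega>. I1 (wiener_shift (-\<tau>) \<omega>) - J (wiener_shift (-\<tau>) \<omega>))"
    proof (rule nm_cong_AE)
      show "AE \<omega> in P. I \<omega> - J (wiener_shift (-\<tau>) \<omega>)
        = I1 (wiener_shift (-\<tau>) \<omega>) - J (wiener_shift (-\<tau>) \<omega>)"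
        using wint_unique[OF I wint_shift[OF I1]] by eventually_elim simp
      show "(\<lambda>\<omega>. I \<omega> - J (wiener_shift (-\<tau>) \<omega>)) \<in> borel_measurable P"
        by (intro L2_measurable L2_diff L' L1)
      show "(\<lambda>\<omega>. I1 (wiener_shift (-\<tau>) \<omega>) - J (wiener_shift (-\<tau>) \<omega>)) \<in> borel_measurable P"
        by (intro L2_measurable L2_diff L' L2_wiener_shift[OF P] L1)
    qed
    also have "\<dots> = nm P (\<lambda>\<omega>. I1 \<omega> - J \<omega>)"
      by (intro L2_wiener_shift(2)[OF P, of "\<lambda>\<omega>. I1 \<omega> - J \<omega>"] L2_diff L L1)
    also have "\<dots> < e" using s1(2)[OF _ I1] s by simp
    finally show ?thesis .
  qed
  then show "\<exists>s0\<le>t. \<forall>s\<le>s0. \<forall>I. wint (\<lambda>u. h (u + \<tau>)) s t I \<longrightarrow>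
    nm P (\<lambda>\<omega>. I \<omega> - J (wiener_shift (-\<tau>) \<omega>)) < e"
    using s1(1) by (intro exI[of _ "s1 - \<tau>"]) auto
qed

text \<open>Restriction can only decrease the absolute value of the integrand, and the kernel is
  nonnegative because 2H - 1 > 0.\<close>

lemma abs_H_mat_subinterval:
  assumes "(\<lambda>u. indicator {..t} u *\<^sub>R h u) \<in> abs_H_mat H" and H1: "1/2 < H"
  shows "(\<lambda>u. indicator {s..t} u *\<^sub>R h u) \<in> abs_H_mat H"
  unfolding abs_H_mat_def
proof (intro CollectI allI)
  fix i j
  let ?f = "\<lambda>u. (indicator {..t} u *\<^sub>R h u) $ i $ j"
    and ?g = "\<lambda>u. (indicator {s..t} u *\<^sub>R h u) $ i $ j"
  let ?E = "\<lambda>f t s. ennreal (H * (2 * H - 1) * \<bar>t - s\<bar> powr (2 * H - 2) * \<bar>f s\<bar> * \<bar>f t\<bar>)"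
  have f: "?f \<in> borel_measurable borel" "(\<integral>\<^sup>+ t. \<integral>\<^sup>+ s. ?E ?f t s \<partial>lborel \<partial>lborel) < \<infinity>"
    using assms(1) by (auto simp: abs_H_mat_def abs_H_def)
  have geq: "?g = (\<lambda>u. indicator {s..t} u * ?f u)" by (auto simp: indicator_def fun_eq_iff)
  have m: "?g \<in> borel_measurable borel" unfolding geq using f(1) by measurable
  have le: "\<bar>?g u\<bar> \<le> \<bar>?f u\<bar>" for u by (auto simp: indicator_def)
  have "(\<integral>\<^sup>+ t. \<integral>\<^sup>+ s. ?E ?g t s \<partial>lborel \<partial>lborel) \<le> (\<integral>\<^sup>+ t. \<integral>\<^sup>+ s. ?E ?f t s \<partial>lborel \<partial>lborel)"
    using H1 by (intro nn_integral_mono ennreal_leI mult_mono le mult_nonneg_nonneg) auto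
  also note f(2)
  finally show "?g \<in> abs_H H" using m by (simp add: abs_H_def)
qed

text \<open>From a chosen family of versions to all versions by uniqueness, and back by choosing one
  version for every s.\<close>

lemma has_wiener_integral_atMost_iff:
  assumes h: "continuous_on UNIV h"
  shows "has_wiener_integral_atMost P H canonical_process h t J \<longleftrightarrow>
    (\<lambda>u. indicator {..t} u *\<^sub>R h u) \<in> abs_H_mat H \<and> wintU h t J"
proof -
  have vec: "has_wiener_integral_vec P H canonical_process h s t I \<longleftrightarrow> wint h s t I"
    if "(\<lambda>u. indicator {..t} u *\<^sub>R h u) \<in> abs_H_mat H" for s I
    using abs_H_mat_subinterval[OF that H] by (simp add: has_wiener_integral_vec_def wint_def
      canonical_process_def)
  have main: "L2 P J \<and> (\<exists>I. (\<forall>s. - s \<le> t \<longrightarrow> wint h (- s) t (I s))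
    \<and> ((\<lambda>s. nm P (\<lambda>\<omega>. I s \<omega> - J \<omega>)) \<longlongrightarrow> 0) at_top)
     \<longleftrightarrow> wintU h t J" (is "?L \<longleftrightarrow> ?R")
  proof
    assume ?L
    then obtain I where J: "L2 P J" and I: "\<And>s. - s \<le> t \<Longrightarrow>
      wint h (- s) t (I s)" "((\<lambda>s. nm P (\<lambda>\<omega>. I s \<omega> - J \<omega>)) \<longlongrightarrow> 0) at_top"
      by blast
    show ?R unfolding wintU_def
    proof (intro conjI h J allI impI)
      fix e :: real assume "e > 0"
      then have "\<forall>\<^sub>F s in at_top. nm P (\<lambda>\<omega>. I s \<omega> - J \<omega>) < e" by (rule order_tendstoD(2)[OF I(2)])
      then obtain r where r: "\<And>s. s \<ge> r \<Longrightarrow> nm P (\<lambda>\<omega>. I s \<omega> - J \<omega>) < e"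
        by (auto simp: eventually_at_top_linorder)
      have "nm P (\<lambda>\<omega>. I' \<omega> - J \<omega>) < e" if "s \<le> min t (- r)" "wint h s t I'" for s I'
      proof -
        have Is: "wint h s t (I (- s))" using I(1)[of "- s"] that(1) by simp
        have "nm P (\<lambda>\<omega>. I' \<omega> - J \<omega>) = nm P (\<lambda>\<omega>. I (- s) \<omega> - J \<omega>)"
          using wint_unique[OF that(2) Is] wint_L2(1)[OF that(2)] wint_L2(1)[OF Is] J
          by (intro nm_cong_AE) (auto dest: L2_measurable)
        then show ?thesis using r[of "- s"] that(1) by simp
      qed
      then show "\<exists>s0\<le>t. \<forall>s\<le>s0. \<forall>I. wint h s t I \<longrightarrow> nm P (\<lambda>\<omega>. I \<omega> - J \<omega>) < e"
        by (intro exI[of _ "min t (- r)"]) auto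
    qed
  next
    assume R: ?R
    have "\<forall>s. \<exists>I. - s \<le> t \<longrightarrow> wint h (- s) t I" using wint_exists'[OF h] by blast
    then obtain I where I: "\<And>s. - s \<le> t \<Longrightarrow> wint h (- s) t (I s)" by metis
    have "((\<lambda>s. nm P (\<lambda>\<omega>. I s \<omega> - J \<omega>)) \<longlongrightarrow> 0) at_top"
    proof (rule order_tendstoI)
      fix e :: real assume "0 < e"
      then obtain s0 where s0: "s0 \<le> t" "\<And>s I. s \<le> s0 \<Longrightarrow> wint h s t I \<Longrightarrow> nm P (\<lambda>\<omega>. I \<omega> - J \<omega>) < e"
        using wintUD(3)[OF R] by blast
      show "\<forall>\<^sub>F s in at_top. nm P (\<lambda>\<omega>. I s \<omega> - J \<omega>) < e"
        using eventually_ge_at_top[of "- s0"]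
      proof eventually_elim
        case (elim s)
        then show ?case using s0(1) by (intro s0(2)[OF _ I]) auto
      qed
    qed (intro always_eventually allI, erule less_le_trans, rule nm_nonneg)
    then show ?L using wintUD(2)[OF R] I by blast
  qed
  show ?thesis
  proof (cases "(\<lambda>u. indicator {..t} u *\<^sub>R h u) \<in> abs_H_mat H")
    case True
    show ?thesis
      unfolding has_wiener_integral_atMost_def in_Lp_2 Lp_dist_2 vec[OF True] main
        using True by blast
  next
    case False
    then show ?thesis by (simp add: has_wiener_integral_atMost_def)
  qed
qed

end

section \<open>Measurability of processes\<close>

lemma borel_measurable_vecI:
  fixes f :: "'a \<Rightarrow> real ^ 'd"
  assumes "\<And>i. (\<lambda>x. f x $ i) \<in> borel_measurable M"
  shows "f \<in> borel_measurable M"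
  using assms by (intro borel_measurable_euclidean_space[THEN iffD2]) (auto simp: Basis_vec_def
    inner_axis)

lemma borel_measurable_component:
  fixes f :: "'a \<Rightarrow> ('b::euclidean_space) ^ 'd"
  assumes "f \<in> borel_measurable M"
  shows "(\<lambda>x. f x $ i) \<in> borel_measurable M"
  by (rule measurable_compose[OF assms]) (intro borel_measurable_continuous_onI continuous_intros)

lemma borel_measurable_matrix_vector:
  fixes f :: "'a \<Rightarrow> real ^ 'd ^ 'd" and g :: "'a \<Rightarrow> real ^ 'd"
  assumes "f \<in> borel_measurable M" "g \<in> borel_measurable M"
  shows "(\<lambda>x. f x *v g x) \<in> borel_measurable M"
  unfolding matrix_vector_mult_def
  by (intro borel_measurable_vecI)
     (simp, intro borel_measurable_sum borel_measurable_times borel_measurable_component assms)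

definition jointly_measurable :: "'w measure \<Rightarrow> (real \<Rightarrow> 'w \<Rightarrow> real ^ 'd) \<Rightarrow> bool" where
  "jointly_measurable M F \<longleftrightarrow> (\<lambda>p. F (fst p) (snd p)) \<in> borel_measurable (lborel \<Otimes>\<^sub>M M)"

text \<open>The value at time t is the limit of values at the grid point just below t. For each mesh
  only countably many times occur, so the approximation is measurable in both variables, as Fubini
  requires.\<close>

lemma continuous_process_jointly_measurable:
  fixes X :: "real \<Rightarrow> 'w \<Rightarrow> real ^ 'd"
  assumes X: "continuous_process M X"
  shows "jointly_measurable M X"
  unfolding jointly_measurable_def
proof (rule borel_measurable_LIMSEQ_metric)
  have [measurable]: "X t \<in> borel_measurable M" for t using X by (simp add: continuous_process_def)
  fix n :: nat
  show "(\<lambda>p. X (real_of_int \<lfloor>real (Suc n) * fst p\<rfloor> / real (Suc n)) (snd p)) \<in> borel_measurable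
    (lborel \<Otimes>\<^sub>M M)"
  proof (rule measurable_compose_countable[where g="\<lambda>p. \<lfloor>real (Suc n) * fst p\<rfloor>"
    and f="\<lambda>k p. X (real_of_int k / real (Suc n)) (snd p)"])
    show "(\<lambda>p. X (real_of_int k / real (Suc n)) (snd p)) \<in> borel_measurable (lborel \<Otimes>\<^sub>M M)" for k
      by measurable
    show "(\<lambda>p. \<lfloor>real (Suc n) * fst p\<rfloor>) \<in> measurable (lborel \<Otimes>\<^sub>M M) (count_space UNIV)" by measurable
  qed
next
  fix p :: "real \<times> 'w" assume "p \<in> space (lborel \<Otimes>\<^sub>M M)"
  then have "snd p \<in> space M" by (auto simp: space_pair_measure)
  then have c: "continuous_on UNIV (\<lambda>t. X t (snd p))" using X by (simp add: continuous_process_def)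
  have "(\<lambda>n. real_of_int \<lfloor>real (Suc n) * fst p\<rfloor> / real (Suc n)) \<longlonglongrightarrow> fst p"
  proof (rule LIMSEQ_I)
    fix e :: real assume "e > 0"
    then obtain N where N: "1 / real (Suc N) < e" by (meson nat_approx_posE)
    have "norm (real_of_int \<lfloor>real (Suc n) * fst p\<rfloor> / real (Suc n) - fst p) < e" if "n \<ge> N" for n
    proof -
      have "\<bar>real_of_int \<lfloor>real (Suc n) * fst p\<rfloor> - real (Suc n) * fst p\<bar> \<le> 1" by linarith
      then have "\<bar>real_of_int \<lfloor>real (Suc n) * fst p\<rfloor> - real (Suc n) * fst p\<bar> / real (Suc n)
        \<le> 1 / real (Suc n)"
        by (intro divide_right_mono) auto
      also have "\<dots> \<le> 1 / real (Suc N)" using that by (intro divide_left_mono) auto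
      also have "\<dots> < e" by (rule N)
      also have "\<bar>real_of_int \<lfloor>real (Suc n) * fst p\<rfloor> - real (Suc n) * fst p\<bar> / real (Suc n)
          = \<bar>real_of_int \<lfloor>real (Suc n) * fst p\<rfloor> / real (Suc n) - fst p\<bar>"
        by (subst abs_of_pos[of "real (Suc n)", symmetric], simp, subst abs_divide[symmetric])
           (simp add: diff_divide_distrib del: of_nat_Suc)
      finally show ?thesis by simp
    qed
    then show "\<exists>no. \<forall>n\<ge>no. norm (real_of_int \<lfloor>real (Suc n) * fst p\<rfloor> / real (Suc n) - fst p) < e"
      by blast
  qed
  then show "(\<lambda>n. X (real_of_int \<lfloor>real (Suc n) * fst p\<rfloor> / real (Suc n)) (snd p)) \<longlonglongrightarrow> X (fst p) (snd
    p)"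
    by (rule continuous_on_tendsto_compose[OF c]) auto
qed

lemma jointly_measurable_continuous:
  assumes X: "jointly_measurable M X" and b: "continuous_on UNIV (\<lambda>(t, x). b t x)"
  shows "jointly_measurable M (\<lambda>s \<omega>. b s (X s \<omega>))"
proof -
  have [measurable]: "(\<lambda>p. X (fst p) (snd p)) \<in> borel_measurable (lborel \<Otimes>\<^sub>M M)"
    using X by (simp add: jointly_measurable_def)
  have p: "(\<lambda>p. (fst p, X (fst p) (snd p))) \<in> borel_measurable (lborel \<Otimes>\<^sub>M M)" by measurable
  have "(\<lambda>p. (case (fst p, X (fst p) (snd p)) of (t, x) \<Rightarrow> b t x)) \<in> borel_measurable (lborel \<Otimes>\<^sub>M M)"
    by (rule measurable_compose[OF p borel_measurable_continuous_onI[OF b]])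
  then show ?thesis by (simp add: jointly_measurable_def)
qed

section \<open>Integrals of processes against exponential weights\<close>

text \<open>Cauchy--Schwarz for the measure \<open>k s ds\<close> of mass \<open>\<kappa>\<close>, then Fubini.\<close>

lemma nm_weighted_integral:
  fixes F G :: "real \<Rightarrow> 'w \<Rightarrow> real ^ 'd" and k :: "real \<Rightarrow> real"
  assumes M: "prob_space M" and F: "jointly_measurable M F" and G: "jointly_measurable M G"
    and k[measurable]: "k \<in> borel_measurable borel" and k0: "\<And>s. 0 \<le> k s"
    and \<kappa>: "(\<integral>\<^sup>+s. ennreal (k s) \<partial>lborel) = ennreal \<kappa>" and \<kappa>0: "0 \<le> \<kappa>"
    and FL: "\<And>s. L2 M (F s)" and FK: "\<And>s. nm M (F s) \<le> K"
    and GF: "\<And>s \<omega>. norm (G s \<omega>) \<le> k s * norm (F s \<omega>)"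
  shows "AE \<omega> in M. integrable lborel (\<lambda>s. G s \<omega>)"
    and "L2 M (\<lambda>\<omega>. \<integral>s. G s \<omega> \<partial>lborel)" and "nm M (\<lambda>\<omega>. \<integral>s. G s \<omega> \<partial>lborel) \<le> \<kappa> * K"
proof -
  interpret prob_space M by (rule M)
  interpret pair_sigma_finite lborel M ..
  interpret MP: pair_sigma_finite M lborel ..
  have [measurable]: "(\<lambda>p. F (fst p) (snd p)) \<in> borel_measurable (lborel \<Otimes>\<^sub>M M)"
    "(\<lambda>p. G (fst p) (snd p)) \<in> borel_measurable (lborel \<Otimes>\<^sub>M M)"
      using F G by (simp_all add: jointly_measurable_def)
  have Fsw: "(\<lambda>p. F (snd p) (fst p)) \<in> borel_measurable (M \<Otimes>\<^sub>M lborel)"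
    using measurable_pair_swap[of "\<lambda>p. F (fst p) (snd p)"] by (simp add: case_prod_unfold comp_def)
  have Gsw: "(\<lambda>p. G (snd p) (fst p)) \<in> borel_measurable (M \<Otimes>\<^sub>M lborel)"
    using measurable_pair_swap[of "\<lambda>p. G (fst p) (snd p)"] by (simp add: case_prod_unfold comp_def)
  have Fs[measurable]: "(\<lambda>s. F s \<omega>) \<in> borel_measurable lborel" "(\<lambda>s. G s \<omega>) \<in> borel_measurable
    lborel" if "\<omega> \<in> space M" for \<omega>
    using measurable_compose[OF measurable_Pair1'[OF that] Fsw] measurable_compose[OF
      measurable_Pair1'[OF that] Gsw] by simp_all
  note [measurable] = Fsw Gsw
  have K0: "0 \<le> K" using FK[of 0] nm_nonneg[of M "F 0"] by linarith
  \<comment> \<open>Integrability of G along a path is still open here, so the estimate is made for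
    this \<open>ennreal\<close> majorant and integrability is read off from its finiteness.\<close>
  define I where "I \<omega> = (\<integral>\<^sup>+s. ennreal (k s * norm (F s \<omega>)) \<partial>lborel)" for \<omega>
  have Im[measurable]: "I \<in> borel_measurable M" unfolding I_def
    by (rule sigma_finite_measure.borel_measurable_nn_integral_fst[OF sigma_finite_lborel, of "\<lambda>p.
      ennreal (k (snd p) * norm (F (snd p) (fst p)))", simplified]) measurable
  have CS: "(I \<omega>)\<^sup>2 \<le> ennreal \<kappa> * (\<integral>\<^sup>+s. ennreal (k s * (norm (F s \<omega>))\<^sup>2) \<partial>lborel)" if \<omega>: "\<omega> \<in> space
    M" for \<omega>
  proof -
    note [measurable] = Fs[OF \<omega>]
    have "I \<omega> = (\<integral>\<^sup>+s. ennreal (sqrt (k s)) * ennreal (sqrt (k s) * norm (F s \<omega>)) \<partial>lborel)"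
      unfolding I_def using k0 by (intro nn_integral_cong) (simp add: ennreal_mult'[symmetric]
        mult.assoc[symmetric])
    then have "(I \<omega>)\<^sup>2 \<le> (\<integral>\<^sup>+s. (ennreal (sqrt (k s)))\<^sup>2 \<partial>lborel) * (\<integral>\<^sup>+s. (ennreal (sqrt (k s) *
      norm (F s \<omega>)))\<^sup>2 \<partial>lborel)"
      using Cauchy_Schwarz_nn_integral[of "\<lambda>s. ennreal (sqrt (k s))" lborel "\<lambda>s. ennreal (sqrt (k s)
        * norm (F s \<omega>))"] by simp
    also have "(\<integral>\<^sup>+s. (ennreal (sqrt (k s)))\<^sup>2 \<partial>lborel) = ennreal \<kappa>"
      unfolding \<kappa>[symmetric] using k0 by (intro nn_integral_cong) (simp add: ennreal_power)
    also have "(\<integral>\<^sup>+s. (ennreal (sqrt (k s) * norm (F s \<omega>)))\<^sup>2 \<partial>lborel)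
      = (\<integral>\<^sup>+s. ennreal (k s * (norm (F s \<omega>))\<^sup>2) \<partial>lborel)"
      using k0 by (intro nn_integral_cong) (simp add: ennreal_power power_mult_distrib)
    finally show ?thesis .
  qed
  have "(\<integral>\<^sup>+\<omega>. \<integral>\<^sup>+s. ennreal (k s * (norm (F s \<omega>))\<^sup>2) \<partial>lborel \<partial>M)
    = (\<integral>\<^sup>+s. \<integral>\<^sup>+\<omega>. ennreal (k s * (norm (F s \<omega>))\<^sup>2) \<partial>M \<partial>lborel)"
    using Fubini'[of "\<lambda>s \<omega>. ennreal (k s * (norm (F s \<omega>))\<^sup>2)"] by (simp add: case_prod_unfold)
  also have "\<dots> \<le> (\<integral>\<^sup>+s. ennreal (k s) * ennreal (K\<^sup>2) \<partial>lborel)"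
  proof (rule nn_integral_mono)
    fix s :: real
    note [measurable] = L2_measurable[OF FL]
    have "(\<integral>\<^sup>+\<omega>. ennreal (k s * (norm (F s \<omega>))\<^sup>2) \<partial>M) = ennreal (k s) * ennreal ((nm M (F s))\<^sup>2)"
      using k0 by (simp add: ennreal_mult nn_integral_cmult nn_integral_L2[OF FL])
    also have "\<dots> \<le> ennreal (k s) * ennreal (K\<^sup>2)"
      using FK by (intro mult_left_mono ennreal_leI power_mono) auto
    finally show "(\<integral>\<^sup>+\<omega>. ennreal (k s * (norm (F s \<omega>))\<^sup>2) \<partial>M) \<le> ennreal (k s) * ennreal (K\<^sup>2)" .
  qed
  also have "\<dots> = ennreal \<kappa> * ennreal (K\<^sup>2)" by (simp add: nn_integral_multc \<kappa>)
  finally have dbl: "(\<integral>\<^sup>+\<omega>. \<integral>\<^sup>+s. ennreal (k s * (norm (F s \<omega>))\<^sup>2) \<partial>lborel \<partial>M)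
    \<le> ennreal \<kappa> * ennreal (K\<^sup>2)" .
  have "(\<integral>\<^sup>+\<omega>. (I \<omega>)\<^sup>2 \<partial>M) \<le> (\<integral>\<^sup>+\<omega>. ennreal \<kappa> * (\<integral>\<^sup>+s. ennreal (k s * (norm (F s \<omega>))\<^sup>2) \<partial>lborel)
    \<partial>M)"
    by (rule nn_integral_mono) (rule CS)
  also have "\<dots> = ennreal \<kappa> * (\<integral>\<^sup>+\<omega>. \<integral>\<^sup>+s. ennreal (k s * (norm (F s \<omega>))\<^sup>2) \<partial>lborel \<partial>M)"
    by (rule nn_integral_cmult) measurable
  also have "\<dots> \<le> ennreal \<kappa> * (ennreal \<kappa> * ennreal (K\<^sup>2))" by (rule mult_left_mono[OF dbl]) simp
  also have "\<dots> = ennreal ((\<kappa> * K)\<^sup>2)" using \<kappa>0 K0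
    by (simp add: ennreal_mult[symmetric] power2_eq_square mult_ac)
  finally have I2: "(\<integral>\<^sup>+\<omega>. (I \<omega>)\<^sup>2 \<partial>M) \<le> ennreal ((\<kappa> * K)\<^sup>2)" .
  then have "(\<integral>\<^sup>+\<omega>. (I \<omega>)\<^sup>2 \<partial>M) \<noteq> \<infinity>" by (auto simp: top_unique)
  then have "AE \<omega> in M. (I \<omega>)\<^sup>2 \<noteq> \<infinity>" by (intro nn_integral_noteq_infinite) measurable
  then have If: "AE \<omega> in M. I \<omega> < \<infinity>" by eventually_elim (auto simp: top.not_eq_extremum
    power2_eq_square ennreal_mult_eq_top_iff)
  have GI: "(\<integral>\<^sup>+s. ennreal (norm (G s \<omega>)) \<partial>lborel) \<le> I \<omega>" for \<omega>
    unfolding I_def by (intro nn_integral_mono ennreal_leI GF)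
  show "AE \<omega> in M. integrable lborel (\<lambda>s. G s \<omega>)"
    using If AE_space
  proof eventually_elim
    case (elim \<omega>)
    note [measurable] = Fs[OF elim(2)]
    show ?case by (rule integrableI_bounded) (use GI[of \<omega>] elim(1) in \<open>auto intro: le_less_trans\<close>)
  qed
  \<comment> \<open>The bound holds for every path, since the integral of a function that is not
    integrable has the value 0.\<close>
  have "ennreal ((norm (\<integral>s. G s \<omega> \<partial>lborel))\<^sup>2) \<le> (I \<omega>)\<^sup>2" for \<omega>
  proof (cases "integrable lborel (\<lambda>s. G s \<omega>)")
    case True
    have "ennreal (norm (\<integral>s. G s \<omega> \<partial>lborel)) \<le> I \<omega>"
      using integral_norm_bound_ennreal[OF True] GI[of \<omega>] by (rule order_trans)
    then show ?thesis by (simp add: ennreal_power[symmetric] power_mono)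
  qed (simp add: not_integrable_integral_eq)
  then have "(\<integral>\<^sup>+\<omega>. ennreal ((norm (\<integral>s. G s \<omega> \<partial>lborel))\<^sup>2) \<partial>M) \<le> (\<integral>\<^sup>+\<omega>. (I \<omega>)\<^sup>2 \<partial>M)"
    by (intro nn_integral_mono)
  then have le: "(\<integral>\<^sup>+\<omega>. ennreal ((norm (\<integral>s. G s \<omega> \<partial>lborel))\<^sup>2) \<partial>M) \<le> ennreal ((\<kappa> * K)\<^sup>2)"
    using I2 by (rule order_trans)
  have m: "(\<lambda>\<omega>. \<integral>s. G s \<omega> \<partial>lborel) \<in> borel_measurable M"
    by (rule sigma_finite_measure.borel_measurable_lebesgue_integral[OF sigma_finite_lborel]) (simp
      add: case_prod_unfold)
  show "L2 M (\<lambda>\<omega>. \<integral>s. G s \<omega> \<partial>lborel)" "nm M (\<lambda>\<omega>. \<integral>s. G s \<omega> \<partial>lborel) \<le> \<kappa> * K"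
    using L2I_nn[OF m le] \<kappa>0 K0 by auto
qed

text \<open>The reflection x = t - s turns the weight into c/m times the exponential density. The
  quotient of \<open>cS\<close> and \<open>mS\<close> in the contraction factor is this
  mass.\<close>

lemma nn_integral_exp_weight:
  assumes m: "m > 0" and c: "0 \<le> c"
  shows "(\<integral>\<^sup>+s. ennreal (indicator {..t} s * (c * exp (- m * (t - s)))) \<partial>lborel) = ennreal (c / m)"
proof -
  interpret E: prob_space "density lborel (exponential_density m)"
    by (rule prob_space_exponential_density[OF m])
  have one: "(\<integral>\<^sup>+x. ennreal (exponential_density m x) \<partial>lborel) = 1"
    using E.emeasure_space_1 by (simp add: emeasure_density)
  have "(\<integral>\<^sup>+s. ennreal (indicator {..t} s * (c * exp (- m * (t - s)))) \<partial>lborel)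
      = (\<integral>\<^sup>+x. ennreal (indicator {..t} (t + (-1) * x) * (c * exp (- m * (t - (t
        + (-1) * x))))) \<partial>lborel)"
    by (subst nn_integral_real_affine[where c="-1" and t=t]) auto
  also have "\<dots> = (\<integral>\<^sup>+x. ennreal (c / m) * ennreal (exponential_density m x) \<partial>lborel)"
    using m c by (intro nn_integral_cong) (auto simp: exponential_density_def
      ennreal_mult[symmetric] indicator_def mult.commute)
  also have "\<dots> = ennreal (c / m)" by (simp add: nn_integral_cmult one)
  finally show ?thesis .
qed

section \<open>The variation of constants formula\<close>

text \<open>Only the semigroup and the law are fixed. Drift and noise coefficient remain arguments,
  so that translated data and differences of data fall under the same lemmas.\<close>

locale mild_setting =
  fixes H cS mS :: real and A :: "real ^ 'd ^ 'd" and P :: "(real \<Rightarrow> real ^ 'd) measure"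
  assumes P: "fbm_law H P" and H: "1/2 < H" "H < 1" and cS: "0 < cS" and mS: "0 < mS"
    and S_le: "\<And>t. onorm ((*v) (matrix_exp (t *\<^sub>R A))) \<le> cS * exp (- mS * t)"
begin

abbreviation S :: "real \<Rightarrow> real ^ 'd ^ 'd" where "S t \<equiv> matrix_exp (t *\<^sub>R A)"

lemma continuous_S: "continuous_on UNIV (\<lambda>s. S (t - s))"
  by (rule continuous_on_compose2[OF continuous_matrix_exp]) (auto intro!: continuous_intros)

lemma norm_S_le: "norm (S t *v x) \<le> cS * exp (- mS * t) * norm x"
  using norm_matrix_vector_le[of "S t" x] mult_right_mono[OF S_le[of t] norm_ge_zero[of x]]
    by linarith

text \<open>F stands for the drift b(s, X(s)), but translates and differences of such drifts belong
  to the class too, although they are not of that form.\<close>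

definition adm :: "(real \<Rightarrow> (real \<Rightarrow> real ^ 'd) \<Rightarrow> real ^ 'd) \<Rightarrow> real \<Rightarrow> bool" where
  "adm F K \<longleftrightarrow> jointly_measurable P F \<and> (\<forall>s. L2 P (F s) \<and> nm P (F s) \<le> K)"

lemma admD:
  assumes "adm F K"
  shows "jointly_measurable P F" "L2 P (F s)" "nm P (F s) \<le> K" "0 \<le> K"
  using assms order_trans[OF nm_nonneg] unfolding adm_def by blast+

definition conv :: "(real \<Rightarrow> (real \<Rightarrow> real ^ 'd) \<Rightarrow> real ^ 'd) \<Rightarrow> real \<Rightarrow> (real \<Rightarrow> real ^ 'd) \<Rightarrow> real ^ 'd"
  where
  "conv F t \<omega> = (LINT s:{..t}|lborel. S (t - s) *v F s \<omega>)"

lemma jointly_measurable_kernel: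
  assumes F: "jointly_measurable P F" and I: "I \<in> sets borel"
  shows "jointly_measurable P (\<lambda>s \<omega>. indicator I s *\<^sub>R (S (t - s) *v F s \<omega>))"
proof -
  have "(\<lambda>s. S (t - s)) \<in> borel_measurable borel"
    by (intro borel_measurable_continuous_onI continuous_S)
  then have "(\<lambda>p. S (t - fst p)) \<in> borel_measurable (lborel \<Otimes>\<^sub>M P)"
    by (rule measurable_compose[rotated]) measurable
  then have [measurable]: "(\<lambda>p. S (t - fst p) *v F (fst p) (snd p)) \<in> borel_measurable (lborel \<Otimes>\<^sub>M
    P)"
    using F unfolding jointly_measurable_def by (rule borel_measurable_matrix_vector)
  note [measurable] = I
  show ?thesis unfolding jointly_measurable_def by measurable
qed

lemma conv_L2:
  assumes F: "adm F K"
  shows "AE \<omega> in P. set_integrable lborel {..t} (\<lambda>s. S (t - s) *v F s \<omega>)"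
    and "L2 P (conv F t)" and "nm P (conv F t) \<le> cS / mS * K"
proof -
  have "AE \<omega> in P. integrable lborel (\<lambda>s. indicator {..t} s *\<^sub>R (S (t - s) *v F s \<omega>))"
    "L2 P (\<lambda>\<omega>. \<integral>s. indicator {..t} s *\<^sub>R (S (t - s) *v F s \<omega>) \<partial>lborel)"
    "nm P (\<lambda>\<omega>. \<integral>s. indicator {..t} s *\<^sub>R (S (t - s) *v F s \<omega>) \<partial>lborel) \<le> cS / mS * K"
    by (rule nm_weighted_integral[OF prob_P[OF P] admD(1)[OF F] jointly_measurable_kernel[OF
      admD(1)[OF F]],
          where k="\<lambda>s. indicator {..t} s * (cS * exp (- mS * (t - s)))" and \<kappa>="cS / mS" and K=K];
        use cS mS admD(2,3)[OF F] norm_S_le nn_integral_exp_weight[OF mS, of cS t] in \<open>auto simp: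
          indicator_def\<close>)+
  then show "AE \<omega> in P. set_integrable lborel {..t} (\<lambda>s. S (t
    - s) *v F s \<omega>)" "L2 P (conv F t)" "nm P (conv F t) \<le> cS / mS * K"
    by (simp_all add: set_integrable_def conv_def[abs_def] set_lebesgue_integral_def)
qed

lemma adm_diff:
  assumes F: "adm F K" and G: "adm G K'" and le: "\<And>s. nm P (\<lambda>\<omega>. F s \<omega> - G s \<omega>) \<le> L"
  shows "adm (\<lambda>s \<omega>. F s \<omega> - G s \<omega>) L"
  using admD(1)[OF F] admD(1)[OF G] le L2_diff(1)[OF admD(2)[OF F] admD(2)[OF G]]
  unfolding adm_def jointly_measurable_def by simp

lemma conv_diff:
  assumes F: "adm F K" and G: "adm G K'"
  shows "AE \<omega> in P. conv F t \<omega> - conv G t \<omega> = conv (\<lambda>s \<omega>. F s \<omega> - G s \<omega>) t \<omega>"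
  using conv_L2(1)[OF F, of t] conv_L2(1)[OF G, of t]
proof eventually_elim
  case (elim \<omega>)
  show ?case unfolding conv_def matrix_vector_mult_diff_distrib set_integral_diff(2)[OF elim] ..
qed

text \<open>The semigroup law cancels the integral over the past, and on ]s, t] the kernel is
  bounded by \<open>cS\<close>.\<close>

lemma conv_step:
  assumes F: "adm F K" and st: "s \<le> t"
  shows "nm P (\<lambda>\<omega>. conv F t \<omega> - S (t - s) *v conv F s \<omega>) \<le> cS * (t - s) * K"
proof -
  \<comment> \<open>Half-open at s, so that this interval and \<open>{..s}\<close> form a disjoint
    decomposition of \<open>{..t}\<close>.\<close>
  let ?g = "\<lambda>\<omega>. \<integral>u. indicator {s<..t} u *\<^sub>R (S (t - u) *v F u \<omega>) \<partial>lborel"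
  let ?k = "\<lambda>u. indicator {s<..t} u * cS"
  have km: "?k \<in> borel_measurable borel" by measurable
  have k0: "0 \<le> ?k u" for u using cS by simp
  have "(\<integral>\<^sup>+u. ennreal (?k u) \<partial>lborel) = (\<integral>\<^sup>+u. ennreal cS * indicator {s<..t} u \<partial>lborel)"
    by (intro nn_integral_cong) (auto simp: indicator_def)
  also have "\<dots> = ennreal (cS * (t - s))" using st cS
    by (simp add: nn_integral_cmult_indicator ennreal_mult)
  finally have k: "(\<integral>\<^sup>+u. ennreal (?k u) \<partial>lborel) = ennreal (cS * (t - s))" .
  have c0: "0 \<le> cS * (t - s)" using cS st by simp
  have "norm (S (t - u) *v x) \<le> cS * norm x" if "u \<le> t" for u and x :: "real ^ 'd"
  proof -
    have "cS * exp (- mS * (t - u)) * norm x \<le> cS * 1 * norm x"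
      using cS mS that by (intro mult_right_mono mult_left_mono) (auto simp: mult_nonneg_nonneg)
    then show ?thesis using norm_S_le[of "t - u" x] by simp
  qed
  then have GF: "norm (indicator {s<..t} u *\<^sub>R (S (t - u) *v F u \<omega>)) \<le> ?k u * norm (F u \<omega>)" for u \<omega>
    by (auto simp: indicator_def)
  note W = nm_weighted_integral[OF prob_P[OF P] admD(1)[OF F] jointly_measurable_kernel[OF
    admD(1)[OF F]]
      km k0 k c0 admD(2)[OF F] admD(3)[OF F] GF]
  have g: "AE \<omega> in P. integrable lborel (\<lambda>u. indicator {s<..t} u *\<^sub>R (S (t
    - u) *v F u \<omega>))" "L2 P ?g" "nm P ?g \<le> (cS * (t - s)) * K"
    using W by auto
  have "AE \<omega> in P. conv F t \<omega> - S (t - s) *v conv F s \<omega> = ?g \<omega>"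
    using conv_L2(1)[OF F, of s] g(1)
  proof eventually_elim
    case (elim \<omega>)
    have lin: "bounded_linear ((*v) (S (t - s)))" by (rule matrix_vector_mul_bounded_linear)
    have SS: "S (t - u) = S (t - s) ** S (s - u)" for u
      using matrix_exp_add[of "t - s" "s - u" A] by simp
    have e1: "integrable lborel (\<lambda>u. indicator {..s} u *\<^sub>R (S (t - u) *v F u \<omega>))"
      and e2: "(\<integral>u. indicator {..s} u *\<^sub>R (S (t - u) *v F u \<omega>) \<partial>lborel) = S (t - s) *v conv F s \<omega>"
    proof -
      have eq: "(\<lambda>u. indicator {..s} u *\<^sub>R (S (t - u) *v F u \<omega>))
        = (\<lambda>u. S (t - s) *v (indicator {..s} u *\<^sub>R (S (s - u) *v F u \<omega>)))"
      proof (rule ext)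
        fix u
        have "S (t - u) *v F u \<omega> = S (t - s) *v (S (s - u) *v F u \<omega>)"
          unfolding matrix_vector_mul_assoc SS[of u, symmetric] ..
        then show "indicator {..s} u *\<^sub>R (S (t - u) *v F u \<omega>)
          = S (t - s) *v (indicator {..s} u *\<^sub>R (S (s - u) *v F u \<omega>))"
          by (simp only: matrix_vector_mult_scaleR)
      qed
      note i = elim(1)[unfolded set_integrable_def]
      show "integrable lborel (\<lambda>u. indicator {..s} u *\<^sub>R (S (t - u) *v F u \<omega>))"
        unfolding eq by (rule integrable_bounded_linear[OF lin i])
      show "(\<integral>u. indicator {..s} u *\<^sub>R (S (t - u) *v F u \<omega>) \<partial>lborel) = S (t - s) *v conv F s \<omega>"
        unfolding eq conv_def set_lebesgue_integral_def by (rule integral_bounded_linear[OF lin i])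
    qed
    have "conv F t \<omega> = (\<integral>u. indicator {..s} u *\<^sub>R (S (t - u) *v F u \<omega>)
      + indicator {s<..t} u *\<^sub>R (S (t - u) *v F u \<omega>) \<partial>lborel)"
      unfolding conv_def set_lebesgue_integral_def
        using st by (intro Bochner_Integration.integral_cong refl) (auto simp: indicator_def)
    also have "\<dots> = S (t - s) *v conv F s \<omega> + ?g \<omega>"
      unfolding Bochner_Integration.integral_add[OF e1 elim(2)] e2 ..
    finally show ?case by simp
  qed
  then have "nm P (\<lambda>\<omega>. conv F t \<omega> - S (t - s) *v conv F s \<omega>) = nm P ?g"
    by (rule nm_cong_AE) (intro L2_measurable L2_diff L2_matrix conv_L2(2)[OF F] g(2))+
  then show ?thesis using g(3) by simp
qed

text \<open>The kernel depends on t - s alone, so a substitution moves the translation from the time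
  to F.\<close>

lemma conv_shift:
  "conv F (t + \<tau>) (wiener_shift (-\<tau>) \<omega>) = conv (\<lambda>s \<omega>. F (s + \<tau>) (wiener_shift (-\<tau>) \<omega>)) t \<omega>"
proof -
  let ?f = "\<lambda>s. indicator {..t + \<tau>} s *\<^sub>R (S (t + \<tau> - s) *v F s (wiener_shift (-\<tau>) \<omega>))"
  have "(\<integral>s. ?f s \<partial>lborel) = (\<integral>s. ?f (\<tau> + 1 * s) \<partial>lborel)"
    using lborel_integral_real_affine[of 1 ?f \<tau>] by simp
  also have "\<dots> = (\<integral>s. indicator {..t} s *\<^sub>R (S (t - s) *v F (s + \<tau>) (wiener_shift (-\<tau>) \<omega>)) \<partial>lborel)"
    by (intro Bochner_Integration.integral_cong refl) (auto simp: indicator_def add.commute)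
  finally show ?thesis by (simp add: conv_def set_lebesgue_integral_def)
qed

section \<open>The noise term and the sum of drift and noise\<close>

definition noise_coeff :: "real" where
  "noise_coeff = cS * (real CARD('d) * real CARD('d))"

lemma noise_coeff_nonneg: "0 \<le> noise_coeff" using cS by (simp add: noise_coeff_def)

lemma noise_entry_le:
  fixes \<sigma> :: "real \<Rightarrow> real ^ 'd ^ 'd"
  assumes "norm (\<sigma> u) \<le> B"
  shows "\<bar>(S (t - u) ** \<sigma> u) $ i $ j\<bar> \<le> noise_coeff * B * exp (- mS * (t - u))"
  using abs_le_onorm_mult[OF S_le[of "t - u"] assms, of i j] by (simp add: noise_coeff_def mult_ac)

lemma noise_continuous:
  fixes \<sigma> :: "real \<Rightarrow> real ^ 'd ^ 'd"
  shows "continuous_on UNIV \<sigma> \<Longrightarrow> continuous_on UNIV (\<lambda>u. S (t - u) ** \<sigma> u)"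
  by (intro continuous_matrix_mult[OF P H(1)] continuous_S)

lemma noise_decaying:
  fixes \<sigma> :: "real \<Rightarrow> real ^ 'd ^ 'd"
  assumes "continuous_on UNIV \<sigma>" "\<And>u. norm (\<sigma> u) \<le> B"
  shows "decaying (\<lambda>u. S (t - u) ** \<sigma> u) t mS (noise_coeff * B)"
  unfolding decaying_def[OF P H(1)]
  by (intro conjI allI impI noise_continuous[OF assms(1)] noise_entry_le assms(2))

definition bnd_cont :: "(real \<Rightarrow> real ^ 'd ^ 'd) \<Rightarrow> real \<Rightarrow> bool" where
  "bnd_cont \<sigma> B \<longleftrightarrow> continuous_on UNIV \<sigma> \<and> (\<forall>u. norm (\<sigma> u) \<le> B)"

text \<open>Y is, at the single time t, a version of drift plus noise. A relation is used because
  the noise is determined up to a null set, and each time may have its own version until continuous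
  paths are produced.\<close>

definition rep :: "(real \<Rightarrow> (real \<Rightarrow> real ^ 'd) \<Rightarrow> real ^ 'd) \<Rightarrow> (real \<Rightarrow> real ^ 'd ^ 'd) \<Rightarrow> real
    \<Rightarrow> ((real \<Rightarrow> real ^ 'd) \<Rightarrow> real ^ 'd) \<Rightarrow> bool" where
  "rep F \<sigma> t Y \<longleftrightarrow> Y \<in> borel_measurable P \<and>
     (\<exists>J. wintU P (\<lambda>u. S (t - u) ** \<sigma> u) t J \<and> (AE \<omega> in P. Y \<omega> = conv F t \<omega> + J \<omega>))"

lemma repE:
  assumes "rep F \<sigma> t Y"
  obtains J where "Y \<in> borel_measurable P" "wintU P (\<lambda>u. S (t
    - u) ** \<sigma> u) t J" "L2 P J" "AE \<omega> in P. Y \<omega> = conv F t \<omega> + J \<omega>"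
  using assms wintUD(2)[OF P H(1)] unfolding rep_def by blast

lemma rep_exists:
  assumes F: "adm F K" and \<sigma>: "bnd_cont \<sigma> B"
  obtains Y where "rep F \<sigma> t Y"
proof -
  obtain J where J: "wintU P (\<lambda>u. S (t - u) ** \<sigma> u) t J"
    using wintU_exists[OF P H(1) mS noise_decaying, of \<sigma> B] \<sigma> unfolding bnd_cont_def by blast
  have "rep F \<sigma> t (\<lambda>\<omega>. conv F t \<omega> + J \<omega>)"
    unfolding rep_def
  proof (intro conjI exI)
    show "(\<lambda>\<omega>. conv F t \<omega> + J \<omega>) \<in> borel_measurable P"
      by (intro L2_measurable L2_add conv_L2(2)[OF F] wintUD(2)[OF P H(1) J])
  qed (use J in auto)
  then show ?thesis by (rule that)
qed

definition noise_const :: real where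
  "noise_const = decay_const TYPE('d) mS * noise_coeff"

lemma noise_const_nonneg: "0 \<le> noise_const"
  unfolding noise_const_def by (intro mult_nonneg_nonneg noise_coeff_nonneg decay_const_nonneg[OF P
    H(1) mS])

lemma nm_noise_le:
  assumes J: "wintU P (\<lambda>u. S (t - u) ** \<sigma> u) t J" and \<sigma>: "bnd_cont \<sigma> B"
  shows "nm P J \<le> noise_const * B"
  using nm_wintU_le[OF P H(1) J mS noise_decaying[of \<sigma> B]] \<sigma>
    by (simp add: noise_const_def bnd_cont_def mult.assoc)

lemma rep_L2:
  assumes F: "adm F K" and \<sigma>: "bnd_cont \<sigma> B" and Y: "rep F \<sigma> t Y"
  shows "L2 P Y" "nm P Y \<le> cS / mS * K + noise_const * B"
proof -
  obtain J where J: "Y \<in> borel_measurable P" "wintU P (\<lambda>u. S (t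
    - u) ** \<sigma> u) t J" "L2 P J" "AE \<omega> in P. Y \<omega> = conv F t \<omega> + J \<omega>"
    using repE[OF Y] by blast
  note L = L2_add(1)[OF conv_L2(2)[OF F, of t] J(3)]
  show "L2 P Y" using L2_cong_AE[OF L J(1) J(4)] .
  have "nm P Y = nm P (\<lambda>\<omega>. conv F t \<omega> + J \<omega>)" by (rule nm_cong_AE[OF J(4) J(1) L2_measurable[OF L]])
  also have "\<dots> \<le> nm P (conv F t) + nm P J" by (rule nm_triangle[OF conv_L2(2)[OF F] J(3)])
  also have "\<dots> \<le> cS / mS * K + noise_const * B"
    by (intro add_mono conv_L2(3)[OF F] nm_noise_le[OF J(2) \<sigma>])
  finally show "nm P Y \<le> cS / mS * K + noise_const * B" .
qed

text \<open>The formula is linear in the pair of drift and noise coefficient, so the difference is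
  represented by the differences of the data and \<open>rep_L2\<close> bounds it. Used with equal
  noise it gives the contraction, with translated data the almost periods.\<close>

lemma rep_diff:
  assumes F: "adm F K" "adm F' K'" and \<sigma>: "bnd_cont \<sigma> B" "bnd_cont \<sigma>' B'"
    and Y: "rep F \<sigma> t Y" "rep F' \<sigma>' t Y'"
    and L: "\<And>s. nm P (\<lambda>\<omega>. F s \<omega> - F' s \<omega>) \<le> L" and b: "\<And>u. norm (\<sigma> u - \<sigma>' u) \<le> b"
  shows "nm P (\<lambda>\<omega>. Y \<omega> - Y' \<omega>) \<le> cS / mS * L + noise_const * b"
proof -
  obtain J where J: "Y \<in> borel_measurable P" "wintU P (\<lambda>u. S (t
    - u) ** \<sigma> u) t J" "L2 P J" "AE \<omega> in P. Y \<omega> = conv F t \<omega> + J \<omega>"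
    using repE[OF Y(1)] by blast
  obtain J' where J': "Y' \<in> borel_measurable P" "wintU P (\<lambda>u. S (t
    - u) ** \<sigma>' u) t J'" "L2 P J'" "AE \<omega> in P. Y' \<omega> = conv F' t \<omega> + J' \<omega>"
    using repE[OF Y(2)] by blast
  note D = adm_diff[OF F L]
  have h: "(\<lambda>u. S (t - u) ** \<sigma> u + (-1) *\<^sub>R (S (t - u) ** \<sigma>' u)) = (\<lambda>u. S (t - u) ** (\<sigma> u - \<sigma>' u))"
    by (simp add: fun_eq_iff vec_eq_iff matrix_matrix_mult_def sum_subtractf[symmetric]
      right_diff_distrib)
  have "wintU P (\<lambda>u. S (t - u) ** (\<sigma> u - \<sigma>' u)) t (\<lambda>\<omega>. J \<omega> + (-1) *\<^sub>R J' \<omega>)"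
    using wintU_add[OF P H(1) J(2) J'(2), of "-1"] unfolding h .
  then have W: "wintU P (\<lambda>u. S (t - u) ** (\<sigma> u - \<sigma>' u)) t (\<lambda>\<omega>. J \<omega> - J' \<omega>)" by simp
  have bc: "bnd_cont (\<lambda>u. \<sigma> u - \<sigma>' u) b" using \<sigma> b
    by (auto simp: bnd_cont_def intro!: continuous_intros)
  have "rep (\<lambda>s \<omega>. F s \<omega> - F' s \<omega>) (\<lambda>u. \<sigma> u - \<sigma>' u) t (\<lambda>\<omega>. Y \<omega> - Y' \<omega>)"
    unfolding rep_def
  proof (intro conjI exI[of _ "\<lambda>\<omega>. J \<omega> - J' \<omega>"] W)
    show "(\<lambda>\<omega>. Y \<omega> - Y' \<omega>) \<in> borel_measurable P" using J(1) J'(1) by measurable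
    show "AE \<omega> in P. Y \<omega> - Y' \<omega> = conv (\<lambda>s \<omega>. F s \<omega> - F' s \<omega>) t \<omega> + (J \<omega> - J' \<omega>)"
      using J(4) J'(4) conv_diff[OF F, of t] by eventually_elim (simp add: algebra_simps)
  qed
  then show ?thesis by (rule rep_L2(2)[OF D bc])
qed

lemma adm_shift:
  assumes F: "adm F K"
  shows "adm (\<lambda>s \<omega>. F (s + \<tau>) (wiener_shift (-\<tau>) \<omega>)) K"
  unfolding adm_def
proof (intro conjI allI)
  have m: "(\<lambda>p. (fst p + \<tau>, wiener_shift (-\<tau>) (snd p))) \<in> measurable (lborel \<Otimes>\<^sub>M P) (lborel \<Otimes>\<^sub>M P)"
    using wiener_shift_measurable[OF P, of "-\<tau>"] by measurable
  show "jointly_measurable P (\<lambda>s \<omega>. F (s + \<tau>) (wiener_shift (-\<tau>) \<omega>))"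
    using measurable_compose[OF m admD(1)[OF F, unfolded jointly_measurable_def]]
      by (simp add: jointly_measurable_def)
  show "L2 P (\<lambda>\<omega>. F (s + \<tau>) (wiener_shift (-\<tau>) \<omega>))" for s
    by (rule L2_wiener_shift(1)[OF P admD(2)[OF F]])
  show "nm P (\<lambda>\<omega>. F (s + \<tau>) (wiener_shift (-\<tau>) \<omega>)) \<le> K" for s
    using L2_wiener_shift(2)[OF P admD(2)[OF F]] admD(3)[OF F] by simp
qed

lemma rep_shift:
  assumes Y: "rep F \<sigma> (t + \<tau>) Y"
  shows "rep (\<lambda>s \<omega>. F (s + \<tau>) (wiener_shift (-\<tau>) \<omega>)) (\<lambda>u. \<sigma> (u
    + \<tau>)) t (\<lambda>\<omega>. Y (wiener_shift (-\<tau>) \<omega>))"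
proof -
  obtain J where J: "Y \<in> borel_measurable P" "wintU P (\<lambda>u. S (t + \<tau> - u) ** \<sigma> u) (t + \<tau>) J" "L2 P J"
      "AE \<omega> in P. Y \<omega> = conv F (t + \<tau>) \<omega> + J \<omega>"
    using repE[OF Y] by blast
  show ?thesis unfolding rep_def
  proof (intro conjI exI[of _ "\<lambda>\<omega>. J (wiener_shift (-\<tau>) \<omega>)"])
    show "(\<lambda>\<omega>. Y (wiener_shift (-\<tau>) \<omega>)) \<in> borel_measurable P"
      by (rule measurable_compose[OF wiener_shift_measurable[OF P] J(1)])
    show "wintU P (\<lambda>u. S (t - u) ** \<sigma> (u + \<tau>)) t (\<lambda>\<omega>. J (wiener_shift (-\<tau>) \<omega>))"
      using wintU_shift[OF P H(1) J(2)] by simp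
    show "AE \<omega> in P. Y (wiener_shift (-\<tau>) \<omega>) = conv (\<lambda>s \<omega>. F (s + \<tau>) (wiener_shift (-\<tau>) \<omega>)) t \<omega>
      + J (wiener_shift (-\<tau>) \<omega>)"
      using AE_wiener_shift[OF P J(4), of "-\<tau>"] by (simp add: conv_shift)
  qed
qed

text \<open>The constant is chosen before F, \<open>\<sigma>\<close> and the times, hence depends on
  the bounds K and B only. The sign of C is asserted under the hypotheses, because negative K or B
  admit no data and could make the expression negative.\<close>

lemma rep_Hoelder:
  "\<exists>C. \<forall>F \<sigma> s t Y Z. adm F K \<longrightarrow> bnd_cont \<sigma> B \<longrightarrow> rep F \<sigma> s Y \<longrightarrow> rep F \<sigma> t Z \<longrightarrow> s \<le> t \<longrightarrow> t - s \<le> 1 \<longrightarrow>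
     0 \<le> C \<and> nm P (\<lambda>\<omega>. Z \<omega> - Y \<omega>) \<le> C * (t - s) powr H"
proof -
  obtain L where L: "0 \<le> L" "\<And>h. 0 \<le> h \<Longrightarrow> h \<le> 1 \<Longrightarrow> onorm ((*v) (S h - mat 1)) \<le> L * h"
    using matrix_exp_Lipschitz[of A] by blast
  let ?Y = "cS / mS * K + noise_const * B" and ?D = "real CARD('d) * real CARD('d)"
  let ?C = "L * ?Y + cS * K + ?D * (noise_coeff * B)"
  have "0 \<le> ?C \<and> nm P (\<lambda>\<omega>. Z \<omega> - Y \<omega>) \<le> ?C * (t - s) powr H"
    if F: "adm F K" and \<sigma>: "bnd_cont \<sigma> B" and Y: "rep F \<sigma> s Y" and Z: "rep F \<sigma> t Z"
      and st: "s \<le> t" "t - s \<le> 1" for F \<sigma> s t Y Z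
  proof
    obtain J where J: "Y \<in> borel_measurable P" "wintU P (\<lambda>u. S (s
      - u) ** \<sigma> u) s J" "L2 P J" "AE \<omega> in P. Y \<omega> = conv F s \<omega> + J \<omega>"
      using repE[OF Y] by blast
    obtain J' where J': "Z \<in> borel_measurable P" "wintU P (\<lambda>u. S (t
      - u) ** \<sigma> u) t J'" "L2 P J'" "AE \<omega> in P. Z \<omega> = conv F t \<omega> + J' \<omega>"
      using repE[OF Z] by blast
    have SS: "S (t - s) ** (S (s - u) ** \<sigma> u) = S (t - u) ** \<sigma> u" for u
      using matrix_exp_add[of "t - s" "s - u" A] by (simp add: matrix_mul_assoc)
    have c: "continuous_on UNIV (\<lambda>u. S (t - u) ** \<sigma> u)"
      using \<sigma> by (intro noise_continuous) (simp add: bnd_cont_def)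
    obtain W where W: "wint P (\<lambda>u. S (t - u) ** \<sigma> u) s t W"
      using wint_exists'[OF P H(1) c st(1)] by blast
    \<comment> \<open>J' and the decomposed integral are versions of the same half-line integral, so
      they agree almost surely.\<close>
    have "wintU P (\<lambda>u. S (t - s) ** (S (s - u) ** \<sigma> u)) t (\<lambda>\<omega>. S (t - s) *v J \<omega> + W \<omega>)"
      by (rule wintU_matrix_concat[OF P H(1) J(2)]) (simp only: SS W)
    then have J'eq: "AE \<omega> in P. J' \<omega> = S (t - s) *v J \<omega> + W \<omega>"
      unfolding SS by (rule wintU_unique[OF P H(1) J'(2)])
    have B: "0 \<le> B" using \<sigma> norm_ge_zero order_trans unfolding bnd_cont_def by blast
    have K: "0 \<le> K" by (rule admD(4)[OF F])
    have LW: "L2 P W" by (rule wint_L2(1)[OF P H(1) W])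
    have nW: "nm P W \<le> ?D * (noise_coeff * B * (t - s) powr H)"
    proof (rule nm_wint_le[OF P H(1) W])
      fix u i j assume u: "u \<in> {s..t}"
      have "\<bar>(S (t - u) ** \<sigma> u) $ i $ j\<bar> \<le> noise_coeff * B * exp (- mS * (t - u))"
        using \<sigma> by (intro noise_entry_le) (simp add: bnd_cont_def)
      also have "\<dots> \<le> noise_coeff * B * 1" using u mS B noise_coeff_nonneg
        by (intro mult_left_mono) (auto simp: mult_nonneg_nonneg)
      finally show "\<bar>(S (t - u) ** \<sigma> u) $ i $ j\<bar> \<le> noise_coeff * B" by simp
    qed
    define V where "V \<omega> = conv F t \<omega> - S (t - s) *v conv F s \<omega>" for \<omega>
    note LF = conv_L2(2)[OF F]
    have LV: "L2 P V" unfolding V_def by (intro L2_diff L2_matrix LF)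
    have nV: "nm P V \<le> cS * (t - s) * K" unfolding V_def by (rule conv_step[OF F st(1)])
    note LY = rep_L2[OF F \<sigma> Y]
    let ?S = "S (t - s) - mat 1"
    have "nm P (\<lambda>\<omega>. Z \<omega> - Y \<omega>) = nm P (\<lambda>\<omega>. ?S *v Y \<omega> + (V \<omega> + W \<omega>))"
    proof (rule nm_cong_AE)
      show "AE \<omega> in P. Z \<omega> - Y \<omega> = ?S *v Y \<omega> + (V \<omega> + W \<omega>)"
        using J(4) J'(4) J'eq
        by eventually_elim (simp add: V_def matrix_vector_mult_diff_rdistrib
          matrix_vector_right_distrib)
      show "(\<lambda>\<omega>. Z \<omega> - Y \<omega>) \<in> borel_measurable P" using J(1) J'(1) by measurable
      show "(\<lambda>\<omega>. ?S *v Y \<omega> + (V \<omega> + W \<omega>)) \<in> borel_measurable P"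
        by (intro L2_measurable L2_add L2_matrix LY LV LW)
    qed
    also have "\<dots> \<le> nm P (\<lambda>\<omega>. ?S *v Y \<omega>) + (nm P V + nm P W)"
      using nm_triangle[OF L2_matrix(1)[OF LY(1)] L2_add(1)[OF LV LW], of ?S] nm_triangle[OF LV LW]
        by linarith
    also have "\<dots> \<le> L * (t - s) powr H * ?Y + (cS * (t - s) powr H * K
      + ?D * (noise_coeff * B * (t - s) powr H))"
    proof -
      \<comment> \<open>For lengths up to 1 the linear contributions are absorbed by the power H <
        1.\<close>
      have h: "t - s \<le> (t - s) powr H"
      proof (cases "t = s")
        case False
        then have "(t - s) powr 1 \<le> (t - s) powr H" using st H by (intro powr_mono') auto
        then show ?thesis using st False by simp
      qed simp
      have "nm P (\<lambda>\<omega>. ?S *v Y \<omega>) \<le> onorm ((*v) ?S) * nm P Y" by (rule L2_matrix(2)[OF LY(1)])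
      also have "\<dots> \<le> (L * (t - s) powr H) * ?Y"
      proof (intro mult_mono LY(2))
        have "onorm ((*v) ?S) \<le> L * (t - s)" using L(2)[of "t - s"] st by simp
        also have "\<dots> \<le> L * (t - s) powr H" using h L(1) by (rule mult_left_mono)
        finally show "onorm ((*v) ?S) \<le> L * (t - s) powr H" .
      qed (use L(1) in auto)
      finally have 1: "nm P (\<lambda>\<omega>. ?S *v Y \<omega>) \<le> L * (t - s) powr H * ?Y" .
      have "cS * (t - s) * K \<le> cS * (t - s) powr H * K"
        using h cS K by (intro mult_right_mono mult_left_mono) auto
      then show ?thesis using 1 nV nW by linarith
    qed
    also have "\<dots> = ?C * (t - s) powr H" by (simp add: algebra_simps)
    finally show "nm P (\<lambda>\<omega>. Z \<omega> - Y \<omega>) \<le> ?C * (t - s) powr H" .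
    have "0 \<le> ?Y" using rep_L2(2)[OF F \<sigma> Y] order_trans[OF nm_nonneg] by blast
    then have "0 \<le> L * ?Y" by (rule mult_nonneg_nonneg[OF L(1)])
    moreover have "0 \<le> cS * K" "0 \<le> ?D * (noise_coeff * B)"
      using cS K B noise_coeff_nonneg by simp_all
    ultimately show "0 \<le> ?C" by linarith
  qed
  then show ?thesis by blast
qed

end

section \<open>Almost periodic processes\<close>

lemma wiener_shift_add: "wiener_shift s (wiener_shift t \<omega>) = wiener_shift (s + t) \<omega>"
  by (simp add: wiener_shift_def fun_eq_iff algebra_simps)

lemma wiener_shift_0: "\<omega> \<in> path_space \<Longrightarrow> wiener_shift 0 \<omega> = \<omega>"
  by (simp add: wiener_shift_def path_space_def)

lemma AP_2_iff:
  "X \<in> AP P 2 \<longleftrightarrow> continuous_process P X \<and> (\<forall>t. L2 P (X t)) \<and> (\<exists>K. \<forall>t. nm P (X t) \<le> K) \<and>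
    (\<forall>t0 \<tau>0. ((\<lambda>(t, \<tau>). nm P (\<lambda>\<omega>. shift_process \<tau> X t \<omega>
      - shift_process \<tau>0 X t0 \<omega>)) \<longlongrightarrow> 0) (at (t0, \<tau>0))) \<and>
    (\<forall>\<epsilon>>0. relatively_dense {\<tau>. \<forall>t. nm P (\<lambda>\<omega>. shift_process \<tau> X t \<omega> - X t \<omega>) \<le> \<epsilon>})"
proof -
  have eq: "(\<integral>\<omega>. norm (X t \<omega>) powr 2 \<partial>P) = (nm P (X t))\<^sup>2" for t
    by (simp add: nm_sq powr_2)
  have B: "bdd_above (range (\<lambda>t. \<integral>\<omega>. norm (X t \<omega>) powr 2 \<partial>P)) \<longleftrightarrow> (\<exists>K. \<forall>t. nm P (X t) \<le> K)"
    unfolding eq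
  proof
    assume "bdd_above (range (\<lambda>t. (nm P (X t))\<^sup>2))"
    then obtain K where "\<And>t. (nm P (X t))\<^sup>2 \<le> K" by (auto simp: bdd_above_def)
    then show "\<exists>K. \<forall>t. nm P (X t) \<le> K" by (intro exI[of _ "sqrt K"] allI real_le_rsqrt)
  next
    assume "\<exists>K. \<forall>t. nm P (X t) \<le> K"
    then obtain K where "\<And>t. nm P (X t) \<le> K" by blast
    then show "bdd_above (range (\<lambda>t. (nm P (X t))\<^sup>2))"
      by (intro bdd_aboveI[of _ "K\<^sup>2"]) (auto intro: power_mono)
  qed
  show ?thesis
    unfolding AP_def mem_Collect_eq B theta_almost_periodic_def in_Lp_2 Lp_dist_2 ..
qed

text \<open>The filter \<open>at\<close> omits the centre, so its value is supplied separately.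
  Halving d passes from the Euclidean distance to the two coordinates.\<close>

lemma eventually_at_Pair_realD:
  assumes "\<forall>\<^sub>F x in at (a::real, b::real). Q x" "Q (a, b)"
  obtains d where "d > 0" "\<And>s t. \<bar>s - a\<bar> < d \<Longrightarrow> \<bar>t - b\<bar> < d \<Longrightarrow> Q (s, t)"
proof -
  obtain d where d: "d > 0" "\<And>x. x \<noteq> (a, b) \<Longrightarrow> dist x (a, b) < d \<Longrightarrow> Q x"
    using assms(1) unfolding eventually_at by auto
  have "Q (s, t)" if "\<bar>s - a\<bar> < d / 2" "\<bar>t - b\<bar> < d / 2" for s t
  proof (cases "(s, t) = (a, b)")
    case False
    have "dist (s, t) (a, b) \<le> \<bar>s - a\<bar> + \<bar>t - b\<bar>"
      using sqrt_sum_squares_le_sum_abs[of "s - a" "t - b"]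
        by (simp add: dist_Pair_Pair dist_real_def)
    also have "\<dots> < d" using that by linarith
    finally show ?thesis using d(2) False by blast
  qed (use assms(2) in auto)
  then show ?thesis using d(1) by (intro that[of "d / 2"]) auto
qed

lemma eventually_at_Pair_realI:
  assumes "d > 0" "\<And>s t. \<bar>s - a\<bar> < d \<Longrightarrow> \<bar>t - b\<bar> < d \<Longrightarrow> Q (s, t)"
  shows "\<forall>\<^sub>F x in at (a::real, b::real). Q x"
  unfolding eventually_at
proof (intro exI[of _ d] conjI ballI impI)
  fix x assume x: "x \<noteq> (a, b) \<and> dist x (a, b) < d"
  have "dist (fst x) a \<le> dist x (a, b)" "dist (snd x) b \<le> dist x (a, b)"
    using dist_fst_le[of x "(a, b)"] dist_snd_le[of x "(a, b)"] by auto
  then have "Q (fst x, snd x)" using x by (intro assms(2)) (auto simp: dist_real_def)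
  then show "Q x" by simp
qed (use assms in auto)

context
  fixes H :: real and P :: "(real \<Rightarrow> real ^ 'd) measure"
  assumes P: "fbm_law H P"
begin

section \<open>Calculus of shifted processes\<close>

lemma nm_wiener_shift_diff:
  assumes "L2 P X" "L2 P Y"
  shows "nm P (\<lambda>\<omega>. X (wiener_shift \<tau> \<omega>) - Y (wiener_shift \<tau> \<omega>)) = nm P (\<lambda>\<omega>. X \<omega> - Y \<omega>)"
  by (rule L2_wiener_shift(2)[OF P L2_diff(1)[OF assms]])

lemma shift_process_L2:
  assumes "\<And>t. L2 P (X t)"
  shows "L2 P (shift_process \<tau> X t)" "nm P (shift_process \<tau> X t) = nm P (X (t + \<tau>))"
  unfolding shift_process_def[abs_def] by (rule L2_wiener_shift[OF P assms])+

lemma nm_shift_process_diff: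
  assumes X: "\<And>t. L2 P (X t)" and Y: "\<And>t. L2 P (Y t)"
  shows "nm P (\<lambda>\<omega>. shift_process \<tau> X t \<omega> - shift_process \<tau> Y t \<omega>)
    = nm P (\<lambda>\<omega>. X (t + \<tau>) \<omega> - Y (t + \<tau>) \<omega>)"
  unfolding shift_process_def by (rule nm_wiener_shift_diff[OF X Y])

lemma shift_process_add:
  "shift_process (\<tau> + \<eta>) X t \<omega> = shift_process \<tau> X (t + \<eta>) (wiener_shift (-\<eta>) \<omega>)"
  by (simp add: shift_process_def wiener_shift_add add_ac)

lemma shift_process_0: "\<omega> \<in> space P \<Longrightarrow> shift_process 0 X t \<omega> = X t \<omega>"
  by (simp add: shift_process_def wiener_shift_0 space_P[OF P])

text \<open>Translations compose, and the inner one preserves P; it therefore only moves the time at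
  which the distance is measured. This is the composition rule required by
  \<open>ap_system\<close>.\<close>

lemma nm_shift_process_add:
  assumes X: "\<And>t. L2 P (X t)"
  shows "nm P (\<lambda>\<omega>. shift_process (\<tau> + \<eta>) X t \<omega> - shift_process \<eta> X t \<omega>)
    = nm P (\<lambda>\<omega>. shift_process \<tau> X (t + \<eta>) \<omega> - X (t + \<eta>) \<omega>)"
  unfolding shift_process_add
  unfolding shift_process_def[of \<eta>]
  by (rule nm_wiener_shift_diff[OF shift_process_L2(1)[where X=X, OF X] X])

lemma AP_ap_system:
  assumes X: "X \<in> AP P 2"
  shows "ap_system (\<lambda>e \<tau> t. nm P (\<lambda>\<omega>. shift_process \<tau> X t \<omega> - X t \<omega>) \<le> e)"
proof -
  have L: "L2 P (X t)" for t using X by (simp add: AP_2_iff)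
  note LS = shift_process_L2(1)[where X=X, OF L]
  show ?thesis unfolding ap_system_def
  proof (intro conjI allI impI)
    fix e e' \<tau> \<eta> t
    assume 1: "nm P (\<lambda>\<omega>. shift_process \<tau> X (t + \<eta>) \<omega> - X (t + \<eta>) \<omega>) \<le> e"
      and 2: "nm P (\<lambda>\<omega>. shift_process \<eta> X t \<omega> - X t \<omega>) \<le> e'"
    show "nm P (\<lambda>\<omega>. shift_process (\<tau> + \<eta>) X t \<omega> - X t \<omega>) \<le> e + e'"
      using nm_triangle3[OF LS[where \<tau>="\<tau> + \<eta>" and t=t] LS[where \<tau>=\<eta>
        and t=t] L[of t]] nm_shift_process_add[where X=X and \<tau>=\<tau> and \<eta>=\<eta> and t=t, OF L] 1 2
          by linarith
  next
    fix e \<tau> t assume 1: "nm P (\<lambda>\<omega>. shift_process \<tau> X t \<omega> - X t \<omega>) \<le> e"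
    \<comment> \<open>The composition rule for the translations by -\<open>\<tau>\<close> and
      \<open>\<tau>\<close>, whose sum is the identity on the path space.\<close>
    have "nm P (\<lambda>\<omega>. shift_process (-\<tau>) X (t + \<tau>) \<omega> - X (t + \<tau>) \<omega>)
      = nm P (\<lambda>\<omega>. shift_process (-\<tau> + \<tau>) X t \<omega> - shift_process \<tau> X t \<omega>)"
      by (rule nm_shift_process_add[where X=X, OF L, symmetric])
    also have "\<dots> = nm P (\<lambda>\<omega>. X t \<omega> - shift_process \<tau> X t \<omega>)"
      by (rule nm_cong) (simp add: shift_process_0)
    finally show "nm P (\<lambda>\<omega>. shift_process (-\<tau>) X (t + \<tau>) \<omega> - X (t + \<tau>) \<omega>) \<le> e"
      using 1 by (simp add: nm_commute)
  next
    fix e t0 :: real assume e: "e > 0"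
    have t: "((\<lambda>(t, \<tau>). nm P (\<lambda>\<omega>. shift_process \<tau> X t \<omega>
      - shift_process 0 X t0 \<omega>)) \<longlongrightarrow> 0) (at (t0, 0))" using X by (simp add: AP_2_iff)
    have "\<forall>\<^sub>F x in at (t0, 0). (case x of (t, \<tau>) \<Rightarrow> nm P (\<lambda>\<omega>. shift_process \<tau> X t \<omega>
      - shift_process 0 X t0 \<omega>)) < e / 2"
      using order_tendstoD(2)[OF t, of "e/2"] e by simp
    then obtain d where d: "d > 0" "\<And>t \<tau>. \<bar>t - t0\<bar> < d \<Longrightarrow> \<bar>\<tau> - 0\<bar> < d \<Longrightarrow>
        (case (t, \<tau>) of (t, \<tau>) \<Rightarrow> nm P (\<lambda>\<omega>. shift_process \<tau> X t \<omega> - shift_process 0 X t0 \<omega>)) < e / 2"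
      by (rule eventually_at_Pair_realD) (use e in auto)
    have "nm P (\<lambda>\<omega>. shift_process \<tau> X t \<omega> - X t \<omega>) \<le> e" if "\<bar>t - t0\<bar> < d" "\<bar>\<tau>\<bar> < d" for t \<tau>
    proof -
      have "nm P (\<lambda>\<omega>. shift_process \<tau> X t \<omega> - X t \<omega>)
        = nm P (\<lambda>\<omega>. shift_process \<tau> X t \<omega> - shift_process 0 X t \<omega>)"
        by (rule nm_cong) (simp add: shift_process_0)
      also have "\<dots> \<le> nm P (\<lambda>\<omega>. shift_process \<tau> X t \<omega> - shift_process 0 X t0 \<omega>)
        + nm P (\<lambda>\<omega>. shift_process 0 X t0 \<omega> - shift_process 0 X t \<omega>)"
        by (rule nm_triangle3[OF LS LS LS])
      also have "\<dots> \<le> e" using d(2)[of t \<tau>] d(2)[of t 0] that nm_commute[of P "shift_process 0 X t0"]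
        d(1) by simp
      finally show ?thesis .
    qed
    then show "\<exists>\<delta>>0. \<forall>t \<tau>. \<bar>t - t0\<bar> < \<delta> \<longrightarrow> \<bar>\<tau>\<bar> < \<delta> \<longrightarrow> nm P (\<lambda>\<omega>. shift_process \<tau> X t \<omega> - X t \<omega>) \<le> e"
      using d(1) by blast
  qed (use X in \<open>auto simp: AP_2_iff\<close>)
qed

text \<open>Joint continuity in t and \<open>\<tau>\<close> splits into continuity in t and uniform
  smallness of small translations. The latter is \<open>ap_small_period\<close> for a system Q of
  the data, which also provides the almost periods of Y.\<close>

lemma AP_intro:
  assumes Y: "continuous_process P Y" and L: "\<And>t. L2 P (Y t)" and K: "\<And>t. nm P (Y t) \<le> K"
    and cont: "\<And>t0 e. e > 0 \<Longrightarrow> \<exists>\<delta>>0. \<forall>t. \<bar>t - t0\<bar> < \<delta> \<longrightarrow> nm P (\<lambda>\<omega>. Y t \<omega> - Y t0 \<omega>) < e"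
    and ap: "\<And>e. e > 0 \<Longrightarrow> \<exists>Q. ap_system Q \<and> (\<exists>e'>0. \<forall>\<tau>. (\<forall>t. Q e' \<tau> t) \<longrightarrow>
      (\<forall>t. nm P (\<lambda>\<omega>. shift_process \<tau> Y t \<omega> - Y t \<omega>) \<le> e))"
  shows "Y \<in> AP P 2"
  unfolding AP_2_iff
proof (intro conjI allI impI Y L)
  show "\<exists>K. \<forall>t. nm P (Y t) \<le> K" using K by blast
  note LS = shift_process_L2(1)[where X=Y, OF L]
  {
    fix e :: real assume "e > 0"
    then obtain Q e' where Q: "ap_system Q" "e' > 0" "\<And>\<tau>. (\<forall>t. Q e' \<tau> t) \<Longrightarrow>
      (\<forall>t. nm P (\<lambda>\<omega>. shift_process \<tau> Y t \<omega> - Y t \<omega>) \<le> e)"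
      using ap by metis
    then show "relatively_dense {\<tau>. \<forall>t. nm P (\<lambda>\<omega>. shift_process \<tau> Y t \<omega> - Y t \<omega>) \<le> e}"
      by (intro relatively_dense_mono[OF ap_systemD(5)[OF Q(1,2)]]) blast
  }
  fix t0 \<tau>0
  show "((\<lambda>(t, \<tau>). nm P (\<lambda>\<omega>. shift_process \<tau> Y t \<omega> - shift_process \<tau>0 Y t0 \<omega>)) \<longlongrightarrow> 0) (at (t0, \<tau>0))"
  proof (rule order_tendstoI)
    fix e :: real assume e: "0 < e"
    then obtain Q e' where Q: "ap_system Q" "e' > 0" "\<And>\<tau>. (\<forall>t. Q e' \<tau> t) \<Longrightarrow>
      (\<forall>t. nm P (\<lambda>\<omega>. shift_process \<tau> Y t \<omega> - Y t \<omega>) \<le> e/2)"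
      using ap[of "e/2"] by auto
    obtain d1 where d1: "d1 > 0" "\<And>\<tau> t. \<bar>\<tau>\<bar> < d1 \<Longrightarrow> Q e' \<tau> t"
      using ap_small_period[OF Q(1,2)] by blast
    obtain d2 where d2: "d2 > 0" "\<And>t. \<bar>t - (t0 + \<tau>0)\<bar> < d2 \<Longrightarrow> nm P (\<lambda>\<omega>. Y t \<omega> - Y (t0 + \<tau>0) \<omega>) < e/2"
      using cont[of "e/2" "t0 + \<tau>0"] e by auto
    show "\<forall>\<^sub>F x in at (t0, \<tau>0). (case x of (t, \<tau>) \<Rightarrow> nm P (\<lambda>\<omega>. shift_process \<tau> Y t \<omega>
      - shift_process \<tau>0 Y t0 \<omega>)) < e"
    proof (rule eventually_at_Pair_realI[of "min d1 d2"])
      fix t \<tau> assume t: "\<bar>t - t0\<bar> < min d1 d2" "\<bar>\<tau> - \<tau>0\<bar> < min d1 d2"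
      \<comment> \<open>Writing \<open>\<tau>\<close> as the small translation
        \<open>\<tau> - \<tau>0\<close> followed by \<open>\<tau>0\<close> makes the bound for small
        translations applicable.\<close>
      have "nm P (\<lambda>\<omega>. shift_process (\<tau> - \<tau>0 + \<tau>0) Y t \<omega> - shift_process \<tau>0 Y t \<omega>) \<le> e/2"
        unfolding nm_shift_process_add[where X=Y, OF L]
          using Q(3)[of "\<tau> - \<tau>0"] d1(2)[of "\<tau> - \<tau>0"] t(2) by simp
      moreover have "nm P (\<lambda>\<omega>. shift_process \<tau>0 Y t \<omega> - shift_process \<tau>0 Y t0 \<omega>) < e/2"
      proof -
        have "nm P (\<lambda>\<omega>. shift_process \<tau>0 Y t \<omega> - shift_process \<tau>0 Y t0 \<omega>)
          = nm P (\<lambda>\<omega>. Y (t + \<tau>0) \<omega> - Y (t0 + \<tau>0) \<omega>)"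
          unfolding shift_process_def by (rule nm_wiener_shift_diff[OF L L])
        then show ?thesis using d2(2)[of "t + \<tau>0"] t(1) by simp
      qed
      ultimately show "(case (t, \<tau>) of (t, \<tau>) \<Rightarrow> nm P (\<lambda>\<omega>. shift_process \<tau> Y t \<omega>
        - shift_process \<tau>0 Y t0 \<omega>)) < e"
        using nm_triangle3[OF LS[where \<tau>=\<tau> and t=t] LS[where \<tau>=\<tau>0 and t=t] LS[where \<tau>=\<tau>0 and t=t0]]
          by simp
    qed (use d1(1) d2(1) in simp)
  next
    fix e :: real assume "e < 0"
    then have "e < nm P Z" for Z :: "(real \<Rightarrow> real ^ 'd) \<Rightarrow> real ^ 'd"
      by (rule less_le_trans[OF _ nm_nonneg])
    then show "\<forall>\<^sub>F x in at (t0, \<tau>0). e < (case x of (t, \<tau>) \<Rightarrow> nm P (\<lambda>\<omega>. shift_process \<tau> Y t \<omega>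
      - shift_process \<tau>0 Y t0 \<omega>))"
      by (intro always_eventually allI) (simp add: case_prod_unfold)
  qed
qed

text \<open>The excess over R is the distance of Z to its radial truncation. It decreases in R and
  tends to 0 in mean square by dominated convergence.\<close>

lemma nm_truncation_tendsto:
  fixes Z :: "(real \<Rightarrow> real ^ 'd) \<Rightarrow> real ^ 'd"
  assumes Z: "L2 P Z" and e: "e > 0"
  obtains N :: nat where "\<And>R. R \<ge> real N \<Longrightarrow> nm P (\<lambda>\<omega>. max (norm (Z \<omega>) - R) 0) < e"
proof -
  note [measurable] = L2_measurable[OF Z]
  have "(\<lambda>n. \<integral>\<omega>. (norm (max (norm (Z \<omega>) - real n) 0))\<^sup>2 \<partial>P) \<longlonglongrightarrow> (\<integral>\<omega>. 0 \<partial>P)"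
  proof (rule integral_dominated_convergence)
    show "integrable P (\<lambda>\<omega>. (norm (Z \<omega>))\<^sup>2)" by (rule L2_integrable[OF Z])
    show "AE \<omega> in P. (\<lambda>n. (norm (max (norm (Z \<omega>) - real n) 0))\<^sup>2) \<longlonglongrightarrow> 0"
    proof (rule AE_I2)
      fix \<omega>
      obtain N :: nat where N: "norm (Z \<omega>) \<le> real N" using real_arch_simple by blast
      have "\<forall>\<^sub>F n in sequentially. (norm (max (norm (Z \<omega>) - real n) 0))\<^sup>2 = 0"
        using eventually_ge_at_top[of N] by eventually_elim (use N in \<open>auto simp: max_def\<close>)
      then show "(\<lambda>n. (norm (max (norm (Z \<omega>) - real n) 0))\<^sup>2) \<longlonglongrightarrow> 0" by (rule tendsto_eventually)
    qed
    show "AE \<omega> in P. norm ((norm (max (norm (Z \<omega>) - real n) 0))\<^sup>2) \<le> (norm (Z \<omega>))\<^sup>2" for n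
      by (intro AE_I2) (auto simp: max_def intro!: power_mono)
  qed simp_all
  then have "(\<lambda>n. nm P (\<lambda>\<omega>. max (norm (Z \<omega>) - real n) 0)) \<longlonglongrightarrow> 0"
    unfolding nm_def using tendsto_real_sqrt by fastforce
  then have "\<forall>\<^sub>F n in sequentially. nm P (\<lambda>\<omega>. max (norm (Z \<omega>) - real n) 0) < e"
    by (rule order_tendstoD(2)) (rule e)
  then obtain N where N: "nm P (\<lambda>\<omega>. max (norm (Z \<omega>) - real N) 0) < e"
    unfolding eventually_sequentially by blast
  have LN: "L2 P (\<lambda>\<omega>. max (norm (Z \<omega>) - real N) 0)" by (rule L2_bound(1)[OF Z]) (auto simp: max_def)
  have "nm P (\<lambda>\<omega>. max (norm (Z \<omega>) - R) 0) < e" if "R \<ge> real N" for R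
  proof -
    have "nm P (\<lambda>\<omega>. max (norm (Z \<omega>) - R) 0) \<le> nm P (\<lambda>\<omega>. max (norm (Z \<omega>) - real N) 0)"
      by (rule L2_bound(2)[OF LN]) (use that in \<open>auto simp: max_def\<close>)
    then show ?thesis using N by simp
  qed
  then show ?thesis by (rule that)
qed

text \<open>An almost periodic process is uniformly integrable in mean square: up to the shift, which
  preserves laws, and up to \<open>\<epsilon>\<close>, it takes only finitely many values in \<open>\<L>\<^sup>2\<close>.\<close>

lemma AP_uniform_truncation:
  assumes X: "X \<in> AP P 2" and e: "e > 0"
  obtains R where "R \<ge> 0" "\<And>s. nm P (\<lambda>\<omega>. max (norm (X s \<omega>) - R) 0) \<le> e"
proof -
  let ?Q = "\<lambda>e \<tau> t. nm P (\<lambda>\<omega>. shift_process \<tau> X t \<omega> - X t \<omega>) \<le> e"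
  have Q: "ap_system ?Q" by (rule AP_ap_system[OF X])
  have L: "L2 P (X t)" for t using X by (simp add: AP_2_iff)
  have e3: "e / 3 > 0" using e by simp
  obtain \<delta> where \<delta>: "\<delta> > 0" "\<And>\<tau> t. \<bar>\<tau>\<bar> < \<delta> \<Longrightarrow> ?Q (e/3) \<tau> t" using ap_small_period[OF Q e3] by blast
  obtain l where l: "l > 0" "\<And>a. \<exists>\<tau>\<in>{\<tau>. \<forall>t. ?Q (e/3) \<tau> t}. a \<le> \<tau> \<and> \<tau> \<le> a + l"
    using relatively_denseD[OF ap_systemD(5)[OF Q e3]] by blast
  \<comment> \<open>A grid finer than \<open>\<delta>\<close>: M + 1 grid times represent all times
    in [0, l] up to a small translation.\<close>
  define h where "h = \<delta> / 2"
  have h: "h > 0" "h < \<delta>" using \<delta>(1) by (auto simp: h_def)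
  define M where "M = nat \<lceil>l / h\<rceil>"
  have "\<forall>k. \<exists>N::nat. \<forall>R\<ge>real N. nm P (\<lambda>\<omega>. max (norm (X (real k * h) \<omega>) - R) 0) < e/3"
    using nm_truncation_tendsto[OF L e3] by metis
  then obtain N :: "nat \<Rightarrow> nat" where N: "\<And>k R. R \<ge> real (N k) \<Longrightarrow>
    nm P (\<lambda>\<omega>. max (norm (X (real k * h) \<omega>) - R) 0) < e/3"
    by metis
  \<comment> \<open>The sum dominates each of the finitely many thresholds.\<close>
  define R where "R = real (\<Sum>k\<le>M. N k)"
  have R0: "0 \<le> R" unfolding R_def by (rule of_nat_0_le_iff)
  have "nm P (\<lambda>\<omega>. max (norm (X s \<omega>) - R) 0) \<le> e" for s
  proof -
    \<comment> \<open>This almost period brings s - \<open>\<eta>\<close> into [0, l]; the remaining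
      distance \<open>\<tau>\<close> to the grid point below is less than \<open>\<delta>\<close>,
      so s is the grid time plus \<open>\<tau> + \<eta>\<close>.\<close>
    obtain \<eta> where \<eta>: "\<forall>t. ?Q (e/3) \<eta> t" "s - l \<le> \<eta>" "\<eta> \<le> s - l + l" using l(2)[of "s - l"] by blast
    define k where "k = nat \<lfloor>(s - \<eta>) / h\<rfloor>"
    have "0 \<le> (s - \<eta>) / h" "(s - \<eta>) / h \<le> l / h" using \<eta> h by (auto intro!: divide_right_mono)
    then have k: "real k \<le> (s - \<eta>) / h" "(s - \<eta>) / h < real k + 1" "k \<le> M"
      unfolding k_def M_def by (auto intro!: nat_mono simp: floor_le_ceiling order_trans[OF
        floor_mono floor_le_ceiling])
    define \<tau> where "\<tau> = s - \<eta> - real k * h"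
    have "real k * h \<le> s - \<eta>" "s - \<eta> < (real k + 1) * h"
      using k(1,2) h(1) by (simp_all add: field_simps)
    then have "\<bar>\<tau>\<bar> < \<delta>" using h by (auto simp: \<tau>_def algebra_simps)
    then have "\<forall>t. ?Q (e/3) \<tau> t" using \<delta>(2) by blast
    then have c0: "?Q (e/3 + e/3) (\<tau> + \<eta>) (real k * h)" using ap_period_add[OF Q] \<eta>(1) by blast
    have s: "real k * h + (\<tau> + \<eta>) = s" by (simp add: \<tau>_def)
    have close: "nm P (\<lambda>\<omega>. X s (wiener_shift (- (\<tau> + \<eta>)) \<omega>) - X (real k * h) \<omega>) \<le> e/3 + e/3"
      using c0 unfolding shift_process_def s .
    let ?Z = "\<lambda>\<omega>. X s (wiener_shift (- (\<tau> + \<eta>)) \<omega>)" and ?W = "X (real k * h)"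
    have LZ: "L2 P ?Z" by (rule L2_wiener_shift(1)[OF P L])
    have LT: "L2 P (\<lambda>\<omega>. max (norm (Z \<omega>) - R) 0)" if Z: "L2 P Z"
      for Z :: "(real \<Rightarrow> real ^ 'd) \<Rightarrow> real ^ 'd"
      by (rule L2_bound(1)[OF Z]) (use L2_measurable[OF Z] R0 in \<open>auto simp: max_def\<close>)
    have "nm P (\<lambda>\<omega>. max (norm (X s \<omega>) - R) 0) = nm P (\<lambda>\<omega>. max (norm (?Z \<omega>) - R) 0)"
      by (rule L2_wiener_shift(2)[OF P LT[OF L], symmetric])
    also have "\<dots> \<le> nm P (\<lambda>\<omega>. max (norm (?W \<omega>) - R) 0)
      + nm P (\<lambda>\<omega>. max (norm (?Z \<omega>) - R) 0 - max (norm (?W \<omega>) - R) 0)"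
      by (rule nm_le_add[OF LT[OF LZ] LT[OF L]])
    \<comment> \<open>The excess over R is a 1-Lipschitz function of the vector.\<close>
    also have "nm P (\<lambda>\<omega>. max (norm (?Z \<omega>) - R) 0 - max (norm (?W \<omega>) - R) 0)
      \<le> nm P (\<lambda>\<omega>. ?Z \<omega> - ?W \<omega>)"
    proof (rule L2_bound(2)[OF L2_diff(1)[OF LZ L]])
      show "AE \<omega> in P. norm (max (norm (?Z \<omega>) - R) 0 - max (norm (?W \<omega>) - R) 0)
        \<le> norm (?Z \<omega> - ?W \<omega>)"
      proof (rule AE_I2)
        fix \<omega>
        show "norm (max (norm (?Z \<omega>) - R) 0 - max (norm (?W \<omega>) - R) 0) \<le> norm (?Z \<omega> - ?W \<omega>)"
          using norm_triangle_ineq3[of "?Z \<omega>" "?W \<omega>"]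
            by (auto simp: max_def abs_if split: if_splits)
      qed
      show "(\<lambda>\<omega>. max (norm (?Z \<omega>) - R) 0 - max (norm (?W \<omega>) - R) 0) \<in> borel_measurable P"
        by (intro L2_measurable L2_diff LT LZ L)
    qed
    also have "nm P (\<lambda>\<omega>. max (norm (?W \<omega>) - R) 0) \<le> e/3"
    proof -
      have "N k \<le> (\<Sum>k\<le>M. N k)" using k(3) by (intro member_le_sum) auto
      then have "real (N k) \<le> R" unfolding R_def by (simp only: of_nat_le_iff)
      then show ?thesis using N by (intro less_imp_le)
    qed
    finally show ?thesis using close by simp
  qed
  then show ?thesis by (rule that[OF R0])
qed

end

section \<open>The operator \<open>\<Gamma>\<close>\<close>

locale sde = mild_setting H cS mS A P
  for H cS mS :: real and A :: "real ^ 'd ^ 'd" and P :: "(real \<Rightarrow> real ^ 'd) measure" +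
  fixes cb mb :: real and b :: "real \<Rightarrow> real ^ 'd \<Rightarrow> real ^ 'd" and \<sigma> :: "real \<Rightarrow> real ^ 'd ^ 'd"
  assumes b_cont: "continuous_on UNIV (\<lambda>(t, x). b t x)"
    and cb: "0 < cb" and mb: "0 < mb"
    and lip: "norm (b t x - b t y) \<le> cb * norm (x - y)"
    and growth: "norm (b t x) \<le> mb * (1 + norm x)"
    and noise_H: "(\<lambda>s. indicator {..t} s *\<^sub>R (matrix_exp ((t - s) *\<^sub>R A) ** \<sigma> s)) \<in> abs_H_mat H"
    and b_ap: "almost_periodic_unif_compact b"
    and \<sigma>_ap: "almost_periodic \<sigma>"
begin

text \<open>Almost periodicity is left out: the size, Hoelder and contraction estimates run in this
  class with an explicit bound K.\<close>

definition proc :: "(real \<Rightarrow> (real \<Rightarrow> real ^ 'd) \<Rightarrow> real ^ 'd) \<Rightarrow> real \<Rightarrow> bool" where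
  "proc X K \<longleftrightarrow> continuous_process P X \<and> (\<forall>t. L2 P (X t) \<and> nm P (X t) \<le> K)"

lemma procD:
  assumes "proc X K"
  shows "continuous_process P X" "X t \<in> borel_measurable P" "L2 P (X t)" "nm P (X t) \<le> K" "0 \<le> K"
  using assms order_trans[OF nm_nonneg] unfolding proc_def continuous_process_def by blast+

lemma AP_proc:
  assumes "X \<in> AP P 2"
  obtains K where "proc X K"
  using assms unfolding AP_2_iff proc_def by blast

lemma adm_b:
  assumes X: "proc X K"
  shows "adm (\<lambda>s \<omega>. b s (X s \<omega>)) (mb * (1 + K))"
  unfolding adm_def
proof (intro conjI allI)
  show "jointly_measurable P (\<lambda>s \<omega>. b s (X s \<omega>))"
    by (rule jointly_measurable_continuous[OF continuous_process_jointly_measurable[OF procD(1)[OF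
      X]] b_cont])
  fix s :: real
  have "continuous_on UNIV (\<lambda>x :: real ^ 'd. (s, x))" by (intro continuous_intros)
  then have "continuous_on UNIV (b s)"
    using continuous_on_compose2[OF b_cont, where s=UNIV and f="\<lambda>x. (s, x)"] by simp
  then have m: "(\<lambda>\<omega>. b s (X s \<omega>)) \<in> borel_measurable P"
    by (intro measurable_compose[OF procD(2)[OF X]] borel_measurable_continuous_onI)
  have c: "L2 P (\<lambda>_. 1::real)" "nm P (\<lambda>_. 1::real) = 1"
    using prob_space.L2_const[OF prob_P[OF P], of "1::real"] by simp_all
  have L1: "L2 P (\<lambda>\<omega>. 1 + norm (X s \<omega>))" by (intro L2_add c L2_norm procD(3)[OF X])
  have L: "L2 P (\<lambda>\<omega>. mb * (1 + norm (X s \<omega>)))" by (rule L2_cmult[OF L1])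
  have le: "AE \<omega> in P. norm (b s (X s \<omega>)) \<le> norm (mb * (1 + norm (X s \<omega>)))"
    using growth mb by (intro AE_I2) (simp add: abs_mult)
  show "L2 P (\<lambda>\<omega>. b s (X s \<omega>))" by (rule L2_bound(1)[OF L m le])
  have "nm P (\<lambda>\<omega>. b s (X s \<omega>)) \<le> nm P (\<lambda>\<omega>. mb * (1 + norm (X s \<omega>)))"
    by (rule L2_bound(2)[OF L m le])
  also have "\<dots> = mb * nm P (\<lambda>\<omega>. 1 + norm (X s \<omega>))" using mb by (simp add: nm_cmult)
  also have "\<dots> \<le> mb * (1 + K)"
    using nm_triangle[OF c(1) L2_norm(1)[OF procD(3)[OF X, of s]]] L2_norm(2)[of P "X s"]
      procD(4)[OF X, of s] c(2) mb
    by (intro mult_left_mono) auto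
  finally show "nm P (\<lambda>\<omega>. b s (X s \<omega>)) \<le> mb * (1 + K)" .
qed

lemma \<sigma>_bnd_cont:
  obtains B where "bnd_cont \<sigma> B"
  using almost_periodic_bounded[OF \<sigma>_ap] \<sigma>_ap unfolding bnd_cont_def almost_periodic_def by metis

lemma rep_cong:
  assumes "rep F \<sigma>' t Z" "Y \<in> borel_measurable P" "AE \<omega> in P. Y \<omega> = Z \<omega>"
  shows "rep F \<sigma>' t Y"
proof -
  obtain J where J: "wintU P (\<lambda>u. S (t - u) ** \<sigma>' u) t J" "AE \<omega> in P. Z \<omega> = conv F t \<omega> + J \<omega>"
    using repE[OF assms(1)] by blast
  have "AE \<omega> in P. Y \<omega> = conv F t \<omega> + J \<omega>" using assms(3) J(2) by eventually_elim simp
  then show ?thesis using J(1) assms(2) unfolding rep_def by blast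
qed

text \<open>Almost sure integrability of the drift follows from \<open>conv_L2\<close>, and
  membership in \<open>abs_H_mat\<close> from the hypothesis on the noise, so the defining formula
  reduces to \<open>rep\<close> at every time.\<close>

lemma is_Gamma_iff:
  assumes X: "proc X K" and Y: "\<And>t. Y t \<in> borel_measurable P"
  shows "is_Gamma P H A b \<sigma> X Y \<longleftrightarrow> (\<forall>t. rep (\<lambda>s \<omega>. b s (X s \<omega>)) \<sigma> t (Y t))"
proof -
  have c: "continuous_on UNIV \<sigma>" using \<sigma>_ap by (simp add: almost_periodic_def)
  have iff: "has_wiener_integral_atMost P H canonical_process (\<lambda>s. S (t - s) ** \<sigma> s) t J
    \<longleftrightarrow> wintU P (\<lambda>s. S (t - s) ** \<sigma> s) t J" for t J
    using has_wiener_integral_atMost_iff[OF P H(1) noise_continuous[OF c]] noise_H by simp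
  have ae: "(AE \<omega> in P. set_integrable lborel {..t} (\<lambda>s. S (t - s) *v b s (X s \<omega>)) \<and>
        Y t \<omega> = (LINT s:{..t}|lborel. S (t - s) *v b s (X s \<omega>)) + J \<omega>)
     \<longleftrightarrow> (AE \<omega> in P. Y t \<omega> = conv (\<lambda>s \<omega>. b s (X s \<omega>)) t \<omega> + J \<omega>)" for t J
    unfolding conv_def using conv_L2(1)[OF adm_b[OF X], of t] by (auto elim: eventually_elim2)
  show ?thesis unfolding is_Gamma_def rep_def iff ae using Y by simp
qed

lemma Hoelder_cont:
  assumes C: "\<And>s t. s \<le> t \<Longrightarrow> t - s \<le> 1 \<Longrightarrow> 0 \<le> C \<and> nm P (\<lambda>\<omega>. Y t \<omega> - Y s \<omega>) \<le> C * (t - s) powr H"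
    and e: "e > 0"
  shows "\<exists>\<delta>>0. \<forall>t. \<bar>t - t0\<bar> < \<delta> \<longrightarrow> nm P (\<lambda>\<omega>. Y t \<omega> - Y t0 \<omega>) < e"
proof -
  have C0: "0 \<le> C" using C[of 0 0] by simp
  \<comment> \<open>Chosen so that C \<open>\<delta>\<close>^H is below e; the summand 1 covers C =
    0, and the minimum keeps to lengths where the Hoelder bound holds.\<close>
  define \<delta> where "\<delta> = min 1 ((e / (C + 1)) powr (1 / H))"
  have ec: "e / (C + 1) > 0" using e C0 by simp
  have \<delta>: "\<delta> > 0" using e C0 by (simp add: \<delta>_def)
  have "nm P (\<lambda>\<omega>. Y t \<omega> - Y t0 \<omega>) < e" if t: "\<bar>t - t0\<bar> < \<delta>" for t
  proof -
    have t1: "\<bar>t - t0\<bar> \<le> 1" "\<bar>t - t0\<bar> \<le> (e / (C + 1)) powr (1 / H)" using t by (auto simp: \<delta>_def)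
    have "nm P (\<lambda>\<omega>. Y t \<omega> - Y t0 \<omega>) \<le> C * \<bar>t - t0\<bar> powr H"
    proof (cases "t0 \<le> t")
      case True
      then show ?thesis using C[of t0 t] t1 by simp
    next
      case False
      then show ?thesis using C[of t t0] t1 nm_commute[of P "Y t" "Y t0"] by simp
    qed
    also have "\<dots> \<le> C * ((e / (C + 1)) powr (1 / H)) powr H"
      using C0 H t1 by (intro mult_left_mono powr_mono2) auto
    also have "\<dots> = C * (e / (C + 1))"
    proof -
      have "1 / H * H = 1" using H by simp
      then show ?thesis unfolding powr_powr by (simp only: powr_one[OF less_imp_le[OF ec]])
    qed
    also have "\<dots> < e" using e C0 by (simp add: divide_simps algebra_simps)
    finally show ?thesis .
  qed
  then show ?thesis using \<delta> by blast
qed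

lemma Gamma_exists:
  assumes X: "proc X K"
  obtains Y where "continuous_process P Y" "is_Gamma P H A b \<sigma> X Y"
proof -
  obtain B where B: "bnd_cont \<sigma> B" by (rule \<sigma>_bnd_cont)
  note F = adm_b[OF X]
  \<comment> \<open>One version per time, chosen independently; only the Hoelder bound then turns
    them into a process with continuous paths.\<close>
  have "\<forall>t. \<exists>Y. rep (\<lambda>s \<omega>. b s (X s \<omega>)) \<sigma> t Y" using rep_exists[OF F B] by metis
  then obtain G where G: "\<And>t. rep (\<lambda>s \<omega>. b s (X s \<omega>)) \<sigma> t (G t)" by metis
  obtain C where *: "\<forall>F \<sigma> s t Y Z. adm F (mb * (1 + K)) \<longrightarrow> bnd_cont \<sigma> B \<longrightarrow> rep F \<sigma> s Y \<longrightarrow> rep F \<sigma> t Z \<longrightarrow>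
    s \<le> t \<longrightarrow> t - s \<le> 1 \<longrightarrow>
     0 \<le> C \<and> nm P (\<lambda>\<omega>. Z \<omega> - Y \<omega>) \<le> C * (t - s) powr H"
    using rep_Hoelder[of "mb * (1 + K)" B] by (rule exE)
  have C: "0 \<le> C \<and> nm P (\<lambda>\<omega>. G t \<omega> - G s \<omega>) \<le> C * (t - s) powr H" if "s \<le> t" "t - s \<le> 1" for s t
    using *[rule_format, OF F B G G that] .
  obtain Y where Y: "continuous_process P Y" "\<And>t. AE \<omega> in P. Y t \<omega> = G t \<omega>"
  proof (rule kolmogorov_L2[OF prob_P[OF P], of G H C])
    show "L2 P (G t)" for t by (rule rep_L2(1)[OF F B G])
    show "0 \<le> C" using C[of 0 0] by simp
    show "nm P (\<lambda>\<omega>. G t \<omega> - G s \<omega>) \<le> C * (t - s) powr H" if "s \<le> t" "t - s \<le> 1" for s t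
      using C[OF that] by simp
  qed (use H in auto)
  have Ym: "Y t \<in> borel_measurable P" for t using Y(1) by (simp add: continuous_process_def)
  have "is_Gamma P H A b \<sigma> X Y"
    unfolding is_Gamma_iff[OF X Ym] using rep_cong[OF G Ym Y(2)] by blast
  with Y(1) show ?thesis by (rule that)
qed

text \<open>Almost periods of the data seen by \<open>\<Gamma>\<close>. As b is almost periodic on
  compact sets only, the values of X are projected to a ball, and the projection error is controlled
  uniformly in time.\<close>

lemma Gamma_shift:
  assumes X: "X \<in> AP P 2" and e: "e > 0"
  obtains Q e' where "ap_system Q" "e' > 0"
    "\<And>\<tau> s. (\<forall>t. Q e' \<tau> t) \<Longrightarrow> nm P (\<lambda>\<omega>. b (s + \<tau>) (X (s + \<tau>) (wiener_shift (-\<tau>) \<omega>)) - b s (X s \<omega>))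
      \<le> e"
    "\<And>\<tau> u. (\<forall>t. Q e' \<tau> t) \<Longrightarrow> norm (\<sigma> (u + \<tau>) - \<sigma> u) \<le> e"
proof -
  obtain K where K: "proc X K" using AP_proc[OF X] .
  \<comment> \<open>The projection error enters twice, at the times s and s + \<open>\<tau>\<close>,
    each time with the Lipschitz constant; together they cost e/2.\<close>
  have "e / (4 * cb) > 0" using e cb by simp
  then obtain R where R: "R \<ge> 0" "\<And>s. nm P (\<lambda>\<omega>. max (norm (X s \<omega>) - R) 0) \<le> e / (4 * cb)"
    using AP_uniform_truncation[OF P X] by blast
  \<comment> \<open>The other half of e pays for the almost period of X, amplified by
    \<open>cb\<close>, and for that of b.\<close>
  define e' where "e' = e / (2 * (cb + 1))"
  have e': "e' > 0" "e' \<le> e" "(cb + 1) * e' = e / 2"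
    using e cb by (auto simp: e'_def divide_simps mult_le_cancel_left1)
  define Q where "Q = (\<lambda>e \<tau> t. nm P (\<lambda>\<omega>. shift_process \<tau> X t \<omega> - X t \<omega>) \<le> e \<and>
     ((\<forall>x\<in>cball 0 R. norm (b (t + \<tau>) x - b t x) \<le> e) \<and> norm (\<sigma> (t + \<tau>) - \<sigma> t) \<le> e))"
  have Q: "ap_system Q" unfolding Q_def
    by (intro ap_system_conj AP_ap_system[OF P X] almost_periodic_unif_compact_system[OF b_ap]
      almost_periodic_system[OF \<sigma>_ap] compact_cball)
  have est: "nm P (\<lambda>\<omega>. b (s + \<tau>) (X (s + \<tau>) (wiener_shift (-\<tau>) \<omega>)) - b s (X s \<omega>))
    \<le> e" if \<tau>: "\<forall>t. Q e' \<tau> t" for \<tau> s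
  proof -
    let ?X' = "\<lambda>\<omega>. X (s + \<tau>) (wiener_shift (-\<tau>) \<omega>)"
    have L': "L2 P ?X'" by (rule L2_wiener_shift(1)[OF P procD(3)[OF K]])
    note L = procD(3)[OF K, of s]
    have d: "nm P (\<lambda>\<omega>. ?X' \<omega> - X s \<omega>) \<le> e'" using \<tau> unfolding Q_def shift_process_def by blast
    let ?f = "\<lambda>\<omega>. cb * norm (?X' \<omega> - X s \<omega>)" and ?g = "\<lambda>\<omega>. (2 * cb) * max (norm (X s \<omega>) - R) 0"
    have Lf: "L2 P ?f" by (intro L2_cmult L2_norm L2_diff L' L)
    have Lg: "L2 P ?g"
      by (intro L2_cmult L2_bound(1)[OF L]) (use L2_measurable[OF L] R(1) in \<open>auto simp: max_def\<close>)
    have c: "L2 P (\<lambda>_. e')" "nm P (\<lambda>_. e') = e'"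
      using prob_space.L2_const[OF prob_P[OF P], of e'] e' by simp_all
    have pw: "norm (b (s + \<tau>) y - b s x) \<le> cb * norm (y - x) + ((2 * cb) * max (norm x - R) 0 + e')"
      for x y
    proof -
      \<comment> \<open>Radial projection of x to the ball. The comparison goes from y to x to z at
        time s + \<open>\<tau>\<close>, there from time s + \<open>\<tau>\<close> to time s at z,
        and back to x.\<close>
      define z where "z = (if norm x \<le> R then x else (R / norm x) *\<^sub>R x)"
      have z: "norm z \<le> R" "norm (x - z) = max (norm x - R) 0"
      proof -
        show "norm z \<le> R" using R(1) by (auto simp: z_def)
        show "norm (x - z) = max (norm x - R) 0"
        proof (cases "norm x \<le> R")
          case False
          then have nx: "norm x > 0" using R(1) by linarith
          have "x - z = (1 - R / norm x) *\<^sub>R x" using False by (simp add: z_def algebra_simps)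
          then have "norm (x - z) = \<bar>1 - R / norm x\<bar> * norm x" by simp
          also have "\<dots> = norm x - R" using False nx by (simp add: abs_if divide_simps algebra_simps)
          finally show ?thesis using False by simp
        qed (simp add: z_def)
      qed
      have 1: "norm (b (s + \<tau>) y - b (s + \<tau>) x) \<le> cb * norm (y - x)" by (rule lip)
      have 2: "norm (b (s + \<tau>) x - b (s + \<tau>) z) \<le> cb * norm (x - z)" by (rule lip)
      have 3: "norm (b (s + \<tau>) z - b s z) \<le> e'" using \<tau> z(1) unfolding Q_def by simp
      have 4: "norm (b s z - b s x) \<le> cb * norm (x - z)"
        using lip[of s z x] by (simp add: norm_minus_commute)
      have "norm (b (s + \<tau>) y - b s x) \<le> norm (b (s + \<tau>) y - b (s + \<tau>) x) + (norm (b (s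
        + \<tau>) x - b (s + \<tau>) z) + (norm (b (s + \<tau>) z - b s z) + norm (b s z - b s x)))"
        using dist_triangle[of "b (s + \<tau>) y" "b s x" "b (s + \<tau>) x"] dist_triangle[of "b (s
          + \<tau>) x" "b s x" "b (s + \<tau>) z"]
          dist_triangle[of "b (s + \<tau>) z" "b s x" "b s z"] unfolding dist_norm by linarith
      then show ?thesis using 1 2 3 4 z(2) by simp
    qed
    have LF: "L2 P (\<lambda>\<omega>. b s (X s \<omega>))" by (rule admD(2)[OF adm_b[OF K]])
    have LF': "L2 P (\<lambda>\<omega>. b (s + \<tau>) (?X' \<omega>))" by (rule L2_wiener_shift(1)[OF P admD(2)[OF adm_b[OF
      K]]])
    have "nm P (\<lambda>\<omega>. b (s + \<tau>) (?X' \<omega>) - b s (X s \<omega>)) \<le> nm P (\<lambda>\<omega>. ?f \<omega> + (?g \<omega> + e'))"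
    proof (rule L2_bound(2))
      show "L2 P (\<lambda>\<omega>. ?f \<omega> + (?g \<omega> + e'))" by (rule L2_add(1)[OF Lf L2_add(1)[OF Lg c(1)]])
      show "(\<lambda>\<omega>. b (s + \<tau>) (?X' \<omega>) - b s (X s \<omega>)) \<in> borel_measurable P"
        by (rule L2_measurable[OF L2_diff(1)[OF LF' LF]])
      show "AE \<omega> in P. norm (b (s + \<tau>) (?X' \<omega>) - b s (X s \<omega>)) \<le> norm (?f \<omega> + (?g \<omega> + e'))"
      proof (rule AE_I2)
        fix \<omega>
        have "0 \<le> ?f \<omega> + (?g \<omega> + e')" using order_trans[OF norm_ge_zero pw[of "?X' \<omega>" "X s \<omega>"]]
          by simp
        then show "norm (b (s + \<tau>) (?X' \<omega>) - b s (X s \<omega>)) \<le> norm (?f \<omega> + (?g \<omega> + e'))"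
          using pw[of "?X' \<omega>" "X s \<omega>"] by simp
      qed
    qed
    also have "\<dots> \<le> nm P ?f + (nm P ?g + nm P (\<lambda>_. e'))"
      using nm_triangle[OF Lf L2_add(1)[OF Lg c(1)]] nm_triangle[OF Lg c(1)] by linarith
    also have "nm P ?f \<le> cb * e'"
      unfolding nm_cmult using d cb L2_norm(2)[of P "\<lambda>\<omega>. ?X' \<omega> - X s \<omega>"]
        by (simp add: mult_left_mono)
    also have "nm P ?g \<le> 2 * cb * (e / (4 * cb))"
    proof -
      have "\<bar>2 * cb\<bar> = 2 * cb" using cb by simp
      then show ?thesis unfolding nm_cmult by (simp only:) (rule mult_left_mono[OF R(2)], use cb in
        simp)
    qed
    also have "2 * cb * (e / (4 * cb)) = e / 2" using cb by simp
    finally show ?thesis using e'(3) c(2) by (simp add: algebra_simps)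
  qed
  show ?thesis
    by (rule that[OF Q e'(1) est]) (use e'(2) in \<open>auto simp: Q_def intro: order_trans\<close>)
qed

lemma Gamma_L2:
  assumes X: "proc X K" and Y: "continuous_process P Y" and G: "is_Gamma P H A b \<sigma> X Y"
    and B: "bnd_cont \<sigma> B"
  shows "proc Y (cS / mS * (mb * (1 + K)) + noise_const * B)"
proof -
  have Ym: "Y t \<in> borel_measurable P" for t using Y by (simp add: continuous_process_def)
  have "rep (\<lambda>s \<omega>. b s (X s \<omega>)) \<sigma> t (Y t)" for t using G unfolding is_Gamma_iff[OF X Ym] by blast
  then show ?thesis unfolding proc_def using Y rep_L2[OF adm_b[OF X] B] by blast
qed

text \<open>C precedes X: all processes with the bound K have images with the same modulus of
  continuity, which is what the Picard limit inherits.\<close>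

lemma Gamma_Hoelder:
  assumes B: "bnd_cont \<sigma> B"
  shows "\<exists>C. \<forall>X Y s t. proc X K \<longrightarrow> continuous_process P Y \<longrightarrow> is_Gamma P H A b \<sigma> X Y \<longrightarrow> s \<le> t \<longrightarrow>
    t - s \<le> 1 \<longrightarrow>
    0 \<le> C \<and> nm P (\<lambda>\<omega>. Y t \<omega> - Y s \<omega>) \<le> C * (t - s) powr H"
proof -
  obtain C where C: "\<forall>F \<sigma> s t Y Z. adm F (mb * (1 + K)) \<longrightarrow> bnd_cont \<sigma> B \<longrightarrow> rep F \<sigma> s Y \<longrightarrow> rep F \<sigma> t Z \<longrightarrow>
    s \<le> t \<longrightarrow> t - s \<le> 1 \<longrightarrow>
     0 \<le> C \<and> nm P (\<lambda>\<omega>. Z \<omega> - Y \<omega>) \<le> C * (t - s) powr H"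
    using rep_Hoelder[of "mb * (1 + K)" B] by (rule exE)
  have "0 \<le> C \<and> nm P (\<lambda>\<omega>. Y t \<omega> - Y s \<omega>) \<le> C * (t - s) powr H"
    if X: "proc X K" and Y: "continuous_process P Y" and G: "is_Gamma P H A b \<sigma> X Y"
      and st: "s \<le> t" "t - s \<le> 1" for X Y s t
  proof -
    have Ym: "Y t \<in> borel_measurable P" for t using Y by (simp add: continuous_process_def)
    have R: "rep (\<lambda>s \<omega>. b s (X s \<omega>)) \<sigma> t (Y t)" for t
      using G unfolding is_Gamma_iff[OF X Ym] by blast
    show ?thesis using C[rule_format, OF adm_b[OF X] B R R st] .
  qed
  then show ?thesis by blast
qed

lemma Gamma_AP:
  assumes X: "X \<in> AP P 2" and Y: "continuous_process P Y" and G: "is_Gamma P H A b \<sigma> X Y"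
  shows "Y \<in> AP P 2"
proof -
  obtain K where K: "proc X K" using AP_proc[OF X] .
  obtain B where B: "bnd_cont \<sigma> B" by (rule \<sigma>_bnd_cont)
  note pY = Gamma_L2[OF K Y G B]
  have R: "rep (\<lambda>s \<omega>. b s (X s \<omega>)) \<sigma> t (Y t)" for t
    using G unfolding is_Gamma_iff[OF K procD(2)[OF pY]] by blast
  obtain C where *: "\<forall>X Y s t. proc X K \<longrightarrow> continuous_process P Y \<longrightarrow> is_Gamma P H A b \<sigma> X Y \<longrightarrow> s \<le> t \<longrightarrow>
    t - s \<le> 1 \<longrightarrow>
    0 \<le> C \<and> nm P (\<lambda>\<omega>. Y t \<omega> - Y s \<omega>) \<le> C * (t - s) powr H"
    using Gamma_Hoelder[OF B, of K] by (rule exE)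
  have C: "0 \<le> C \<and> nm P (\<lambda>\<omega>. Y t \<omega> - Y s \<omega>) \<le> C * (t - s) powr H" if "s \<le> t" "t - s \<le> 1" for s t
    using *[rule_format, OF K Y G that] .
  show ?thesis
  proof (rule AP_intro[OF P Y procD(3)[OF pY] procD(4)[OF pY]])
    show "\<exists>\<delta>>0. \<forall>t. \<bar>t - t0\<bar> < \<delta> \<longrightarrow> nm P (\<lambda>\<omega>. Y t \<omega> - Y t0 \<omega>) < e" if "e > 0" for t0 e
      by (rule Hoelder_cont[OF C that])
    fix e :: real assume e: "e > 0"
    let ?M = "cS / mS + noise_const"
    have M: "0 \<le> ?M" using cS mS noise_const_nonneg by (simp add: add_nonneg_nonneg)
    \<comment> \<open>M collects the masses of the drift and noise kernels; the summand 1 keeps the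
      quotient defined.\<close>
    define e1 where "e1 = e / (?M + 1)"
    have e1: "e1 > 0" "?M * e1 \<le> e" using e M by (auto simp: e1_def divide_simps algebra_simps)
    obtain Q e' where Q: "ap_system Q" "e' > 0"
      "\<And>\<tau> s. (\<forall>t. Q e' \<tau> t) \<Longrightarrow> nm P (\<lambda>\<omega>. b (s + \<tau>) (X (s + \<tau>) (wiener_shift (-\<tau>) \<omega>)) - b s (X s \<omega>))
        \<le> e1"
      "\<And>\<tau> u. (\<forall>t. Q e' \<tau> t) \<Longrightarrow> norm (\<sigma> (u + \<tau>) - \<sigma> u) \<le> e1"
      using Gamma_shift[OF X e1(1)] by blast
    have "nm P (\<lambda>\<omega>. shift_process \<tau> Y t \<omega> - Y t \<omega>) \<le> e" if \<tau>: "\<forall>t. Q e' \<tau> t" for \<tau> t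
    proof -
      have B': "bnd_cont (\<lambda>u. \<sigma> (u + \<tau>)) B" using B unfolding bnd_cont_def
        by (auto intro!: continuous_on_compose2[of UNIV \<sigma>] continuous_intros)
      \<comment> \<open>\<open>rep_shift\<close> represents the translate of Y by the translated
        data, so \<open>rep_diff\<close> compares it with Y.\<close>
      have "nm P (\<lambda>\<omega>. Y (t + \<tau>) (wiener_shift (-\<tau>) \<omega>) - Y t \<omega>) \<le> cS / mS * e1 + noise_const * e1"
        by (rule rep_diff[OF adm_shift[OF adm_b[OF K]] adm_b[OF K] B' B rep_shift[OF R] R Q(3)[OF \<tau>]
          Q(4)[OF \<tau>]])
      also have "\<dots> = ?M * e1" by (simp add: algebra_simps)
      finally show ?thesis using e1(2) by (simp add: shift_process_def)
    qed
    then show "\<exists>Q. ap_system Q \<and> (\<exists>e'>0. \<forall>\<tau>. (\<forall>t. Q e' \<tau> t) \<longrightarrow>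
      (\<forall>t. nm P (\<lambda>\<omega>. shift_process \<tau> Y t \<omega> - Y t \<omega>) \<le> e))"
      using Q(1,2) by blast
  qed
qed

text \<open>Both images carry the same noise, so it cancels. The Lipschitz constant of b times the
  mass of the kernel is the contraction factor.\<close>

lemma Gamma_diff:
  assumes X: "proc X K" and X': "proc X' K'" and Y: "continuous_process P Y" "continuous_process P
    Y'"
    and G: "is_Gamma P H A b \<sigma> X Y" "is_Gamma P H A b \<sigma> X' Y'"
    and L: "\<And>s. nm P (\<lambda>\<omega>. X s \<omega> - X' s \<omega>) \<le> L"
  shows "nm P (\<lambda>\<omega>. Y t \<omega> - Y' t \<omega>) \<le> (cS * cb / mS) * L"
proof -
  obtain B where B: "bnd_cont \<sigma> B" by (rule \<sigma>_bnd_cont)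
  have Ym: "Y t \<in> borel_measurable P" "Y' t \<in> borel_measurable P" for t
    using Y by (simp_all add: continuous_process_def)
  have R: "rep (\<lambda>s \<omega>. b s (X s \<omega>)) \<sigma> t (Y t)" using G(1) unfolding is_Gamma_iff[OF X Ym(1)] by blast
  have R': "rep (\<lambda>s \<omega>. b s (X' s \<omega>)) \<sigma> t (Y' t)"
    using G(2) unfolding is_Gamma_iff[OF X' Ym(2)] by blast
  have bL: "nm P (\<lambda>\<omega>. b s (X s \<omega>) - b s (X' s \<omega>)) \<le> cb * L" for s
  proof -
    have D: "L2 P (\<lambda>\<omega>. cb *\<^sub>R (X s \<omega> - X' s \<omega>))"
      by (intro L2_scaleR L2_diff procD(3)[OF X] procD(3)[OF X'])
    have "nm P (\<lambda>\<omega>. b s (X s \<omega>) - b s (X' s \<omega>)) \<le> nm P (\<lambda>\<omega>. cb *\<^sub>R (X s \<omega> - X' s \<omega>))"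
    proof (rule L2_bound(2)[OF D])
      show "(\<lambda>\<omega>. b s (X s \<omega>) - b s (X' s \<omega>)) \<in> borel_measurable P"
        by (rule L2_measurable[OF L2_diff(1)[OF admD(2)[OF adm_b[OF X]] admD(2)[OF adm_b[OF X']]]])
    qed (use lip cb in auto)
    also have "\<dots> \<le> cb * L" using L[of s] cb by (simp add: nm_scaleR mult_left_mono)
    finally show ?thesis .
  qed
  have "nm P (\<lambda>\<omega>. Y t \<omega> - Y' t \<omega>) \<le> cS / mS * (cb * L) + noise_const * 0"
    by (rule rep_diff[OF adm_b[OF X] adm_b[OF X'] B B R R' bL]) simp
  then show ?thesis by simp
qed

text \<open>Both solutions are their own images, so the contraction estimate may be iterated,
  starting from the sum of their bounds. The distance at each time is below every geometric term,
  hence zero.\<close>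

lemma solution_unique:
  assumes q: "cS * cb / mS < 1" and X: "X \<in> AP P 2" "is_solution P H A b \<sigma> X"
    and X': "X' \<in> AP P 2" "is_solution P H A b \<sigma> X'"
  shows "modification P X' X"
proof -
  let ?q = "cS * cb / mS"
  have q0: "0 \<le> ?q" using cS cb mS by simp
  obtain K where K: "proc X K" using AP_proc[OF X(1)] .
  obtain K' where K': "proc X' K'" using AP_proc[OF X'(1)] .
  note G = X(2)[unfolded is_solution_def] X'(2)[unfolded is_solution_def]
  have it: "nm P (\<lambda>\<omega>. X' t \<omega> - X t \<omega>) \<le> ?q ^ n * (K' + K)" for t n
  proof (induction n arbitrary: t)
    case 0
    show ?case using nm_triangle_diff[OF procD(3)[OF K', of t] procD(3)[OF K, of t]] procD(4)[OF K',
      of t] procD(4)[OF K, of t] by simp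
  next
    case (Suc n)
    have "nm P (\<lambda>\<omega>. X' t \<omega> - X t \<omega>) \<le> ?q * (?q ^ n * (K' + K))"
      by (rule Gamma_diff[OF K' K _ _ _ _ Suc]) (use G in auto)
    then show ?case by (simp add: mult.assoc)
  qed
  have "AE \<omega> in P. X' t \<omega> = X t \<omega>" for t
  proof -
    have "(\<lambda>n. ?q ^ n * (K' + K)) \<longlonglongrightarrow> 0 * (K' + K)"
      using q q0 by (intro tendsto_intros LIMSEQ_power_zero) simp
    then have "nm P (\<lambda>\<omega>. X' t \<omega> - X t \<omega>) \<le> 0 * (K' + K)"
      by (rule tendsto_lowerbound) (use it in auto)
    then show ?thesis using nm_le_0_AE[OF L2_diff(1)[OF procD(3)[OF K', of t] procD(3)[OF K, of t]]]
      by simp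
  qed
  then show ?thesis by (simp add: modification_def)
qed

lemma zero_AP: "(\<lambda>_ _. 0) \<in> AP P 2"
  unfolding AP_2_iff shift_process_def continuous_process_def
  by (auto simp: relatively_dense_def case_prod_unfold intro!: exI[of _ 0] exI[of _ "1::real"]
    continuous_intros)

text \<open>Picard iteration. The iterates are uniformly Hoelder continuous in the mean square, hence so
  is
  their limit, which therefore has a modification with continuous paths.\<close>

lemma solution_exists:
  assumes q: "cS * cb / mS < 1"
  shows "\<exists>X\<in>AP P 2. is_solution P H A b \<sigma> X"
proof -
  let ?q = "cS * cb / mS"
  have q0: "0 \<le> ?q" using cS cb mS by simp
  have ex: "\<exists>Y. Y \<in> AP P 2 \<and> is_Gamma P H A b \<sigma> X Y" if X: "X \<in> AP P 2" for X
  proof -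
    obtain K where K: "proc X K" using AP_proc[OF X] .
    obtain Y where "continuous_process P Y" "is_Gamma P H A b \<sigma> X Y" using Gamma_exists[OF K] .
    then show ?thesis using Gamma_AP[OF X] by blast
  qed
  define X where "X = rec_nat (\<lambda>_ _. 0) (\<lambda>_ X. SOME Y. Y \<in> AP P 2 \<and> is_Gamma P H A b \<sigma> X Y)"
  have X0: "X 0 = (\<lambda>_ _. 0)" and XS: "X (Suc n) = (SOME Y. Y \<in> AP P 2 \<and> is_Gamma P H A b \<sigma> (X n) Y)"
    for n
    by (simp_all add: X_def)
  have XAP: "X n \<in> AP P 2" for n
  proof (induction n)
    case 0
    show ?case using zero_AP by (simp add: X0)
  next
    case (Suc n)
    show ?case unfolding XS using someI_ex[OF ex[OF Suc]] by blast
  qed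
  have XG: "is_Gamma P H A b \<sigma> (X n) (X (Suc n))" for n
    unfolding XS using someI_ex[OF ex[OF XAP[of n]]] by blast
  have Xc: "continuous_process P (X n)" for n using XAP[of n] by (simp add: AP_2_iff)
  have XL: "L2 P (X n t)" for n t using XAP[of n] by (simp add: AP_2_iff)
  have Xp: "\<exists>K. proc (X n) K" for n using AP_proc[OF XAP[of n]] by blast
  obtain K1 where K1: "proc (X 1) K1" using Xp by blast
  have K10: "0 \<le> K1" by (rule procD(5)[OF K1])
  have step: "nm P (\<lambda>\<omega>. X (Suc n) t \<omega> - X n t \<omega>) \<le> ?q ^ n * K1" for n t
  proof (induction n arbitrary: t)
    case 0
    show ?case using procD(4)[OF K1, of t] by (simp add: X0)
  next
    case (Suc n)
    obtain K K' where "proc (X (Suc n)) K" "proc (X n) K'" using Xp by blast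
    then have "nm P (\<lambda>\<omega>. X (Suc (Suc n)) t \<omega> - X (Suc n) t \<omega>) \<le> ?q * (?q ^ n * K1)"
      by (rule Gamma_diff[OF _ _ Xc Xc XG XG Suc])
    then show ?case by (simp add: mult.assoc)
  qed
  \<comment> \<open>The sum of the geometric series of steps, and the fixed point of D =
    \<open>K1\<close> + qD.\<close>
  define D where "D = K1 / (1 - ?q)"
  have "x + r * (x / (1 - r)) = x / (1 - r)" if "r < 1" for x r :: real
    using that by (simp add: field_simps)
  from this[OF q, of K1] have D2: "K1 + ?q * D = D" unfolding D_def .
  have "0 < 1 - ?q" using q by simp
  then have D: "0 \<le> D" "K1 + ?q * D = D" using K10 D2 unfolding D_def
    by (simp_all only: divide_nonneg_pos)
  have far: "nm P (\<lambda>\<omega>. X (n + k) t \<omega> - X n t \<omega>) \<le> ?q ^ n * D" for n k t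
  proof -
    \<comment> \<open>The sharper bound, a partial geometric sum, is the one that survives the
      induction on k.\<close>
    have "nm P (\<lambda>\<omega>. X (n + k) t \<omega> - X n t \<omega>) \<le> ?q ^ n * (D - ?q ^ k * D)"
    proof (induction k)
      case (Suc k)
      have "nm P (\<lambda>\<omega>. X (n + Suc k) t \<omega> - X n t \<omega>) \<le> ?q ^ (n + k) * K1 + ?q ^ n * (D - ?q ^ k * D)"
        using nm_triangle3[OF XL[of "n + Suc k" t] XL[of "n + k" t] XL[of n t]] step[of "n
          + k" t] Suc by simp
      also have "\<dots> = ?q ^ n * (D - ?q ^ k * (D - K1))" by (simp add: power_add algebra_simps)
      also have "D - K1 = ?q * D" using D(2) by linarith
      finally show ?case by (simp add: mult_ac)
    qed simp
    also have "\<dots> \<le> ?q ^ n * D" using q0 D(1) by (intro mult_left_mono) auto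
    finally show ?thesis .
  qed
  have qD: "(\<lambda>n. ?q ^ n * D) \<longlonglongrightarrow> 0"
    using tendsto_mult_left_zero[OF LIMSEQ_power_zero[of ?q], of D] q q0 by simp
  have exZ: "\<exists>Z. L2 P Z \<and> (\<lambda>n. nm P (\<lambda>\<omega>. X n t \<omega> - Z \<omega>)) \<longlonglongrightarrow> 0" for t
  proof (rule prob_space.L2_complete[OF prob_P[OF P], of "\<lambda>n. X n t"])
    show "L2 P (X n t)" for n by (rule XL)
    fix e :: real assume e: "e > 0"
    then obtain N where N: "\<And>n. n \<ge> N \<Longrightarrow> ?q ^ n * D < e"
      using order_tendstoD(2)[OF qD] unfolding eventually_sequentially by blast
    have "nm P (\<lambda>\<omega>. X m t \<omega> - X n t \<omega>) < e" if "m \<ge> N" "n \<ge> N" for m n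
    proof (cases "n \<le> m")
      case True
      then show ?thesis using far[of n "m - n" t] N[OF that(2)] by simp
    next
      case False
      then show ?thesis using far[of m "n - m" t] N[OF that(1)] nm_commute[of P "X m t" "X n t"]
        by simp
    qed
    then show "\<exists>N. \<forall>m\<ge>N. \<forall>n\<ge>N. nm P (\<lambda>\<omega>. X m t \<omega> - X n t \<omega>) < e" by blast
  qed blast
  define Z where "Z t = (SOME Z. L2 P Z \<and> (\<lambda>n. nm P (\<lambda>\<omega>. X n t \<omega> - Z \<omega>)) \<longlonglongrightarrow> 0)" for t
  have ZL: "L2 P (Z t)" and Zlim: "(\<lambda>n. nm P (\<lambda>\<omega>. X n t \<omega> - Z t \<omega>)) \<longlonglongrightarrow> 0" for t
    using someI_ex[OF exZ[of t]] by (simp_all add: Z_def)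
  have XZ: "nm P (\<lambda>\<omega>. X n t \<omega> - Z t \<omega>) \<le> ?q ^ n * D" for n t
  proof -
    have "nm P (\<lambda>\<omega>. Z t \<omega> - X n t \<omega>) \<le> ?q ^ n * D"
    proof (rule nm_lim_le)
      show "L2 P (\<lambda>\<omega>. X (n + k) t \<omega> - X n t \<omega>)" for k by (intro L2_diff XL)
      show "L2 P (\<lambda>\<omega>. Z t \<omega> - X n t \<omega>)" by (intro L2_diff XL ZL)
      show "(\<lambda>k. nm P (\<lambda>\<omega>. X (n + k) t \<omega> - X n t \<omega> - (Z t \<omega> - X n t \<omega>))) \<longlonglongrightarrow> 0"
        using LIMSEQ_ignore_initial_segment[OF Zlim[of t], of n] by (simp add: add.commute)
      show "\<forall>\<^sub>F k in sequentially. nm P (\<lambda>\<omega>. X (n + k) t \<omega> - X n t \<omega>) \<le> ?q ^ n * D"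
        using far by simp
    qed
    then show ?thesis by (simp add: nm_commute)
  qed
  \<comment> \<open>Since the iteration starts at 0, the distance to \<open>X 0\<close> bounds every
    iterate by the same D, and a single Hoelder constant serves all images.\<close>
  have Xbd: "proc (X n) D" for n
    unfolding proc_def using Xc XL far[of 0 n] by (auto simp: X0)
  obtain B where B: "bnd_cont \<sigma> B" by (rule \<sigma>_bnd_cont)
  obtain C where *: "\<forall>X Y s t. proc X D \<longrightarrow> continuous_process P Y \<longrightarrow> is_Gamma P H A b \<sigma> X Y \<longrightarrow> s \<le> t \<longrightarrow>
    t - s \<le> 1 \<longrightarrow>
    0 \<le> C \<and> nm P (\<lambda>\<omega>. Y t \<omega> - Y s \<omega>) \<le> C * (t - s) powr H"
    using Gamma_Hoelder[OF B, of D] by (rule exE)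
  have C: "0 \<le> C \<and> nm P (\<lambda>\<omega>. X (Suc n) t \<omega> - X (Suc n) s \<omega>) \<le> C * (t - s) powr H"
    if "s \<le> t" "t - s \<le> 1" for n s t
    using *[rule_format, OF Xbd Xc XG that] .
  have C0: "0 \<le> C" using C[of 0 0] by simp
  have ZH: "nm P (\<lambda>\<omega>. Z t \<omega> - Z s \<omega>) \<le> C * (t - s) powr H" if "s \<le> t" "t - s \<le> 1" for s t
  proof (rule nm_lim_le)
    show "L2 P (\<lambda>\<omega>. X (Suc n) t \<omega> - X (Suc n) s \<omega>)" for n by (intro L2_diff XL)
    show "L2 P (\<lambda>\<omega>. Z t \<omega> - Z s \<omega>)" by (intro L2_diff ZL)
    show "(\<lambda>n. nm P (\<lambda>\<omega>. X (Suc n) t \<omega> - X (Suc n) s \<omega> - (Z t \<omega> - Z s \<omega>))) \<longlonglongrightarrow> 0"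
    proof (rule nm_tendsto_0)
      show "(\<lambda>n. nm P (\<lambda>\<omega>. X (Suc n) t \<omega> - Z t \<omega>) + nm P (\<lambda>\<omega>. X (Suc n) s \<omega> - Z s \<omega>)) \<longlonglongrightarrow> 0"
        using tendsto_add[OF LIMSEQ_Suc[OF Zlim[of t]] LIMSEQ_Suc[OF Zlim[of s]]] by simp
      show "nm P (\<lambda>\<omega>. X (Suc n) t \<omega> - X (Suc n) s \<omega> - (Z t \<omega> - Z s \<omega>))
        \<le> nm P (\<lambda>\<omega>. X (Suc n) t \<omega> - Z t \<omega>) + nm P (\<lambda>\<omega>. X (Suc n) s \<omega> - Z s \<omega>)" for n
        using nm_triangle_diff[OF L2_diff(1)[OF XL[of "Suc n" t] ZL[of t]] L2_diff(1)[OF XL[of "Suc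
          n" s] ZL[of s]]]
        by (simp add: algebra_simps)
    qed
    show "\<forall>\<^sub>F n in sequentially. nm P (\<lambda>\<omega>. X (Suc n) t \<omega> - X (Suc n) s \<omega>) \<le> C * (t - s) powr H"
      using C that by simp
  qed
  obtain Y where Y: "continuous_process P Y" "\<And>t. AE \<omega> in P. Y t \<omega> = Z t \<omega>"
    using kolmogorov_L2[OF prob_P[OF P] ZL H(1) C0 ZH] by blast
  have Ym: "Y t \<in> borel_measurable P" for t using Y(1) by (simp add: continuous_process_def)
  have YL: "L2 P (Y t)" for t by (rule L2_cong_AE[OF ZL Ym Y(2)])
  have YZ: "nm P (\<lambda>\<omega>. W \<omega> - Y t \<omega>) = nm P (\<lambda>\<omega>. W \<omega> - Z t \<omega>)" if W: "L2 P W" for W t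
  proof (rule nm_cong_AE)
    show "AE \<omega> in P. W \<omega> - Y t \<omega> = W \<omega> - Z t \<omega>" using Y(2)[of t] by eventually_elim simp
  qed (intro L2_measurable L2_diff W YL ZL)+
  have XY: "nm P (\<lambda>\<omega>. X n t \<omega> - Y t \<omega>) \<le> ?q ^ n * D" for n t using XZ YZ[OF XL] by simp
  have YD: "nm P (Y t) \<le> D" for t using XY[of 0 t] by (simp add: X0 nm_minus)
  have pY: "proc Y D" unfolding proc_def using Y(1) YL YD by blast
  have YAP: "Y \<in> AP P 2"
  proof (rule AP_intro[OF P Y(1) YL YD])
    have "0 \<le> C \<and> nm P (\<lambda>\<omega>. Y t \<omega> - Y s \<omega>) \<le> C * (t - s) powr H" if "s \<le> t" "t - s \<le> 1" for s t
      using ZH[OF that] YZ[OF YL, of t s] YZ[OF ZL, of s t] nm_commute[of P "Y t" "Z s"]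
        nm_commute[of P "Z s" "Z t"] C0 by simp
    then show "\<exists>\<delta>>0. \<forall>t. \<bar>t - t0\<bar> < \<delta> \<longrightarrow> nm P (\<lambda>\<omega>. Y t \<omega> - Y t0 \<omega>) < e" if "e > 0" for t0 e
      by (rule Hoelder_cont[OF _ that])
    fix e :: real assume e: "e > 0"
    \<comment> \<open>A single iterate close to Y at all times suffices: its almost periods for e/3
      are almost periods of Y for e.\<close>
    obtain n where n: "?q ^ n * D < e / 3"
      using order_tendstoD(2)[OF qD, of "e/3"] e unfolding eventually_sequentially by auto
    have "nm P (\<lambda>\<omega>. shift_process \<tau> Y t \<omega> - Y t \<omega>)
      \<le> e" if \<tau>: "\<forall>t. nm P (\<lambda>\<omega>. shift_process \<tau> (X n) t \<omega> - X n t \<omega>) \<le> e/3" for \<tau> t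
    proof -
      have 1: "nm P (\<lambda>\<omega>. shift_process \<tau> Y t \<omega> - shift_process \<tau> (X n) t \<omega>) \<le> e/3"
        unfolding nm_shift_process_diff[where X=Y and Y="X n", OF P YL XL]
          using XY[of n "t + \<tau>"] n by (simp add: nm_commute)
      have LSY: "L2 P (shift_process \<tau> Y t)" by (rule shift_process_L2(1)[where X=Y, OF P YL])
      have LSX: "L2 P (shift_process \<tau> (X n) t)"
        by (rule shift_process_L2(1)[where X="X n", OF P XL])
      show ?thesis
        using 1 \<tau>[rule_format, of t] XY[of n t] n nm_triangle3[OF LSY LSX YL[of t]] nm_triangle3[OF
          LSX XL[of n t] YL[of t]] by linarith
    qed
    then show "\<exists>Q. ap_system Q \<and> (\<exists>e'>0. \<forall>\<tau>. (\<forall>t. Q e' \<tau> t) \<longrightarrow>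
      (\<forall>t. nm P (\<lambda>\<omega>. shift_process \<tau> Y t \<omega> - Y t \<omega>) \<le> e))"
      using AP_ap_system[OF P XAP[of n]] e
      by (intro exI[of _ "\<lambda>e \<tau> t. nm P (\<lambda>\<omega>. shift_process \<tau> (X n) t \<omega> - X n t \<omega>)
        \<le> e"] conjI exI[of _ "e/3"]) auto
  qed
  \<comment> \<open>V is the image of Y. Both Y and V are limits of the iterates, V because the
    contraction estimate compares it with the image of \<open>X n\<close>; hence Y is its own
    image.\<close>
  obtain V where V: "V \<in> AP P 2" "is_Gamma P H A b \<sigma> Y V" using ex[OF YAP] by blast
  have Vc: "continuous_process P V" and VL: "\<And>t. L2 P (V t)" using V(1) by (simp_all add: AP_2_iff)
  have Vm: "V t \<in> borel_measurable P" for t by (rule L2_measurable[OF VL])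
  have "AE \<omega> in P. Y t \<omega> = V t \<omega>" for t
  proof -
    have "nm P (\<lambda>\<omega>. Y t \<omega> - V t \<omega>) \<le> ?q ^ n * D + ?q * (?q ^ n * D)" for n
    proof -
      have "nm P (\<lambda>\<omega>. X (Suc n) t \<omega> - V t \<omega>) \<le> ?q * (?q ^ n * D)"
        by (rule Gamma_diff[OF Xbd pY Xc Vc XG V(2) XY])
      moreover have "?q ^ Suc n * D \<le> ?q ^ n * D"
        using q q0 D(1) by (intro mult_right_mono power_decreasing) auto
      ultimately show ?thesis
        using nm_triangle3[OF YL[of t] XL[of "Suc n" t] VL[of t]] XY[of "Suc n" t] nm_commute[of P
          "Y t" "X (Suc n) t"] by linarith
    qed
    moreover have "(\<lambda>n. ?q ^ n * D + ?q * (?q ^ n * D)) \<longlonglongrightarrow> 0"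
      using tendsto_add[OF qD tendsto_mult_right_zero[OF qD, of ?q]] by simp
    ultimately have "nm P (\<lambda>\<omega>. Y t \<omega> - V t \<omega>) \<le> 0"
      by (intro tendsto_lowerbound[where F=sequentially]) auto
    then show ?thesis using nm_le_0_AE[OF L2_diff(1)[OF YL[of t] VL[of t]]] by simp
  qed
  then have "rep (\<lambda>s \<omega>. b s (Y s \<omega>)) \<sigma> t (Y t)" for t
    using V(2) rep_cong[OF _ Ym] unfolding is_Gamma_iff[OF pY Vm] by blast
  then have "is_Gamma P H A b \<sigma> Y Y" unfolding is_Gamma_iff[OF pY Ym] by blast
  then show ?thesis using YAP Y(1) unfolding is_solution_def by blast
qed

end

theorem theorem3p3:
  fixes H c\<^sub>S m\<^sub>S c\<^sub>b m\<^sub>b :: real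
    and A :: "real ^ 'd ^ 'd"
    and b :: "real \<Rightarrow> real ^ 'd \<Rightarrow> real ^ 'd"
    and \<sigma> :: "real \<Rightarrow> real ^ 'd ^ 'd"
    and P :: "(real \<Rightarrow> real ^ 'd) measure"
  assumes "1 / 2 < H" and "H < 1"
    and "continuous_on UNIV (\<lambda>(t, x). b t x)"
    and "continuous_on UNIV \<sigma>"
    and "fbm_law H P"
    and "c\<^sub>S > 0" and "m\<^sub>S > 0"
    and "\<And>t. onorm ((*v) (matrix_exp (t *\<^sub>R A))) \<le> c\<^sub>S * exp (- m\<^sub>S * t)"
    and "c\<^sub>b > 0" and "m\<^sub>b > 0"
    and "\<And>t x y. norm (b t x - b t y) \<le> c\<^sub>b * norm (x - y)"
    and "\<And>t x. norm (b t x) \<le> m\<^sub>b * (1 + norm x)"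
    and "\<And>t. (\<lambda>s. indicator {..t} s *\<^sub>R (matrix_exp ((t - s) *\<^sub>R A) ** \<sigma> s)) \<in> abs_H_mat H"
    and "almost_periodic_unif_compact b"
    and "almost_periodic \<sigma>"
  shows "(\<forall>X\<in>AP P 2. \<exists>Y\<in>AP P 2. is_Gamma P H A b \<sigma> X Y) \<and>
    (c\<^sub>S * c\<^sub>b / m\<^sub>S < 1 \<longrightarrow>
      (\<exists>X\<in>AP P 2. is_solution P H A b \<sigma> X \<and>
        (\<forall>X'\<in>AP P 2. is_solution P H A b \<sigma> X' \<longrightarrow> modification P X' X)))"
proof -
  interpret sde H c\<^sub>S m\<^sub>S A P c\<^sub>b m\<^sub>b b \<sigma>
    by unfold_locales (use assms in auto)
  have "\<exists>Y\<in>AP P 2. is_Gamma P H A b \<sigma> X Y" if X: "X \<in> AP P 2" for X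
  proof -
    obtain K where K: "proc X K" using AP_proc[OF X] .
    obtain Y where "continuous_process P Y" "is_Gamma P H A b \<sigma> X Y" using Gamma_exists[OF K] .
    then show ?thesis using Gamma_AP[OF X] by blast
  qed
  then show ?thesis using solution_exists solution_unique by blast
qed

end
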